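(* Let $u\ge d\ge 1$ be integers and let $E\in E(u)$ be a linear expanding map of $\mathbb{T}^u$. Then there exists a nonempty open subset $\mathcal{U}$ of $C(d)\times C^2(\mathbb{T}^u,\mathbb{R}^d)$, all of whose elements $(C,f)$ satisfy $|\det E\,\det C|>1$, such that for every $(C,f)\in\mathcal{U}$ the SRB measure $\mu_T$ of the map $T=T(E,C,f)$ is absolutely continuous with respect to the volume of $\mathbb{T}^u\times\mathbb{R}^d$.
   Context: $\mathbb{T}^u=\mathbb{R}^u/\mathbb{Z}^u$; vectors carry the Euclidean norm and linear maps the operator norm. $E(u)$ is the set of linear expanding maps of $\mathbb{T}^u$: maps $E:\mathbb{T}^u\to\mathbb{T}^u$ induced by a linear map (denoted by the same letter) $E:\mathbb{R}^u\to\mathbb{R}^u$ preserving the lattice $\mathbb{Z}^u$ ($E(\mathbb{Z}^u)\subset\mathbb{Z}^u$), with $\|E^{-1}\|<1$. $C(d)$ is the set of linear contractions of $\mathbb{R}^d$, i.e. linear $C:\mathbb{R}^d\to\mathbb{R}^d$ with $\|Cv\|<\|v\|$ for all $v\neq0$, with the topology of $d\times d$ matrices; $C^2(\mathbb{T}^u,\mathbb{R}^d)$ carries the $C^2$ topology. For $f\in C^2(\mathbb{T}^u,\mathbb{R}^d)$, $T=T(E,C,f):\mathbb{T}^u\times\mathbb{R}^d\to\mathbb{T}^u\times\mathbb{R}^d$ is $T(x,y)=(E(x),C(y)+f(x))$. The map $T$ has a unique SRB measure $\mu_T$: the unique $T$-invariant Borel probability measure such that $\frac1n\sum_{k=0}^{n-1}\delta_{T^k(z)}\to\mu_T$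 weakly for volume-almost every $z\in\mathbb{T}^u\times\mathbb{R}^d$. The volume is the product of normalized Lebesgue measure on $\mathbb{T}^u$ and Lebesgue measure on $\mathbb{R}^d$. *)

theory Defs
  imports "HOL-Probability.Probability"
begin

section \<open>The torus\<close>

definition integer_lattice :: "(real ^ 'n) set" where
  "integer_lattice = {x. \<forall>i. x $ i \<in> \<int>}"

lemma integer_lattice_0: "0 \<in> integer_lattice"
  by (simp add: integer_lattice_def)

lemma integer_lattice_add: "x \<in> integer_lattice \<Longrightarrow> y \<in> integer_lattice \<Longrightarrow> x + y \<in> integer_lattice"
  by (simp add: integer_lattice_def)

lemma integer_lattice_minus: "x \<in> integer_lattice \<Longrightarrow> - x \<in> integer_lattice"
  by (simp add: integer_lattice_def)

definition torus_rel :: "real ^ 'n \<Rightarrow> real ^ 'n \<Rightarrow> bool" where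
  "torus_rel x y \<longleftrightarrow> x - y \<in> integer_lattice"

lemma equivp_torus_rel: "equivp torus_rel"
proof (rule equivpI)
  show "reflp (torus_rel :: real ^ 'n \<Rightarrow> _)"
    by (simp add: reflp_def torus_rel_def integer_lattice_0)
  show "symp (torus_rel :: real ^ 'n \<Rightarrow> _)"
    unfolding symp_def torus_rel_def by (metis integer_lattice_minus minus_diff_eq)
  show "transp (torus_rel :: real ^ 'n \<Rightarrow> _)"
    unfolding transp_def torus_rel_def by (metis integer_lattice_add diff_add_cancel add_diff_eq)
qed

quotient_type 'n torus = "real ^ ('n::finite)" / torus_rel
  by (rule equivp_torus_rel)

definition to_torus :: "real ^ 'n \<Rightarrow> 'n torus" where
  "to_torus = abs_torus"

lemma to_torus_eq_iff: "to_torus x = to_torus y \<longleftrightarrow> x - y \<in> integer_lattice"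
  using Quotient_rel_abs[OF Quotient_torus] torus.abs_eq_iff[of x y]
  by (simp add: to_torus_def torus_rel_def)

lemma to_torus_rep [simp]: "to_torus (rep_torus p) = p"
  by (simp add: to_torus_def Quotient_abs_rep[OF Quotient_torus])

lemma range_to_torus: "range to_torus = UNIV"
  by (metis surjI to_torus_rep)

text \<open>The quotient topology\<close>

instantiation torus :: (finite) topological_space
begin

definition open_torus :: "'a torus set \<Rightarrow> bool" where
  "open_torus U \<longleftrightarrow> open (to_torus -` U)"

instance
proof
  show "open (UNIV :: 'a torus set)" by (simp add: open_torus_def)
  show "open (S \<inter> T)" if "open S" "open T" for S T :: "'a torus set"
    using that by (simp add: open_torus_def open_Int)
  show "open (\<Union>K)" if "\<forall>S\<in>K. open S" for K :: "'a torus set set"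
    using that by (simp add: open_torus_def vimage_Union open_UN)
qed

end

lemma continuous_on_to_torus: "continuous_on UNIV to_torus"
  by (simp add: continuous_on_open_vimage open_torus_def)

lemma open_to_torus_image:
  assumes "open U" shows "open (to_torus ` U)"
proof -
  have "to_torus -` to_torus ` U = (\<Union>k\<in>integer_lattice. (\<lambda>x. k + x) ` U)"
  proof (intro equalityI subsetI)
    fix x assume "x \<in> to_torus -` to_torus ` U"
    then obtain y where "y \<in> U" "x - y \<in> integer_lattice" by (auto simp: to_torus_eq_iff)
    moreover have "x = (x - y) + y" by simp
    ultimately show "x \<in> (\<Union>k\<in>integer_lattice. (\<lambda>x. k + x) ` U)" by blast
  next
    fix x assume "x \<in> (\<Union>k\<in>integer_lattice. (\<lambda>x. k + x) ` U)"
    then obtain k y where "k \<in> integer_lattice" "y \<in> U" "x = k + y" by blast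
    then show "x \<in> to_torus -` to_torus ` U"
      by (auto intro!: image_eqI[of _ _ y] simp: to_torus_eq_iff)
  qed
  then show ?thesis
    using assms by (auto simp: open_torus_def intro!: open_UN open_translation)
qed

instance torus :: (finite) second_countable_topology
proof
  obtain B :: "(real ^ 'a) set set" where B: "countable B" "topological_basis B"
    using ex_countable_basis by blast
  let ?B = "(\<lambda>V. to_torus ` V) ` B"
  have "topological_basis ?B"
  proof (rule topological_basisI)
    fix V assume "V \<in> ?B"
    then show "open V"
      by (auto intro: open_to_torus_image topological_basis_open[OF B(2)])
  next
    fix O' :: "'a torus set" and p
    assume O': "open O'" "p \<in> O'"
    have "open (to_torus -` O')" "rep_torus p \<in> to_torus -` O'"
      using O' by (simp_all add: open_torus_def)
    then obtain V where V: "V \<in> B" "rep_torus p \<in> V" "V \<subseteq> to_torus -` O'"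
      by (rule topological_basisE[OF B(2)])
    have "to_torus (rep_torus p) \<in> to_torus ` V" using V(2) by (rule imageI)
    then have "p \<in> to_torus ` V" by simp
    moreover have "to_torus ` V \<subseteq> O'" using V(3) by (simp add: image_subset_iff_subset_vimage)
    ultimately show "\<exists>B'\<in>?B. p \<in> B' \<and> B' \<subseteq> O'" using V(1) by (intro bexI[of _ "to_torus ` V"]) simp_all
  qed
  then have "open = generate_topology ?B" by (rule topological_basis_imp_subbasis)
  moreover have "countable ?B" using B(1) by simp
  ultimately show "\<exists>B::'a torus set set. countable B \<and> open = generate_topology B" by (intro exI[of _ ?B] conjI)
qed

section \<open>Volume\<close>

definition torus_measure :: "('n::finite) torus measure" where
  "torus_measure = distr (restrict_space lborel (cbox 0 (\<chi> i. 1))) borel to_torus"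

definition product_volume :: "('u::finite torus \<times> (real ^ 'd)) measure" where
  "product_volume = torus_measure \<Otimes>\<^sub>M lborel"

lemma sets_product_volume: "sets (product_volume :: ('u::finite torus \<times> (real ^ 'd)) measure) = sets borel"
proof -
  have "sets (product_volume :: ('u torus \<times> (real ^ 'd)) measure) =
      sets (borel \<Otimes>\<^sub>M borel :: ('u torus \<times> (real ^ 'd)) measure)"
    unfolding product_volume_def by (intro sets_pair_measure_cong) (simp_all add: torus_measure_def)
  also have "(borel \<Otimes>\<^sub>M borel :: ('u torus \<times> (real ^ 'd)) measure) = borel"
    by (rule borel_prod)
  finally show ?thesis .
qed

lemma prob_space_torus_measure: "prob_space (torus_measure :: ('n::finite) torus measure)"
  unfolding torus_measure_def
proof (rule prob_space.prob_space_distr)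
  let ?Q = "cbox 0 (\<chi> i. 1) :: (real ^ 'n) set"
  have "emeasure lborel ?Q = 1"
  proof -
    have "?Q \<noteq> {}" by (auto simp: interval_ne_empty_cart less_eq_vec_def)
    then have "measure lborel ?Q = 1" by (simp add: content_cbox_cart)
    moreover have "emeasure lborel ?Q \<noteq> \<top>"
      using emeasure_lborel_cbox_finite[of 0 "(\<chi> i. 1) :: real ^ 'n"] by (simp add: less_top)
    ultimately show ?thesis by (simp add: emeasure_eq_ennreal_measure)
  qed
  then show "prob_space (restrict_space lborel ?Q)"
    by (intro prob_spaceI) (simp add: emeasure_restrict_space space_restrict_space)
  have "to_torus \<in> borel_measurable borel"
    by (rule borel_measurable_continuous_onI[OF continuous_on_to_torus])
  then show "to_torus \<in> restrict_space lborel ?Q \<rightarrow>\<^sub>M borel"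
    by (intro measurable_restrict_space1) simp
qed

section \<open>Linear expanding maps and linear contractions\<close>

definition expanding :: "real ^ 'u ^ 'u \<Rightarrow> bool" where
  "expanding E \<longleftrightarrow>
     (*v) E ` integer_lattice \<subseteq> integer_lattice \<and>
     invertible E \<and> onorm ((*v) (matrix_inv E)) < 1"

definition contractions :: "(real ^ 'd ^ 'd) set" where
  "contractions = {C. \<forall>v. v \<noteq> 0 \<longrightarrow> norm (C *v v) < norm v}"

text \<open>The choice of representative is immaterial when \<open>E\<close> preserves the lattice.\<close>

definition torus_map :: "real ^ 'u ^ 'u \<Rightarrow> 'u torus \<Rightarrow> 'u torus" where
  "torus_map E p = to_torus (E *v rep_torus p)"

lemma torus_map_to_torus:
  assumes "(*v) E ` integer_lattice \<subseteq> integer_lattice"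
  shows "torus_map E (to_torus x) = to_torus (E *v x)"
proof -
  have "rep_torus (to_torus x) - x \<in> integer_lattice"
    by (simp flip: to_torus_eq_iff)
  then have "E *v (rep_torus (to_torus x) - x) \<in> integer_lattice" using assms by blast
  then show ?thesis
    by (simp add: torus_map_def to_torus_eq_iff matrix_vector_mult_diff_distrib)
qed

definition skew_map ::
  "real ^ 'u ^ 'u \<Rightarrow> real ^ 'd ^ 'd \<Rightarrow> ('u torus \<Rightarrow> real ^ 'd) \<Rightarrow>
     'u torus \<times> (real ^ 'd) \<Rightarrow> 'u torus \<times> (real ^ 'd)" where
  "skew_map E C f = (\<lambda>(x, y). (torus_map E x, C *v y + f x))"

section \<open>The space of \<open>C\<^sup>2\<close> functions on the torus\<close>

definition total_deriv :: "('a::real_normed_vector \<Rightarrow> 'b::real_normed_vector) \<Rightarrow> 'a \<Rightarrow> 'a \<Rightarrow>\<^sub>L 'b" where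
  "total_deriv f x = Blinfun (frechet_derivative f (at x))"

definition C2 :: "('a::real_normed_vector \<Rightarrow> 'b::real_normed_vector) \<Rightarrow> bool" where
  "C2 f \<longleftrightarrow> f differentiable_on UNIV \<and> total_deriv f differentiable_on UNIV \<and> continuous_on UNIV (total_deriv (total_deriv f))"

definition lift :: "('u::finite torus \<Rightarrow> 'b) \<Rightarrow> real ^ 'u \<Rightarrow> 'b" where
  "lift f x = f (to_torus x)"

definition C2_space :: "('u::finite torus \<Rightarrow> real ^ 'd) set" where
  "C2_space = {f. C2 (lift f)}"

definition C2_norm :: "('u::finite torus \<Rightarrow> real ^ 'd) \<Rightarrow> real" where
  "C2_norm f = (SUP x. norm (lift f x)) + (SUP x. norm (total_deriv (lift f) x)) + (SUP x. norm (total_deriv (total_deriv (lift f)) x))"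

text \<open>
  The value outside \<open>C2_space\<close> is irrelevant for the topology; it is set to \<open>0\<close> because
  \<open>Metric_space\<close> asks for nonnegativity and symmetry everywhere.
\<close>

definition C2_dist :: "('u::finite torus \<Rightarrow> real ^ 'd) \<Rightarrow> ('u torus \<Rightarrow> real ^ 'd) \<Rightarrow> real" where
  "C2_dist f g = (if f \<in> C2_space \<and> g \<in> C2_space then C2_norm (\<lambda>x. f x - g x) else 0)"

definition C2_topology :: "('u::finite torus \<Rightarrow> real ^ 'd) topology" where
  "C2_topology = Metric_space.mtopology C2_space C2_dist"

lemma total_deriv_eqI:
  fixes f :: "'a::euclidean_space \<Rightarrow> 'b::real_normed_vector"
  assumes "(f has_derivative blinfun_apply A) (at x)"
  shows "total_deriv f x = A"
  using frechet_derivative_at[OF assms] by (metis total_deriv_def blinfun_apply_inverse)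

lemma has_derivative_total_deriv:
  fixes f :: "'a::euclidean_space \<Rightarrow> 'b::real_normed_vector"
  assumes "f differentiable_on UNIV"
  shows "(f has_derivative blinfun_apply (total_deriv f x)) (at x)"
proof -
  have "(f has_derivative frechet_derivative f (at x)) (at x)"
    using assms by (simp add: differentiable_on_def frechet_derivative_works)
  then show ?thesis
    by (simp add: total_deriv_def bounded_linear_Blinfun_apply has_derivative_bounded_linear)
qed

lemma total_deriv_diff:
  fixes f g :: "'a::euclidean_space \<Rightarrow> 'b::real_normed_vector"
  assumes "f differentiable_on UNIV" "g differentiable_on UNIV"
  shows "total_deriv (\<lambda>x. f x - g x) = (\<lambda>x. total_deriv f x - total_deriv g x)"
proof
  fix x
  show "total_deriv (\<lambda>x. f x - g x) x = total_deriv f x - total_deriv g x"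
    using has_derivative_diff[OF assms[THEN has_derivative_total_deriv]]
    by (intro total_deriv_eqI) (simp add: minus_blinfun.rep_eq)
qed

lemma C2_diff:
  fixes f g :: "'a::euclidean_space \<Rightarrow> 'b::real_normed_vector"
  assumes "C2 f" "C2 g"
  shows "C2 (\<lambda>x. f x - g x)" "total_deriv (total_deriv (\<lambda>x. f x - g x)) = (\<lambda>x. total_deriv (total_deriv f) x - total_deriv (total_deriv g) x)"
  using assms by (auto simp: C2_def total_deriv_diff intro!: differentiable_on_diff continuous_intros)

lemma total_deriv_periodic:
  fixes f :: "'a::euclidean_space \<Rightarrow> 'b::real_normed_vector"
  assumes "f differentiable_on UNIV" "\<And>x. f (x + k) = f x"
  shows "total_deriv f (x + k) = total_deriv f x"
proof -
  have "((\<lambda>y. f (y + k)) has_derivative blinfun_apply (total_deriv f (x + k))) (at x)"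
    by (rule has_derivative_compose[where f = "\<lambda>y. y + k" and f' = "\<lambda>h. h", simplified])
       (auto intro!: derivative_eq_intros has_derivative_total_deriv[OF assms(1)])
  then show ?thesis using assms(2) by (intro total_deriv_eqI[symmetric]) simp
qed

lemma bounded_periodic:
  fixes g :: "real ^ 'n \<Rightarrow> 'b::real_normed_vector"
  assumes "continuous_on UNIV g" "\<And>x k. k \<in> integer_lattice \<Longrightarrow> g (x + k) = g x"
  shows "bdd_above (range (\<lambda>x. norm (g x)))"
proof -
  let ?Q = "cbox 0 (\<chi> i. 1) :: (real ^ 'n) set"
  have "bounded (g ` ?Q)"
    by (intro compact_imp_bounded compact_continuous_image continuous_on_subset[OF assms(1)]) auto
  then obtain B where B: "\<And>x. x \<in> ?Q \<Longrightarrow> norm (g x) \<le> B"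
    by (auto simp: bounded_iff)
  have "norm (g x) \<le> B" for x
  proof -
    let ?k = "(\<chi> i. - of_int \<lfloor>x $ i\<rfloor>) :: real ^ 'n"
    have "?k \<in> integer_lattice" by (simp add: integer_lattice_def)
    then have "g (x + ?k) = g x" by (rule assms(2))
    moreover have "x + ?k \<in> ?Q"
      by (auto simp: mem_box_cart) linarith
    ultimately show ?thesis using B by metis
  qed
  then show ?thesis by (intro bdd_aboveI2)
qed

lemma C2_space_diff: "f \<in> C2_space \<Longrightarrow> g \<in> C2_space \<Longrightarrow> (\<lambda>x. f x - g x) \<in> C2_space"
  using C2_diff(1)[of "lift f" "lift g"] by (simp add: C2_space_def lift_def[abs_def])

lemma C2_space_bdd:
  fixes f :: "'u::finite torus \<Rightarrow> real ^ 'd"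
  assumes "f \<in> C2_space"
  shows "bdd_above (range (\<lambda>x. norm (lift f x)))"
    "bdd_above (range (\<lambda>x. norm (total_deriv (lift f) x)))"
    "bdd_above (range (\<lambda>x. norm (total_deriv (total_deriv (lift f)) x)))"
proof -
  have f: "lift f differentiable_on UNIV" "total_deriv (lift f) differentiable_on UNIV"
    "continuous_on UNIV (total_deriv (total_deriv (lift f)))"
    using assms by (auto simp: C2_space_def C2_def)
  have p0: "lift f (x + k) = lift f x" if "k \<in> integer_lattice" for x k
  proof -
    have "to_torus (x + k) = to_torus x" using that by (simp add: to_torus_eq_iff)
    then show ?thesis by (simp add: lift_def)
  qed
  have p1: "total_deriv (lift f) (x + k) = total_deriv (lift f) x" if "k \<in> integer_lattice" for x k
    by (rule total_deriv_periodic[OF f(1) p0[OF that]])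
  have p2: "total_deriv (total_deriv (lift f)) (x + k) = total_deriv (total_deriv (lift f)) x" if "k \<in> integer_lattice" for x k
    by (rule total_deriv_periodic[OF f(2) p1[OF that]])
  show "bdd_above (range (\<lambda>x. norm (lift f x)))"
    by (rule bounded_periodic[OF differentiable_imp_continuous_on[OF f(1)] p0])
  show "bdd_above (range (\<lambda>x. norm (total_deriv (lift f) x)))"
    by (rule bounded_periodic[OF differentiable_imp_continuous_on[OF f(2)] p1])
  show "bdd_above (range (\<lambda>x. norm (total_deriv (total_deriv (lift f)) x)))"
    by (rule bounded_periodic[OF f(3) p2])
qed

lemma SUP_norm_nonneg:
  fixes g :: "'a::real_normed_vector \<Rightarrow> 'b::real_normed_vector"
  assumes "bdd_above (range (\<lambda>x. norm (g x)))"
  shows "0 \<le> (SUP x. norm (g x))"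
  by (rule order_trans[OF norm_ge_zero cSUP_upper[OF UNIV_I assms, of 0]])

lemma SUP_norm_triangle:
  fixes g h :: "'a::real_normed_vector \<Rightarrow> 'b::real_normed_vector"
  assumes "bdd_above (range (\<lambda>x. norm (g x)))" "bdd_above (range (\<lambda>x. norm (h x)))"
  shows "(SUP x. norm (g x + h x)) \<le> (SUP x. norm (g x)) + (SUP x. norm (h x))"
  by (intro cSUP_least UNIV_not_empty order_trans[OF norm_triangle_ineq] add_mono
      cSUP_upper UNIV_I assms)

lemma Metric_space_C2:
  "Metric_space C2_space (C2_dist :: ('u::finite torus \<Rightarrow> real ^ 'd) \<Rightarrow> _)"
proof
  have dist: "C2_dist f g = (SUP x. norm (lift f x - lift g x)) +
      (SUP x. norm (total_deriv (lift f) x - total_deriv (lift g) x)) +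
      (SUP x. norm (total_deriv (total_deriv (lift f)) x - total_deriv (total_deriv (lift g)) x))"
    and bdd: "bdd_above (range (\<lambda>x. norm (lift f x - lift g x)))"
      "bdd_above (range (\<lambda>x. norm (total_deriv (lift f) x - total_deriv (lift g) x)))"
      "bdd_above (range (\<lambda>x. norm (total_deriv (total_deriv (lift f)) x - total_deriv (total_deriv (lift g)) x)))"
    if fg: "f \<in> C2_space" "g \<in> C2_space" for f g :: "'u torus \<Rightarrow> real ^ 'd"
  proof -
    have l: "lift (\<lambda>x. f x - g x) = (\<lambda>x. lift f x - lift g x)" by (simp add: lift_def fun_eq_iff)
    have d: "total_deriv (lift (\<lambda>x. f x - g x)) = (\<lambda>x. total_deriv (lift f) x - total_deriv (lift g) x)"
      unfolding l using fg by (intro total_deriv_diff) (auto simp: C2_space_def C2_def)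
    have dd: "total_deriv (total_deriv (lift (\<lambda>x. f x - g x))) = (\<lambda>x. total_deriv (total_deriv (lift f)) x - total_deriv (total_deriv (lift g)) x)"
      unfolding l using fg by (intro C2_diff(2)) (auto simp: C2_space_def)
    show "C2_dist f g = (SUP x. norm (lift f x - lift g x)) +
      (SUP x. norm (total_deriv (lift f) x - total_deriv (lift g) x)) +
      (SUP x. norm (total_deriv (total_deriv (lift f)) x - total_deriv (total_deriv (lift g)) x))"
      using fg unfolding C2_dist_def C2_norm_def unfolding dd unfolding d unfolding l by simp
    show "bdd_above (range (\<lambda>x. norm (lift f x - lift g x)))"
      "bdd_above (range (\<lambda>x. norm (total_deriv (lift f) x - total_deriv (lift g) x)))"
      "bdd_above (range (\<lambda>x. norm (total_deriv (total_deriv (lift f)) x - total_deriv (total_deriv (lift g)) x)))"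
      using C2_space_bdd[OF C2_space_diff[OF fg]] unfolding dd unfolding d unfolding l by simp_all
  qed
  fix f g h :: "'u torus \<Rightarrow> real ^ 'd"
  show "0 \<le> C2_dist f g"
  proof (cases "f \<in> C2_space \<and> g \<in> C2_space")
    case True
    then show ?thesis by (simp add: dist bdd[THEN SUP_norm_nonneg])
  qed (auto simp: C2_dist_def)
  show "C2_dist f g = C2_dist g f"
  proof (cases "f \<in> C2_space \<and> g \<in> C2_space")
    case True
    then show ?thesis by (simp add: dist norm_minus_commute)
  qed (auto simp: C2_dist_def)
  show "C2_dist f g = 0 \<longleftrightarrow> f = g" if fg: "f \<in> C2_space" "g \<in> C2_space"
  proof
    assume "f = g"
    then show "C2_dist f g = 0" using fg by (simp add: dist)
  next
    assume "C2_dist f g = 0"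
    then have "(SUP x. norm (lift f x - lift g x)) = 0"
      using bdd[OF fg, THEN SUP_norm_nonneg] by (simp add: dist[OF fg])
    then have "norm (lift f x - lift g x) \<le> 0" for x
      using cSUP_upper[OF UNIV_I bdd(1)[OF fg], of x] by simp
    then have "f (to_torus x) = g (to_torus x)" for x by (simp add: lift_def)
    then show "f = g" by (metis ext to_torus_rep)
  qed
  show "C2_dist f h \<le> C2_dist f g + C2_dist g h"
    if "f \<in> C2_space" "g \<in> C2_space" "h \<in> C2_space"
    using SUP_norm_triangle[OF bdd(1)[OF that(1,2)] bdd(1)[OF that(2,3)]]
      SUP_norm_triangle[OF bdd(2)[OF that(1,2)] bdd(2)[OF that(2,3)]]
      SUP_norm_triangle[OF bdd(3)[OF that(1,2)] bdd(3)[OF that(2,3)]]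
    by (simp add: dist that)
qed

lemma topspace_C2_topology: "topspace C2_topology = C2_space"
  by (simp add: C2_topology_def Metric_space.topspace_mtopology[OF Metric_space_C2])

section \<open>SRB measures\<close>

definition weakly_converges :: "(nat \<Rightarrow> 'a::topological_space measure) \<Rightarrow> 'a measure \<Rightarrow> bool" where
  "weakly_converges \<nu> \<mu> \<longleftrightarrow>
     (\<forall>\<phi>::'a \<Rightarrow> real. continuous_on UNIV \<phi> \<and> bounded (range \<phi>) \<longrightarrow>
        (\<lambda>n. integral\<^sup>L (\<nu> n) \<phi>) \<longlonglongrightarrow> integral\<^sup>L \<mu> \<phi>)"

text \<open>The measure \<open>(\<delta>\<^bsub>z\<^esub> + \<dots> + \<delta>\<^bsub>T\<^sup>n\<^sup>-\<^sup>1 z\<^esub>) / n\<close>\<close>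

definition empirical_measure :: "('a::topological_space \<Rightarrow> 'a) \<Rightarrow> 'a \<Rightarrow> nat \<Rightarrow> 'a measure" where
  "empirical_measure T z n = distr (uniform_count_measure {..<n}) borel (\<lambda>k. (T ^^ k) z)"

lemma integral_empirical_measure:
  fixes \<phi> :: "'a::topological_space \<Rightarrow> real"
  assumes "\<phi> \<in> borel_measurable borel"
  shows "integral\<^sup>L (empirical_measure T z n) \<phi> = (\<Sum>k<n. \<phi> ((T ^^ k) z)) / n"
proof -
  have "(\<lambda>k. (T ^^ k) z) \<in> uniform_count_measure {..<n} \<rightarrow>\<^sub>M borel"
    by (simp cong: measurable_cong_sets)
  then show ?thesis
    unfolding empirical_measure_def
    by (subst integral_distr[OF _ assms]) (simp_all add: integral_uniform_count_measure)
qed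

definition SRB_measure ::
  "('u::finite torus \<times> (real ^ 'd) \<Rightarrow> 'u torus \<times> (real ^ 'd)) \<Rightarrow> ('u torus \<times> (real ^ 'd)) measure \<Rightarrow> bool" where
  "SRB_measure T \<mu> \<longleftrightarrow>
     sets \<mu> = sets borel \<and> prob_space \<mu> \<and> distr \<mu> borel T = \<mu> \<and>
     (AE z in product_volume. weakly_converges (empirical_measure T z) \<mu>)"

end

theory Submission
  imports Defs
begin

text \<open>
  Write \<open>T(x, y) = (E x, C y + f x)\<close> for the skew product. The uniform distribution on the product
  of the torus with a unit box is pushed forward by the iterates of \<open>T\<^sup>q\<close>, for a fixed large \<open>q\<close>. Over
  a point \<open>x\<close> of the torus the density of the result is an average of translates of one kernel, one
  translate for every sequence of inverse branches of \<open>E\<^sup>q\<close>; the translation is the value at \<open>x\<close> of a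
  branch, a Lipschitz function which sums \<open>C\<^sup>k f\<close> along the backward orbit of \<open>x\<close>. The integral of the
  squared density is called the energy. One more step of \<open>T\<^sup>q\<close> writes the new density as a sum of
  \<open>N = \<bar>det E\<bar>\<^sup>q\<close> pieces, one per preimage. Cauchy-Schwarz for \<open>N\<close> summands only shows that the energy
  grows at most by the factor \<open>\<bar>det C\<bar>\<close> to the power \<open>- q\<close>. If two of the pieces have a bounded overlap,
  they can be merged before the inequality is applied (\<open>square_sum_merge_pair\<close>), and the factor drops
  to \<open>(N - 1) / (N \<bar>det C\<bar>\<^sup>q)\<close>. It is less than 1 as soon as \<open>C\<close> is close to the identity, and then all
  energies are bounded (\<open>energy_bounded\<close>).

  The overlap of two pieces is bounded when the difference of their branches is transverse, which
  means close to a linear surjection onto the fibre (\<open>transversal_ball_bound\<close>). A fibre map with this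
  property for one pair of preimages is built from a homoclinic orbit of \<open>0\<close>
  (\<open>exists_transverse_fibre_map\<close>). Choose a lattice vector \<open>l\<close> for which \<open>w = E\<^sup>-\<^sup>1 l\<close> is not in the lattice.
  On the torus the points \<open>E\<^sup>-\<^sup>k l\<close> with \<open>k \<ge> 2\<close> and their limit \<open>0\<close> differ from \<open>w\<close>, so a bump around \<open>w\<close>
  can vanish near all of them, and as \<open>u \<ge> d\<close> its derivative at \<open>w\<close> can be onto. Let two backward orbits
  share their first steps, which shrink the unit cube to a small neighbourhood of \<open>0\<close>. If the first one
  then stays near \<open>0\<close>, it does not meet the bump; if the second one jumps to \<open>w\<close> and returns to \<open>0\<close> along
  the homoclinic orbit, it meets the bump exactly once. The difference of the two branches is then a
  linear surjection up to small errors. All estimates use only the distance of \<open>C\<close> from the identity and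
  the Lipschitz constant of the perturbation of \<open>f\<close>, so they persist on an open set of pairs.

  Bounded energy makes the pushforwards uniformly absolutely continuous. Their integrals of Lipschitz
  functions converge, because \<open>T\<close> contracts the fibres and \<open>E\<close> preserves Lebesgue measure
  (\<open>initial_means\<close>); by uniform absolute continuity the pushforwards then converge on every Borel set,
  and the limit is a measure (\<open>setwise_limit_measure\<close>), which inherits absolute continuity. Along almost every orbit the averages
  of a Lipschitz function converge to its integral against this limit (\<open>orbit_averages\<close>): fibre
  contraction reduces the claim to functions on the torus, whose correlations under \<open>E\<close> decay
  exponentially since averaging over preimages flattens a function (\<open>torus_decorrelation\<close>). Countably
  many tent functions determine weak convergence, so the limit measure is the SRB measure.
\<close>

section \<open>Lebesgue measure under linear maps\<close>

lemma nn_integral_lborel_translate: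
  fixes h :: "'a::euclidean_space \<Rightarrow> ennreal"
  assumes [measurable]: "h \<in> borel_measurable borel"
  shows "(\<integral>\<^sup>+x. h (x + a) \<partial>lborel) = (\<integral>\<^sup>+x. h x \<partial>lborel)"
proof -
  have "(\<integral>\<^sup>+x. h x \<partial>lborel) = (\<integral>\<^sup>+x. h x \<partial>distr lborel borel ((+) a))"
    by (simp add: lborel_distr_plus)
  also have "\<dots> = (\<integral>\<^sup>+x. h (x + a) \<partial>lborel)"
    by (subst nn_integral_distr) (simp_all add: add.commute)
  finally show ?thesis ..
qed

lemma nn_integral_lborel_reflect:
  fixes h :: "'a::euclidean_space \<Rightarrow> ennreal"
  assumes [measurable]: "h \<in> borel_measurable borel"
  shows "(\<integral>\<^sup>+x. h (a - x) \<partial>lborel) = (\<integral>\<^sup>+x. h x \<partial>lborel)"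
proof -
  have "(\<integral>\<^sup>+x. h x \<partial>lborel) = (\<integral>\<^sup>+x. h x \<partial>density (distr lborel borel (\<lambda>x. a + (-1) *\<^sub>R x)) (\<lambda>_. ennreal (\<bar>-1\<bar> ^ DIM('a))))"
    by (subst lborel_affine[of "-1" a]) simp_all
  also have "\<dots> = (\<integral>\<^sup>+x. h (a - x) \<partial>lborel)"
    by (simp add: density_1 nn_integral_distr)
  finally show ?thesis ..
qed

text \<open>
  The inverse of \<open>\<bar>det L\<bar>\<close>, as the factor by which taking preimages changes volume; it is the same for
  all sets (\<open>nn_integral_linear\<close>) and can be read off from one cube.
\<close>

definition volume_factor :: "('a::euclidean_space \<Rightarrow> 'a) \<Rightarrow> ennreal" where
  "volume_factor L = emeasure lborel (L -` cbox 0 One)"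

text \<open>
  Both \<open>h \<mapsto> \<integral> h \<circ> L\<close> and Lebesgue measure are translation invariant, and two such measures are
  proportional: integrate \<open>h (L x) g (y + L x)\<close> over \<open>x\<close> and \<open>y\<close> in both orders, with \<open>g\<close> the indicator of
  a cube.
\<close>

lemma nn_integral_linear:
  fixes L :: "'a::euclidean_space \<Rightarrow> 'a"
  assumes L: "linear L" "linear Li" "\<And>x. L (Li x) = x" and [measurable]: "h \<in> borel_measurable borel"
  shows "(\<integral>\<^sup>+x. h (L x) \<partial>lborel) = volume_factor L * (\<integral>\<^sup>+x. h x \<partial>lborel)"
proof -
  have [measurable]: "L \<in> borel_measurable borel" "Li \<in> borel_measurable borel"
    using L by (auto intro!: borel_measurable_continuous_onI linear_continuous_on simp: linear_conv_bounded_linear)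
  define g :: "'a \<Rightarrow> ennreal" where "g = indicator (cbox 0 One)"
  have [measurable]: "g \<in> borel_measurable borel" by (simp add: g_def)
  have "emeasure lborel (cbox (0::'a) One) = 1" 
    by (subst emeasure_lborel_cbox) auto
  then have g1: "(\<integral>\<^sup>+y. g y \<partial>lborel) = 1" by (simp add: g_def)
  have "(\<integral>\<^sup>+x. h (L x) \<partial>lborel) = (\<integral>\<^sup>+x. h (L x) * (\<integral>\<^sup>+y. g (y + L x) \<partial>lborel) \<partial>lborel)"
    by (simp add: nn_integral_lborel_translate g1)
  also have "\<dots> = (\<integral>\<^sup>+x. (\<integral>\<^sup>+y. h (L x) * g (y + L x) \<partial>lborel) \<partial>lborel)"
    by (simp add: nn_integral_cmult)
  also have "\<dots> = (\<integral>\<^sup>+y. (\<integral>\<^sup>+x. h (L x) * g (y + L x) \<partial>lborel) \<partial>lborel)"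
    by (rule lborel_pair.Fubini') measurable
  also have "\<dots> = (\<integral>\<^sup>+y. (\<integral>\<^sup>+x. h (L x - y) * g (L x) \<partial>lborel) \<partial>lborel)"
  proof (rule nn_integral_cong)
    fix y
    have "(\<integral>\<^sup>+x. h (L x) * g (y + L x) \<partial>lborel) = (\<integral>\<^sup>+x. h (L (x + - Li y)) * g (y + L (x + - Li y)) \<partial>lborel)"
      by (rule nn_integral_lborel_translate[symmetric]) simp
    also have "\<dots> = (\<integral>\<^sup>+x. h (L x - y) * g (L x) \<partial>lborel)"
      using L by (simp add: linear_diff)
    finally show "(\<integral>\<^sup>+x. h (L x) * g (y + L x) \<partial>lborel) = (\<integral>\<^sup>+x. h (L x - y) * g (L x) \<partial>lborel)" .
  qed
  also have "\<dots> = (\<integral>\<^sup>+x. (\<integral>\<^sup>+y. h (L x - y) * g (L x) \<partial>lborel) \<partial>lborel)"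
    by (rule lborel_pair.Fubini') measurable
  also have "\<dots> = (\<integral>\<^sup>+x. (\<integral>\<^sup>+y. h y \<partial>lborel) * g (L x) \<partial>lborel)"
    by (simp add: nn_integral_multc nn_integral_lborel_reflect)
  also have "\<dots> = (\<integral>\<^sup>+y. h y \<partial>lborel) * (\<integral>\<^sup>+x. indicator (L -` cbox 0 One) x \<partial>lborel)"
    by (simp add: nn_integral_cmult g_def indicator_def)
  also have "(\<integral>\<^sup>+x. indicator (L -` cbox 0 One) x \<partial>lborel) = volume_factor L"
    unfolding volume_factor_def
    by (subst nn_integral_indicator) (simp_all add: measurable_sets_borel[of L lborel])
  finally show ?thesis by (simp add: mult.commute)
qed

lemma emeasure_linear_vimage:
  fixes L :: "'a::euclidean_space \<Rightarrow> 'a"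
  assumes L: "linear L" "linear Li" "\<And>x. L (Li x) = x" and A: "A \<in> sets borel"
  shows "emeasure lborel (L -` A) = volume_factor L * emeasure lborel A"
proof -
  have [measurable]: "L \<in> borel_measurable borel"
    using L by (auto intro!: borel_measurable_continuous_onI linear_continuous_on simp: linear_conv_bounded_linear)
  have "(\<integral>\<^sup>+x. indicator A (L x) \<partial>lborel) = (\<integral>\<^sup>+x. indicator (L -` A) x \<partial>lborel)"
    by (simp add: indicator_def)
  also have "\<dots> = emeasure lborel (L -` A)"
    using A by (subst nn_integral_indicator) (simp_all add: measurable_sets_borel[of L lborel])
  finally show ?thesis
    using nn_integral_linear[OF L, of "indicator A"] A by simp
qed

section \<open>Inverse branches modulo the lattice\<close>

definition half_open_cube :: "(real ^ 'n) set" where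
  "half_open_cube = {x. \<forall>i. 0 \<le> x $ i \<and> x $ i < 1}"

definition floor_vec :: "real ^ 'n \<Rightarrow> real ^ 'n" where
  "floor_vec x = (\<chi> i. of_int \<lfloor>x $ i\<rfloor>)"

lemma floor_vec_lattice [simp]: "floor_vec x \<in> integer_lattice"
  by (simp add: floor_vec_def integer_lattice_def)

lemma diff_floor_vec [simp]: "x - floor_vec x \<in> half_open_cube"
  by (auto simp: floor_vec_def half_open_cube_def) linarith+

lemma integer_lattice_diff: "x \<in> integer_lattice \<Longrightarrow> y \<in> integer_lattice \<Longrightarrow> x - y \<in> integer_lattice"
  by (simp add: integer_lattice_def)

lemma half_open_cube_unique:
  assumes "x \<in> half_open_cube" "y \<in> half_open_cube" "x - y \<in> integer_lattice"
  shows "x = y"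
proof -
  have "x $ i = y $ i" for i
  proof -
    obtain k :: int where k: "x $ i - y $ i = k"
      using assms(3) by (auto simp: integer_lattice_def elim: Ints_cases)
    have "0 \<le> x $ i" "x $ i < 1" "0 \<le> y $ i" "y $ i < 1"
      using assms(1,2) by (simp_all add: half_open_cube_def)
    then have "k = 0" using k by linarith
    with k show ?thesis by simp
  qed
  then show ?thesis by (simp add: vec_eq_iff)
qed

lemma borel_half_open_cube [measurable]: "(half_open_cube :: (real ^ 'n) set) \<in> sets borel"
  unfolding half_open_cube_def by measurable

lemma half_open_cube_subset: "half_open_cube \<subseteq> cbox 0 (\<chi> i. 1)"
  by (auto simp: half_open_cube_def mem_box_cart less_imp_le)

lemma bounded_half_open_cube: "bounded half_open_cube"
  by (rule bounded_subset[OF bounded_cbox half_open_cube_subset])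

lemma norm_half_open_cube:
  fixes x :: "real ^ 'n"
  assumes "x \<in> half_open_cube"
  shows "norm x \<le> CARD('n)"
proof -
  have "norm x \<le> (\<Sum>i\<in>UNIV. \<bar>x $ i\<bar>)" by (rule norm_le_l1_cart)
  also have "\<dots> \<le> (\<Sum>i\<in>(UNIV :: 'n set). 1)"
    using assms by (intro sum_mono) (auto simp: half_open_cube_def less_imp_le)
  finally show ?thesis by simp
qed

lemma emeasure_unit_cbox: "emeasure lborel (cbox 0 (\<chi> i. 1) :: (real ^ 'n) set) = 1"
proof -
  have "cbox 0 (\<chi> i. 1) \<noteq> ({} :: (real ^ 'n) set)" by (auto simp: interval_ne_empty_cart less_eq_vec_def)
  then have "measure lborel (cbox 0 (\<chi> i. 1) :: (real ^ 'n) set) = 1" by (simp add: content_cbox_cart)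
  moreover have "emeasure lborel (cbox 0 (\<chi> i. 1) :: (real ^ 'n) set) \<noteq> \<top>"
    using emeasure_lborel_cbox_finite[of 0 "(\<chi> i. 1) :: real ^ 'n"] by (simp add: less_top)
  ultimately show ?thesis by (simp add: emeasure_eq_ennreal_measure)
qed

lemma emeasure_half_open_cube: "emeasure lborel (half_open_cube :: (real ^ 'n) set) = 1"
proof (rule antisym)
  have "emeasure lborel (half_open_cube :: (real ^ 'n) set) \<le> emeasure lborel (cbox 0 (\<chi> i. 1) :: (real ^ 'n) set)"
    by (rule emeasure_mono[OF half_open_cube_subset]) simp
  then show "emeasure lborel (half_open_cube :: (real ^ 'n) set) \<le> 1" by (simp only: emeasure_unit_cbox)
  have "emeasure lborel (box 0 (\<chi> i. 1) :: (real ^ 'n) set) = 1"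
    using emeasure_unit_cbox[where 'n = 'n] by (simp add: emeasure_lborel_box_eq emeasure_lborel_cbox_eq)
  moreover have "box 0 (\<chi> i. 1) \<subseteq> (half_open_cube :: (real ^ 'n) set)"
    by (auto simp: half_open_cube_def mem_box_cart less_imp_le)
  ultimately show "emeasure lborel (half_open_cube :: (real ^ 'n) set) \<ge> 1"
    by (metis emeasure_mono borel_half_open_cube sets_lborel)
qed

lemma finite_lattice_bounded:
  assumes "bounded B"
  shows "finite (integer_lattice \<inter> (B :: (real ^ 'n) set))"
proof -
  obtain b where b: "\<And>x. x \<in> B \<Longrightarrow> norm x \<le> b" using assms by (auto simp: bounded_iff)
  let ?K = "{- \<lceil>b\<rceil>..\<lceil>b\<rceil>}"
  have "integer_lattice \<inter> B \<subseteq> (\<lambda>k. \<chi> i. of_int (k i)) ` (UNIV \<rightarrow>\<^sub>E ?K)"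
  proof
    fix x :: "real ^ 'n" assume x: "x \<in> integer_lattice \<inter> B"
    define k where "k i = \<lfloor>x $ i\<rfloor>" for i
    have kx: "of_int (k i) = x $ i" for i
      using x by (auto simp: integer_lattice_def k_def elim!: Ints_cases)
    have xb: "\<bar>x $ i\<bar> \<le> b" for i using b[of x] x component_le_norm_cart[of x i] by auto
    then have "real_of_int (k i) \<le> \<lceil>b\<rceil>" "- \<lceil>b\<rceil> \<le> real_of_int (k i)" for i
      unfolding kx using le_of_int_ceiling[of b] xb[of i] by linarith+
    then have "k i \<in> ?K" for i unfolding of_int_minus[symmetric] of_int_le_iff by simp
    then have "k \<in> UNIV \<rightarrow>\<^sub>E ?K" by auto
    then show "x \<in> (\<lambda>k. \<chi> i. of_int (k i)) ` (UNIV \<rightarrow>\<^sub>E ?K)"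
      by (intro image_eqI[of _ _ k]) (simp_all add: kx)
  qed
  moreover have "finite (UNIV \<rightarrow>\<^sub>E ?K :: ('n \<Rightarrow> int) set)" by (intro finite_PiE) auto
  ultimately show ?thesis using finite_surj by blast
qed

definition lattice_periodic :: "(real ^ 'n \<Rightarrow> 'b) \<Rightarrow> bool" where
  "lattice_periodic \<Psi> \<longleftrightarrow> (\<forall>x. \<forall>l\<in>integer_lattice. \<Psi> (x + l) = \<Psi> x)"

lemma lattice_periodicD: "lattice_periodic \<Psi> \<Longrightarrow> x - y \<in> integer_lattice \<Longrightarrow> \<Psi> x = \<Psi> y"
  unfolding lattice_periodic_def by (metis add.commute diff_add_cancel)

text \<open>
  A linear bijection \<open>G\<close> that preserves the integer lattice induces an endomorphism of the torus. The
  preimages of the class of \<open>x\<close> are the classes of \<open>Gi (x + d)\<close>, where \<open>d\<close> runs over representatives of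
  the lattice modulo its image under \<open>G\<close>.
\<close>

locale lattice_map =
  fixes G Gi :: "real ^ 'u \<Rightarrow> real ^ 'u"
  assumes linear_G: "linear G" and linear_Gi: "linear Gi"
    and G_Gi [simp]: "G (Gi x) = x" and Gi_G [simp]: "Gi (G x) = x"
    and G_lattice: "l \<in> integer_lattice \<Longrightarrow> G l \<in> integer_lattice"
begin

text \<open>
  A complete set of representatives for every \<open>x\<close>. The choice \<open>x = 0\<close> is used throughout; the others
  appear when \<open>Gi\<close> maps a cube onto a set that does not fit the lattice cubes.
\<close>

definition coset_reps :: "real ^ 'u \<Rightarrow> (real ^ 'u) set" where
  "coset_reps x = {l \<in> integer_lattice. Gi (x + l) \<in> half_open_cube}"

definition coset_rep :: "real ^ 'u \<Rightarrow> real ^ 'u \<Rightarrow> real ^ 'u" where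
  "coset_rep x l = l - G (floor_vec (Gi (x + l)))"

lemma coset_rep_in: "l \<in> integer_lattice \<Longrightarrow> coset_rep x l \<in> coset_reps x"
proof -
  assume l: "l \<in> integer_lattice"
  have "Gi (x + coset_rep x l) = Gi (x + l) - floor_vec (Gi (x + l))"
    by (simp add: coset_rep_def linear_add[OF linear_Gi] linear_diff[OF linear_Gi] add_diff_eq)
  then show ?thesis
    using l by (simp add: coset_reps_def coset_rep_def G_lattice integer_lattice_diff)
qed

lemma coset_rep_unique:
  assumes "d \<in> coset_reps x" "l \<in> integer_lattice" "Gi (l - d) \<in> integer_lattice"
  shows "coset_rep x l = d"
proof -
  let ?m = "floor_vec (Gi (x + l))"
  have "Gi (x + coset_rep x l) - Gi (x + d) = Gi (l - d) - ?m"
    by (simp add: coset_rep_def linear_add[OF linear_Gi] linear_diff[OF linear_Gi])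
  moreover have "Gi (x + coset_rep x l) \<in> half_open_cube" "Gi (x + d) \<in> half_open_cube"
    using coset_rep_in[OF assms(2), of x] assms(1) by (auto simp: coset_reps_def)
  ultimately have "Gi (x + coset_rep x l) = Gi (x + d)"
    using assms(3) by (intro half_open_cube_unique) (auto intro: integer_lattice_diff)
  then have "G (Gi (x + coset_rep x l)) = G (Gi (x + d))" by simp
  then show ?thesis by simp
qed

lemma Gi_diff_coset_rep: "Gi (l - coset_rep x l) \<in> integer_lattice"
  by (simp add: coset_rep_def)

lemma finite_coset_reps: "finite (coset_reps x)"
proof -
  have "coset_reps x \<subseteq> integer_lattice \<inter> (\<lambda>y. y - x) ` (G ` half_open_cube)"
  proof
    fix l assume "l \<in> coset_reps x"
    then have "l \<in> integer_lattice" "Gi (x + l) \<in> half_open_cube" "l = G (Gi (x + l)) - x"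
      by (auto simp: coset_reps_def)
    then show "l \<in> integer_lattice \<inter> (\<lambda>y. y - x) ` (G ` half_open_cube)" by blast
  qed
  moreover have "bounded ((\<lambda>y. y - x) ` (G ` half_open_cube))"
    using bounded_translation[of "G ` half_open_cube" "-x"] bounded_linear_image[OF bounded_half_open_cube, of G] linear_G
    by (simp add: linear_conv_bounded_linear)
  ultimately show ?thesis by (meson finite_lattice_bounded finite_subset)
qed

text \<open>
  Moving the base point by a lattice vector permutes the cosets, so the sum of a periodic function
  over all preimages depends neither on the representatives nor on the lift of the base point.
\<close>

lemma sum_coset_reps_shift:
  fixes \<Psi> :: "real ^ 'u \<Rightarrow> 'b::comm_monoid_add"
  assumes \<Psi>: "lattice_periodic \<Psi>" and z: "z - y \<in> integer_lattice"
  shows "(\<Sum>d\<in>coset_reps x. \<Psi> (Gi (z + d))) = (\<Sum>d\<in>coset_reps x'. \<Psi> (Gi (y + d)))"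
proof -
  have mem: "d \<in> integer_lattice" if "d \<in> coset_reps t" for d t using that by (simp add: coset_reps_def)
  define a where "a = z - y"
  note z = z[folded a_def]
  have inv: "coset_rep t (coset_rep t' (d + b) + c) = d"
    if "d \<in> coset_reps t" "b \<in> integer_lattice" "b = - c" for t t' d b c
  proof (rule coset_rep_unique[OF that(1)])
    have m: "coset_rep t' (d + b) \<in> integer_lattice"
      by (intro mem[OF coset_rep_in] integer_lattice_add mem[OF that(1)] that(2))
    have "c \<in> integer_lattice" using integer_lattice_minus[OF that(2)] that(3) by simp
    with m show "coset_rep t' (d + b) + c \<in> integer_lattice" by (rule integer_lattice_add)
    have "coset_rep t' (d + b) + c - d = - ((d + b) - coset_rep t' (d + b))"
      using that(3) by simp
    then have "Gi (coset_rep t' (d + b) + c - d) = - Gi ((d + b) - coset_rep t' (d + b))"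
      by (simp only: linear_neg[OF linear_Gi])
    then show "Gi (coset_rep t' (d + b) + c - d) \<in> integer_lattice"
      by (simp only: integer_lattice_minus Gi_diff_coset_rep)
  qed
  show ?thesis
  proof (rule sum.reindex_bij_witness[where j = "\<lambda>d. coset_rep x' (d + a)" and i = "\<lambda>d. coset_rep x (d + - a)"])
    fix d assume d: "d \<in> coset_reps x"
    show "coset_rep x (coset_rep x' (d + a) + - a) = d" by (rule inv[OF d z]) simp
    show "coset_rep x' (d + a) \<in> coset_reps x'" by (intro coset_rep_in integer_lattice_add z mem[OF d])
    have "Gi (y + coset_rep x' (d + a)) - Gi (z + d) = - Gi ((d + a) - coset_rep x' (d + a))"
      by (simp add: linear_diff[OF linear_Gi] linear_add[OF linear_Gi] a_def)
    also have "\<dots> \<in> integer_lattice" by (intro integer_lattice_minus Gi_diff_coset_rep)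
    finally show "\<Psi> (Gi (y + coset_rep x' (d + a))) = \<Psi> (Gi (z + d))"
      by (rule lattice_periodicD[OF \<Psi>])
  next
    fix d assume d: "d \<in> coset_reps x'"
    show "coset_rep x' (coset_rep x (d + - a) + a) = d"
      by (rule inv[OF d]) (simp_all add: integer_lattice_minus z)
    show "coset_rep x (d + - a) \<in> coset_reps x"
      by (intro coset_rep_in integer_lattice_add integer_lattice_minus z mem[OF d])
  qed
qed

lemma measurable_Gi [measurable]: "Gi \<in> borel_measurable borel"
  and measurable_G [measurable]: "G \<in> borel_measurable borel"
  using linear_G linear_Gi
  by (auto intro!: borel_measurable_continuous_onI linear_continuous_on simp: linear_conv_bounded_linear)

text \<open>
  Substituting \<open>y = Gi x\<close> turns the integral of \<open>\<Psi>\<close> over the unit cube into one over its image under \<open>G\<close>.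
  That image is cut along the lattice cubes and the pieces are translated back to the unit cube; the
  translations that land on a given \<open>x\<close> are exactly \<open>coset_reps x\<close>.
\<close>

lemma nn_integral_sum_coset_reps_aux:
  fixes \<Psi> :: "real ^ 'u \<Rightarrow> ennreal"
  assumes \<Psi>: "lattice_periodic \<Psi>" and [measurable]: "\<Psi> \<in> borel_measurable borel"
  shows "(\<integral>\<^sup>+x\<in>half_open_cube. (\<Sum>d\<in>coset_reps 0. \<Psi> (Gi (x + d))) \<partial>lborel) =
     volume_factor Gi * (\<integral>\<^sup>+x\<in>half_open_cube. \<Psi> x \<partial>lborel)"
proof -
  let ?Q = "half_open_cube :: (real ^ 'u) set"
  define FL where "FL = integer_lattice \<inter> {l. \<exists>x\<in>?Q. Gi (x + l) \<in> ?Q}"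
  have fin: "finite FL"
  proof -
    obtain b where b0: "0 < b" and b: "\<And>y. norm (G y) \<le> norm y * b"
      using linear_G by (metis bounded_linear.pos_bounded linear_conv_bounded_linear)
    have "norm l \<le> CARD('u) * b + CARD('u)" if "Gi (x + l) \<in> ?Q" "x \<in> ?Q" for l x
    proof -
      have "norm l = norm (G (Gi (x + l)) - x)" by simp
      also have "\<dots> \<le> norm (G (Gi (x + l))) + norm x" by (rule norm_triangle_ineq4)
      also have "norm (G (Gi (x + l))) \<le> norm (Gi (x + l)) * b" by (rule b)
      also have "\<dots> \<le> CARD('u) * b"
        using norm_half_open_cube[OF that(1)] b0 by (intro mult_mono) auto
      finally show ?thesis using norm_half_open_cube[OF that(2)] by simp
    qed
    then have "bounded {l. \<exists>x\<in>?Q. Gi (x + l) \<in> ?Q}" by (auto simp: bounded_iff)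
    then show ?thesis unfolding FL_def by (rule finite_lattice_bounded)
  qed
  have "volume_factor Gi * (\<integral>\<^sup>+x\<in>?Q. \<Psi> x \<partial>lborel) = (\<integral>\<^sup>+x. \<Psi> (Gi x) * indicator ?Q (Gi x) \<partial>lborel)"
    by (rule nn_integral_linear[OF linear_Gi linear_G Gi_G, symmetric]) simp
  also have "\<dots> = (\<integral>\<^sup>+x. (\<Sum>l\<in>FL. \<Psi> (Gi x) * indicator ?Q (Gi x) * indicator ?Q (x - l)) \<partial>lborel)"
  proof (rule nn_integral_cong)
    fix x :: "real ^ 'u"
    have "(\<Sum>l\<in>FL. indicator ?Q (x - l)) = (1::ennreal)" if x: "Gi x \<in> ?Q"
    proof -
      have "Gi ((x - floor_vec x) + floor_vec x) \<in> ?Q" using x by simp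
      then have fl: "floor_vec x \<in> FL" unfolding FL_def
        using floor_vec_lattice diff_floor_vec by blast
      have "indicator ?Q (x - l) = (if l = floor_vec x then 1 else 0 :: ennreal)" if "l \<in> FL" for l
      proof -
        have "x - l \<in> ?Q \<longleftrightarrow> l = floor_vec x"
        proof
          assume "x - l \<in> ?Q"
          have "x - l - (x - floor_vec x) \<in> integer_lattice"
            using \<open>l \<in> FL\<close> by (simp add: FL_def integer_lattice_diff)
          with \<open>x - l \<in> ?Q\<close> have "x - l = x - floor_vec x"
            by (intro half_open_cube_unique diff_floor_vec)
          then show "l = floor_vec x" by simp
        qed simp
        then show ?thesis by (simp add: indicator_def)
      qed
      then have "(\<Sum>l\<in>FL. indicator ?Q (x - l)) = (\<Sum>l\<in>FL. if l = floor_vec x then 1 else 0 :: ennreal)"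
        by (intro sum.cong) auto
      also have "\<dots> = 1" using fin fl by simp
      finally show ?thesis .
    qed
    then show "\<Psi> (Gi x) * indicator ?Q (Gi x) = (\<Sum>l\<in>FL. \<Psi> (Gi x) * indicator ?Q (Gi x) * indicator ?Q (x - l))"
      by (auto simp: sum_distrib_left[symmetric] indicator_def)
  qed
  also have "\<dots> = (\<Sum>l\<in>FL. \<integral>\<^sup>+x. \<Psi> (Gi x) * indicator ?Q (Gi x) * indicator ?Q (x - l) \<partial>lborel)"
    by (rule nn_integral_sum) simp
  also have "\<dots> = (\<Sum>l\<in>FL. \<integral>\<^sup>+x. \<Psi> (Gi (x + l)) * indicator ?Q (Gi (x + l)) * indicator ?Q x \<partial>lborel)"
  proof (intro sum.cong refl)
    fix l
    show "(\<integral>\<^sup>+x. \<Psi> (Gi x) * indicator ?Q (Gi x) * indicator ?Q (x - l) \<partial>lborel) =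
        (\<integral>\<^sup>+x. \<Psi> (Gi (x + l)) * indicator ?Q (Gi (x + l)) * indicator ?Q x \<partial>lborel)"
      by (subst nn_integral_lborel_translate[of _ l, symmetric]) simp_all
  qed
  also have "\<dots> = (\<integral>\<^sup>+x. (\<Sum>l\<in>FL. \<Psi> (Gi (x + l)) * indicator ?Q (Gi (x + l)) * indicator ?Q x) \<partial>lborel)"
    by (rule nn_integral_sum[symmetric]) simp
  also have "\<dots> = (\<integral>\<^sup>+x\<in>?Q. (\<Sum>d\<in>coset_reps 0. \<Psi> (Gi (x + d))) \<partial>lborel)"
  proof (rule nn_integral_cong)
    fix x :: "real ^ 'u"
    have "(\<Sum>l\<in>FL. \<Psi> (Gi (x + l)) * indicator ?Q (Gi (x + l))) = (\<Sum>d\<in>coset_reps 0. \<Psi> (Gi (x + d)))" if "x \<in> ?Q"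
    proof -
      have "(\<Sum>d\<in>coset_reps 0. \<Psi> (Gi (x + d))) = (\<Sum>d\<in>coset_reps x. \<Psi> (Gi (x + d)))"
        by (rule sum_coset_reps_shift[OF \<Psi>]) (simp add: integer_lattice_0)
      also have "\<dots> = (\<Sum>d\<in>coset_reps x. \<Psi> (Gi (x + d)) * indicator ?Q (Gi (x + d)))"
        by (intro sum.cong) (auto simp: coset_reps_def)
      also have "\<dots> = (\<Sum>l\<in>FL. \<Psi> (Gi (x + l)) * indicator ?Q (Gi (x + l)))"
        using that by (intro sum.mono_neutral_left fin) (auto simp: coset_reps_def FL_def)
      finally show ?thesis ..
    qed
    then show "(\<Sum>l\<in>FL. \<Psi> (Gi (x + l)) * indicator ?Q (Gi (x + l)) * indicator ?Q x) =
        (\<Sum>d\<in>coset_reps 0. \<Psi> (Gi (x + d))) * indicator ?Q x"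
      by (auto simp: sum_distrib_right[symmetric] indicator_def)
  qed
  finally show ?thesis ..
qed

abbreviation D :: "(real ^ 'u) set" where "D \<equiv> coset_reps 0"

text \<open>
  The case \<open>\<Psi> = 1\<close> of the transfer formula counts the preimages.
\<close>

lemma volume_factor_Gi: "volume_factor Gi = card D"
  using nn_integral_sum_coset_reps_aux[of "\<lambda>_. 1"] 
  by (simp add: lattice_periodic_def emeasure_half_open_cube nn_integral_cmult)

lemma nn_integral_sum_coset_reps:
  fixes \<Psi> :: "real ^ 'u \<Rightarrow> ennreal"
  assumes "lattice_periodic \<Psi>" and "\<Psi> \<in> borel_measurable borel"
  shows "(\<integral>\<^sup>+x\<in>half_open_cube. (\<Sum>d\<in>D. \<Psi> (Gi (x + d))) \<partial>lborel) =
     card D * (\<integral>\<^sup>+x\<in>half_open_cube. \<Psi> x \<partial>lborel)"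
  using nn_integral_sum_coset_reps_aux[OF assms] by (simp add: volume_factor_Gi)

lemma zero_in_D: "0 \<in> D"
  by (simp add: coset_reps_def integer_lattice_0 linear_0[OF linear_Gi] half_open_cube_def)

lemma card_D_pos: "card D > 0"
  using zero_in_D finite_coset_reps card_gt_0_iff by blast

end

section \<open>Transverse differences of branches\<close>

lemma emeasure_ball_scale:
  assumes "r \<ge> 0" "c \<ge> 0"
  shows "emeasure lborel (ball (x::'a::euclidean_space) (c * r)) = ennreal (c ^ DIM('a)) * emeasure lborel (ball (y::'a) r)"
  using assms by (simp add: emeasure_ball power_mult_distrib ennreal_mult'[symmetric] unit_ball_vol_nonneg algebra_simps)

text \<open>
  If \<open>h\<close> moves by about \<open>s\<close> when its argument moves by \<open>R s\<close>, then in every affine slice \<open>t \<mapsto> x + R t\<close> the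
  values of \<open>h\<close> separate at least half as fast as \<open>t\<close>. The part of the slice that \<open>h\<close> sends into a ball
  of radius \<open>r\<close> therefore lies in a ball of radius \<open>4 r\<close>, and Fubini over the slices gives the bound.
  The constant depends on \<open>R\<close> and \<open>Q\<close> alone, which makes it uniform over all pairs of branches.
\<close>

lemma transversal_ball_bound:
  fixes R :: "'b::euclidean_space \<Rightarrow> 'a::euclidean_space" and Q :: "'a set"
  assumes R: "linear R" and Q: "bounded Q" and [measurable]: "Q \<in> sets borel"
  shows "\<exists>K::real. K \<ge> 0 \<and> (\<forall>h::'a \<Rightarrow> 'b. h \<in> borel_measurable borel \<longrightarrow>
     (\<forall>y s. y \<in> Q \<longrightarrow> y + R s \<in> Q \<longrightarrow> norm (h (y + R s) - h y - s) \<le> norm s / 2) \<longrightarrow>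
     (\<forall>v r. r > 0 \<longrightarrow> emeasure lborel {x \<in> Q. dist (h x) v < r} \<le> ennreal K * emeasure lborel (ball v r)))"
proof -
  have [measurable]: "R \<in> borel_measurable borel"
    using R by (auto intro!: borel_measurable_continuous_onI linear_continuous_on simp: linear_conv_bounded_linear)
  obtain b where b0: "0 < b" and b: "\<And>y. norm (R y) \<le> norm y * b"
    using R by (metis bounded_linear.pos_bounded linear_conv_bounded_linear)
  obtain q where q0: "q > 0" and q: "\<And>x. x \<in> Q \<Longrightarrow> norm x \<le> q"
    using Q by (auto simp: bounded_pos)
  let ?B = "ball (0::'b) 1"
  have [measurable]: "?B \<in> sets borel" by simp
  define V W where "V = measure lborel (cball (0::'a) (q + b))" and "W = measure lborel ?B"
  have V: "emeasure lborel (cball (0::'a) (q + b)) = ennreal V"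
    unfolding V_def by (rule emeasure_eq_ennreal_measure) (use emeasure_lborel_cball_finite[of "0::'a" "q+b"] in \<open>simp add: less_top\<close>)
  have W: "emeasure lborel ?B = ennreal W"
    unfolding W_def by (rule emeasure_eq_ennreal_measure) (use emeasure_lborel_ball_finite[of "0::'b" 1] in \<open>simp add: less_top\<close>)
  have W0: "W > 0" unfolding W_def by (simp add: content_ball_pos)
  have V0: "V \<ge> 0" unfolding V_def by simp
  define K where "K = V * 4 ^ DIM('b) / W"
  show ?thesis
  proof (intro exI[of _ K] conjI allI impI)
    show "K \<ge> 0" using W0 V0 by (simp add: K_def)
    fix h :: "'a \<Rightarrow> 'b" and v and r :: real
    assume [measurable]: "h \<in> borel_measurable borel" and r: "r > 0"
      and h: "\<forall>y s. y \<in> Q \<longrightarrow> y + R s \<in> Q \<longrightarrow> norm (h (y + R s) - h y - s) \<le> norm s / 2"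
    define S where "S = {x \<in> Q. dist (h x) v < r}"
    have [measurable]: "S \<in> sets borel" unfolding S_def by measurable
    have "emeasure lborel S * emeasure lborel ?B = (\<integral>\<^sup>+x. indicator S x \<partial>lborel) * (\<integral>\<^sup>+t. indicator ?B t \<partial>lborel)"
      by (simp add: nn_integral_indicator)
    also have "\<dots> = (\<integral>\<^sup>+t. indicator ?B t * (\<integral>\<^sup>+x. indicator S x \<partial>lborel) \<partial>lborel)"
      by (subst nn_integral_cmult[symmetric], measurable) (simp only: mult.commute)
    also have "\<dots> = (\<integral>\<^sup>+t. indicator ?B t * (\<integral>\<^sup>+x. indicator S (x + R t) \<partial>lborel) \<partial>lborel)"
      by (subst nn_integral_lborel_translate) simp_all
    also have "\<dots> = (\<integral>\<^sup>+t. (\<integral>\<^sup>+x. indicator ?B t * indicator S (x + R t) \<partial>lborel) \<partial>lborel)"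
      by (simp add: nn_integral_cmult)
    also have "\<dots> = (\<integral>\<^sup>+x. (\<integral>\<^sup>+t. indicator ?B t * indicator S (x + R t) \<partial>lborel) \<partial>lborel)"
      by (rule lborel_pair.Fubini') measurable
    also have "\<dots> \<le> (\<integral>\<^sup>+x. emeasure lborel (ball v (4 * r)) * indicator (cball (0::'a) (q + b)) x \<partial>lborel)"
    proof (rule nn_integral_mono)
      fix x
      define U where "U = {t \<in> ?B. x + R t \<in> S}"
      have [measurable]: "U \<in> sets borel" unfolding U_def by measurable
      have "(\<integral>\<^sup>+t. indicator ?B t * indicator S (x + R t) \<partial>lborel) = (\<integral>\<^sup>+t. indicator U t \<partial>lborel)"
        by (intro nn_integral_cong) (auto simp: U_def indicator_def)
      also have "\<dots> = emeasure lborel U" by simp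
      also have "\<dots> \<le> emeasure lborel (ball v (4 * r)) * indicator (cball (0::'a) (q + b)) x"
      proof (cases "U = {}")
        case False
        then obtain t0 where t0: "t0 \<in> U" by blast
        have "norm x = norm ((x + R t0) - R t0)" by simp
        also have "\<dots> \<le> norm (x + R t0) + norm (R t0)" by (rule norm_triangle_ineq4)
        also have "\<dots> \<le> q + b"
        proof (rule add_mono)
          show "norm (x + R t0) \<le> q" using t0 by (intro q) (simp add: U_def S_def)
          have "norm t0 * b \<le> 1 * b" using t0 b0 by (intro mult_right_mono) (auto simp: U_def)
          then show "norm (R t0) \<le> b" using b[of t0] by simp
        qed
        finally have "x \<in> cball 0 (q + b)" by simp
        moreover have "U \<subseteq> ball t0 (4 * r)"
        proof
          fix t assume t: "t \<in> U"
          have eq: "(x + R t0) + R (t - t0) = x + R t" by (simp add: linear_diff[OF R])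
          have "norm (h (x + R t) - h (x + R t0) - (t - t0)) \<le> norm (t - t0) / 2"
            using h[rule_format, of "x + R t0" "t - t0"] t t0 unfolding eq by (auto simp: U_def S_def)
          moreover have "norm (t - t0) \<le> norm (h (x + R t) - h (x + R t0)) + norm (h (x + R t) - h (x + R t0) - (t - t0))"
            by (metis norm_triangle_sub norm_minus_commute add.commute)
          moreover have "norm (h (x + R t) - h (x + R t0)) < 2 * r"
            using t t0 dist_triangle2[of "h (x + R t)" "h (x + R t0)" v] by (auto simp: U_def S_def dist_norm)
          ultimately show "t \<in> ball t0 (4 * r)" by (simp add: dist_norm norm_minus_commute)
        qed
        then have "emeasure lborel U \<le> emeasure lborel (ball t0 (4 * r))" by (intro emeasure_mono) simp_all
        moreover have "emeasure lborel (ball t0 (4 * r)) = emeasure lborel (ball v (4 * r))"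
          using r by (simp add: emeasure_ball)
        ultimately show ?thesis by simp
      qed simp
      finally show "(\<integral>\<^sup>+t. indicator ?B t * indicator S (x + R t) \<partial>lborel) \<le> emeasure lborel (ball v (4 * r)) * indicator (cball (0::'a) (q + b)) x" .
    qed
    also have "\<dots> = emeasure lborel (ball v (4 * r)) * ennreal V"
      by (subst nn_integral_cmult_indicator) (simp_all add: V)
    also have "\<dots> = ennreal (4 ^ DIM('b)) * emeasure lborel (ball v r) * ennreal V"
      using r by (simp add: emeasure_ball_scale[of r 4 v v])
    finally have le: "emeasure lborel S * ennreal W \<le> ennreal (4 ^ DIM('b)) * emeasure lborel (ball v r) * ennreal V"
      by (simp only: W)
    have "emeasure lborel S = emeasure lborel S * ennreal W * ennreal (1 / W)"
      using W0 by (simp add: mult.assoc ennreal_mult'[symmetric])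
    also have "\<dots> \<le> ennreal (4 ^ DIM('b)) * emeasure lborel (ball v r) * ennreal V * ennreal (1 / W)"
      by (intro mult_right_mono le) simp
    also have "\<dots> = (ennreal (4 ^ DIM('b)) * ennreal V * ennreal (1 / W)) * emeasure lborel (ball v r)"
      by (simp only: mult.assoc mult.commute mult.left_commute)
    also have "ennreal (4 ^ DIM('b)) * ennreal V * ennreal (1 / W) = ennreal K"
      unfolding K_def using V0 W0 by (subst ennreal_mult[symmetric]; simp add: algebra_simps)+
    finally show "emeasure lborel {x \<in> Q. dist (h x) v < r} \<le> ennreal K * emeasure lborel (ball v r)"
      by (simp only: S_def)
  qed
qed

text \<open>
  On an open set \<open>U\<close> the indicator is at most the lower limit of its averages over balls of radius
  tending to 0. For such an average the bound on balls applies after Fubini, and Fatou concludes.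
\<close>

lemma open_bound_from_ball_bound:
  fixes h :: "'a::euclidean_space \<Rightarrow> 'b::euclidean_space"
  assumes [measurable]: "h \<in> borel_measurable borel" "Q \<in> sets borel"
    and ball: "\<And>v r. r > 0 \<Longrightarrow> emeasure lborel {x \<in> Q. dist (h x) v < r} \<le> ennreal K * emeasure lborel (ball v r)"
    and U: "open U"
  shows "emeasure lborel {x \<in> Q. h x \<in> U} \<le> ennreal K * emeasure lborel U"
proof -
  have [measurable]: "U \<in> sets borel" using U by simp
  have [measurable]: "ball w e \<in> sets borel" for w :: 'b and e by simp
  define r where "r n = inverse (real (Suc n))" for n
  have r: "r n > 0" for n by (simp add: r_def)
  define c where "c n = 1 / emeasure lborel (ball (0::'b) (r n))" for n
  have bpos: "emeasure lborel (ball w (r n)) \<noteq> 0" and bfin: "emeasure lborel (ball w (r n)) \<noteq> \<top>" for w :: 'b and n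
    using r[of n] emeasure_lborel_ball_finite[of w "r n"]
    by (auto simp: emeasure_ball less_top ennreal_eq_0_iff not_le unit_ball_vol_pos)
  have b0: "emeasure lborel (ball w (r n)) = emeasure lborel (ball (0::'b) (r n))" for w :: 'b and n
    using r[of n] by (simp add: emeasure_ball)
  have c: "c n * emeasure lborel (ball w (r n)) = 1" for w :: 'b and n
    unfolding c_def b0[of w] using bpos[of 0 n] bfin[of 0 n]
    by (simp add: ennreal_divide_times ennreal_divide_self less_top[symmetric])
  define f where "f n v = c n * (\<integral>\<^sup>+w. indicator U w * indicator (ball v (r n)) w \<partial>lborel)" for n v
  have [measurable]: "(\<lambda>x. f n (h x)) \<in> borel_measurable borel" for n
    unfolding f_def by (simp add: indicator_def[abs_def] dist_commute) measurable
  have "emeasure lborel {x \<in> Q. h x \<in> U} = (\<integral>\<^sup>+x. indicator {x \<in> Q. h x \<in> U} x \<partial>lborel)" by simp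
  also have "\<dots> \<le> (\<integral>\<^sup>+x. liminf (\<lambda>n. indicator Q x * f n (h x)) \<partial>lborel)"
  proof (rule nn_integral_mono)
    fix x
    show "indicator {x \<in> Q. h x \<in> U} x \<le> liminf (\<lambda>n. indicator Q x * f n (h x))"
    proof (cases "x \<in> Q \<and> h x \<in> U")
      case True
      then obtain e where e: "e > 0" "ball (h x) e \<subseteq> U" using U by (meson openE)
      have "eventually (\<lambda>n. r n < e) sequentially"
        unfolding r_def using e(1) by real_asymp
      then have "eventually (\<lambda>n. 1 \<le> indicator Q x * f n (h x)) sequentially"
      proof eventually_elim
        case (elim n)
        have "(\<integral>\<^sup>+w. indicator U w * indicator (ball (h x) (r n)) w \<partial>lborel) = (\<integral>\<^sup>+w. indicator (ball (h x) (r n)) w \<partial>lborel)"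
          using e(2) elim by (intro nn_integral_cong) (auto simp: indicator_def)
        then show ?case using True c[of n "h x"] by (simp add: f_def)
      qed
      then show ?thesis by (intro Liminf_bounded) (use True in simp)
    qed simp
  qed
  also have "\<dots> \<le> liminf (\<lambda>n. \<integral>\<^sup>+x. indicator Q x * f n (h x) \<partial>lborel)"
    by (rule nn_integral_liminf) measurable
  also have "\<dots> \<le> liminf (\<lambda>n. ennreal K * emeasure lborel U)"
  proof (rule Liminf_mono, rule always_eventually, rule allI)
    fix n
    have "(\<integral>\<^sup>+x. indicator Q x * f n (h x) \<partial>lborel) =
        (\<integral>\<^sup>+x. (\<integral>\<^sup>+w. c n * (indicator Q x * (indicator U w * indicator (ball (h x) (r n)) w)) \<partial>lborel) \<partial>lborel)"
    proof (rule nn_integral_cong)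
      fix x
      have m: "(\<lambda>w. indicator U w * indicator (ball (h x) (r n)) w :: ennreal) \<in> borel_measurable lborel"
        by measurable
      have "(\<integral>\<^sup>+w. (c n * indicator Q x) * (indicator U w * indicator (ball (h x) (r n)) w) \<partial>lborel) =
          (c n * indicator Q x) * (\<integral>\<^sup>+w. indicator U w * indicator (ball (h x) (r n)) w \<partial>lborel)"
        by (rule nn_integral_cmult[OF m])
      then show "indicator Q x * f n (h x) =
          (\<integral>\<^sup>+w. c n * (indicator Q x * (indicator U w * indicator (ball (h x) (r n)) w)) \<partial>lborel)"
        unfolding f_def by (simp only: mult.assoc mult.left_commute)
    qed
    also have "\<dots> = (\<integral>\<^sup>+w. (\<integral>\<^sup>+x. c n * (indicator Q x * (indicator U w * indicator (ball (h x) (r n)) w)) \<partial>lborel) \<partial>lborel)"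
      by (rule lborel_pair.Fubini') (simp add: indicator_def[abs_def])
    also have "\<dots> = (\<integral>\<^sup>+w. c n * indicator U w * (\<integral>\<^sup>+x. indicator {x \<in> Q. dist (h x) w < r n} x \<partial>lborel) \<partial>lborel)"
    proof (rule nn_integral_cong)
      fix w
      have "(\<integral>\<^sup>+x. c n * (indicator Q x * (indicator U w * indicator (ball (h x) (r n)) w)) \<partial>lborel) =
          (\<integral>\<^sup>+x. c n * indicator U w * indicator {x \<in> Q. dist (h x) w < r n} x \<partial>lborel)"
        by (intro nn_integral_cong) (auto simp: indicator_def)
      then show "(\<integral>\<^sup>+x. c n * (indicator Q x * (indicator U w * indicator (ball (h x) (r n)) w)) \<partial>lborel) =
          c n * indicator U w * (\<integral>\<^sup>+x. indicator {x \<in> Q. dist (h x) w < r n} x \<partial>lborel)"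
        by (simp add: nn_integral_cmult)
    qed
    also have "\<dots> \<le> (\<integral>\<^sup>+w. ennreal K * indicator U w \<partial>lborel)"
    proof (rule nn_integral_mono)
      fix w
      have "c n * indicator U w * (\<integral>\<^sup>+x. indicator {x \<in> Q. dist (h x) w < r n} x \<partial>lborel) =
          c n * indicator U w * emeasure lborel {x \<in> Q. dist (h x) w < r n}" by simp
      also have "\<dots> \<le> c n * indicator U w * (ennreal K * emeasure lborel (ball w (r n)))"
        by (intro mult_left_mono ball r) simp
      also have "\<dots> = (c n * emeasure lborel (ball w (r n))) * (ennreal K * indicator U w)"
        by (simp only: mult.assoc mult.commute mult.left_commute)
      also have "\<dots> = ennreal K * indicator U w" by (simp only: c mult_1)
      finally show "c n * indicator U w * (\<integral>\<^sup>+x. indicator {x \<in> Q. dist (h x) w < r n} x \<partial>lborel) \<le> ennreal K * indicator U w" .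
    qed
    also have "\<dots> = ennreal K * emeasure lborel U" by (simp add: nn_integral_cmult)
    finally show "(\<integral>\<^sup>+x. indicator Q x * f n (h x) \<partial>lborel) \<le> ennreal K * emeasure lborel U" .
  qed
  also have "\<dots> = ennreal K * emeasure lborel U" by (simp add: Liminf_const)
  finally show ?thesis .
qed

section \<open>Densities of pushforwards and their energy\<close>

lemma volume_factor_inverse:
  fixes L :: "'a::euclidean_space \<Rightarrow> 'a"
  assumes "linear L" "linear Li" "\<And>x. L (Li x) = x" "\<And>x. Li (L x) = x"
  shows "volume_factor L * volume_factor Li = 1"
proof -
  let ?c = "indicator (cbox 0 One) :: 'a \<Rightarrow> ennreal"
  have 1: "(\<integral>\<^sup>+x. ?c x \<partial>lborel) = 1" by (simp add: emeasure_lborel_cbox)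
  have [measurable]: "Li \<in> borel_measurable borel"
    using assms by (auto intro!: borel_measurable_continuous_onI linear_continuous_on simp: linear_conv_bounded_linear)
  have "1 = (\<integral>\<^sup>+x. ?c (Li (L x)) \<partial>lborel)" by (simp only: assms 1)
  also have "\<dots> = volume_factor L * (\<integral>\<^sup>+x. ?c (Li x) \<partial>lborel)"
    by (rule nn_integral_linear[OF assms(1-3)]) measurable
  also have "(\<integral>\<^sup>+x. ?c (Li x) \<partial>lborel) = volume_factor Li * (\<integral>\<^sup>+x. ?c x \<partial>lborel)"
    by (rule nn_integral_linear[OF assms(2,1,4)]) measurable
  finally show ?thesis by (simp only: 1 mult_1_right)
qed

text \<open>
  Cauchy-Schwarz for \<open>card I - 1\<close> summands, after \<open>v i\<close> and \<open>v j\<close> have been added up to a single one. The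
  gain of 1 in the constant is what beats the growth of the energy.
\<close>

lemma square_sum_merge_pair:
  fixes v :: "'a \<Rightarrow> real"
  assumes fin: "finite I" and ij: "i \<in> I" "j \<in> I" "i \<noteq> j"
  shows "(\<Sum>k\<in>I. v k)\<^sup>2 \<le> (real (card I) - 1) * ((\<Sum>k\<in>I. (v k)\<^sup>2) + 2 * (v i * v j))"
proof -
  define w where "w k = (if k = j then v i + v j else v k)" for k
  define J where "J = I - {i} - {j}"
  have I: "I = insert i (insert j J)" "i \<notin> insert j J" "j \<notin> J" "finite J" using fin ij by (auto simp: J_def)
  have wJ: "(\<Sum>k\<in>J. w k) = (\<Sum>k\<in>J. v k)" "(\<Sum>k\<in>J. (w k)\<^sup>2) = (\<Sum>k\<in>J. (v k)\<^sup>2)"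
    by (auto simp: w_def J_def intro!: sum.cong)
  have "(\<Sum>k\<in>insert j J. w k * 1)\<^sup>2 \<le> (\<Sum>k\<in>insert j J. (w k)\<^sup>2) * (\<Sum>k\<in>insert j J. 1\<^sup>2)"
    by (rule Cauchy_Schwarz_ineq_sum)
  moreover have "(\<Sum>k\<in>insert j J. w k * 1) = (\<Sum>k\<in>I. v k)" using I by (simp add: wJ) (simp add: w_def)
  moreover have "(\<Sum>k\<in>insert j J. (w k)\<^sup>2) = (\<Sum>k\<in>I. (v k)\<^sup>2) + 2 * (v i * v j)"
    using I by (simp add: wJ) (simp add: w_def power2_sum)
  moreover have "(\<Sum>k\<in>insert j J. 1\<^sup>2) = real (card I) - 1" using I by simp
  ultimately show ?thesis by (simp add: mult.commute)
qed

text \<open>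
  The lift to \<open>\<real>\<^sup>u \<times> \<real>\<^sup>d\<close> of a skew product with base map \<open>G\<close>, fibre map \<open>B\<close> and translation \<open>g\<close>. It will be
  used for a power of the given skew product.
\<close>

locale skew_block = lattice_map G Gi for G Gi :: "real ^ 'u \<Rightarrow> real ^ 'u" +
  fixes B Bi :: "real ^ 'd \<Rightarrow> real ^ 'd" and g :: "real ^ 'u \<Rightarrow> real ^ 'd"
  assumes linear_B: "linear B" and linear_Bi: "linear Bi"
    and B_Bi [simp]: "B (Bi z) = z" and Bi_B [simp]: "Bi (B z) = z"
    and g_periodic: "lattice_periodic g" and borel_g [measurable]: "g \<in> borel_measurable borel"
begin

lemma measurable_B [measurable]: "B \<in> borel_measurable borel"
  and measurable_Bi [measurable]: "Bi \<in> borel_measurable borel"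
  using linear_B linear_Bi
  by (auto intro!: borel_measurable_continuous_onI linear_continuous_on simp: linear_conv_bounded_linear)

text \<open>
  The absolute value of the determinant of \<open>B\<close>.
\<close>

definition jac :: real where "jac = enn2real (volume_factor Bi)"

lemma volume_factor_Bi: "volume_factor Bi = ennreal jac" and jac_pos: "jac > 0"
proof -
  have "volume_factor Bi * volume_factor B = 1"
    by (rule volume_factor_inverse) (simp_all add: linear_B linear_Bi)
  then have "volume_factor Bi \<noteq> \<top>" "volume_factor Bi \<noteq> 0"
    by (auto simp: ennreal_top_mult split: if_splits)
  then show "volume_factor Bi = ennreal jac" "jac > 0"
    by (simp_all add: jac_def enn2real_positive_iff less_top zero_less_iff_neq_zero)
qed

lemma nn_integral_fiber_change:
  assumes [measurable]: "h \<in> borel_measurable borel"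
  shows "(\<integral>\<^sup>+z. h (Bi (z - a)) \<partial>lborel) = ennreal jac * (\<integral>\<^sup>+z. h z \<partial>lborel)"
proof -
  have "(\<integral>\<^sup>+z. h (Bi (z - a)) \<partial>lborel) = (\<integral>\<^sup>+z. h (Bi z) \<partial>lborel)"
    using nn_integral_lborel_translate[of "\<lambda>z. h (Bi z)" "-a"] by simp
  also have "\<dots> = ennreal jac * (\<integral>\<^sup>+z. h z \<partial>lborel)"
    unfolding volume_factor_Bi[symmetric] by (rule nn_integral_linear[OF linear_Bi linear_B]) simp_all
  finally show ?thesis .
qed

abbreviation N :: nat where "N \<equiv> card D"

definition words :: "nat \<Rightarrow> (real ^ 'u) list set" where
  "words n = {a. set a \<subseteq> D \<and> length a = n}"

lemma card_words: "card (words n) = N ^ n"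
  unfolding words_def by (rule card_lists_length_eq) (rule finite_coset_reps)

lemma words_0 [simp]: "words 0 = {[]}"
  by (auto simp: words_def)

lemma sum_words_Suc: "(\<Sum>a\<in>words (Suc n). F a) = (\<Sum>d\<in>D. \<Sum>a\<in>words n. F (d # a))"
proof -
  have "words (Suc n) = (\<lambda>(d, a). d # a) ` (D \<times> words n)"
    unfolding words_def by (auto simp: image_iff length_Suc_conv) 
  moreover have "inj_on (\<lambda>(d, a). d # a) (D \<times> words n)" by (auto simp: inj_on_def)
  ultimately show ?thesis
    by (simp add: sum.reindex sum.cartesian_product comp_def split_def)
qed

text \<open>
  The image of the zero section under the iterated skew product, seen along a sequence of inverse
  branches of \<open>G\<close>; the first entry of the list is the most recent branch.
\<close>

fun branch :: "(real ^ 'u) list \<Rightarrow> real ^ 'u \<Rightarrow> real ^ 'd" where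
  "branch [] x = 0"
| "branch (d # a) x = g (Gi (x + d)) + B (branch a (Gi (x + d)))"

lemma measurable_branch [measurable]: "branch a \<in> borel_measurable borel"
proof (induction a)
  case Nil
  then show ?case by (simp add: branch.simps[abs_def])
next
  case (Cons d a)
  note [measurable] = Cons
  have "(\<lambda>x. g (Gi (x + d)) + B (branch a (Gi (x + d)))) \<in> borel_measurable borel" by measurable
  then show ?case by (simp add: branch.simps[abs_def])
qed

text \<open>
  The density of the image of the uniform distribution on the open unit box under the \<open>n\<close>-th power of \<open>B\<close>.
  The box is open so that the kernel is a multiple of the indicator of an open set.
\<close>

fun kern :: "nat \<Rightarrow> real ^ 'd \<Rightarrow> real" where
  "kern 0 v = indicator (box 0 One) v"
| "kern (Suc n) v = kern n (Bi v) / jac"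

lemma kern_eq: "\<exists>U. open U \<and> kern n = (\<lambda>v. indicator U v / jac ^ n)"
proof (induction n)
  case 0
  show ?case by (rule exI[of _ "box 0 One"]) (auto simp: kern.simps[abs_def])
next
  case (Suc n)
  then obtain U where U: "open U" "kern n = (\<lambda>v. indicator U v / jac ^ n)" by blast
  have "open (Bi -` U)"
    using linear_Bi U(1) by (intro open_vimage) (auto intro!: linear_continuous_on simp: linear_conv_bounded_linear)
  moreover have "kern (Suc n) = (\<lambda>v. indicator (Bi -` U) v / jac ^ Suc n)"
    by (simp add: U(2) kern.simps[abs_def] fun_eq_iff indicator_def)
  ultimately show ?case by blast
qed

lemma kern_nonneg: "kern n v \<ge> 0"
  by (induction n arbitrary: v) (use jac_pos in auto)

lemma measurable_kern [measurable]: "kern n \<in> borel_measurable borel"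
proof -
  obtain U where "open U" "kern n = (\<lambda>v. indicator U v / jac ^ n)" using kern_eq by blast
  then show ?thesis by simp
qed

lemma integral_kern: "(\<integral>\<^sup>+v. ennreal (kern n v) \<partial>lborel) = 1"
proof (induction n)
  case 0
  have "(\<integral>\<^sup>+v. ennreal (kern 0 v) \<partial>lborel) = (\<integral>\<^sup>+v. indicator (box (0::real^'d) One) v \<partial>lborel)"
    by (intro nn_integral_cong) (simp add: indicator_def)
  also have "\<dots> = 1" by (simp add: emeasure_lborel_box)
  finally show ?case .
next
  case (Suc n)
  have "(\<integral>\<^sup>+v. ennreal (kern (Suc n) v) \<partial>lborel) = (\<integral>\<^sup>+v. ennreal (1 / jac) * ennreal (kern n (Bi v)) \<partial>lborel)"
    using jac_pos kern_nonneg by (intro nn_integral_cong) (simp add: ennreal_mult[symmetric])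
  also have "\<dots> = ennreal (1 / jac) * (\<integral>\<^sup>+v. ennreal (kern n (Bi (v - 0))) \<partial>lborel)"
    by (simp add: nn_integral_cmult)
  also have "(\<integral>\<^sup>+v. ennreal (kern n (Bi (v - 0))) \<partial>lborel) = ennreal jac * 1"
    unfolding Suc.IH[symmetric] by (rule nn_integral_fiber_change) measurable
  finally show ?case using jac_pos by (simp add: ennreal_mult[symmetric])
qed

text \<open>
  The density, over the point \<open>x\<close>, of the pushforward of the uniform distribution by \<open>n\<close> steps, and the
  contribution to the density of step \<open>n + 1\<close> of one inverse branch \<open>d\<close>.
\<close>

definition dens :: "nat \<Rightarrow> real ^ 'u \<Rightarrow> real ^ 'd \<Rightarrow> real" where
  "dens n x z = (\<Sum>a\<in>words n. kern n (z - branch a x)) / N ^ n"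

definition part :: "nat \<Rightarrow> real ^ 'u \<Rightarrow> real ^ 'u \<Rightarrow> real ^ 'd \<Rightarrow> real" where
  "part n d x z = dens n (Gi (x + d)) (Bi (z - g (Gi (x + d)))) / (N * jac)"

lemma dens_nonneg: "dens n x z \<ge> 0"
  by (simp add: dens_def sum_nonneg kern_nonneg)

lemma part_nonneg: "part n d x z \<ge> 0"
  using jac_pos by (simp add: part_def dens_nonneg)

lemma measurable_dens [measurable]: "(\<lambda>p. dens n (fst p) (snd p)) \<in> borel_measurable (borel \<Otimes>\<^sub>M borel)"
  unfolding dens_def by measurable

lemma measurable_dens_comp [measurable (raw)]:
  assumes "s \<in> M \<rightarrow>\<^sub>M borel" "t \<in> M \<rightarrow>\<^sub>M borel"
  shows "(\<lambda>x. dens n (s x) (t x)) \<in> borel_measurable M"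
  using measurable_compose[OF measurable_Pair[OF assms] measurable_dens[of n]] by simp

lemma part_eq: "part n d x z = (\<Sum>a\<in>words n. kern (Suc n) (z - branch (d # a) x)) / N ^ Suc n"
proof -
  let ?p = "Gi (x + d)"
  have "kern (Suc n) (z - branch (d # a) x) = kern n (Bi (z - g ?p) - branch a ?p) / jac" for a
    by (simp add: linear_diff[OF linear_Bi] linear_add[OF linear_Bi] diff_diff_eq)
  then have "(\<Sum>a\<in>words n. kern (Suc n) (z - branch (d # a) x)) = (\<Sum>a\<in>words n. kern n (Bi (z - g ?p) - branch a ?p)) / jac"
    by (simp only: sum_divide_distrib)
  then show ?thesis
    by (simp only: part_def dens_def divide_divide_eq_left power_Suc of_nat_mult mult.commute mult.left_commute)
qed

lemma dens_Suc: "dens (Suc n) x z = (\<Sum>d\<in>D. part n d x z)"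
  unfolding part_eq dens_def sum_words_Suc by (simp only: sum_divide_distrib)

lemma dens_periodic: "lattice_periodic (dens n)"
proof (induction n)
  case 0
  have "dens 0 = (\<lambda>x z. kern 0 z)" by (simp add: dens_def fun_eq_iff)
  then show ?case by (simp add: lattice_periodic_def)
next
  case (Suc n)
  have "dens (Suc n) (x + l) z = dens (Suc n) x z" if "l \<in> integer_lattice" for x l z
  proof -
    define \<Psi> where "\<Psi> p = dens n p (Bi (z - g p)) / (N * jac)" for p
    have "lattice_periodic \<Psi>"
      using Suc g_periodic by (simp add: lattice_periodic_def \<Psi>_def)
    from sum_coset_reps_shift[OF this, of "x + l" x 0 0] that
    show ?thesis by (simp add: dens_Suc part_def \<Psi>_def)
  qed
  then show ?case by (simp add: lattice_periodic_def fun_eq_iff)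
qed

definition lifted :: "(real ^ 'u) \<times> (real ^ 'd) \<Rightarrow> (real ^ 'u) \<times> (real ^ 'd)" where
  "lifted p = (G (fst p), g (fst p) + B (snd p))"

lemma measurable_lifted [measurable]: "lifted \<in> borel \<Otimes>\<^sub>M borel \<rightarrow>\<^sub>M borel \<Otimes>\<^sub>M borel"
  unfolding lifted_def by measurable

text \<open>
  The density of step \<open>n + 1\<close> is the transfer operator applied to that of step \<open>n\<close>. After the change of
  variables \<open>z = g p + B w\<close> in the fibre, the sum over preimages is integrated with
  \<open>nn_integral_sum_coset_reps\<close>.
\<close>

lemma dens_duality_step:
  fixes \<phi> :: "(real ^ 'u) \<times> (real ^ 'd) \<Rightarrow> ennreal"
  assumes [measurable]: "\<phi> \<in> borel_measurable (borel \<Otimes>\<^sub>M borel)"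
    and per: "\<And>x l z. l \<in> integer_lattice \<Longrightarrow> \<phi> (x + l, z) = \<phi> (x, z)"
  shows "(\<integral>\<^sup>+x\<in>half_open_cube. (\<integral>\<^sup>+z. ennreal (dens (Suc n) x z) * \<phi> (x, z) \<partial>lborel) \<partial>lborel) =
    (\<integral>\<^sup>+x\<in>half_open_cube. (\<integral>\<^sup>+z. ennreal (dens n x z) * \<phi> (lifted (x, z)) \<partial>lborel) \<partial>lborel)"
proof -
  define \<Psi> where "\<Psi> p = (\<integral>\<^sup>+w. ennreal (dens n p w) * \<phi> (lifted (p, w)) \<partial>lborel)" for p
  have [measurable]: "\<Psi> \<in> borel_measurable borel" unfolding \<Psi>_def by measurable
  have per\<Psi>: "lattice_periodic \<Psi>"
    using dens_periodic[of n] g_periodic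
    by (simp add: lattice_periodic_def \<Psi>_def lifted_def linear_add[OF linear_G] per G_lattice)
  have c: "ennreal (1 / (N * jac)) * ennreal jac = ennreal (1 / N)"
    using jac_pos by (subst ennreal_mult[symmetric]) auto
  have *: "(\<integral>\<^sup>+z. ennreal (part n d x z) * \<phi> (x, z) \<partial>lborel) = ennreal (1 / N) * \<Psi> (Gi (x + d))" if "d \<in> D" for d x
  proof -
    have d: "- d \<in> integer_lattice" using that by (simp add: coset_reps_def integer_lattice_minus)
    let ?p = "Gi (x + d)"
    define h where "h w = ennreal (1 / (N * jac)) * (ennreal (dens n ?p w) * \<phi> (lifted (?p, w)))" for w
    have [measurable]: "h \<in> borel_measurable borel" unfolding h_def by measurable
    have "lifted (?p, Bi (z - g ?p)) = (x + d, z)" for z by (simp add: lifted_def)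
    moreover have "\<phi> (x, z) = \<phi> (x + d, z)" for z using per[OF d, of "x + d" z] by simp
    ultimately have "ennreal (part n d x z) * \<phi> (x, z) = h (Bi (z - g ?p))" for z
      using jac_pos dens_nonneg by (simp add: h_def part_def mult.assoc[symmetric] ennreal_mult[symmetric])
    then have "(\<integral>\<^sup>+z. ennreal (part n d x z) * \<phi> (x, z) \<partial>lborel) = ennreal jac * (\<integral>\<^sup>+w. h w \<partial>lborel)"
      by (simp add: nn_integral_fiber_change)
    also have "\<dots> = ennreal jac * (ennreal (1 / (N * jac)) * \<Psi> ?p)"
      unfolding h_def \<Psi>_def by (subst nn_integral_cmult) simp_all
    finally show ?thesis unfolding c[symmetric] by (simp only: mult_ac)
  qed
  have [measurable]: "(\<lambda>p. part n d (fst p) (snd p)) \<in> borel_measurable (borel \<Otimes>\<^sub>M borel)" for d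
    unfolding part_def by measurable
  have [measurable]: "(\<lambda>z. part n d x z) \<in> borel_measurable borel" for d x
    unfolding part_def by measurable
  have "(\<integral>\<^sup>+z. ennreal (dens (Suc n) x z) * \<phi> (x, z) \<partial>lborel) = (\<Sum>d\<in>D. ennreal (1 / N) * \<Psi> (Gi (x + d)))" for x
  proof -
    have "(\<integral>\<^sup>+z. ennreal (dens (Suc n) x z) * \<phi> (x, z) \<partial>lborel) = (\<integral>\<^sup>+z. (\<Sum>d\<in>D. ennreal (part n d x z) * \<phi> (x, z)) \<partial>lborel)"
      by (simp only: dens_Suc sum_ennreal[OF part_nonneg, symmetric] sum_distrib_right)
    also have "\<dots> = (\<Sum>d\<in>D. \<integral>\<^sup>+z. ennreal (part n d x z) * \<phi> (x, z) \<partial>lborel)"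
      by (rule nn_integral_sum) measurable
    also have "\<dots> = (\<Sum>d\<in>D. ennreal (1 / N) * \<Psi> (Gi (x + d)))" by (intro sum.cong refl *)
    finally show ?thesis .
  qed
  then have "(\<integral>\<^sup>+x\<in>half_open_cube. (\<integral>\<^sup>+z. ennreal (dens (Suc n) x z) * \<phi> (x, z) \<partial>lborel) \<partial>lborel) =
      (\<integral>\<^sup>+x\<in>half_open_cube. (\<Sum>d\<in>D. ennreal (1 / N) * \<Psi> (Gi (x + d))) \<partial>lborel)" by simp
  also have "\<dots> = card D * (\<integral>\<^sup>+x\<in>half_open_cube. ennreal (1 / N) * \<Psi> x \<partial>lborel)"
    using per\<Psi> by (intro nn_integral_sum_coset_reps) (auto simp: lattice_periodic_def)
  also have "\<dots> = card D * (ennreal (1 / N) * (\<integral>\<^sup>+x\<in>half_open_cube. \<Psi> x \<partial>lborel))"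
    by (simp add: nn_integral_cmult mult.assoc)
  also have "\<dots> = (\<integral>\<^sup>+x\<in>half_open_cube. \<Psi> x \<partial>lborel)"
    using card_D_pos by (simp add: mult.assoc[symmetric] ennreal_of_nat_eq_real_of_nat ennreal_mult[symmetric])
  finally show ?thesis unfolding \<Psi>_def .
qed

lemma dens_duality:
  fixes \<phi> :: "(real ^ 'u) \<times> (real ^ 'd) \<Rightarrow> ennreal"
  assumes "\<phi> \<in> borel_measurable (borel \<Otimes>\<^sub>M borel)"
    and "\<And>x l z. l \<in> integer_lattice \<Longrightarrow> \<phi> (x + l, z) = \<phi> (x, z)"
  shows "(\<integral>\<^sup>+x\<in>half_open_cube. (\<integral>\<^sup>+z. ennreal (dens n x z) * \<phi> (x, z) \<partial>lborel) \<partial>lborel) =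
    (\<integral>\<^sup>+x\<in>half_open_cube. (\<integral>\<^sup>+z. ennreal (dens 0 x z) * \<phi> ((lifted ^^ n) (x, z)) \<partial>lborel) \<partial>lborel)"
  using assms
proof (induction n arbitrary: \<phi>)
  case (Suc n)
  note [measurable] = Suc.prems(1)
  have per: "\<phi> (lifted (x + l, z)) = \<phi> (lifted (x, z))" if "l \<in> integer_lattice" for x l z
    using that Suc.prems(2) g_periodic by (simp add: lifted_def linear_add[OF linear_G] G_lattice lattice_periodic_def)
  have "(\<integral>\<^sup>+x\<in>half_open_cube. (\<integral>\<^sup>+z. ennreal (dens n x z) * \<phi> (lifted (x, z)) \<partial>lborel) \<partial>lborel) =
    (\<integral>\<^sup>+x\<in>half_open_cube. (\<integral>\<^sup>+z. ennreal (dens 0 x z) * \<phi> (lifted ((lifted ^^ n) (x, z))) \<partial>lborel) \<partial>lborel)"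
    by (rule Suc.IH[of "\<lambda>p. \<phi> (lifted p)"]) (use per in auto)
  with dens_duality_step[OF Suc.prems] show ?case by simp
qed simp

definition energy :: "nat \<Rightarrow> ennreal" where
  "energy n = (\<integral>\<^sup>+x\<in>half_open_cube. (\<integral>\<^sup>+z. ennreal ((dens n x z)\<^sup>2) \<partial>lborel) \<partial>lborel)"

lemma energy_0: "energy 0 = 1"
proof -
  have d: "dens 0 x z = indicator (box 0 One) z" for x z by (simp add: dens_def fun_eq_iff)
  have "(\<integral>\<^sup>+z. ennreal ((dens 0 x z)\<^sup>2) \<partial>lborel) = (\<integral>\<^sup>+z. indicator (box (0::real^'d) One) z \<partial>lborel)" for x
    by (intro nn_integral_cong) (simp add: d indicator_def)
  also have "(\<integral>\<^sup>+z. indicator (box (0::real^'d) One) z \<partial>lborel) = 1" by (simp add: emeasure_lborel_box)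
  finally show ?thesis by (simp add: energy_def emeasure_half_open_cube)
qed

text \<open>
  Each piece contracts the fibre, which multiplies the integral of the square by the inverse of the
  Jacobian; the sum over preimages of a periodic function then integrates to \<open>N\<close> times its integral.
\<close>

lemma energy_diagonal:
  "(\<Sum>d\<in>D. \<integral>\<^sup>+x\<in>half_open_cube. (\<integral>\<^sup>+z. ennreal ((part n d x z)\<^sup>2) \<partial>lborel) \<partial>lborel) = ennreal (1 / (N * jac)) * energy n"
proof -
  define \<Psi> where "\<Psi> p = ennreal (1 / (N\<^sup>2 * jac)) * (\<integral>\<^sup>+w. ennreal ((dens n p w)\<^sup>2) \<partial>lborel)" for p
  have [measurable]: "\<Psi> \<in> borel_measurable borel" unfolding \<Psi>_def by measurable
  have per: "lattice_periodic \<Psi>" using dens_periodic[of n] by (simp add: lattice_periodic_def \<Psi>_def)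
  have *: "(\<integral>\<^sup>+z. ennreal ((part n d x z)\<^sup>2) \<partial>lborel) = \<Psi> (Gi (x + d))" for d x
  proof -
    let ?p = "Gi (x + d)"
    define h where "h w = ennreal (1 / (N * jac)\<^sup>2) * ennreal ((dens n ?p w)\<^sup>2)" for w
    have [measurable]: "h \<in> borel_measurable borel" unfolding h_def by measurable
    have "ennreal ((part n d x z)\<^sup>2) = h (Bi (z - g ?p))" for z
      by (simp add: h_def part_def power_divide ennreal_mult[symmetric])
    then have "(\<integral>\<^sup>+z. ennreal ((part n d x z)\<^sup>2) \<partial>lborel) = ennreal jac * (\<integral>\<^sup>+w. h w \<partial>lborel)"
      by (simp add: nn_integral_fiber_change)
    also have "\<dots> = ennreal jac * (ennreal (1 / (N * jac)\<^sup>2) * (\<integral>\<^sup>+w. ennreal ((dens n ?p w)\<^sup>2) \<partial>lborel))"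
      unfolding h_def by (subst nn_integral_cmult) simp_all
    also have "\<dots> = ennreal (jac * (1 / (N * jac)\<^sup>2)) * (\<integral>\<^sup>+w. ennreal ((dens n ?p w)\<^sup>2) \<partial>lborel)"
      using jac_pos by (subst ennreal_mult) (auto simp: mult.assoc)
    also have "jac * (1 / (N * jac)\<^sup>2) = 1 / (N\<^sup>2 * jac)"
      using jac_pos by (simp add: power2_eq_square)
    finally show ?thesis by (simp add: \<Psi>_def)
  qed
  have "(\<Sum>d\<in>D. \<integral>\<^sup>+x\<in>half_open_cube. (\<integral>\<^sup>+z. ennreal ((part n d x z)\<^sup>2) \<partial>lborel) \<partial>lborel) =
      (\<Sum>d\<in>D. \<integral>\<^sup>+x\<in>half_open_cube. \<Psi> (Gi (x + d)) \<partial>lborel)" by (simp add: *)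
  also have "\<dots> = (\<integral>\<^sup>+x\<in>half_open_cube. (\<Sum>d\<in>D. \<Psi> (Gi (x + d))) \<partial>lborel)"
    unfolding sum_distrib_right by (rule nn_integral_sum[symmetric]) measurable
  also have "\<dots> = card D * (\<integral>\<^sup>+x\<in>half_open_cube. \<Psi> x \<partial>lborel)"
    using per by (rule nn_integral_sum_coset_reps) measurable
  also have "(\<integral>\<^sup>+x\<in>half_open_cube. \<Psi> x \<partial>lborel) = ennreal (1 / (N\<^sup>2 * jac)) * energy n"
    unfolding \<Psi>_def energy_def mult.assoc by (rule nn_integral_cmult) measurable
  also have "card D * (ennreal (1 / (N\<^sup>2 * jac)) * energy n) = ennreal (real N * (1 / (N\<^sup>2 * jac))) * energy n"
    using jac_pos by (subst ennreal_mult) (auto simp: mult.assoc ennreal_of_nat_eq_real_of_nat)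
  also have "real N * (1 / (N\<^sup>2 * jac)) = 1 / (N * jac)"
    using card_D_pos by (simp add: power2_eq_square)
  finally show ?thesis .
qed

text \<open>
  Both pieces are averages of translates of one kernel. For a pair of translates, shifting the fibre
  variable leaves the kernel evaluated at the difference of the branches, and transversality bounds
  its integral over the base by a multiple of the integral of the kernel, which is 1.
\<close>

lemma energy_cross:
  assumes A: "A \<ge> 0" and trans: "\<And>a b v U. set a \<subseteq> D \<Longrightarrow> set b \<subseteq> D \<Longrightarrow> open U \<Longrightarrow>
      emeasure lborel {x \<in> half_open_cube. v + (branch (d1 # b) x - branch (d0 # a) x) \<in> U} \<le> ennreal A * emeasure lborel U"
  shows "(\<integral>\<^sup>+x\<in>half_open_cube. (\<integral>\<^sup>+z. ennreal (part n d0 x z * part n d1 x z) \<partial>lborel) \<partial>lborel) \<le> ennreal A"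
proof -
  let ?Q = "half_open_cube :: (real ^ 'u) set"
  define c where "c = 1 / (real N ^ Suc n)\<^sup>2"
  have c: "c \<ge> 0" by (simp add: c_def)
  define K where "K a b x z = kern (Suc n) (z - branch (d0 # a) x) * kern (Suc n) (z - branch (d1 # b) x)" for a b x z
  have Kn: "K a b x z \<ge> 0" for a b x z unfolding K_def by (simp add: kern_nonneg del: kern.simps)
  have [measurable]: "(\<lambda>p. K a b (fst p) (snd p)) \<in> borel_measurable (borel \<Otimes>\<^sub>M borel)" for a b
    unfolding K_def by measurable
  have [measurable]: "(\<lambda>z. K a b x z) \<in> borel_measurable borel" for a b x
    unfolding K_def by measurable
  have *: "part n d0 x z * part n d1 x z = (\<Sum>a\<in>words n. \<Sum>b\<in>words n. c * K a b x z)" for x z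
  proof -
    have "part n d0 x z * part n d1 x z = c * ((\<Sum>a\<in>words n. kern (Suc n) (z - branch (d0 # a) x)) *
        (\<Sum>b\<in>words n. kern (Suc n) (z - branch (d1 # b) x)))"
      unfolding part_eq c_def by (simp add: power2_eq_square del: kern.simps branch.simps power_Suc)
    then show ?thesis by (subst (asm) sum_product) (simp only: sum_distrib_left K_def)
  qed
  have "(\<integral>\<^sup>+x\<in>?Q. (\<integral>\<^sup>+z. ennreal (part n d0 x z * part n d1 x z) \<partial>lborel) \<partial>lborel) =
     (\<integral>\<^sup>+x\<in>?Q. (\<integral>\<^sup>+z. (\<Sum>a\<in>words n. \<Sum>b\<in>words n. ennreal (c * K a b x z)) \<partial>lborel) \<partial>lborel)"
  proof -
    have "ennreal (\<Sum>a\<in>words n. \<Sum>b\<in>words n. c * K a b x z) = (\<Sum>a\<in>words n. \<Sum>b\<in>words n. ennreal (c * K a b x z))" for x z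
      by (simp only: sum_ennreal[symmetric] sum_nonneg mult_nonneg_nonneg c Kn)
    with * show ?thesis by (simp only:)
  qed
  also have "\<dots> = (\<Sum>a\<in>words n. \<Sum>b\<in>words n. (\<integral>\<^sup>+x\<in>?Q. (\<integral>\<^sup>+z. ennreal (c * K a b x z) \<partial>lborel) \<partial>lborel))"
    by (simp add: nn_integral_sum sum_distrib_right)
  also have "\<dots> \<le> (\<Sum>a\<in>words n. \<Sum>b\<in>words n. ennreal (c * A))"
  proof (intro sum_mono)
    fix a b assume ab: "a \<in> words n" "b \<in> words n"
    define h where "h x = branch (d1 # b) x - branch (d0 # a) x" for x
    have [measurable]: "h \<in> borel_measurable borel" unfolding h_def by (simp del: branch.simps)
    obtain U where U: "open U" "kern (Suc n) = (\<lambda>v. indicator U v / jac ^ Suc n)" using kern_eq by blast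
    have [measurable]: "U \<in> sets borel" using U(1) by simp
    let ?k = "kern (Suc n)"
    have kU: "ennreal (?k v) = ennreal (1 / jac ^ Suc n) * indicator U v" for v
      by (simp add: U(2) indicator_def)
    have Ik: "(\<integral>\<^sup>+v. ennreal (?k v) \<partial>lborel) = ennreal (1 / jac ^ Suc n) * emeasure lborel U"
      unfolding kU by (rule nn_integral_cmult_indicator) simp
    have "(\<integral>\<^sup>+x\<in>?Q. (\<integral>\<^sup>+z. ennreal (K a b x z) \<partial>lborel) \<partial>lborel) =
        (\<integral>\<^sup>+x\<in>?Q. (\<integral>\<^sup>+v. ennreal (?k v) * ennreal (?k (v + h x)) \<partial>lborel) \<partial>lborel)"
    proof (rule nn_integral_cong, rule arg_cong2[where f = times, OF _ refl])
      fix x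
      have "(\<integral>\<^sup>+v. ennreal (?k v) * ennreal (?k (v + h x)) \<partial>lborel) =
          (\<integral>\<^sup>+z. ennreal (?k (z + - branch (d1 # b) x)) * ennreal (?k (z + - branch (d1 # b) x + h x)) \<partial>lborel)"
        by (subst nn_integral_lborel_translate) (simp_all del: branch.simps kern.simps)
      also have "\<dots> = (\<integral>\<^sup>+z. ennreal (K a b x z) \<partial>lborel)"
        by (intro nn_integral_cong) (simp add: K_def h_def ennreal_mult[symmetric] kern_nonneg mult.commute del: branch.simps kern.simps)
      finally show "(\<integral>\<^sup>+z. ennreal (K a b x z) \<partial>lborel) = (\<integral>\<^sup>+v. ennreal (?k v) * ennreal (?k (v + h x)) \<partial>lborel)" ..
    qed
    also have "\<dots> = (\<integral>\<^sup>+x. (\<integral>\<^sup>+v. ennreal (?k v) * ennreal (?k (v + h x)) * indicator ?Q x \<partial>lborel) \<partial>lborel)"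
      by (intro nn_integral_cong nn_integral_multc[symmetric]) (simp del: kern.simps)
    also have "\<dots> = (\<integral>\<^sup>+v. (\<integral>\<^sup>+x. ennreal (?k v) * ennreal (?k (v + h x)) * indicator ?Q x \<partial>lborel) \<partial>lborel)"
      by (rule lborel_pair.Fubini') (simp del: kern.simps)
    also have "\<dots> \<le> (\<integral>\<^sup>+v. ennreal A * ennreal (?k v) \<partial>lborel)"
    proof (rule nn_integral_mono)
      fix v
      have "(\<integral>\<^sup>+x. ennreal (?k v) * ennreal (?k (v + h x)) * indicator ?Q x \<partial>lborel) =
          (\<integral>\<^sup>+x. (ennreal (?k v) * ennreal (1 / jac ^ Suc n)) * indicator {x \<in> ?Q. v + h x \<in> U} x \<partial>lborel)"
        by (intro nn_integral_cong) (auto simp: kU indicator_def simp del: kern.simps)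
      also have "\<dots> = ennreal (?k v) * ennreal (1 / jac ^ Suc n) * emeasure lborel {x \<in> ?Q. v + h x \<in> U}"
        by (subst nn_integral_cmult_indicator) simp_all
      also have "\<dots> \<le> ennreal (?k v) * ennreal (1 / jac ^ Suc n) * (ennreal A * emeasure lborel U)"
        using ab U(1) unfolding h_def words_def by (intro mult_left_mono trans) auto
      also have "\<dots> = ennreal A * ennreal (?k v) * (\<integral>\<^sup>+v. ennreal (?k v) \<partial>lborel)"
        unfolding Ik by (simp only: mult_ac)
      also have "\<dots> = ennreal A * ennreal (?k v)" by (simp only: integral_kern mult_1_right)
      finally show "(\<integral>\<^sup>+x. ennreal (?k v) * ennreal (?k (v + h x)) * indicator ?Q x \<partial>lborel) \<le> ennreal A * ennreal (?k v)" .
    qed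
    also have "\<dots> = ennreal A * (\<integral>\<^sup>+v. ennreal (?k v) \<partial>lborel)"
      by (rule nn_integral_cmult) (simp del: kern.simps)
    also have "\<dots> = ennreal A" by (simp only: integral_kern mult_1_right)
    finally have le: "(\<integral>\<^sup>+x\<in>?Q. (\<integral>\<^sup>+z. ennreal (K a b x z) \<partial>lborel) \<partial>lborel) \<le> ennreal A" .
    have "(\<integral>\<^sup>+x\<in>?Q. (\<integral>\<^sup>+z. ennreal (c * K a b x z) \<partial>lborel) \<partial>lborel) = 
        (\<integral>\<^sup>+x\<in>?Q. ennreal c * (\<integral>\<^sup>+z. ennreal (K a b x z) \<partial>lborel) \<partial>lborel)"
      using c Kn by (simp add: ennreal_mult nn_integral_cmult)
    also have "\<dots> = ennreal c * (\<integral>\<^sup>+x\<in>?Q. (\<integral>\<^sup>+z. ennreal (K a b x z) \<partial>lborel) \<partial>lborel)"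
      unfolding mult.assoc by (rule nn_integral_cmult) measurable
    also have "\<dots> \<le> ennreal c * ennreal A" by (intro mult_left_mono le) simp
    finally show "(\<integral>\<^sup>+x\<in>?Q. (\<integral>\<^sup>+z. ennreal (c * K a b x z) \<partial>lborel) \<partial>lborel) \<le> ennreal (c * A)"
      using c A by (simp add: ennreal_mult)
  qed
  also have "\<dots> = ennreal (N ^ n * (N ^ n * (c * A)))"
    using c A by (simp add: card_words ennreal_of_nat_eq_real_of_nat ennreal_mult[symmetric])
  also have "\<dots> \<le> ennreal A"
  proof (rule ennreal_leI)
    have N: "real N \<ge> 1" using card_D_pos by simp
    have "real (N ^ n * N ^ n) * c = 1 / (real N * real N)"
      using N unfolding c_def by (simp add: power2_eq_square field_simps)
    also have "\<dots> \<le> 1" using mult_mono[OF N N] by simp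
    finally have "real (N ^ n * N ^ n) * c \<le> 1" .
    then show "real (N ^ n) * (real (N ^ n) * (c * A)) \<le> A"
      using mult_right_mono[of "real (N ^ n * N ^ n) * c" 1 A] A by (simp add: mult_ac)
  qed
  finally show ?thesis .
qed

text \<open>
  \<open>square_sum_merge_pair\<close> is integrated: the squares contribute \<open>energy_diagonal\<close>, and the product of the
  merged pair contributes the bounded \<open>energy_cross\<close>.
\<close>

lemma energy_step:
  assumes d: "d0 \<in> D" "d1 \<in> D" "d0 \<noteq> d1" and A: "A \<ge> 0"
    and trans: "\<And>a b v U. set a \<subseteq> D \<Longrightarrow> set b \<subseteq> D \<Longrightarrow> open U \<Longrightarrow>
      emeasure lborel {x \<in> half_open_cube. v + (branch (d1 # b) x - branch (d0 # a) x) \<in> U} \<le> ennreal A * emeasure lborel U"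
  shows "energy (Suc n) \<le> ennreal ((real N - 1) / (N * jac)) * energy n + ennreal (2 * (real N - 1) * A)"
proof -
  let ?Q = "half_open_cube :: (real ^ 'u) set"
  have N1: "real N - 1 \<ge> 0" using card_D_pos by simp
  have [measurable]: "(\<lambda>p. part n d (fst p) (snd p)) \<in> borel_measurable (borel \<Otimes>\<^sub>M borel)" for d
    unfolding part_def by measurable
  have [measurable]: "(\<lambda>z. part n d x z) \<in> borel_measurable borel" for d x
    unfolding part_def by measurable
  have pw: "ennreal ((dens (Suc n) x z)\<^sup>2) \<le> ennreal (real N - 1) *
      ((\<Sum>d\<in>D. ennreal ((part n d x z)\<^sup>2)) + 2 * ennreal (part n d0 x z * part n d1 x z))" for x z
  proof -
    have "(dens (Suc n) x z)\<^sup>2 \<le> (real N - 1) * ((\<Sum>d\<in>D. (part n d x z)\<^sup>2) + 2 * (part n d0 x z * part n d1 x z))"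
      unfolding dens_Suc by (rule square_sum_merge_pair[OF finite_coset_reps d])
    then have "ennreal ((dens (Suc n) x z)\<^sup>2) \<le> ennreal ((real N - 1) * ((\<Sum>d\<in>D. (part n d x z)\<^sup>2) + 2 * (part n d0 x z * part n d1 x z)))"
      by (rule ennreal_leI)
    also have "\<dots> = ennreal (real N - 1) * ((\<Sum>d\<in>D. ennreal ((part n d x z)\<^sup>2)) + 2 * ennreal (part n d0 x z * part n d1 x z))"
      using N1 by (simp add: ennreal_mult ennreal_plus sum_nonneg part_nonneg sum_ennreal)
    finally show ?thesis .
  qed
  have "energy (Suc n) \<le> (\<integral>\<^sup>+x\<in>?Q. (\<integral>\<^sup>+z. ennreal (real N - 1) *
      ((\<Sum>d\<in>D. ennreal ((part n d x z)\<^sup>2)) + 2 * ennreal (part n d0 x z * part n d1 x z)) \<partial>lborel) \<partial>lborel)"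
    unfolding energy_def by (intro nn_integral_mono mult_right_mono pw) simp
  also have "\<dots> = (\<integral>\<^sup>+x. ennreal (real N - 1) * ((\<Sum>d\<in>D. (\<integral>\<^sup>+z. ennreal ((part n d x z)\<^sup>2) \<partial>lborel) * indicator ?Q x) +
      2 * ((\<integral>\<^sup>+z. ennreal (part n d0 x z * part n d1 x z) \<partial>lborel) * indicator ?Q x)) \<partial>lborel)"
    by (intro nn_integral_cong) (simp add: nn_integral_cmult nn_integral_add nn_integral_sum indicator_def del: sum_ennreal)
  also have "\<dots> = ennreal (real N - 1) * ((\<Sum>d\<in>D. \<integral>\<^sup>+x\<in>?Q. (\<integral>\<^sup>+z. ennreal ((part n d x z)\<^sup>2) \<partial>lborel) \<partial>lborel) +
      2 * (\<integral>\<^sup>+x\<in>?Q. (\<integral>\<^sup>+z. ennreal (part n d0 x z * part n d1 x z) \<partial>lborel) \<partial>lborel))"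
    by (simp add: nn_integral_cmult nn_integral_add nn_integral_sum)
  also have "\<dots> \<le> ennreal (real N - 1) * (ennreal (1 / (N * jac)) * energy n + 2 * ennreal A)"
    unfolding energy_diagonal using energy_cross[OF A trans, where n = n]
    by (intro mult_left_mono add_left_mono) auto
  also have "\<dots> = ennreal ((real N - 1) / (N * jac)) * energy n + ennreal (2 * (real N - 1) * A)"
  proof -
    have 1: "ennreal (real N - 1) * ennreal (1 / (N * jac)) = ennreal ((real N - 1) / (N * jac))"
      using N1 jac_pos by (simp add: ennreal_mult[symmetric])
    have 2: "ennreal (real N - 1) * (2 * ennreal A) = ennreal (2 * (real N - 1) * A)"
      using ennreal_mult[of "2 * (real N - 1)" A] ennreal_mult[of 2 "real N - 1"] N1 A
      by (simp only: mult_ac ennreal_numeral mult_nonneg_nonneg zero_le_numeral)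
    show ?thesis unfolding distrib_left 2 by (simp only: mult.assoc[symmetric] 1)
  qed
  finally show ?thesis .
qed

text \<open>
  The hypothesis on \<open>jac\<close> says that the factor in \<open>energy_step\<close> is less than 1, so the energies are bounded
  by the fixed point of an affine contraction.
\<close>

lemma energy_bounded:
  assumes d: "d0 \<in> D" "d1 \<in> D" "d0 \<noteq> d1" and A: "A \<ge> 0"
    and trans: "\<And>a b v U. set a \<subseteq> D \<Longrightarrow> set b \<subseteq> D \<Longrightarrow> open U \<Longrightarrow>
      emeasure lborel {x \<in> half_open_cube. v + (branch (d1 # b) x - branch (d0 # a) x) \<in> U} \<le> ennreal A * emeasure lborel U"
    and fat: "real N - 1 < N * jac"
  shows "\<exists>b\<ge>0. \<forall>n. energy n \<le> ennreal b"
proof -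
  define \<theta> where "\<theta> = (real N - 1) / (N * jac)"
  define K where "K = 2 * (real N - 1) * A"
  define b where "b = 1 + K / (1 - \<theta>)"
  have N1: "real N - 1 \<ge> 0" using card_D_pos by simp
  have \<theta>: "0 \<le> \<theta>" "\<theta> < 1" using N1 jac_pos fat by (simp_all add: \<theta>_def)
  have K: "K \<ge> 0" using N1 A by (simp add: K_def)
  define L where "L = K / (1 - \<theta>)"
  have "K = L * (1 - \<theta>)" using \<theta> by (simp add: L_def)
  then have "\<theta> * b + K = \<theta> + K / (1 - \<theta>)" unfolding b_def L_def[symmetric] by (simp add: algebra_simps)
  then have b: "b \<ge> 0" "\<theta> * b + K \<le> b" using \<theta> K by (simp_all add: b_def)
  have "energy n \<le> ennreal b" for n
  proof (induction n)
    case 0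
    have "1 \<le> b" using \<theta> K by (simp add: b_def)
    then show ?case by (simp add: energy_0)
  next
    case (Suc n)
    have "energy (Suc n) \<le> ennreal \<theta> * energy n + ennreal K"
      unfolding \<theta>_def K_def by (rule energy_step[OF d A trans])
    also have "\<dots> \<le> ennreal \<theta> * ennreal b + ennreal K" by (intro add_right_mono mult_left_mono Suc) simp
    also have "\<dots> = ennreal (\<theta> * b + K)" using \<theta> K b(1) by (simp add: ennreal_mult ennreal_plus)
    also have "\<dots> \<le> ennreal b" by (intro ennreal_leI b)
    finally show ?case .
  qed
  with b(1) show ?thesis by blast
qed

text \<open>
  A density \<open>\<rho>\<close> satisfies \<open>\<rho> \<le> t + \<rho>\<^sup>2 / t\<close>, so a bound on the energy controls the mass of every set by its
  volume, uniformly in \<open>n\<close>. Choosing \<open>t\<close> large makes this uniform absolute continuity.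
\<close>

lemma pushforward_uniform_bound:
  assumes b: "energy n \<le> ennreal b" and t: "t > 0"
    and S [measurable]: "S \<in> sets (borel \<Otimes>\<^sub>M borel)"
    and per: "\<And>x l z. l \<in> integer_lattice \<Longrightarrow> (x + l, z) \<in> S \<longleftrightarrow> (x, z) \<in> S"
  shows "(\<integral>\<^sup>+x\<in>half_open_cube. (\<integral>\<^sup>+z\<in>box 0 One. indicator S ((lifted ^^ n) (x, z)) \<partial>lborel) \<partial>lborel) \<le>
    ennreal t * (\<integral>\<^sup>+x\<in>half_open_cube. (\<integral>\<^sup>+z. indicator S (x, z) \<partial>lborel) \<partial>lborel) + ennreal (b / t)"
proof -
  let ?Q = "half_open_cube :: (real ^ 'u) set"
  have "dens 0 x z = indicator (box 0 One) z" for x z by (simp add: dens_def)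
  then have "(\<integral>\<^sup>+x\<in>?Q. (\<integral>\<^sup>+z\<in>box 0 One. indicator S ((lifted ^^ n) (x, z)) \<partial>lborel) \<partial>lborel) =
      (\<integral>\<^sup>+x\<in>?Q. (\<integral>\<^sup>+z. ennreal (dens 0 x z) * indicator S ((lifted ^^ n) (x, z)) \<partial>lborel) \<partial>lborel)"
    by (simp add: ennreal_indicator mult.commute)
  also have "\<dots> = (\<integral>\<^sup>+x\<in>?Q. (\<integral>\<^sup>+z. ennreal (dens n x z) * indicator S (x, z) \<partial>lborel) \<partial>lborel)"
    by (rule dens_duality[symmetric]) (use per in \<open>auto simp: indicator_def\<close>)
  also have "\<dots> \<le> (\<integral>\<^sup>+x\<in>?Q. (\<integral>\<^sup>+z. ennreal t * indicator S (x, z) + ennreal (1 / t) * ennreal ((dens n x z)\<^sup>2) \<partial>lborel) \<partial>lborel)"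
  proof (intro nn_integral_mono mult_right_mono)
    fix x z
    have "dens n x z \<le> t + 1 / t * (dens n x z)\<^sup>2"
    proof (cases "dens n x z \<le> t")
      case False
      then have "t * dens n x z \<le> (dens n x z)\<^sup>2" using t by (simp add: power2_eq_square)
      then show ?thesis using t by (simp add: field_simps) (smt (verit) mult_nonneg_nonneg)
    qed (use t in \<open>auto intro: add_increasing2\<close>)
    then have "ennreal (dens n x z) \<le> ennreal t + ennreal (1 / t) * ennreal ((dens n x z)\<^sup>2)"
      using t by (simp add: ennreal_mult[symmetric] ennreal_plus[symmetric] ennreal_leI del: ennreal_plus)
    then show "ennreal (dens n x z) * indicator S (x, z) \<le> ennreal t * indicator S (x, z) + ennreal (1 / t) * ennreal ((dens n x z)\<^sup>2)"
      by (auto simp: indicator_def)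
  qed simp
  also have "\<dots> = (\<integral>\<^sup>+x. ennreal t * ((\<integral>\<^sup>+z. indicator S (x, z) \<partial>lborel) * indicator ?Q x) +
       ennreal (1 / t) * ((\<integral>\<^sup>+z. ennreal ((dens n x z)\<^sup>2) \<partial>lborel) * indicator ?Q x) \<partial>lborel)"
    by (intro nn_integral_cong) (simp add: nn_integral_cmult nn_integral_add indicator_def)
  also have "\<dots> = ennreal t * (\<integral>\<^sup>+x\<in>?Q. (\<integral>\<^sup>+z. indicator S (x, z) \<partial>lborel) \<partial>lborel) + ennreal (1 / t) * energy n"
    by (simp add: nn_integral_cmult nn_integral_add energy_def)
  also have "\<dots> \<le> ennreal t * (\<integral>\<^sup>+x\<in>?Q. (\<integral>\<^sup>+z. indicator S (x, z) \<partial>lborel) \<partial>lborel) + ennreal (1 / t) * ennreal b"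
    by (intro add_left_mono mult_left_mono b) simp
  also have "ennreal (1 / t) * ennreal b = ennreal (b / t)" using t by (simp add: ennreal_mult'[symmetric])
  finally show ?thesis .
qed

end

section \<open>Averages of weakly correlated sequences\<close>

text \<open>
  Between consecutive squares \<open>m\<^sup>2\<close> and \<open>(m + 1)\<^sup>2\<close> a bounded sequence adds at most \<open>2 m\<close> terms, which is
  negligible against \<open>m\<^sup>2\<close>.
\<close>

lemma averages_from_squares:
  fixes a :: "nat \<Rightarrow> real"
  assumes b: "\<And>k. \<bar>a k\<bar> \<le> b"
    and sq: "(\<lambda>j. (\<Sum>k<(Suc j)\<^sup>2. a k) / (Suc j)\<^sup>2) \<longlonglongrightarrow> 0"
  shows "(\<lambda>n. (\<Sum>k<n. a k) / n) \<longlonglongrightarrow> 0"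
proof -
  (* Suc (r n) is the integer part of the square root of n *)
  define r where "r n = nat \<lfloor>sqrt (real n)\<rfloor> - 1" for n
  have r_lim: "filterlim r at_top sequentially"
    unfolding r_def filterlim_at_top
  proof
    fix Z
    have "\<forall>\<^sub>F n in sequentially. (Z + 1)\<^sup>2 \<le> n" by (rule eventually_ge_at_top)
    then show "\<forall>\<^sub>F n in sequentially. Z \<le> nat \<lfloor>sqrt (real n)\<rfloor> - 1"
    proof eventually_elim
      case (elim n)
      then have "(real (Z + 1))\<^sup>2 \<le> real n" using of_nat_le_iff[where 'a = real, of "(Z+1)\<^sup>2" n] by simp
      then have "real (Z + 1) \<le> sqrt (real n)" by (rule real_le_rsqrt)
      then have "int (Z + 1) \<le> \<lfloor>sqrt (real n)\<rfloor>" by (simp add: le_floor_iff)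
      then show ?case by linarith
    qed
  qed
  have b0: "b \<ge> 0" using b[of 0] by linarith
  have bound: "\<bar>(\<Sum>k<n. a k) / n\<bar> \<le> \<bar>(\<Sum>k<(Suc (r n))\<^sup>2. a k) / (Suc (r n))\<^sup>2\<bar> + 3 * b / real (Suc (r n))" if n: "n \<ge> 1" for n
  proof -
    define m where "m = Suc (r n)"
    have m1: "m \<ge> 1" by (simp add: m_def)
    have "\<lfloor>sqrt (real n)\<rfloor> \<ge> 1" using n by (simp add: le_floor_iff)
    then have m: "int m = \<lfloor>sqrt (real n)\<rfloor>" by (simp add: m_def r_def)
    then have "real m \<le> sqrt n" "sqrt n < real m + 1" by linarith+
    then have "(real m)\<^sup>2 \<le> real n" "real n < (real m + 1)\<^sup>2"
      using power_mono[of "real m" "sqrt n" 2] power_strict_mono[of "sqrt n" "real m + 1" 2] by simp_all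
    then have "real (m\<^sup>2) \<le> real n" "real n < real ((m + 1)\<^sup>2)" by (simp_all add: add.commute)
    then have mn: "m\<^sup>2 \<le> n" "n < (m + 1)\<^sup>2" by (simp_all only: of_nat_le_iff of_nat_less_iff)
    then have d: "n - m\<^sup>2 \<le> 2 * m" by (simp add: power2_eq_square)
    have "(\<Sum>k<n. a k) = (\<Sum>k<m\<^sup>2. a k) + (\<Sum>k=m\<^sup>2..<n. a k)"
      using mn by (metis lessThan_atLeast0 sum.atLeastLessThan_concat zero_le)
    moreover have "\<bar>\<Sum>k=m\<^sup>2..<n. a k\<bar> \<le> (\<Sum>k=m\<^sup>2..<n. b)" by (rule order_trans[OF sum_abs sum_mono[OF b]])
    moreover have "(\<Sum>k=m\<^sup>2..<n. b) = real (n - m\<^sup>2) * b" by simp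
    moreover have "real (n - m\<^sup>2) * b \<le> real (2 * m) * b" using d b0 by (intro mult_right_mono) (simp only: of_nat_le_iff)
    ultimately have "\<bar>\<Sum>k<n. a k\<bar> \<le> \<bar>\<Sum>k<m\<^sup>2. a k\<bar> + 2 * m * b" by linarith
    then have "\<bar>\<Sum>k<n. a k\<bar> / n \<le> (\<bar>\<Sum>k<m\<^sup>2. a k\<bar> + 2 * m * b) / n" by (rule divide_right_mono) simp
    also have "\<dots> \<le> (\<bar>\<Sum>k<m\<^sup>2. a k\<bar> + 2 * m * b) / real (m\<^sup>2)"
    proof (rule divide_left_mono)
      show "real (m\<^sup>2) \<le> real n" using mn(1) by (simp only: of_nat_le_iff)
      show "0 \<le> \<bar>\<Sum>k<m\<^sup>2. a k\<bar> + 2 * m * b" using b0 by simp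
      show "0 < real n * real (m\<^sup>2)" using n m1 by simp
    qed
    also have "\<dots> = \<bar>\<Sum>k<m\<^sup>2. a k\<bar> / real (m\<^sup>2) + 2 * b / m"
      using m1 by (simp add: add_divide_distrib power2_eq_square)
    also have "2 * b / m \<le> 3 * b / m" using b0 m1 by (intro divide_right_mono) auto
    finally show ?thesis by (simp add: m_def abs_divide)
  qed
  have "(\<lambda>n. \<bar>(\<Sum>k<(Suc (r n))\<^sup>2. a k) / (Suc (r n))\<^sup>2\<bar> + 3 * b / real (Suc (r n))) \<longlonglongrightarrow> \<bar>0\<bar> + 0"
  proof (intro tendsto_add tendsto_rabs)
    show "(\<lambda>n. (\<Sum>k<(Suc (r n))\<^sup>2. a k) / (Suc (r n))\<^sup>2) \<longlonglongrightarrow> 0"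
      using filterlim_compose[OF sq r_lim] by simp
    have "(\<lambda>j. 3 * b / real (Suc j)) \<longlonglongrightarrow> 0" by real_asymp
    from filterlim_compose[OF this r_lim] show "(\<lambda>n. 3 * b / real (Suc (r n))) \<longlonglongrightarrow> 0" .
  qed
  then have "(\<lambda>n. \<bar>(\<Sum>k<(Suc (r n))\<^sup>2. a k) / (Suc (r n))\<^sup>2\<bar> + 3 * b / real (Suc (r n))) \<longlonglongrightarrow> 0" by simp
  then show ?thesis
    by (rule Lim_null_comparison[rotated]) (use bound in \<open>auto simp: eventually_sequentially intro!: exI[of _ 1]\<close>)
qed

text \<open>
  Exponentially small correlations give the average of \<open>n\<close> variables a second moment of order \<open>1 / n\<close>. Along
  the squares these second moments are summable, so the averages tend to 0 almost everywhere there,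
  and \<open>averages_from_squares\<close> fills the gaps.
\<close>

lemma (in prob_space) lln_exponential_decorrelation:
  fixes X :: "nat \<Rightarrow> 'a \<Rightarrow> real"
  assumes [measurable]: "\<And>k. X k \<in> borel_measurable M"
    and b: "\<And>k x. x \<in> space M \<Longrightarrow> \<bar>X k x\<bar> \<le> b"
    and corr: "\<And>i k. \<bar>expectation (\<lambda>x. X i x * X (i + k) x)\<bar> \<le> A * \<kappa> ^ k"
    and \<kappa>: "0 \<le> \<kappa>" "\<kappa> < 1"
  shows "AE x in M. (\<lambda>n. (\<Sum>k<n. X k x) / n) \<longlonglongrightarrow> 0"
proof -
  have A: "A \<ge> 0" using order_trans[OF abs_ge_zero corr[of 0 0]] by simp
  obtain x0 where "x0 \<in> space M" using not_empty by blast
  then have b0: "b \<ge> 0" using b[of x0 0] by linarith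
  have int: "integrable M (\<lambda>x. X i x * X j x)" for i j
    by (rule integrable_const_bound[where B = "b * b"])
       (auto simp: abs_mult intro!: AE_I2 mult_mono b b0)
  have c2: "\<bar>expectation (\<lambda>x. X i x * X j x)\<bar> \<le> A * \<kappa> ^ (if i \<le> j then j - i else i - j)" for i j
    using corr[of i "j - i"] corr[of j "i - j"] by (auto simp: mult.commute)
  have row: "(\<Sum>j<n. A * \<kappa> ^ (if i \<le> j then j - i else i - j)) \<le> 2 * A / (1 - \<kappa>)" if "i < n" for i n
  proof -
    have geo: "(\<Sum>k\<in>S. \<kappa> ^ k) \<le> 1 / (1 - \<kappa>)" if "finite S" for S
      using sum_le_suminf[OF summable_geometric that, of \<kappa>] \<kappa> suminf_geometric[of \<kappa>] by auto
    have "(\<Sum>j<n. \<kappa> ^ (if i \<le> j then j - i else i - j)) = (\<Sum>j\<in>{i..<n}. \<kappa> ^ (j - i)) + (\<Sum>j\<in>{..<i}. \<kappa> ^ (i - j))"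
    proof -
      have un: "{..<n} = {i..<n} \<union> {..<i}" using that by auto
      have "(\<Sum>j<n. \<kappa> ^ (if i \<le> j then j - i else i - j)) =
         (\<Sum>j\<in>{i..<n}. \<kappa> ^ (if i \<le> j then j - i else i - j)) + (\<Sum>j\<in>{..<i}. \<kappa> ^ (if i \<le> j then j - i else i - j))"
        unfolding un by (rule sum.union_disjoint) auto
      then show ?thesis by simp
    qed
    also have "(\<Sum>j\<in>{i..<n}. \<kappa> ^ (j - i)) = (\<Sum>k\<in>(\<lambda>j. j - i) ` {i..<n}. \<kappa> ^ k)"
      by (subst sum.reindex) (auto simp: inj_on_def)
    also have "\<dots> \<le> 1 / (1 - \<kappa>)" by (rule geo) simp
    also have "(\<Sum>j\<in>{..<i}. \<kappa> ^ (i - j)) = (\<Sum>k\<in>(\<lambda>j. i - j) ` {..<i}. \<kappa> ^ k)"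
      by (subst sum.reindex) (auto simp: inj_on_def)
    also have "\<dots> \<le> 1 / (1 - \<kappa>)" by (rule geo) simp
    finally have "(\<Sum>j<n. \<kappa> ^ (if i \<le> j then j - i else i - j)) \<le> 2 / (1 - \<kappa>)" by simp
    from mult_left_mono[OF this A] show ?thesis by (simp add: sum_distrib_left mult.commute)
  qed
  have var: "expectation (\<lambda>x. (\<Sum>k<n. X k x)\<^sup>2) \<le> n * (2 * A / (1 - \<kappa>))" for n
  proof -
    have "expectation (\<lambda>x. (\<Sum>k<n. X k x)\<^sup>2) = (\<Sum>i<n. \<Sum>j<n. expectation (\<lambda>x. X i x * X j x))"
      by (simp add: power2_eq_square sum_product int)
    also have "\<dots> \<le> (\<Sum>i<n. \<Sum>j<n. A * \<kappa> ^ (if i \<le> j then j - i else i - j))"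
      by (rule sum_mono, rule sum_mono, rule abs_le_D1[OF c2])
    also have "\<dots> \<le> (\<Sum>i<n. 2 * A / (1 - \<kappa>))" by (intro sum_mono row) simp
    finally show ?thesis by simp
  qed
  define Y where "Y j x = ((\<Sum>k<(Suc j)\<^sup>2. X k x) / (Suc j)\<^sup>2)\<^sup>2" for j x
  have [measurable]: "Y j \<in> borel_measurable M" for j unfolding Y_def by measurable
  have Y: "(\<integral>\<^sup>+x. ennreal (Y j x) \<partial>M) \<le> ennreal (2 * A / (1 - \<kappa>) * inverse ((real (Suc j))\<^sup>2))" for j
  proof -
    let ?n = "(Suc j)\<^sup>2"
    have i2: "integrable M (\<lambda>x. (\<Sum>k<n. X k x)\<^sup>2)" for n
      by (simp add: power2_eq_square sum_product int)
    have YY: "Y j x = (\<Sum>k<?n. X k x)\<^sup>2 / (real ?n)\<^sup>2" for x by (simp add: Y_def power_divide)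
    have "(\<integral>\<^sup>+x. ennreal (Y j x) \<partial>M) = ennreal (expectation (Y j))"
      unfolding YY[abs_def] using i2 by (intro nn_integral_eq_integral) auto
    also have "expectation (Y j) = expectation (\<lambda>x. (\<Sum>k<?n. X k x)\<^sup>2) / (real ?n)\<^sup>2"
      unfolding YY[abs_def] by simp
    also have "ennreal \<dots> \<le> ennreal (real ?n * (2 * A / (1 - \<kappa>)) / (real ?n)\<^sup>2)"
      by (intro ennreal_leI divide_right_mono var) simp
    also have "real ?n * (2 * A / (1 - \<kappa>)) / (real ?n)\<^sup>2 = 2 * A / (1 - \<kappa>) * inverse ((real (Suc j))\<^sup>2)"
    proof -
      have n: "real ?n = (real (Suc j))\<^sup>2" by simp
      have "(real (Suc j))\<^sup>2 \<noteq> 0" by simp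
      moreover have "c * a / c\<^sup>2 = a * inverse c" if "c \<noteq> 0" for a c :: real
        using that by (simp add: power2_eq_square divide_inverse)
      ultimately show ?thesis unfolding n by blast
    qed
    finally show ?thesis .
  qed
  have "(\<integral>\<^sup>+x. (\<Sum>j. ennreal (Y j x)) \<partial>M) = (\<Sum>j. \<integral>\<^sup>+x. ennreal (Y j x) \<partial>M)"
    by (rule nn_integral_suminf) measurable
  also have "\<dots> \<le> (\<Sum>j. ennreal (2 * A / (1 - \<kappa>) * inverse ((real (Suc j))\<^sup>2)))"
    by (intro suminf_le Y) auto
  also have "\<dots> < \<top>"
  proof -
    have "summable (\<lambda>j. inverse ((real (Suc j))\<^sup>2))"
      using inverse_power_summable[of 2, where 'a = real] by (subst summable_Suc_iff) simp
    then have "summable (\<lambda>j. 2 * A / (1 - \<kappa>) * inverse ((real (Suc j))\<^sup>2))" by (rule summable_mult)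
    then show ?thesis using A \<kappa> by (subst suminf_ennreal2) auto
  qed
  finally have "(\<integral>\<^sup>+x. (\<Sum>j. ennreal (Y j x)) \<partial>M) \<noteq> \<infinity>" by simp
  then have "AE x in M. (\<Sum>j. ennreal (Y j x)) \<noteq> \<infinity>"
    by (intro nn_integral_PInf_AE) measurable
  then show ?thesis
  proof (rule AE_mp, intro AE_I2 impI)
    fix x assume x: "x \<in> space M" and fin: "(\<Sum>j. ennreal (Y j x)) \<noteq> \<infinity>"
    have "summable (\<lambda>j. Y j x)"
      using fin by (intro summable_suminf_not_top) (auto simp: Y_def)
    then have "(\<lambda>j. Y j x) \<longlonglongrightarrow> 0" by (rule summable_LIMSEQ_zero)
    then have "(\<lambda>j. sqrt (Y j x)) \<longlonglongrightarrow> sqrt 0" by (intro tendsto_intros)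
    then have "(\<lambda>j. \<bar>(\<Sum>k<(Suc j)\<^sup>2. X k x) / (Suc j)\<^sup>2\<bar>) \<longlonglongrightarrow> 0" by (simp add: Y_def)
    then have "(\<lambda>j. (\<Sum>k<(Suc j)\<^sup>2. X k x) / (Suc j)\<^sup>2) \<longlonglongrightarrow> 0" by (simp only: tendsto_rabs_zero_iff)
    then show "(\<lambda>n. (\<Sum>k<n. X k x) / n) \<longlonglongrightarrow> 0"
      by (rule averages_from_squares[OF b[OF x]])
  qed
qed

section \<open>Integration on the torus\<close>

lemma measurable_to_torus [measurable]: "to_torus \<in> borel \<rightarrow>\<^sub>M borel"
  by (rule borel_measurable_continuous_onI[OF continuous_on_to_torus])

lemma sets_torus_measure [simp, measurable_cong]: "sets torus_measure = sets borel"
  by (simp add: torus_measure_def)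

lemma space_torus_measure [simp]: "space torus_measure = UNIV"
  by (simp add: torus_measure_def)

text \<open>
  The closed unit cube that defines the measure on the torus differs from the half-open one, which
  is a fundamental domain of the lattice, by a null set.
\<close>

lemma nn_integral_torus:
  fixes h :: "'n::finite torus \<Rightarrow> ennreal"
  assumes [measurable]: "h \<in> borel_measurable borel"
  shows "(\<integral>\<^sup>+p. h p \<partial>torus_measure) = (\<integral>\<^sup>+x\<in>half_open_cube. h (to_torus x) \<partial>lborel)"
proof -
  let ?Q = "half_open_cube :: (real ^ 'n) set" and ?C = "cbox 0 (\<chi> i. 1) :: (real ^ 'n) set"
  have [measurable]: "to_torus \<in> restrict_space lborel ?C \<rightarrow>\<^sub>M borel"
    by (intro measurable_restrict_space1) simp
  have sub: "?Q \<subseteq> ?C" by (rule half_open_cube_subset)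
  have "emeasure lborel (?C - ?Q) = emeasure lborel ?C - emeasure lborel ?Q"
    by (rule emeasure_Diff) (simp_all add: emeasure_half_open_cube half_open_cube_subset)
  then have "?C - ?Q \<in> null_sets lborel"
    by (intro null_setsI) (simp_all add: emeasure_half_open_cube emeasure_unit_cbox)
  then have ae: "AE x in lborel. x \<notin> ?C - ?Q" by (rule AE_not_in)
  have "(\<integral>\<^sup>+p. h p \<partial>torus_measure) = (\<integral>\<^sup>+x. h (to_torus x) \<partial>restrict_space lborel ?C)"
    unfolding torus_measure_def by (rule nn_integral_distr) measurable
  also have "\<dots> = (\<integral>\<^sup>+x\<in>?C. h (to_torus x) \<partial>lborel)"
    by (rule nn_integral_restrict_space) simp
  also have "\<dots> = (\<integral>\<^sup>+x\<in>?Q. h (to_torus x) \<partial>lborel)"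
    using ae sub
    by (intro nn_integral_cong_AE) (auto simp: indicator_def elim!: eventually_mono)
  finally show ?thesis .
qed

interpretation torus_prob: prob_space "torus_measure :: ('n::finite) torus measure"
  by (rule prob_space_torus_measure)

context lattice_map
begin

definition torus_avg :: "('u torus \<Rightarrow> real) \<Rightarrow> real ^ 'u \<Rightarrow> real" where
  "torus_avg \<psi> x = (\<Sum>d\<in>D. \<psi> (to_torus (Gi (x + d)))) / card D"

lemma torus_correlation_eq:
  fixes \<psi> \<omega> :: "'u torus \<Rightarrow> real"
  assumes [measurable]: "\<psi> \<in> borel_measurable borel" "\<omega> \<in> borel_measurable borel" "\<tau> \<in> borel \<rightarrow>\<^sub>M borel"
    and \<tau>: "\<And>x. \<tau> (to_torus x) = to_torus (G x)" and pos: "\<And>p. \<psi> p \<ge> 0" "\<And>p. \<omega> p \<ge> 0"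
  shows "(\<integral>\<^sup>+p. ennreal (\<psi> p * \<omega> (\<tau> p)) \<partial>torus_measure) =
    (\<integral>\<^sup>+x\<in>half_open_cube. ennreal (torus_avg \<psi> x * \<omega> (to_torus x)) \<partial>lborel)"
proof -
  let ?Q = "half_open_cube :: (real ^ 'u) set"
  define \<Psi> where "\<Psi> x = ennreal (\<psi> (to_torus x) * \<omega> (\<tau> (to_torus x)))" for x
  have [measurable]: "\<Psi> \<in> borel_measurable borel" unfolding \<Psi>_def by measurable
  have per: "lattice_periodic \<Psi>"
  proof -
    have "to_torus (x + l) = to_torus x" if "l \<in> integer_lattice" for x l :: "real ^ 'u"
      using that by (simp add: to_torus_eq_iff)
    then show ?thesis by (simp add: lattice_periodic_def \<Psi>_def)
  qed
  have N0: "real (card D) > 0" using card_D_pos by simp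
  have eq: "(\<Sum>d\<in>D. \<Psi> (Gi (x + d))) = of_nat (card D) * ennreal (torus_avg \<psi> x * \<omega> (to_torus x))" for x
  proof -
    have "\<omega> (\<tau> (to_torus (Gi (x + d)))) = \<omega> (to_torus x)" if "d \<in> D" for d
    proof -
      have "to_torus (x + d) = to_torus x" using that by (simp add: to_torus_eq_iff coset_reps_def)
      then show ?thesis by (simp add: \<tau>)
    qed
    then have "(\<Sum>d\<in>D. \<Psi> (Gi (x + d))) = (\<Sum>d\<in>D. ennreal (\<psi> (to_torus (Gi (x + d))) * \<omega> (to_torus x)))"
      by (intro sum.cong) (simp_all add: \<Psi>_def)
    also have "\<dots> = ennreal (\<Sum>d\<in>D. \<psi> (to_torus (Gi (x + d))) * \<omega> (to_torus x))"
      by (rule sum_ennreal) (simp add: pos)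
    also have "(\<Sum>d\<in>D. \<psi> (to_torus (Gi (x + d))) * \<omega> (to_torus x)) = real (card D) * (torus_avg \<psi> x * \<omega> (to_torus x))"
      using N0 by (simp add: torus_avg_def sum_distrib_right)
    also have "ennreal \<dots> = ennreal (real (card D)) * ennreal (torus_avg \<psi> x * \<omega> (to_torus x))"
      by (rule ennreal_mult') simp
    finally show ?thesis by (simp only: ennreal_of_nat_eq_real_of_nat)
  qed
  have [measurable]: "torus_avg \<psi> \<in> borel_measurable borel" unfolding torus_avg_def by measurable
  have "of_nat (card D) * (\<integral>\<^sup>+p. ennreal (\<psi> p * \<omega> (\<tau> p)) \<partial>torus_measure) = of_nat (card D) * (\<integral>\<^sup>+x\<in>?Q. \<Psi> x \<partial>lborel)"
    by (simp add: nn_integral_torus \<Psi>_def)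
  also have "\<dots> = (\<integral>\<^sup>+x\<in>?Q. (\<Sum>d\<in>D. \<Psi> (Gi (x + d))) \<partial>lborel)"
    by (rule nn_integral_sum_coset_reps[symmetric, OF per]) measurable
  also have "\<dots> = of_nat (card D) * (\<integral>\<^sup>+x\<in>?Q. ennreal (torus_avg \<psi> x * \<omega> (to_torus x)) \<partial>lborel)"
    unfolding eq mult.assoc by (rule nn_integral_cmult) measurable
  finally have "of_nat (card D) * (\<integral>\<^sup>+p. ennreal (\<psi> p * \<omega> (\<tau> p)) \<partial>torus_measure) =
     of_nat (card D) * (\<integral>\<^sup>+x\<in>?Q. ennreal (torus_avg \<psi> x * \<omega> (to_torus x)) \<partial>lborel)" .
  then show ?thesis using card_D_pos by (subst (asm) ennreal_mult_cancel_left) auto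
qed

text \<open>
  The correlation of \<open>\<psi>\<close> with \<open>\<omega> \<circ> \<tau>\<close> equals the integral of \<open>\<omega>\<close> against the average of \<open>\<psi>\<close> over the
  preimages under \<open>\<tau>\<close>. If \<open>\<psi>\<close> oscillates by at most \<open>\<epsilon>\<close> on each inverse branch of the unit cube, that
  average is within \<open>\<epsilon>\<close> of the mean of \<open>\<psi>\<close>.
\<close>

lemma torus_decorrelation:
  fixes \<psi> \<omega> :: "'u torus \<Rightarrow> real"
  assumes m [measurable]: "\<psi> \<in> borel_measurable borel" "\<omega> \<in> borel_measurable borel" "\<tau> \<in> borel \<rightarrow>\<^sub>M borel"
    and \<tau>: "\<And>x. \<tau> (to_torus x) = to_torus (G x)" and pos: "\<And>p. \<psi> p \<ge> 0" "\<And>p. \<omega> p \<ge> 0"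
    and bd: "\<And>p. \<psi> p \<le> b" "\<And>p. \<omega> p \<le> b"
    and osc: "\<And>x x' d. x \<in> half_open_cube \<Longrightarrow> x' \<in> half_open_cube \<Longrightarrow>
       \<bar>\<psi> (to_torus (Gi (x + d))) - \<psi> (to_torus (Gi (x' + d)))\<bar> \<le> \<epsilon>"
  shows "\<bar>(\<integral>p. \<psi> p * \<omega> (\<tau> p) \<partial>torus_measure) - (\<integral>p. \<psi> p \<partial>torus_measure) * (\<integral>p. \<omega> p \<partial>torus_measure)\<bar> \<le> \<epsilon> * b"
proof -
  let ?Q = "half_open_cube :: (real ^ 'u) set"
  define m where "m = (\<integral>p. \<psi> p \<partial>torus_measure)"
  define c where "c = (\<integral>p. \<omega> p \<partial>torus_measure)"
  have b0: "b \<ge> 0" using pos(1) bd(1) order_trans by blast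
  have N0: "real (card D) > 0" using card_D_pos by simp
  have "(0::real ^ 'u) \<in> ?Q" by (simp add: half_open_cube_def)
  from osc[OF this this, of 0] have \<epsilon>: "\<epsilon> \<ge> 0" by simp
  have int: "integrable torus_measure \<psi>" "integrable torus_measure \<omega>" "integrable torus_measure (\<lambda>p. \<psi> p * \<omega> (\<tau> p))"
  proof -
    show "integrable torus_measure \<psi>" "integrable torus_measure \<omega>"
      using pos bd by (auto intro!: torus_prob.integrable_const_bound[where B = b])
    show "integrable torus_measure (\<lambda>p. \<psi> p * \<omega> (\<tau> p))"
      using pos bd b0 by (intro torus_prob.integrable_const_bound[where B = "b * b"] AE_I2) (auto simp: abs_mult intro!: mult_mono)
  qed
  have avg_pos: "torus_avg \<psi> x \<ge> 0" for x by (simp add: torus_avg_def sum_nonneg pos)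
  have [measurable]: "torus_avg \<psi> \<in> borel_measurable borel" unfolding torus_avg_def by measurable
  have avg_osc: "torus_avg \<psi> x \<le> torus_avg \<psi> x' + \<epsilon>" if "x \<in> ?Q" "x' \<in> ?Q" for x x'
  proof -
    have "(\<Sum>d\<in>D. \<psi> (to_torus (Gi (x + d)))) \<le> (\<Sum>d\<in>D. \<psi> (to_torus (Gi (x' + d))) + \<epsilon>)"
      using osc[OF that] by (intro sum_mono) (smt (verit))
    then have "(\<Sum>d\<in>D. \<psi> (to_torus (Gi (x + d)))) / card D \<le> ((\<Sum>d\<in>D. \<psi> (to_torus (Gi (x' + d)))) + card D * \<epsilon>) / card D"
      by (intro divide_right_mono) (auto simp: sum.distrib)
    then show ?thesis using N0 by (simp add: torus_avg_def add_divide_distrib)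
  qed
  have em: "(\<integral>\<^sup>+x\<in>?Q. ennreal (torus_avg \<psi> x) \<partial>lborel) = ennreal m"
  proof -
    have "ennreal m = (\<integral>\<^sup>+p. ennreal (\<psi> p) \<partial>torus_measure)"
      unfolding m_def using int(1) pos by (intro nn_integral_eq_integral[symmetric]) auto
    also have "\<dots> = (\<integral>\<^sup>+x\<in>?Q. ennreal (torus_avg \<psi> x) \<partial>lborel)"
      using torus_correlation_eq[of \<psi> "\<lambda>_. 1" \<tau>] \<tau> pos by simp
    finally show ?thesis ..
  qed
  have m0: "m \<ge> 0" "c \<ge> 0" unfolding m_def c_def using pos by simp_all
  have cb: "c \<le> b"
  proof -
    have "c \<le> (\<integral>p. b \<partial>(torus_measure :: 'u torus measure))"
      unfolding c_def using int bd by (intro integral_mono) auto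
    then show ?thesis by (simp add: torus_prob.prob_space[unfolded space_torus_measure])
  qed
  have up: "torus_avg \<psi> x \<le> m + \<epsilon>" if x: "x \<in> ?Q" for x
  proof -
    have "ennreal (torus_avg \<psi> x) = (\<integral>\<^sup>+x'\<in>?Q. ennreal (torus_avg \<psi> x) \<partial>lborel)"
      by (simp add: nn_integral_cmult_indicator emeasure_half_open_cube)
    also have "\<dots> \<le> (\<integral>\<^sup>+x'. ennreal (torus_avg \<psi> x') * indicator ?Q x' + ennreal \<epsilon> * indicator ?Q x' \<partial>lborel)"
      using avg_osc[OF x] \<epsilon> avg_pos
      by (intro nn_integral_mono) (auto simp: indicator_def ennreal_plus[symmetric] ennreal_leI simp del: ennreal_plus)
    also have "\<dots> = ennreal m + ennreal \<epsilon>"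
      by (simp add: nn_integral_add em nn_integral_cmult_indicator emeasure_half_open_cube)
    finally show ?thesis using m0 \<epsilon> by (simp add: ennreal_plus[symmetric] del: ennreal_plus)
  qed
  have lo: "m \<le> torus_avg \<psi> x + \<epsilon>" if x: "x \<in> ?Q" for x
  proof -
    have "ennreal m \<le> (\<integral>\<^sup>+x'. ennreal (torus_avg \<psi> x + \<epsilon>) * indicator ?Q x' \<partial>lborel)"
      unfolding em[symmetric] using avg_osc[OF _ x] by (intro nn_integral_mono) (auto simp: indicator_def intro!: ennreal_leI)
    also have "\<dots> = ennreal (torus_avg \<psi> x + \<epsilon>)"
      by (simp add: nn_integral_cmult_indicator emeasure_half_open_cube)
    finally show ?thesis using avg_pos[of x] \<epsilon> by (simp del: ennreal_plus)
  qed
  define I where "I = (\<integral>p. \<psi> p * \<omega> (\<tau> p) \<partial>torus_measure)"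
  have I0: "I \<ge> 0" unfolding I_def using pos by simp
  have eI: "ennreal I = (\<integral>\<^sup>+x\<in>?Q. ennreal (torus_avg \<psi> x * \<omega> (to_torus x)) \<partial>lborel)"
  proof -
    have "ennreal I = (\<integral>\<^sup>+p. ennreal (\<psi> p * \<omega> (\<tau> p)) \<partial>torus_measure)"
      unfolding I_def using int(3) pos by (intro nn_integral_eq_integral[symmetric]) auto
    also have "\<dots> = (\<integral>\<^sup>+x\<in>?Q. ennreal (torus_avg \<psi> x * \<omega> (to_torus x)) \<partial>lborel)"
      by (rule torus_correlation_eq) (use \<tau> pos in auto)
    finally show ?thesis .
  qed
  have ec: "(\<integral>\<^sup>+x\<in>?Q. ennreal (\<omega> (to_torus x)) \<partial>lborel) = ennreal c"
  proof -
    have "ennreal c = (\<integral>\<^sup>+p. ennreal (\<omega> p) \<partial>torus_measure)"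
      unfolding c_def using int(2) pos by (intro nn_integral_eq_integral[symmetric]) auto
    then show ?thesis by (simp add: nn_integral_torus)
  qed
  have "ennreal I \<le> (\<integral>\<^sup>+x. ennreal (m + \<epsilon>) * (ennreal (\<omega> (to_torus x)) * indicator ?Q x) \<partial>lborel)"
    unfolding eI using up pos m0 \<epsilon>
    by (intro nn_integral_mono) (auto simp: indicator_def ennreal_mult[symmetric] simp del: ennreal_plus intro!: ennreal_leI mult_right_mono)
  also have "\<dots> = ennreal ((m + \<epsilon>) * c)"
    using m0 \<epsilon> by (simp add: nn_integral_cmult ec ennreal_mult del: ennreal_plus)
  finally have 1: "I \<le> (m + \<epsilon>) * c" using m0 \<epsilon> by (simp add: mult_nonneg_nonneg)
  have "ennreal (m * c) = (\<integral>\<^sup>+x. ennreal m * (ennreal (\<omega> (to_torus x)) * indicator ?Q x) \<partial>lborel)"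
    using m0 by (simp add: nn_integral_cmult ec ennreal_mult)
  also have "\<dots> \<le> (\<integral>\<^sup>+x. ennreal (torus_avg \<psi> x * \<omega> (to_torus x)) * indicator ?Q x + ennreal \<epsilon> * (ennreal (\<omega> (to_torus x)) * indicator ?Q x) \<partial>lborel)"
  proof (rule nn_integral_mono)
    fix x
    have "ennreal m * ennreal (\<omega> (to_torus x)) \<le> ennreal (torus_avg \<psi> x * \<omega> (to_torus x)) + ennreal \<epsilon> * ennreal (\<omega> (to_torus x))" if "x \<in> ?Q"
    proof -
      have "m * \<omega> (to_torus x) \<le> torus_avg \<psi> x * \<omega> (to_torus x) + \<epsilon> * \<omega> (to_torus x)"
        using mult_right_mono[OF lo[OF that] pos(2)[of "to_torus x"]] by (simp add: distrib_right)
      then show ?thesis using m0 \<epsilon> pos avg_pos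
        by (simp add: ennreal_mult[symmetric] ennreal_plus[symmetric] ennreal_leI del: ennreal_plus)
    qed
    then show "ennreal m * (ennreal (\<omega> (to_torus x)) * indicator ?Q x) \<le> ennreal (torus_avg \<psi> x * \<omega> (to_torus x)) * indicator ?Q x + ennreal \<epsilon> * (ennreal (\<omega> (to_torus x)) * indicator ?Q x)"
      by (auto simp: indicator_def)
  qed
  also have "\<dots> = ennreal I + ennreal \<epsilon> * ennreal c"
    by (simp add: nn_integral_add nn_integral_cmult ec eI)
  finally have 2: "m * c \<le> I + \<epsilon> * c"
    using m0 \<epsilon> I0 by (simp add: ennreal_mult[symmetric] ennreal_plus[symmetric] del: ennreal_plus)
  have "\<epsilon> * c \<le> \<epsilon> * b" using \<epsilon> cb by (rule mult_left_mono[rotated])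
  with 1 2 show ?thesis unfolding I_def[symmetric] m_def[symmetric] c_def[symmetric] by (simp add: algebra_simps abs_le_iff)
qed

end

section \<open>Orbit averages of skew products\<close>

lemma to_torus_add_lattice: "l \<in> integer_lattice \<Longrightarrow> to_torus (x + l) = to_torus x"
  by (simp add: to_torus_eq_iff)

text \<open>
  The torus has the quotient topology, so continuity may be checked on lifts.
\<close>

lemma continuous_on_torusI:
  fixes \<psi> :: "'n::finite torus \<Rightarrow> 'c::topological_space"
  assumes "continuous_on UNIV (\<lambda>x. \<psi> (to_torus x))"
  shows "continuous_on UNIV \<psi>"
proof -
  have "open (\<psi> -` U)" if "open U" for U
  proof -
    have "open ((\<lambda>x. \<psi> (to_torus x)) -` U)" by (rule open_vimage[OF that assms])
    then show ?thesis by (simp add: open_torus_def vimage_def)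
  qed
  then show ?thesis by (simp add: continuous_on_open_vimage)
qed

text \<open>
  The product of the quotient map with the identity is an open surjection, so continuity may again be
  checked on lifts.
\<close>

lemma continuous_on_torus_prodI:
  fixes \<phi> :: "'n::finite torus \<times> 'b::topological_space \<Rightarrow> 'c::topological_space"
  assumes "continuous_on UNIV (\<lambda>p. \<phi> (to_torus (fst p), snd p))"
  shows "continuous_on UNIV \<phi>"
proof -
  have "open (\<phi> -` U)" if "open U" for U
  proof (rule open_prod_intro)
    fix z assume z: "z \<in> \<phi> -` U"
    let ?W = "(\<lambda>p. \<phi> (to_torus (fst p), snd p)) -` U"
    have W: "open ?W" by (rule open_vimage[OF that assms])
    have "(rep_torus (fst z), snd z) \<in> ?W" using z by simp
    then obtain A B where AB: "open A" "open B" "(rep_torus (fst z), snd z) \<in> A \<times> B" "A \<times> B \<subseteq> ?W"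
      by (rule open_prod_elim[OF W])
    have "z \<in> to_torus ` A \<times> B"
      using AB(3) by (auto simp: mem_Times_iff intro: image_eqI[where x = "rep_torus (fst z)"])
    moreover have "to_torus ` A \<times> B \<subseteq> \<phi> -` U" using AB(4) by auto
    ultimately show "\<exists>A B. open A \<and> open B \<and> z \<in> A \<times> B \<and> A \<times> B \<subseteq> \<phi> -` U"
      using AB(1,2) open_to_torus_image by blast
  qed
  then show ?thesis by (simp add: continuous_on_open_vimage)
qed

text \<open>
  Bounded functions whose lifts are Lipschitz. They are stable under composition with the skew
  product and rich enough to determine measures and weak convergence.
\<close>

definition lip_test :: "('u::finite torus \<times> (real ^ 'd) \<Rightarrow> real) \<Rightarrow> bool" where
  "lip_test \<phi> \<longleftrightarrow> (\<exists>b. \<forall>z. \<bar>\<phi> z\<bar> \<le> b) \<and>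
     (\<exists>L\<ge>0. \<forall>x x' y y'. \<bar>\<phi> (to_torus x, y) - \<phi> (to_torus x', y')\<bar> \<le> L * (norm (x - x') + norm (y - y')))"

lemma lip_testE:
  assumes "lip_test \<phi>"
  obtains b L where "b \<ge> 0" "L \<ge> 0" "\<And>z. \<bar>\<phi> z\<bar> \<le> b"
    "\<And>x x' y y'. \<bar>\<phi> (to_torus x, y) - \<phi> (to_torus x', y')\<bar> \<le> L * (norm (x - x') + norm (y - y'))"
    "\<And>p y y'. \<bar>\<phi> (p, y) - \<phi> (p, y')\<bar> \<le> L * norm (y - y')"
proof -
  obtain b L where b: "\<And>z. \<bar>\<phi> z\<bar> \<le> b" and L: "L \<ge> 0"
    "\<And>x x' y y'. \<bar>\<phi> (to_torus x, y) - \<phi> (to_torus x', y')\<bar> \<le> L * (norm (x - x') + norm (y - y'))"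
    using assms by (auto simp: lip_test_def)
  have "b \<ge> 0" using order_trans[OF abs_ge_zero b] .
  moreover have "\<bar>\<phi> (p, y) - \<phi> (p, y')\<bar> \<le> L * norm (y - y')" for p y y'
    using L(2)[of "rep_torus p" y "rep_torus p" y'] by simp
  ultimately show ?thesis using b L that by blast
qed

lemma lip_test_continuous:
  assumes "lip_test \<phi>"
  shows "continuous_on UNIV \<phi>"
proof (rule continuous_on_torus_prodI)
  from assms obtain b L where L: "L \<ge> 0"
    "\<And>x x' y y'. \<bar>\<phi> (to_torus x, y) - \<phi> (to_torus x', y')\<bar> \<le> L * (norm (x - x') + norm (y - y'))"
    by (rule lip_testE) blast
  have "(2 * L)-lipschitz_on UNIV (\<lambda>p. \<phi> (to_torus (fst p), snd p))"
  proof (rule lipschitz_onI)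
    fix p q :: "(real ^ 'a) \<times> (real ^ 'b)"
    have "dist (\<phi> (to_torus (fst p), snd p)) (\<phi> (to_torus (fst q), snd q)) \<le> L * (dist (fst p) (fst q) + dist (snd p) (snd q))"
      using L(2) by (simp add: dist_norm)
    also have "\<dots> \<le> L * (2 * dist p q)"
      using dist_fst_le[of p q] dist_snd_le[of p q] L(1) by (intro mult_left_mono) auto
    finally show "dist (\<phi> (to_torus (fst p), snd p)) (\<phi> (to_torus (fst q), snd q)) \<le> 2 * L * dist p q" by simp
  qed (use L in simp)
  then show "continuous_on UNIV (\<lambda>p. \<phi> (to_torus (fst p), snd p))" by (rule lipschitz_on_continuous_on)
qed

lemma lip_test_measurable: "lip_test \<phi> \<Longrightarrow> \<phi> \<in> borel_measurable borel"
  by (intro borel_measurable_continuous_onI lip_test_continuous)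

definition initial_measure :: "('u::finite torus \<times> (real ^ 'd)) measure" where
  "initial_measure = torus_measure \<Otimes>\<^sub>M uniform_measure lborel (box 0 One)"

lemma prob_space_uniform_box: "prob_space (uniform_measure lborel (box (0::real^'d) One))"
  by (rule prob_space_uniform_measure) (simp_all add: emeasure_lborel_box)

lemma prob_space_initial: "prob_space (initial_measure :: ('u::finite torus \<times> (real ^ 'd)) measure)"
proof -
  interpret A: prob_space "torus_measure :: 'u torus measure" by (rule prob_space_torus_measure)
  interpret B: prob_space "uniform_measure lborel (box (0::real^'d) One)" by (rule prob_space_uniform_box)
  interpret pair_prob_space "torus_measure :: 'u torus measure" "uniform_measure lborel (box (0::real^'d) One)" ..
  show ?thesis unfolding initial_measure_def by unfold_locales
qed

lemma sets_initial [measurable_cong]: "sets (initial_measure :: ('u::finite torus \<times> (real ^ 'd)) measure) = sets borel"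
proof -
  have "sets (initial_measure :: ('u torus \<times> (real ^ 'd)) measure) =
      sets (borel \<Otimes>\<^sub>M borel :: ('u torus \<times> (real ^ 'd)) measure)"
    unfolding initial_measure_def by (intro sets_pair_measure_cong) simp_all
  then show ?thesis by (simp only: borel_prod)
qed

lemma AE_initial_bound:
  "AE z in (initial_measure :: ('u::finite torus \<times> (real ^ 'd)) measure). norm (snd z) \<le> CARD('d)"
proof -
  let ?U = "uniform_measure lborel (box (0::real^'d) One)"
  let ?I = "initial_measure :: ('u torus \<times> (real ^ 'd)) measure"
  interpret U: prob_space ?U by (rule prob_space_uniform_box)
  interpret I: prob_space ?I by (rule prob_space_initial)
  have "emeasure ?U (box 0 One) = 1"
    by (simp add: emeasure_uniform_measure emeasure_lborel_box)
  then have "emeasure ?I (UNIV \<times> box 0 One) = 1"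
    unfolding initial_measure_def
    using torus_prob.emeasure_space_1[where 'n = 'u]
    by (subst U.emeasure_pair_measure_Times) simp_all
  then have "I.prob (UNIV \<times> box 0 One) = 1" by (simp add: measure_def)
  from I.AE_prob_1[OF this] show ?thesis
  proof (rule AE_mp, intro AE_I2 impI)
    fix z :: "'u torus \<times> (real ^ 'd)" assume "z \<in> UNIV \<times> box 0 One"
    then have "\<And>i. i \<in> Basis \<Longrightarrow> \<bar>snd z \<bullet> i\<bar> \<le> 1" by (auto simp: mem_Times_iff mem_box)
    then have "(\<Sum>i\<in>Basis. \<bar>snd z \<bullet> i\<bar>) \<le> (\<Sum>i\<in>(Basis :: (real^'d) set). 1)" by (intro sum_mono)
    with norm_le_l1[of "snd z"] show "norm (snd z) \<le> CARD('d)" by simp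
  qed
qed

lemma matrix_iterate_linear: "linear (((*v) A) ^^ k)" for A :: "real ^ 'n ^ 'n"
proof (induction k)
  case (Suc k)
  then have "linear ((*v) A \<circ> ((*v) A) ^^ k)" by (rule linear_compose) (rule matrix_vector_mul_linear)
  then show ?case by (simp only: funpow.simps)
qed (simp only: funpow.simps linear_id)

lemma matrix_inverse_apply:
  fixes A :: "real ^ 'n ^ 'n"
  assumes "invertible A"
  shows "A *v (matrix_inv A *v x) = x" "matrix_inv A *v (A *v x) = x"
proof -
  have "A ** matrix_inv A = mat 1 \<and> matrix_inv A ** A = mat 1"
    using assms unfolding invertible_def matrix_inv_def by (rule someI_ex)
  then show "A *v (matrix_inv A *v x) = x" "matrix_inv A *v (A *v x) = x"
    by (simp_all add: matrix_vector_mul_assoc)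
qed

lemma funpow_inverse:
  fixes g h :: "'a \<Rightarrow> 'a"
  assumes "\<And>x. g (h x) = x"
  shows "(g ^^ k) ((h ^^ k) x) = x"
proof (induction k arbitrary: x)
  case (Suc k)
  have "(g ^^ Suc k) ((h ^^ Suc k) x) = (g ^^ k) (g (h ((h ^^ k) x)))" by (simp add: funpow_swap1)
  then show ?case by (simp only: assms Suc)
qed simp

text \<open>
  The skew product with explicit constants: \<open>\<kappa>\<close> and \<open>lam\<close> are rates of contraction of the inverse of \<open>E\<close> and
  of \<open>C\<close>, \<open>Lf\<close> is a Lipschitz constant and \<open>bf\<close> a bound of \<open>f\<close>.
\<close>

locale skew_system =
  fixes E :: "real ^ 'u ^ 'u" and C :: "real ^ 'd ^ 'd" and f :: "'u torus \<Rightarrow> real ^ 'd"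
    and \<kappa> lam Lf bf :: real
  assumes expanding_E: "expanding E"
    and \<kappa>: "0 \<le> \<kappa>" "\<kappa> < 1" "\<And>x. norm (matrix_inv E *v x) \<le> \<kappa> * norm x"
    and lam: "0 \<le> lam" "lam < 1" "\<And>y. norm (C *v y) \<le> lam * norm y"
    and bf: "\<And>p. norm (f p) \<le> bf"
    and Lf: "0 \<le> Lf" "\<And>x x'. norm (lift f x - lift f x') \<le> Lf * norm (x - x')"
begin

abbreviation "T \<equiv> skew_map E C f"
abbreviation "tm \<equiv> torus_map E"
abbreviation "Ek k \<equiv> ((*v) E) ^^ k"
abbreviation "Eik k \<equiv> ((*v) (matrix_inv E)) ^^ k"

lemma E_lattice: "(*v) E ` integer_lattice \<subseteq> integer_lattice"
  using expanding_E by (simp add: expanding_def)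

lemma E_inv: "E *v (matrix_inv E *v x) = x" "matrix_inv E *v (E *v x) = x"
  using matrix_inverse_apply[of E] expanding_E by (simp_all add: expanding_def)

lemma Ek_Eik: "Ek k (Eik k x) = x" "Eik k (Ek k x) = x"
  by (simp_all add: funpow_inverse E_inv)

lemma Ek_lattice: "l \<in> integer_lattice \<Longrightarrow> Ek k l \<in> integer_lattice"
  by (induction k) (use E_lattice in auto)

sublocale iter: lattice_map "Ek k" "Eik k" for k
  by (intro lattice_map.intro matrix_iterate_linear Ek_Eik Ek_lattice)

lemma Eik_norm: "norm (Eik k x) \<le> \<kappa> ^ k * norm x"
proof (induction k)
  case (Suc k)
  have "norm (Eik (Suc k) x) \<le> \<kappa> * norm (Eik k x)" using \<kappa>(3) by simp
  also have "\<dots> \<le> \<kappa> * (\<kappa> ^ k * norm x)" using Suc \<kappa>(1) by (rule mult_left_mono)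
  finally show ?case by simp
qed simp

lemma tm_to_torus: "(tm ^^ k) (to_torus x) = to_torus (Ek k x)"
  by (induction k) (simp_all add: torus_map_to_torus[OF E_lattice])

lemma tm_measurable [measurable]: "tm \<in> borel \<rightarrow>\<^sub>M borel"
proof (rule borel_measurable_continuous_onI, rule continuous_on_torusI)
  have "continuous_on UNIV (\<lambda>x. to_torus (E *v x))"
    by (rule continuous_on_compose2[OF continuous_on_to_torus linear_continuous_on[OF matrix_vector_mul_bounded_linear]]) simp
  then show "continuous_on UNIV (\<lambda>x. tm (to_torus x))" by (simp add: torus_map_to_torus[OF E_lattice])
qed

lemma f_continuous: "continuous_on UNIV (lift f)"
  by (rule lipschitz_on_continuous_on[of Lf]) (auto intro!: lipschitz_onI simp: dist_norm Lf)

lemma T_continuous: "continuous_on UNIV T"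
proof (rule continuous_on_torus_prodI)
  have mv: "continuous_on UNIV (\<lambda>p. A *v s p)" if "continuous_on UNIV s"
    for A :: "real ^ 'n::finite ^ 'm::finite" and s :: "(real^'u) \<times> (real^'d) \<Rightarrow> real ^ 'n"
    by (rule bounded_linear.continuous_on[OF matrix_vector_mul_bounded_linear that])
  have eq: "T (to_torus (fst p), snd p) = (to_torus (E *v fst p), C *v snd p + lift f (fst p))" for p
    by (simp add: skew_map_def torus_map_to_torus[OF E_lattice] lift_def)
  show "continuous_on UNIV (\<lambda>p. T (to_torus (fst p), snd p))"
    unfolding eq
  proof (intro continuous_on_Pair continuous_on_add)
    show "continuous_on UNIV (\<lambda>p :: (real^'u) \<times> (real^'d). to_torus (E *v fst p))"
      by (rule continuous_on_compose2[OF continuous_on_to_torus mv]) (simp_all add: continuous_on_fst)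
    show "continuous_on UNIV (\<lambda>p :: (real^'u) \<times> (real^'d). C *v snd p)"
      by (rule mv) (simp add: continuous_on_snd)
    show "continuous_on UNIV (\<lambda>p :: (real^'u) \<times> (real^'d). lift f (fst p))"
      by (rule continuous_on_compose2[OF f_continuous]) (simp_all add: continuous_on_fst)
  qed
qed

lemma T_measurable [measurable]: "T \<in> borel \<rightarrow>\<^sub>M borel"
  by (rule borel_measurable_continuous_onI[OF T_continuous])

lemma T_iterate_measurable [measurable]: "(T ^^ n) \<in> borel \<rightarrow>\<^sub>M borel"
  by measurable

lemma T_eq: "T z = (tm (fst z), C *v snd z + f (fst z))"
  by (simp add: skew_map_def split_beta)

lemma fst_T: "fst ((T ^^ k) z) = (tm ^^ k) (fst z)"
  by (induction k) (simp_all add: T_eq)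

lemma snd_T_diff: "norm (snd ((T ^^ k) (p, y)) - snd ((T ^^ k) (p, y'))) \<le> lam ^ k * norm (y - y')"
proof (induction k)
  case (Suc k)
  have "snd ((T ^^ Suc k) (p, y)) - snd ((T ^^ Suc k) (p, y')) = C *v (snd ((T ^^ k) (p, y)) - snd ((T ^^ k) (p, y')))"
    by (simp add: T_eq fst_T matrix_vector_mult_diff_distrib)
  then have "norm (snd ((T ^^ Suc k) (p, y)) - snd ((T ^^ Suc k) (p, y'))) \<le> lam * norm (snd ((T ^^ k) (p, y)) - snd ((T ^^ k) (p, y')))"
    using lam(3) by simp
  also have "\<dots> \<le> lam * (lam ^ k * norm (y - y'))" using Suc lam(1) by (rule mult_left_mono)
  finally show ?case by simp
qed simp

text \<open>
  The radius of the ball in the fibre that absorbs all orbits.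
\<close>

definition R0 :: real where "R0 = bf / (1 - lam)"

lemma bf0: "bf \<ge> 0" using order_trans[OF norm_ge_zero bf] .

lemma R0: "R0 \<ge> 0" "lam * R0 + bf = R0"
  using bf0 lam(2) by (simp_all add: R0_def field_simps)

lemma snd_T_bound: "norm (snd ((T ^^ k) z)) \<le> norm (snd z) + R0"
proof (induction k)
  case (Suc k)
  have "norm (snd ((T ^^ Suc k) z)) \<le> norm (C *v snd ((T ^^ k) z)) + norm (f (fst ((T ^^ k) z)))"
    by (simp add: T_eq norm_triangle_ineq)
  also have "\<dots> \<le> lam * norm (snd ((T ^^ k) z)) + bf" by (intro add_mono lam bf)
  also have "\<dots> \<le> lam * (norm (snd z) + R0) + bf" by (intro add_right_mono mult_left_mono Suc lam)
  also have "\<dots> = lam * norm (snd z) + R0" using R0(2) by (simp add: algebra_simps)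
  also have "lam * norm (snd z) \<le> 1 * norm (snd z)" using lam by (intro mult_right_mono) auto
  finally show ?case by simp
qed (simp add: R0)

lemma lip_test_T: "lip_test \<phi> \<Longrightarrow> lip_test (\<lambda>z. \<phi> (T z))"
proof -
  assume "lip_test \<phi>"
  then obtain b L where b: "\<And>z. \<bar>\<phi> z\<bar> \<le> b" and L: "L \<ge> 0"
    "\<And>x x' y y'. \<bar>\<phi> (to_torus x, y) - \<phi> (to_torus x', y')\<bar> \<le> L * (norm (x - x') + norm (y - y'))"
    by (rule lip_testE) blast
  obtain K where K: "K > 0" "\<And>x. norm (E *v x) \<le> norm x * K"
    using bounded_linear.pos_bounded[of "(*v) E"] by (auto simp: linear_conv_bounded_linear[symmetric])
  have "\<bar>\<phi> (T (to_torus x, y)) - \<phi> (T (to_torus x', y'))\<bar> \<le> (L * (K + Lf + 1)) * (norm (x - x') + norm (y - y'))" for x x' y y'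
  proof -
    have "\<bar>\<phi> (T (to_torus x, y)) - \<phi> (T (to_torus x', y'))\<bar> \<le>
        L * (norm (E *v x - E *v x') + norm ((C *v y + lift f x) - (C *v y' + lift f x')))"
      using L(2) by (simp add: T_eq torus_map_to_torus[OF E_lattice] lift_def)
    also have "\<dots> \<le> L * ((K + Lf + 1) * (norm (x - x') + norm (y - y')))"
    proof (rule mult_left_mono[OF _ L(1)])
      have "norm (E *v x - E *v x') \<le> K * norm (x - x')"
        using K(2)[of "x - x'"] by (simp add: matrix_vector_mult_diff_distrib mult.commute)
      moreover have "norm ((C *v y + lift f x) - (C *v y' + lift f x')) \<le> norm (C *v (y - y')) + norm (lift f x - lift f x')"
        by (metis add_diff_add matrix_vector_mult_diff_distrib norm_triangle_ineq)
      moreover have "norm (C *v (y - y')) \<le> 1 * norm (y - y')"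
        using lam by (intro order_trans[OF lam(3)] mult_right_mono) auto
      moreover have "norm (lift f x - lift f x') \<le> Lf * norm (x - x')" by (rule Lf)
      moreover have "(K + Lf + 1) * (norm (x - x') + norm (y - y')) = K * norm (x - x') + Lf * norm (x - x') + norm (x - x')
          + K * norm (y - y') + Lf * norm (y - y') + norm (y - y')" by (simp only: distrib_left distrib_right mult_1)
      moreover have "0 \<le> norm (x - x')" "0 \<le> K * norm (y - y')" "0 \<le> Lf * norm (y - y')" using K(1) Lf(1) by simp_all
      ultimately show "norm (E *v x - E *v x') + norm ((C *v y + lift f x) - (C *v y' + lift f x')) \<le>
         (K + Lf + 1) * (norm (x - x') + norm (y - y'))" by linarith
    qed
    finally show ?thesis by (simp add: mult.assoc)
  qed
  moreover have "L * (K + Lf + 1) \<ge> 0" using L K Lf by simp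
  ultimately show ?thesis using b unfolding lip_test_def by blast
qed

lemma lip_test_T_iterate: "lip_test \<phi> \<Longrightarrow> lip_test (\<lambda>z. \<phi> ((T ^^ n) z))"
proof (induction n arbitrary: \<phi>)
  case (Suc n)
  from Suc.IH[OF lip_test_T[OF Suc.prems]] show ?case by simp
qed simp

text \<open>
  The inverse branches of the \<open>k\<close>-th power of \<open>E\<close> contract by \<open>\<kappa>\<close> to the power \<open>k\<close>, so \<open>torus_decorrelation\<close>
  yields exponential decay of correlations. The constant \<open>b\<close> is added first because that lemma is about
  nonnegative functions.
\<close>

lemma torus_lln:
  fixes \<psi> :: "'u torus \<Rightarrow> real"
  assumes b: "\<And>p. \<bar>\<psi> p\<bar> \<le> b" and L: "\<And>x x'. \<bar>\<psi> (to_torus x) - \<psi> (to_torus x')\<bar> \<le> L * norm (x - x')" "L \<ge> 0"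
    and m [measurable]: "\<psi> \<in> borel_measurable borel"
  shows "AE p in torus_measure. (\<lambda>n. (\<Sum>k<n. \<psi> ((tm ^^ k) p)) / n) \<longlonglongrightarrow> (\<integral>p. \<psi> p \<partial>torus_measure)"
    and "(\<integral>p. \<psi> ((tm ^^ k) p) \<partial>torus_measure) = (\<integral>p. \<psi> p \<partial>torus_measure)"
proof -
  have b0: "b \<ge> 0" using order_trans[OF abs_ge_zero b] .
  define s where "s p = \<psi> p + b" for p
  have s: "s p \<ge> 0" "s p \<le> 2 * b" for p using b[of p] by (auto simp: s_def)
  have [measurable]: "s \<in> borel_measurable borel" unfolding s_def by measurable
  have int: "integrable torus_measure (\<lambda>p. h ((tm ^^ k) p))" if "h \<in> borel_measurable borel" "\<And>p. \<bar>h p\<bar> \<le> c" for h :: "'u torus \<Rightarrow> real" and c k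
    using that by (intro torus_prob.integrable_const_bound[where B = c]) (auto intro!: measurable_compose[OF _ that(1)])
  have ints: "integrable torus_measure (\<lambda>p. s ((tm ^^ k) p))" for k
    using s b0 by (intro int[where c = "2 * b"]) auto
  have int\<psi>: "integrable torus_measure (\<lambda>p. \<psi> ((tm ^^ k) p))" for k
    by (intro int[where c = b] b m)
  have sE: "(\<integral>p. s ((tm ^^ k) p) \<partial>torus_measure) = (\<integral>p. \<psi> ((tm ^^ k) p) \<partial>torus_measure) + b" for k
    unfolding s_def using int\<psi>[of k] by (simp add: torus_prob.prob_space[unfolded space_torus_measure])
  have inv: "(\<integral>p. h ((tm ^^ k) p) \<partial>torus_measure) = (\<integral>p. h p \<partial>torus_measure)"
    if "h \<in> borel_measurable borel" "\<And>p. h p \<ge> 0" "\<And>p. h p \<le> c" "c \<ge> 1" for h :: "'u torus \<Rightarrow> real" and c k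
    using iter.torus_decorrelation[of "\<lambda>_. 1" h "tm ^^ k" k c 0] that
    by (simp add: tm_to_torus torus_prob.prob_space[unfolded space_torus_measure])
  have invs: "(\<integral>p. s ((tm ^^ k) p) \<partial>torus_measure) = (\<integral>p. s p \<partial>torus_measure)" for k
    using s by (intro inv[where c = "2 * b + 1"]) (auto intro: order_trans[OF s(2)] simp: b0)
  from this[of k] sE[of k] sE[of 0] show "(\<integral>p. \<psi> ((tm ^^ k) p) \<partial>torus_measure) = (\<integral>p. \<psi> p \<partial>torus_measure)" by simp
  define c where "c = (\<integral>p. s p \<partial>torus_measure)"
  define X where "X k p = s ((tm ^^ k) p) - c" for k p
  have Xm: "X k \<in> borel_measurable torus_measure" for k unfolding X_def by measurable
  have c: "0 \<le> c" "c \<le> 2 * b"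
  proof -
    show "0 \<le> c" unfolding c_def by (simp add: s)
    have "c \<le> (\<integral>p. 2 * b \<partial>(torus_measure :: 'u torus measure))"
      unfolding c_def using ints[of 0] s by (intro integral_mono) auto
    then show "c \<le> 2 * b" by (simp add: torus_prob.prob_space[unfolded space_torus_measure])
  qed
  have Xb: "\<bar>X k p\<bar> \<le> 2 * b" for k p using s[of "(tm ^^ k) p"] c by (auto simp: X_def)
  define A where "A = L * (2 * CARD('u)) * (2 * b)"
  have corr: "\<bar>\<integral>p. X i p * X (i + k) p \<partial>torus_measure\<bar> \<le> A * \<kappa> ^ k" for i k
  proof -
    have osc: "\<bar>s (to_torus (Eik k (x + d))) - s (to_torus (Eik k (x' + d)))\<bar> \<le> L * (\<kappa> ^ k * (2 * CARD('u)))"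
      if "x \<in> half_open_cube" "x' \<in> half_open_cube" for x x' d
    proof -
      have "\<bar>s (to_torus (Eik k (x + d))) - s (to_torus (Eik k (x' + d)))\<bar> \<le> L * norm (Eik k (x + d) - Eik k (x' + d))"
        unfolding s_def using L(1) by simp
      also have "Eik k (x + d) - Eik k (x' + d) = Eik k (x - x')"
        by (simp add: linear_diff[OF iter.linear_Gi, symmetric])
      also have "norm (Eik k (x - x')) \<le> \<kappa> ^ k * norm (x - x')" by (rule Eik_norm)
      also have "norm (x - x') \<le> 2 * CARD('u)"
        using norm_triangle_ineq4[of x x'] norm_half_open_cube[OF that(1)] norm_half_open_cube[OF that(2)] by simp
      finally show ?thesis using L(2) \<kappa>(1) by (simp add: mult_left_mono)
    qed
    have ms: "s \<in> borel_measurable borel" and tmk: "tm ^^ k \<in> borel \<rightarrow>\<^sub>M borel" by measurable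
    have dec: "\<bar>(\<integral>p. s p * s ((tm ^^ k) p) \<partial>torus_measure) - c * c\<bar> \<le> L * (\<kappa> ^ k * (2 * CARD('u))) * (2 * b)"
      unfolding c_def
      by (rule iter.torus_decorrelation[OF ms ms tmk tm_to_torus s(1) s(1) s(2) s(2) osc])
    have [measurable]: "(\<lambda>p. s p * s ((tm ^^ k) p)) \<in> borel_measurable borel" by measurable
    have "(\<integral>p. s ((tm ^^ i) p) * s ((tm ^^ (i + k)) p) \<partial>torus_measure) = (\<integral>p. s p * s ((tm ^^ k) p) \<partial>torus_measure)"
    proof -
      have "(tm ^^ (i + k)) p = (tm ^^ k) ((tm ^^ i) p)" for p by (simp add: add.commute[of i] funpow_add)
      moreover have "s p * s ((tm ^^ k) p) \<le> 2 * b * (2 * b) + 1" for p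
      proof -
        have "s p * s ((tm ^^ k) p) \<le> 2 * b * (2 * b)" using s b0 by (intro mult_mono) auto
        then show ?thesis by simp
      qed
      ultimately show ?thesis
        using inv[of "\<lambda>p. s p * s ((tm ^^ k) p)" "2 * b * (2 * b) + 1" i] s b0 by simp
    qed
    moreover have "(\<integral>p. X i p * X (i + k) p \<partial>torus_measure) = (\<integral>p. s ((tm ^^ i) p) * s ((tm ^^ (i + k)) p) \<partial>torus_measure) - c * c"
    proof -
      have ii: "integrable torus_measure (\<lambda>p. s ((tm ^^ i) p) * s ((tm ^^ (i + k)) p))"
      proof (rule torus_prob.integrable_const_bound[where B = "2 * b * (2 * b)"], rule AE_I2)
        fix p
        have "s ((tm ^^ i) p) * s ((tm ^^ (i + k)) p) \<le> 2 * b * (2 * b)" using s b0 by (intro mult_mono) auto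
        then show "norm (s ((tm ^^ i) p) * s ((tm ^^ (i + k)) p)) \<le> 2 * b * (2 * b)"
          using s by (simp only: real_norm_def abs_mult abs_of_nonneg)
      qed measurable
      have "X i p * X (i + k) p = s ((tm ^^ i) p) * s ((tm ^^ (i + k)) p) - c * s ((tm ^^ i) p) - c * s ((tm ^^ (i + k)) p) + c * c" for p
        by (simp add: X_def algebra_simps)
      then have "(\<integral>p. X i p * X (i + k) p \<partial>torus_measure) = (\<integral>p. s ((tm ^^ i) p) * s ((tm ^^ (i + k)) p) \<partial>torus_measure) - c * c - c * c + c * c"
        using ii ints[of i] ints[of "i + k"]
        by (simp add: invs c_def[symmetric] torus_prob.prob_space[unfolded space_torus_measure])
      then show ?thesis by simp
    qed
    ultimately show ?thesis using dec by (simp add: A_def mult_ac)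
  qed
  have "AE p in torus_measure. (\<lambda>n. (\<Sum>k<n. X k p) / n) \<longlonglongrightarrow> 0"
    by (rule torus_prob.lln_exponential_decorrelation[OF Xm Xb corr \<kappa>(1,2)])
  then show "AE p in torus_measure. (\<lambda>n. (\<Sum>k<n. \<psi> ((tm ^^ k) p)) / n) \<longlonglongrightarrow> (\<integral>p. \<psi> p \<partial>torus_measure)"
  proof (rule AE_mp, intro AE_I2 impI)
    fix p assume lim: "(\<lambda>n. (\<Sum>k<n. X k p) / n) \<longlonglongrightarrow> 0"
    have cE: "c = (\<integral>p. \<psi> p \<partial>torus_measure) + b" using sE[of 0] by (simp add: c_def)
    have "(\<lambda>n. (\<Sum>k<n. X k p) / n + (c - b)) \<longlonglongrightarrow> 0 + (c - b)" by (intro tendsto_intros lim)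
    moreover have "\<forall>\<^sub>F n in sequentially. (\<Sum>k<n. X k p) / n + (c - b) = (\<Sum>k<n. \<psi> ((tm ^^ k) p)) / n"
      using eventually_gt_at_top[of 0]
      by eventually_elim (simp add: X_def s_def sum.distrib sum_subtractf field_simps)
    ultimately show "(\<lambda>n. (\<Sum>k<n. \<psi> ((tm ^^ k) p)) / n) \<longlonglongrightarrow> (\<integral>p. \<psi> p \<partial>torus_measure)"
      using cE by (auto intro: Lim_transform_eventually)
  qed
qed

text \<open>
  The mean of \<open>\<phi>\<close> over the image of the zero section, and its limit, which will be the integral of \<open>\<phi>\<close>
  against the SRB measure.
\<close>

definition section_mean :: "('u torus \<times> (real ^ 'd) \<Rightarrow> real) \<Rightarrow> nat \<Rightarrow> real" where
  "section_mean \<phi> n = (\<integral>p. \<phi> ((T ^^ n) (p, 0)) \<partial>torus_measure)"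

definition limit_mean :: "('u torus \<times> (real ^ 'd) \<Rightarrow> real) \<Rightarrow> real" where
  "limit_mean \<phi> = lim (section_mean \<phi>)"

lemma section_facts:
  assumes "lip_test \<phi>"
  shows "(\<lambda>p. \<phi> ((T ^^ n) (p, 0))) \<in> borel_measurable borel"
    and "AE p in torus_measure. (\<lambda>N. (\<Sum>k<N. \<phi> ((T ^^ n) ((tm ^^ k) p, 0))) / N) \<longlonglongrightarrow> section_mean \<phi> n"
    and "(\<integral>p. \<phi> ((T ^^ n) ((tm ^^ k) p, 0)) \<partial>torus_measure) = section_mean \<phi> n"
proof -
  have l: "lip_test (\<lambda>z. \<phi> ((T ^^ n) z))" by (rule lip_test_T_iterate[OF assms])
  then obtain b L where bL: "L \<ge> 0" "\<And>z. \<bar>\<phi> ((T ^^ n) z)\<bar> \<le> b"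
    "\<And>x x' y y'. \<bar>\<phi> ((T ^^ n) (to_torus x, y)) - \<phi> ((T ^^ n) (to_torus x', y'))\<bar> \<le> L * (norm (x - x') + norm (y - y'))"
    by (rule lip_testE) blast
  have "(\<lambda>p::'u torus. (p, 0 :: real ^ 'd)) \<in> borel \<rightarrow>\<^sub>M borel"
    by (intro borel_measurable_continuous_onI continuous_on_Pair continuous_on_id continuous_on_const)
  from measurable_compose[OF this lip_test_measurable[OF l]]
  show m: "(\<lambda>p. \<phi> ((T ^^ n) (p, 0))) \<in> borel_measurable borel" .
  have L: "\<bar>\<phi> ((T ^^ n) (to_torus x, 0)) - \<phi> ((T ^^ n) (to_torus x', 0))\<bar> \<le> L * norm (x - x')" for x x'
    using bL(3)[of x 0 x' 0] by simp
  show "AE p in torus_measure. (\<lambda>N. (\<Sum>k<N. \<phi> ((T ^^ n) ((tm ^^ k) p, 0))) / N) \<longlonglongrightarrow> section_mean \<phi> n"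
    "(\<integral>p. \<phi> ((T ^^ n) ((tm ^^ k) p, 0)) \<partial>torus_measure) = section_mean \<phi> n"
    unfolding section_mean_def by (rule torus_lln[OF bL(2) L bL(1) m])+
qed

text \<open>
  Replacing the fibre coordinate at time \<open>k\<close> by 0 is forgotten exponentially fast, because the fibres
  are contracted. Hence \<open>\<phi>\<close> at time \<open>m + k\<close> is nearly a function of the base point at time \<open>k\<close>.
\<close>

lemma section_shift:
  assumes L: "\<And>p y y'. \<bar>\<phi> (p, y) - \<phi> (p, y')\<bar> \<le> L * norm (y - y')" "L \<ge> 0"
  shows "\<bar>\<phi> ((T ^^ (m + k)) z) - \<phi> ((T ^^ m) ((tm ^^ k) (fst z), 0))\<bar> \<le> L * (lam ^ m * (norm (snd z) + R0))"
proof -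
  define w where "w = (T ^^ k) z"
  have w: "w = ((tm ^^ k) (fst z), snd w)" by (simp add: w_def fst_T[symmetric])
  define p where "p = (tm ^^ k) (fst z)"
  have e: "(T ^^ (m + k)) z = (T ^^ m) (p, snd w)" using w by (simp add: funpow_add w_def p_def)
  have 1: "(T ^^ m) (p, y) = ((tm ^^ m) p, snd ((T ^^ m) (p, y)))" for y
    by (metis fst_T fst_conv prod.collapse)
  have "\<bar>\<phi> ((T ^^ m) (p, snd w)) - \<phi> ((T ^^ m) (p, 0))\<bar> \<le> L * norm (snd ((T ^^ m) (p, snd w)) - snd ((T ^^ m) (p, 0)))"
    using L(1)[of "(tm ^^ m) p" "snd ((T ^^ m) (p, snd w))" "snd ((T ^^ m) (p, 0))"] unfolding 1[symmetric] .
  also have "\<dots> \<le> L * (lam ^ m * norm (snd w - 0))" by (intro mult_left_mono snd_T_diff L(2))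
  also have "\<dots> \<le> L * (lam ^ m * (norm (snd z) + R0))"
    using snd_T_bound[of k z] lam(1) L(2) by (intro mult_left_mono) (auto simp: w_def)
  finally show ?thesis unfolding e p_def .
qed

lemma section_integrable:
  assumes "lip_test \<phi>"
  shows "integrable torus_measure (\<lambda>p. \<phi> ((T ^^ n) ((tm ^^ k) p, 0)))"
proof -
  from assms obtain b where "\<And>z. \<bar>\<phi> z\<bar> \<le> b" by (rule lip_testE) blast
  moreover have "(\<lambda>p. \<phi> ((T ^^ n) ((tm ^^ k) p, 0))) \<in> borel_measurable borel"
    by (rule measurable_compose[OF _ section_facts(1)[OF assms]]) measurable
  ultimately show ?thesis by (intro torus_prob.integrable_const_bound[where B = b]) auto
qed

text \<open>
  By \<open>section_shift\<close> the two functions are close after the first is viewed along the base map, and the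
  base map preserves the measure of the torus.
\<close>

lemma section_mean_Cauchy_bound:
  assumes "lip_test \<phi>" and L: "\<And>p y y'. \<bar>\<phi> (p, y) - \<phi> (p, y')\<bar> \<le> L * norm (y - y')" "L \<ge> 0"
  shows "\<bar>section_mean \<phi> (m + k) - section_mean \<phi> m\<bar> \<le> L * (lam ^ m * R0)"
proof -
  have "section_mean \<phi> (m + k) - section_mean \<phi> m =
      (\<integral>p. \<phi> ((T ^^ (m + k)) (p, 0)) - \<phi> ((T ^^ m) ((tm ^^ k) p, 0)) \<partial>torus_measure)"
    using section_integrable[OF assms(1), of "m + k" 0] section_integrable[OF assms(1), of m k]
    by (simp add: section_mean_def[of _ "m + k"] section_facts(3)[OF assms(1)])
  also have "\<bar>\<dots>\<bar> \<le> (\<integral>p. L * (lam ^ m * R0) \<partial>(torus_measure :: 'u torus measure))"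
  proof (rule integral_abs_bound[THEN order_trans], rule integral_mono)
    show "integrable torus_measure (\<lambda>p. \<bar>\<phi> ((T ^^ (m + k)) (p, 0)) - \<phi> ((T ^^ m) ((tm ^^ k) p, 0))\<bar>)"
      using section_integrable[OF assms(1), of "m + k" 0] section_integrable[OF assms(1), of m k] by simp
    show "\<bar>\<phi> ((T ^^ (m + k)) (p, 0)) - \<phi> ((T ^^ m) ((tm ^^ k) p, 0))\<bar> \<le> L * (lam ^ m * R0)" for p
      using section_shift[OF L, of m k "(p, 0)"] by simp
  qed simp
  finally show ?thesis by (simp add: torus_prob.prob_space[unfolded space_torus_measure])
qed

lemma section_mean_limit:
  assumes "lip_test \<phi>" and L: "\<And>p y y'. \<bar>\<phi> (p, y) - \<phi> (p, y')\<bar> \<le> L * norm (y - y')" "L \<ge> 0"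
  shows "section_mean \<phi> \<longlonglongrightarrow> limit_mean \<phi>" "\<bar>limit_mean \<phi> - section_mean \<phi> m\<bar> \<le> L * (lam ^ m * R0)"
proof -
  have z: "(\<lambda>m. 2 * (L * (lam ^ m * R0))) \<longlonglongrightarrow> 0"
    using lam by (auto intro!: tendsto_mult_right_zero tendsto_mult_left_zero LIMSEQ_power_zero)
  have "Cauchy (section_mean \<phi>)"
  proof (rule metric_CauchyI)
    fix e :: real assume "e > 0"
    then obtain m where m: "2 * (L * (lam ^ m * R0)) < e"
      using order_tendstoD(2)[OF z, of e] by (auto simp: eventually_sequentially)
    show "\<exists>M. \<forall>i\<ge>M. \<forall>j\<ge>M. dist (section_mean \<phi> i) (section_mean \<phi> j) < e"
    proof (intro exI[of _ m] allI impI)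
      fix i j assume "m \<le> i" "m \<le> j"
      then show "dist (section_mean \<phi> i) (section_mean \<phi> j) < e"
        using section_mean_Cauchy_bound[OF assms, of m "i - m"] section_mean_Cauchy_bound[OF assms, of m "j - m"] m
        by (simp add: dist_real_def)
    qed
  qed
  then have "convergent (section_mean \<phi>)" by (rule Cauchy_convergent)
  then show lim: "section_mean \<phi> \<longlonglongrightarrow> limit_mean \<phi>" by (simp add: limit_mean_def convergent_LIMSEQ_iff)
  have "(\<lambda>k. \<bar>section_mean \<phi> (m + k) - section_mean \<phi> m\<bar>) \<longlonglongrightarrow> \<bar>limit_mean \<phi> - section_mean \<phi> m\<bar>"
    using LIMSEQ_ignore_initial_segment[OF lim, of m] by (intro tendsto_intros) (simp add: add.commute)
  then show "\<bar>limit_mean \<phi> - section_mean \<phi> m\<bar> \<le> L * (lam ^ m * R0)"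
    by (rule LIMSEQ_le_const2) (use section_mean_Cauchy_bound[OF assms] in blast)
qed

text \<open>
  For fixed \<open>m\<close>, \<open>section_shift\<close> replaces \<open>\<phi>\<close> along the orbit by a function on the torus, to which
  \<open>torus_lln\<close> applies; the error tends to 0 with \<open>m\<close>. The exceptional set lies in the base, since the
  fibre coordinate of the starting point is forgotten.
\<close>

theorem orbit_averages:
  assumes "lip_test \<phi>"
  shows "AE p in torus_measure. \<forall>y. (\<lambda>n. (\<Sum>k<n. \<phi> ((T ^^ k) (p, y))) / n) \<longlonglongrightarrow> limit_mean \<phi>"
proof -
  from assms obtain b L where b: "b \<ge> 0" "\<And>z. \<bar>\<phi> z\<bar> \<le> b" and L0: "L \<ge> 0"
    and L: "\<And>p y y'. \<bar>\<phi> (p, y) - \<phi> (p, y')\<bar> \<le> L * norm (y - y')" by (rule lip_testE) blast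
  have "AE p in torus_measure. \<forall>m. (\<lambda>N. (\<Sum>k<N. \<phi> ((T ^^ m) ((tm ^^ k) p, 0))) / N) \<longlonglongrightarrow> section_mean \<phi> m"
    using section_facts(2)[OF assms] by (simp add: AE_all_countable)
  then show ?thesis
  proof (rule AE_mp, intro AE_I2 impI allI)
    fix p y
    assume lim: "\<forall>m. (\<lambda>N. (\<Sum>k<N. \<phi> ((T ^^ m) ((tm ^^ k) p, 0))) / N) \<longlonglongrightarrow> section_mean \<phi> m"
    define a where "a k = \<phi> ((T ^^ k) (p, y))" for k
    define s where "s m k = \<phi> ((T ^^ m) ((tm ^^ k) p, 0))" for m k
    define \<eta> where "\<eta> m = L * (lam ^ m * (norm y + R0))" for m
    have \<eta>: "\<eta> \<longlonglongrightarrow> 0" unfolding \<eta>_def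
      using lam by (auto intro!: tendsto_mult_right_zero tendsto_mult_left_zero LIMSEQ_power_zero)
    have a: "\<bar>a k\<bar> \<le> b" for k by (simp add: a_def b)
    (* the first term on the right pays for shifting the time by m, the second for replacing the
       function and its mean by those of level m *)
    have bound: "\<bar>(\<Sum>k<n. a k) / n - limit_mean \<phi>\<bar> \<le> 2 * m * b / n + 2 * \<eta> m + \<bar>(\<Sum>k<n. s m k) / n - section_mean \<phi> m\<bar>"
      if n: "n > 0" for n m
    proof -
      have "\<bar>(\<Sum>k<n. a k) - (\<Sum>k<n. a (m + k))\<bar> \<le> 2 * m * b"
      proof -
        have split: "(\<Sum>k<i + j. a k) = (\<Sum>k<i. a k) + (\<Sum>k<j. a (i + k))" for i j
          by (induction j) simp_all
        have "(\<Sum>k<n. a (m + k)) + (\<Sum>k<m. a k) = (\<Sum>k<n. a k) + (\<Sum>k<m. a (n + k))"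
          using split[of m n] split[of n m] by (simp add: add.commute)
        moreover have "\<bar>\<Sum>k<m. a (i + k)\<bar> \<le> m * b" for i
          using order_trans[OF sum_abs sum_bounded_above[of "{..<m}" "\<lambda>k. \<bar>a (i + k)\<bar>" b]] a by simp
        note this[of 0] this[of n]
        ultimately show ?thesis by simp
      qed
      moreover have "\<bar>(\<Sum>k<n. a (m + k)) - (\<Sum>k<n. s m k)\<bar> \<le> n * \<eta> m"
      proof -
        have "\<bar>(\<Sum>k<n. a (m + k)) - (\<Sum>k<n. s m k)\<bar> \<le> (\<Sum>k<n. \<bar>a (m + k) - s m k\<bar>)"
          by (simp add: sum_subtractf[symmetric] sum_abs)
        also have "\<dots> \<le> (\<Sum>k<n. \<eta> m)"
          using section_shift[OF L L0, of m _ "(p, y)"] by (intro sum_mono) (simp add: a_def s_def \<eta>_def)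
        finally show ?thesis by simp
      qed
      ultimately have "\<bar>(\<Sum>k<n. a k) - (\<Sum>k<n. s m k)\<bar> \<le> 2 * m * b + n * \<eta> m" by linarith
      then have "\<bar>(\<Sum>k<n. a k) - (\<Sum>k<n. s m k)\<bar> / n \<le> (2 * m * b + n * \<eta> m) / n" by (rule divide_right_mono) simp
      then have "\<bar>(\<Sum>k<n. a k) / n - (\<Sum>k<n. s m k) / n\<bar> \<le> 2 * m * b / n + \<eta> m"
        using n by (simp add: diff_divide_distrib[symmetric] abs_divide add_divide_distrib)
      moreover have "\<bar>limit_mean \<phi> - section_mean \<phi> m\<bar> \<le> \<eta> m"
      proof -
        have "L * (lam ^ m * R0) \<le> \<eta> m" unfolding \<eta>_def using lam L0 by (intro mult_left_mono) auto
        with section_mean_limit(2)[OF assms L L0, of m] show ?thesis by linarith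
      qed
      ultimately show ?thesis by linarith
    qed
    show "(\<lambda>n. (\<Sum>k<n. \<phi> ((T ^^ k) (p, y))) / n) \<longlonglongrightarrow> limit_mean \<phi>"
      unfolding a_def[symmetric]
    proof (rule LIMSEQ_I)
      fix e :: real assume e: "e > 0"
      then obtain m where m: "2 * \<eta> m < e / 3"
        using order_tendstoD(2)[OF \<eta>, of "e / 6"] by (auto simp: eventually_sequentially field_simps)
      have "(\<lambda>n. 2 * m * b / real n + \<bar>(\<Sum>k<n. s m k) / n - section_mean \<phi> m\<bar>) \<longlonglongrightarrow> 0 + \<bar>section_mean \<phi> m - section_mean \<phi> m\<bar>"
        using lim by (intro tendsto_intros lim_const_over_n) (auto simp: s_def)
      then have "\<forall>\<^sub>F n in sequentially. 2 * m * b / real n + \<bar>(\<Sum>k<n. s m k) / n - section_mean \<phi> m\<bar> < e / 3"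
        using e by (intro order_tendstoD) auto
      then have "\<forall>\<^sub>F n in sequentially. norm ((\<Sum>k<n. a k) / n - limit_mean \<phi>) < e"
        using eventually_gt_at_top[of 0]
      proof eventually_elim
        case (elim n)
        then show ?case using bound[of n m] m e unfolding real_norm_def by linarith
      qed
      then show "\<exists>no. \<forall>n\<ge>no. norm ((\<Sum>k<n. a k) / n - limit_mean \<phi>) < e"
        by (simp add: eventually_sequentially)
    qed
  qed
qed

theorem initial_means:
  assumes "lip_test \<phi>"
  shows "(\<lambda>n. \<integral>z. \<phi> ((T ^^ n) z) \<partial>initial_measure) \<longlonglongrightarrow> limit_mean \<phi>"
proof -
  from assms obtain b L where b: "b \<ge> 0" "\<And>z. \<bar>\<phi> z\<bar> \<le> b" and L0: "L \<ge> 0"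
    and L: "\<And>p y y'. \<bar>\<phi> (p, y) - \<phi> (p, y')\<bar> \<le> L * norm (y - y')" by (rule lip_testE) blast
  let ?U = "uniform_measure lborel (box (0::real^'d) One)" and ?d = "real (CARD('d))"
  let ?I = "initial_measure :: ('u torus \<times> (real ^ 'd)) measure"
  interpret U: prob_space ?U by (rule prob_space_uniform_box)
  interpret I: prob_space ?I by (rule prob_space_initial)
  have fst_m: "fst \<in> ?I \<rightarrow>\<^sub>M borel"
    unfolding initial_measure_def by (rule measurable_fst'') simp
  have fst_d: "distr ?I torus_measure fst = torus_measure"
    unfolding initial_measure_def by (rule U.distr_pair_fst)
  have [measurable]: "\<phi> \<in> borel_measurable borel" by (rule lip_test_measurable[OF assms])
  have int1: "integrable ?I (\<lambda>z. \<phi> ((T ^^ n) z))" for n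
    using b by (intro I.integrable_const_bound[where B = b]) auto
  have m2: "(\<lambda>z. \<phi> ((T ^^ n) (fst z, 0))) \<in> borel_measurable ?I" for n
    by (rule measurable_compose[OF fst_m section_facts(1)[OF assms]])
  have int2: "integrable ?I (\<lambda>z. \<phi> ((T ^^ n) (fst z, 0)))" for n
    using b m2 by (intro I.integrable_const_bound[where B = b]) auto
  have sec: "(\<integral>z. \<phi> ((T ^^ n) (fst z, 0)) \<partial>?I) = section_mean \<phi> n" for n
  proof -
    have "section_mean \<phi> n = (\<integral>p. \<phi> ((T ^^ n) (p, 0)) \<partial>distr ?I torus_measure fst)"
      unfolding section_mean_def fst_d ..
    also have "\<dots> = (\<integral>z. \<phi> ((T ^^ n) (fst z, 0)) \<partial>?I)"
      using fst_m section_facts(1)[OF assms]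
      by (intro integral_distr) (simp_all add: measurable_cong_sets[OF refl sets_torus_measure] measurable_cong_sets[OF sets_torus_measure refl])
    finally show ?thesis ..
  qed
  have bound: "\<bar>(\<integral>z. \<phi> ((T ^^ n) z) \<partial>?I) - section_mean \<phi> n\<bar> \<le> L * (lam ^ n * (?d + R0))" for n
  proof -
    have "(\<integral>z. \<phi> ((T ^^ n) z) \<partial>?I) - section_mean \<phi> n = (\<integral>z. \<phi> ((T ^^ n) z) - \<phi> ((T ^^ n) (fst z, 0)) \<partial>?I)"
      using int1 int2 by (simp add: sec)
    also have "\<bar>\<dots>\<bar> \<le> (\<integral>z. L * (lam ^ n * (?d + R0)) \<partial>?I)"
    proof (rule integral_abs_bound[THEN order_trans], rule integral_mono_AE)
      show "integrable ?I (\<lambda>z. \<bar>\<phi> ((T ^^ n) z) - \<phi> ((T ^^ n) (fst z, 0))\<bar>)"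
        using int1 int2 by simp
      show "AE z in ?I. \<bar>\<phi> ((T ^^ n) z) - \<phi> ((T ^^ n) (fst z, 0))\<bar> \<le> L * (lam ^ n * (?d + R0))"
        using AE_initial_bound
      proof (rule AE_mp, intro AE_I2 impI)
        fix z :: "'u torus \<times> (real ^ 'd)" assume "norm (snd z) \<le> ?d"
        then have "L * (lam ^ n * (norm (snd z) + R0)) \<le> L * (lam ^ n * (?d + R0))"
          using L0 lam by (intro mult_left_mono) auto
        with section_shift[OF L L0, of n 0 z]
        show "\<bar>\<phi> ((T ^^ n) z) - \<phi> ((T ^^ n) (fst z, 0))\<bar> \<le> L * (lam ^ n * (?d + R0))" by simp
      qed
    qed simp
    finally show ?thesis by (simp add: I.prob_space)
  qed
  have z: "(\<lambda>n. L * (lam ^ n * (?d + R0))) \<longlonglongrightarrow> 0"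
    using lam by (auto intro!: tendsto_mult_right_zero tendsto_mult_left_zero LIMSEQ_power_zero)
  have "(\<lambda>n. (\<integral>z. \<phi> ((T ^^ n) z) \<partial>?I) - section_mean \<phi> n) \<longlonglongrightarrow> 0"
    by (rule Lim_null_comparison[OF _ z]) (use bound in auto)
  from tendsto_add[OF this section_mean_limit(1)[OF assms L L0]] show ?thesis by simp
qed

end

section \<open>Setwise limits of measures\<close>

lemma convergent_of_approximants:
  fixes x :: "nat \<Rightarrow> real"
  assumes "\<And>e. e > 0 \<Longrightarrow> \<exists>y. convergent y \<and> (\<forall>n. \<bar>x n - y n\<bar> \<le> e)"
  shows "convergent x"
proof -
  have "Cauchy x"
  proof (rule metric_CauchyI)
    fix e :: real assume e: "e > 0"
    then obtain y where y: "convergent y" "\<And>n. \<bar>x n - y n\<bar> \<le> e / 4" using assms[of "e / 4"] by auto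
    then have "Cauchy y" by (simp add: convergent_Cauchy)
    then obtain M where M: "\<And>m n. m \<ge> M \<Longrightarrow> n \<ge> M \<Longrightarrow> dist (y m) (y n) < e / 4"
      using metric_CauchyD[of y "e / 4"] e by auto
    show "\<exists>M. \<forall>m\<ge>M. \<forall>n\<ge>M. dist (x m) (x n) < e"
    proof (intro exI[of _ M] allI impI)
      fix m n assume "m \<ge> M" "n \<ge> M"
      then show "dist (x m) (x n) < e" using M[of m n] y(2)[of m] y(2)[of n] e unfolding dist_real_def by linarith
    qed
  qed
  then show ?thesis by (rule Cauchy_convergent)
qed

text \<open>
  Uniform absolute continuity makes the tails of a disjoint union uniformly small. Convergence
  therefore passes from a generator to all measurable sets, and the same smallness makes the limit
  continuous at the empty set, hence countably additive.
\<close>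

lemma setwise_limit_measure:
  fixes V :: "'a measure" and \<nu> :: "nat \<Rightarrow> 'a measure"
  assumes V: "finite_measure V" and \<nu>: "\<And>n. prob_space (\<nu> n)" "\<And>n. sets (\<nu> n) = sets V"
    and gen: "sets V = sigma_sets (space V) \<G>" "Int_stable \<G>" "\<G> \<subseteq> Pow (space V)"
    and uni: "\<And>e. e > 0 \<Longrightarrow> \<exists>\<delta>>0. \<forall>n. \<forall>A\<in>sets V. measure V A < \<delta> \<longrightarrow> measure (\<nu> n) A \<le> e"
    and conv: "\<And>A. A \<in> \<G> \<Longrightarrow> convergent (\<lambda>n. measure (\<nu> n) A)"
  shows "\<exists>\<mu>. sets \<mu> = sets V \<and> prob_space \<mu> \<and> (\<forall>A\<in>sets V. (\<lambda>n. measure (\<nu> n) A) \<longlonglongrightarrow> measure \<mu> A)"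
proof -
  interpret V: finite_measure V by (rule V)
  have sp: "space (\<nu> n) = space V" for n by (rule sets_eq_imp_space_eq[OF \<nu>(2)])
  interpret \<nu>: prob_space "\<nu> n" for n by (rule \<nu>(1))
  have small: "\<exists>i. \<forall>n. measure (\<nu> n) (A i) \<le> e"
    if A: "range A \<subseteq> sets V" "decseq A" "(\<Inter>i. A i) = {}" and e: "e > 0" for A e
  proof -
    obtain \<delta> where \<delta>: "\<delta> > 0" "\<forall>n. \<forall>A\<in>sets V. measure V A < \<delta> \<longrightarrow> measure (\<nu> n) A \<le> e"
      using uni[OF e] by blast
    have "(\<lambda>i. measure V (A i)) \<longlonglongrightarrow> 0"
      using V.finite_Lim_measure_decseq[OF A(1,2)] A(3) by simp
    then obtain i where "measure V (A i) < \<delta>"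
      using order_tendstoD(2)[OF _ \<delta>(1)] by (fastforce simp: eventually_sequentially)
    then show ?thesis using \<delta>(2) A(1) by blast
  qed
  have all: "convergent (\<lambda>n. measure (\<nu> n) A)" if "A \<in> sets V" for A
    using gen(2,3) that[unfolded gen(1)]
  proof (induction rule: sigma_sets_induct_disjoint)
    case (basic A)
    then show ?case by (rule conv)
  next
    case empty
    then show ?case by (simp add: convergent_const)
  next
    case (compl A)
    have "measure (\<nu> n) (space V - A) = 1 - measure (\<nu> n) A" for n
      using \<nu>.prob_compl[of A n] compl(1) by (simp add: sp \<nu>(2) gen(1))
    then show ?case using convergent_diff[OF convergent_const compl(2)] by simp
  next
    case (union A)
    have A: "A i \<in> sets V" for i using union(2) gen(1) by auto
    show ?case
    proof (rule convergent_of_approximants)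
      fix e :: real assume e: "e > 0"
      define tail where "tail m = (\<Union>i\<in>{m..}. A i)" for m
      have tm: "range tail \<subseteq> sets V" unfolding tail_def using A by auto
      have "decseq tail" unfolding tail_def decseq_def by (force intro!: UN_mono)
      moreover have "(\<Inter>m. tail m) = {}"
      proof (rule ccontr)
        assume "(\<Inter>m. tail m) \<noteq> {}"
        then obtain x where x: "\<And>m. x \<in> tail m" by blast
        then obtain i where i: "x \<in> A i" using x[of 0] by (auto simp: tail_def)
        from x[of "Suc i"] obtain j where "j \<ge> Suc i" "x \<in> A j" by (auto simp: tail_def)
        moreover from \<open>j \<ge> Suc i\<close> union(1) have "A i \<inter> A j = {}" by (simp add: disjoint_family_on_def)
        ultimately show False using i by blast
      qed
      ultimately obtain m where m: "\<And>n. measure (\<nu> n) (tail m) \<le> e" using small[OF tm _ _ e] by blast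
      show "\<exists>y. convergent y \<and> (\<forall>n. \<bar>measure (\<nu> n) (\<Union>i. A i) - y n\<bar> \<le> e)"
      proof (intro exI conjI allI)
        show "convergent (\<lambda>n. \<Sum>i<m. measure (\<nu> n) (A i))"
          by (rule convergent_sum) (rule union(3))
        fix n
        have un: "(\<Union>i. A i) = (\<Union>i<m. A i) \<union> tail m" 
        proof -
          have "UNIV = {..<m} \<union> {m..}" by auto
          then show ?thesis unfolding tail_def by (metis UN_Un)
        qed
        have "measure (\<nu> n) (\<Union>i. A i) = measure (\<nu> n) (\<Union>i<m. A i) + measure (\<nu> n) (tail m)"
          unfolding un
        proof (rule \<nu>.finite_measure_Union)
          show "(\<Union>i<m. A i) \<in> sets (\<nu> n)" using A by (auto simp: \<nu>(2))
          show "tail m \<in> sets (\<nu> n)" using tm by (auto simp: \<nu>(2))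
          show "(\<Union>i<m. A i) \<inter> tail m = {}"
          proof (rule ccontr)
            assume "(\<Union>i<m. A i) \<inter> tail m \<noteq> {}"
            then obtain x i j where ij: "x \<in> A i" "i < m" "x \<in> A j" "m \<le> j" by (auto simp: tail_def)
            then have "A i \<inter> A j = {}" using union(1) by (simp add: disjoint_family_on_def)
            with ij show False by blast
          qed
        qed
        moreover have "measure (\<nu> n) (\<Union>i<m. A i) = (\<Sum>i<m. measure (\<nu> n) (A i))"
          using A union(1) by (intro \<nu>.finite_measure_finite_Union) (auto simp: \<nu>(2) disjoint_family_on_def)
        ultimately show "\<bar>measure (\<nu> n) (\<Union>i. A i) - (\<Sum>i<m. measure (\<nu> n) (A i))\<bar> \<le> e"
          using m[of n] by simp
      qed
    qed
  qed
  define \<mu>0 where "\<mu>0 A = ennreal (lim (\<lambda>n. measure (\<nu> n) A))" for A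
  have limA: "(\<lambda>n. measure (\<nu> n) A) \<longlonglongrightarrow> lim (\<lambda>n. measure (\<nu> n) A)" if "A \<in> sets V" for A
    using all[OF that] by (simp add: convergent_LIMSEQ_iff)
  have lim0: "lim (\<lambda>n. measure (\<nu> n) A) \<ge> 0" if "A \<in> sets V" for A
    by (rule LIMSEQ_le_const[OF limA[OF that]]) simp
  have pos: "positive (sets V) \<mu>0" by (simp add: positive_def \<mu>0_def)
  have add: "additive (sets V) \<mu>0"
    unfolding additive_def
  proof (intro ballI impI)
    fix A B assume AB: "A \<in> sets V" "B \<in> sets V" "A \<inter> B = {}"
    have "(\<lambda>n. measure (\<nu> n) A + measure (\<nu> n) B) \<longlonglongrightarrow> lim (\<lambda>n. measure (\<nu> n) A) + lim (\<lambda>n. measure (\<nu> n) B)"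
      by (intro tendsto_add limA AB)
    moreover have "measure (\<nu> n) A + measure (\<nu> n) B = measure (\<nu> n) (A \<union> B)" for n
      using AB by (intro \<nu>.finite_measure_Union[symmetric]) (auto simp: \<nu>(2))
    ultimately have "lim (\<lambda>n. measure (\<nu> n) (A \<union> B)) = lim (\<lambda>n. measure (\<nu> n) A) + lim (\<lambda>n. measure (\<nu> n) B)"
      by (intro limI) simp
    then show "\<mu>0 (A \<union> B) = \<mu>0 A + \<mu>0 B" using lim0 AB by (simp add: \<mu>0_def)
  qed
  have cadd: "countably_additive (sets V) \<mu>0"
  proof (rule sets.empty_continuous_imp_countably_additive[OF pos add])
    show "\<forall>A\<in>sets V. \<mu>0 A \<noteq> \<infinity>" by (simp add: \<mu>0_def)
    fix A :: "nat \<Rightarrow> 'a set" assume A: "range A \<subseteq> sets V" "decseq A" "(\<Inter>i. A i) = {}"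
    have As: "A i \<in> sets V" for i using A(1) by auto
    have "(\<lambda>i. lim (\<lambda>n. measure (\<nu> n) (A i))) \<longlonglongrightarrow> 0"
    proof (rule LIMSEQ_I)
      fix e :: real assume e: "e > 0"
      then obtain i where i: "\<And>n. measure (\<nu> n) (A i) \<le> e / 2" using small[OF A, of "e / 2"] by auto
      have "lim (\<lambda>n. measure (\<nu> n) (A j)) \<le> e / 2" if "j \<ge> i" for j
      proof (rule LIMSEQ_le_const2[OF limA[OF As]], intro exI[of _ 0] allI impI)
        fix n
        have "measure (\<nu> n) (A j) \<le> measure (\<nu> n) (A i)"
          using A(2) that As by (intro \<nu>.finite_measure_mono) (auto simp: decseq_def \<nu>(2))
        with i[of n] show "measure (\<nu> n) (A j) \<le> e / 2" by linarith
      qed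
      then show "\<exists>no. \<forall>j\<ge>no. norm (lim (\<lambda>n. measure (\<nu> n) (A j)) - 0) < e"
        using lim0[OF As] e by (intro exI[of _ i]) (force intro: le_less_trans)
    qed
    then show "(\<lambda>i. \<mu>0 (A i)) \<longlonglongrightarrow> 0" unfolding \<mu>0_def by (simp add: tendsto_ennreal_iff lim0 As flip: ennreal_0)
  qed
  define \<mu> where "\<mu> = measure_of (space V) (sets V) \<mu>0"
  have s\<mu>: "sets \<mu> = sets V" unfolding \<mu>_def by simp
  have e\<mu>: "emeasure \<mu> A = \<mu>0 A" if "A \<in> sets V" for A
    unfolding \<mu>_def by (rule emeasure_measure_of_sigma[OF sets.sigma_algebra_axioms pos cadd that])
  have m\<mu>: "measure \<mu> A = lim (\<lambda>n. measure (\<nu> n) A)" if "A \<in> sets V" for A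
    using e\<mu>[OF that] lim0[OF that] by (simp add: measure_def \<mu>0_def)
  have "emeasure \<mu> (space \<mu>) = 1"
  proof -
    have "space \<mu> = space V" by (rule sets_eq_imp_space_eq[OF s\<mu>])
    moreover have "measure (\<nu> n) (space V) = 1" for n using \<nu>.prob_space[of n] by (simp add: sp)
    ultimately show ?thesis using e\<mu>[of "space V"] by (simp add: \<mu>0_def)
  qed
  then have "prob_space \<mu>" by (rule prob_spaceI)
  moreover have "\<forall>A\<in>sets V. (\<lambda>n. measure (\<nu> n) A) \<longlonglongrightarrow> measure \<mu> A"
    using limA m\<mu> by simp
  ultimately show ?thesis using s\<mu> by blast
qed

text \<open>
  A bounded function is uniformly close to a function with finitely many values, obtained by rounding
  \<open>N \<phi>\<close> down.
\<close>

lemma setwise_limit_integral: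
  fixes \<phi> :: "'a \<Rightarrow> real"
  assumes \<nu>: "\<And>n. prob_space (\<nu> n)" "\<And>n. sets (\<nu> n) = sets \<mu>" and \<mu>: "prob_space \<mu>"
    and lim: "\<And>A. A \<in> sets \<mu> \<Longrightarrow> (\<lambda>n. measure (\<nu> n) A) \<longlonglongrightarrow> measure \<mu> A"
    and \<phi> [measurable]: "\<phi> \<in> borel_measurable \<mu>" and b: "\<And>x. \<bar>\<phi> x\<bar> \<le> b"
  shows "(\<lambda>n. \<integral>x. \<phi> x \<partial>\<nu> n) \<longlonglongrightarrow> (\<integral>x. \<phi> x \<partial>\<mu>)"
proof (rule LIMSEQ_I)
  fix e :: real assume e: "e > 0"
  define N where "N = 4 / e"
  have N: "N > 0" using e by (simp add: N_def)
  define K where "K = \<lceil>N * b\<rceil> + 1"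
  define S where "S = {-K..K}"
  define g where "g x = \<lfloor>N * \<phi> x\<rfloor>" for x
  define h where "h x = (\<Sum>k\<in>S. (of_int k / N) * indicator {y \<in> space \<mu>. g y = k} x)" for x :: 'a
  have lvl: "{y \<in> space \<mu>. g y = k} \<in> sets \<mu>" for k unfolding g_def by measurable
  have gS: "g x \<in> S" for x
  proof -
    have "\<bar>N * \<phi> x\<bar> \<le> N * b" using b[of x] N by (simp add: abs_mult)
    then show ?thesis unfolding S_def g_def K_def by simp linarith
  qed
  have h: "\<bar>\<phi> x - h x\<bar> \<le> e / 4" if "x \<in> space \<mu>" for x
  proof -
    have "h x = (\<Sum>k\<in>S. if k = g x then of_int k / N else 0)"
      unfolding h_def using that by (intro sum.cong) auto
    also have "\<dots> = of_int (g x) / N" using gS[of x] by (simp add: S_def)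
    finally have "h x = of_int (g x) / N" .
    moreover have "of_int (g x) \<le> N * \<phi> x" "N * \<phi> x \<le> of_int (g x) + 1" unfolding g_def by linarith+
    ultimately have "N * h x \<le> N * \<phi> x" "N * \<phi> x \<le> N * (h x + 1 / N)" using N by (simp_all add: distrib_left)
    then have "h x \<le> \<phi> x" "\<phi> x \<le> h x + 1 / N" using N by (simp_all only: mult_le_cancel_left_pos)
    then show ?thesis by (simp add: N_def)
  qed
  have app: "\<bar>(\<integral>x. \<phi> x \<partial>\<rho>) - (\<Sum>k\<in>S. (of_int k / N) * measure \<rho> {y \<in> space \<mu>. g y = k})\<bar> \<le> e / 4"
    if "prob_space \<rho>" and sets: "sets \<rho> = sets \<mu>" for \<rho>
  proof -
    interpret prob_space \<rho> by fact
    have sp: "space \<rho> = space \<mu>" by (rule sets_eq_imp_space_eq[OF sets])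
    have [measurable]: "\<phi> \<in> borel_measurable \<rho>" using \<phi> by (simp cong: measurable_cong_sets add: sets)
    have i\<phi>: "integrable \<rho> \<phi>" using b by (intro integrable_const_bound[where B = b]) auto
    have ii: "integrable \<rho> (\<lambda>x. (of_int k / N) * indicator {y \<in> space \<mu>. g y = k} x)" for k
      using lvl[of k] by (intro integrable_mult_right integrable_real_indicator) (auto simp: sets emeasure_eq_measure)
    have ih: "integrable \<rho> h" unfolding h_def by (intro Bochner_Integration.integrable_sum ii)
    have "(\<integral>x. h x \<partial>\<rho>) = (\<Sum>k\<in>S. (of_int k / N) * measure \<rho> {y \<in> space \<mu>. g y = k})"
      unfolding h_def using ii lvl sets.sets_into_space[OF lvl]
      by (simp add: Bochner_Integration.integral_sum sp Int_absorb2 Int_absorb1)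
    then have "(\<integral>x. \<phi> x \<partial>\<rho>) - (\<Sum>k\<in>S. (of_int k / N) * measure \<rho> {y \<in> space \<mu>. g y = k}) = (\<integral>x. \<phi> x - h x \<partial>\<rho>)"
      using i\<phi> ih by simp
    also have "\<bar>\<dots>\<bar> \<le> (\<integral>x. e / 4 \<partial>\<rho>)"
    proof (rule integral_abs_bound[THEN order_trans], rule integral_mono)
      show "integrable \<rho> (\<lambda>x. \<bar>\<phi> x - h x\<bar>)" using i\<phi> ih by simp
    qed (use h sp in auto)
    finally show ?thesis by (simp add: prob_space)
  qed
  have "(\<lambda>n. \<Sum>k\<in>S. (of_int k / N) * measure (\<nu> n) {y \<in> space \<mu>. g y = k}) \<longlonglongrightarrow>
     (\<Sum>k\<in>S. (of_int k / N) * measure \<mu> {y \<in> space \<mu>. g y = k})"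
    by (intro tendsto_intros lim lvl)
  then obtain no where no: "\<And>n. n \<ge> no \<Longrightarrow> \<bar>(\<Sum>k\<in>S. (of_int k / N) * measure (\<nu> n) {y \<in> space \<mu>. g y = k}) -
      (\<Sum>k\<in>S. (of_int k / N) * measure \<mu> {y \<in> space \<mu>. g y = k})\<bar> < e / 4"
    using LIMSEQ_D[of _ _ "e / 4"] e by fastforce
  then show "\<exists>no. \<forall>n\<ge>no. norm ((\<integral>x. \<phi> x \<partial>\<nu> n) - (\<integral>x. \<phi> x \<partial>\<mu>)) < e"
  proof (intro exI[of _ no] allI impI)
    fix n assume "n \<ge> no"
    then show "norm ((\<integral>x. \<phi> x \<partial>\<nu> n) - (\<integral>x. \<phi> x \<partial>\<mu>)) < e"
      using app[OF \<nu>, of n] app[OF \<mu> refl] e no[of n] unfolding real_norm_def by linarith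
  qed
qed

section \<open>Tent functions\<close>

text \<open>
  The preimage in \<open>\<real>\<^sup>u \<times> \<real>\<^sup>d\<close>; the Euclidean distance to this periodic set is a substitute for a distance on
  the torus.
\<close>

definition cover_set :: "('u::finite torus \<times> (real ^ 'd)) set \<Rightarrow> ((real ^ 'u) \<times> (real ^ 'd)) set" where
  "cover_set A = {p. (to_torus (fst p), snd p) \<in> A}"

definition tent :: "('u::finite torus \<times> (real ^ 'd)) set \<Rightarrow> nat \<Rightarrow> 'u torus \<times> (real ^ 'd) \<Rightarrow> real" where
  "tent A j z = max 0 (1 - real j * infdist (rep_torus (fst z), snd z) (cover_set A))"

lemma infdist_cover_shift:
  assumes l: "l \<in> integer_lattice"
  shows "infdist (x + l, y) (cover_set A) = infdist (x, y) (cover_set A)"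
proof -
  have le: "infdist (x + k, y) (cover_set A) \<le> infdist (x, y) (cover_set A)" if k: "k \<in> integer_lattice" for x k
  proof (cases "cover_set A = {}")
    case False
    have "infdist (x + k, y) (cover_set A) \<le> dist (x, y) a" if a: "a \<in> cover_set A" for a
    proof -
      have "(fst a + k, snd a) \<in> cover_set A" using a k by (simp add: cover_set_def to_torus_add_lattice)
      then have "infdist (x + k, y) (cover_set A) \<le> dist (x + k, y) (fst a + k, snd a)" by (rule infdist_le)
      also have "\<dots> = dist (x, y) a" by (simp add: dist_prod_def)
      finally show ?thesis .
    qed
    then show ?thesis using False by (subst (2) infdist_def) (auto intro!: cINF_greatest)
  qed (simp add: infdist_def)
  show ?thesis using le[OF l, of x] le[OF integer_lattice_minus[OF l], of "x + l"] by simp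
qed

lemma tent_to_torus: "tent A j (to_torus x, y) = max 0 (1 - real j * infdist (x, y) (cover_set A))"
proof -
  have "rep_torus (to_torus x) - x \<in> integer_lattice" by (simp flip: to_torus_eq_iff)
  from infdist_cover_shift[OF this, of x y A] show ?thesis by (simp add: tent_def)
qed

lemma tent_bounds: "0 \<le> tent A j z" "tent A j z \<le> 1"
  by (auto simp: tent_def infdist_nonneg)

lemma lip_test_tent: "lip_test (tent A j)"
proof -
  have "\<bar>tent A j (to_torus x, y) - tent A j (to_torus x', y')\<bar> \<le> real j * (norm (x - x') + norm (y - y'))" for x x' y y'
  proof -
    have "\<bar>tent A j (to_torus x, y) - tent A j (to_torus x', y')\<bar> \<le> \<bar>real j * infdist (x, y) (cover_set A) - real j * infdist (x', y') (cover_set A)\<bar>"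
      unfolding tent_to_torus by linarith
    also have "\<dots> = real j * \<bar>infdist (x, y) (cover_set A) - infdist (x', y') (cover_set A)\<bar>"
      by (simp add: right_diff_distrib[symmetric] abs_mult)
    also have "\<dots> \<le> real j * dist (x, y) (x', y')" by (intro mult_left_mono infdist_triangle_abs) simp
    also have "dist (x, y) (x', y') \<le> norm (x - x') + norm (y - y')"
      using norm_Pair_le[of "x - x'" "y - y'"] by (simp add: dist_norm)
    finally show ?thesis by (simp add: mult_left_mono)
  qed
  moreover have "\<bar>tent A j z\<bar> \<le> 1" for z using tent_bounds[of A j z] by simp
  ultimately show ?thesis unfolding lip_test_def using of_nat_0_le_iff by blast
qed

lemma closed_cover_set: "closed A \<Longrightarrow> closed (cover_set A)"
proof -
  assume A: "closed A"
  have "continuous_on UNIV (\<lambda>p :: (real^'a) \<times> (real^'b). (to_torus (fst p), snd p))"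
    by (intro continuous_on_Pair continuous_on_compose2[OF continuous_on_to_torus continuous_on_fst] continuous_on_snd continuous_on_id) simp
  from continuous_closed_vimage[OF A this[unfolded continuous_on_eq_continuous_at[OF open_UNIV], rule_format, OF UNIV_I]]
  show ?thesis by (simp add: cover_set_def vimage_def)
qed

text \<open>
  Tents decrease to the indicator of a closed set, and eventually vanish at every point outside it.
\<close>

lemma tent_limit:
  assumes A: "closed A" "A \<noteq> {}"
  shows "(\<lambda>j. tent A j z) \<longlonglongrightarrow> indicator A z" and "z \<in> A \<Longrightarrow> tent A j z = 1"
    and "i \<le> j \<Longrightarrow> tent A j z \<le> tent A i z" and "z \<notin> A \<Longrightarrow> \<exists>j. tent A j z = 0"
proof -
  let ?p = "(rep_torus (fst z), snd z)"
  have zA: "z \<in> A \<longleftrightarrow> ?p \<in> cover_set A" by (simp add: cover_set_def)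
  obtain a where "a \<in> A" using A(2) by blast
  then have "(rep_torus (fst a), snd a) \<in> cover_set A" by (simp add: cover_set_def)
  then have ne: "cover_set A \<noteq> {}" by blast
  have iff: "z \<in> A \<longleftrightarrow> infdist ?p (cover_set A) = 0"
    unfolding zA by (rule in_closed_iff_infdist_zero[OF closed_cover_set[OF A(1)] ne])
  show 1: "tent A j z = 1" if "z \<in> A" for j using that iff by (simp add: tent_def)
  show "tent A j z \<le> tent A i z" if "i \<le> j" for i j
  proof -
    have "real i * infdist ?p (cover_set A) \<le> real j * infdist ?p (cover_set A)"
      using that by (intro mult_right_mono) (auto simp: infdist_nonneg)
    then show ?thesis by (simp add: tent_def)
  qed
  have ev: "\<forall>\<^sub>F j in sequentially. tent A j z = 0" if "z \<notin> A"
  proof -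
    have d: "infdist ?p (cover_set A) > 0" using that iff infdist_nonneg[of ?p "cover_set A"] by linarith
    have "\<forall>\<^sub>F j in sequentially. 1 / infdist ?p (cover_set A) < real j" by real_asymp
    then show ?thesis
      by eventually_elim (use d in \<open>simp add: tent_def field_simps\<close>)
  qed
  show "(\<lambda>j. tent A j z) \<longlonglongrightarrow> indicator A z"
    by (cases "z \<in> A") (simp_all add: 1 tendsto_eventually[OF ev])
  show "\<exists>j. tent A j z = 0" if "z \<notin> A" using ev[OF that] by (auto simp: eventually_sequentially)
qed

text \<open>
  Integrals of tents determine the measures of closed sets, which form a generator closed under
  intersections.
\<close>

lemma measure_eqI_lip_test:
  assumes \<mu>: "prob_space \<mu>" "sets \<mu> = sets borel" and \<nu>: "prob_space \<nu>" "sets \<nu> = sets borel"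
    and eq: "\<And>\<phi>. lip_test \<phi> \<Longrightarrow> (\<integral>z. \<phi> z \<partial>\<mu>) = (\<integral>z. \<phi> z \<partial>\<nu>)"
  shows "\<mu> = (\<nu> :: ('u::finite torus \<times> (real ^ 'd)) measure)"
proof -
  interpret \<mu>: prob_space \<mu> by fact
  interpret \<nu>: prob_space \<nu> by fact
  have lim: "(\<lambda>j. \<integral>z. tent A j z \<partial>\<rho>) \<longlonglongrightarrow> measure \<rho> A"
    if "prob_space \<rho>" "sets \<rho> = sets borel" "closed A" "A \<noteq> {}" for A and \<rho> :: "('u torus \<times> (real ^ 'd)) measure"
  proof -
    interpret prob_space \<rho> by fact
    have m: "tent A j \<in> borel_measurable \<rho>" for j
      using lip_test_measurable[OF lip_test_tent] that(2) by (simp cong: measurable_cong_sets)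
    have sp: "space \<rho> = UNIV" using sets_eq_imp_space_eq[OF that(2)] by simp
    have "(\<lambda>j. \<integral>z. tent A j z \<partial>\<rho>) \<longlonglongrightarrow> (\<integral>z. indicator A z \<partial>\<rho>)"
    proof (rule integral_dominated_convergence[where w = "\<lambda>_. 1"])
      show "indicator A \<in> borel_measurable \<rho>" using that by (intro borel_measurable_indicator) (simp add: borel_closed)
      show "AE z in \<rho>. (\<lambda>j. tent A j z) \<longlonglongrightarrow> indicator A z" using tent_limit(1)[OF that(3,4)] by simp
      show "AE z in \<rho>. norm (tent A j z) \<le> 1" for j using tent_bounds[of A j] by simp
    qed (use m in auto)
    then show ?thesis using sp by simp
  qed
  show ?thesis
  proof (rule measure_eqI_generator_eq[where E = "Collect closed" and \<Omega> = UNIV and A = "\<lambda>_. UNIV"])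
    show "Int_stable (Collect closed :: ('u torus \<times> (real ^ 'd)) set set)" by (auto simp: Int_stable_def)
    show "sets \<mu> = sigma_sets UNIV (Collect closed)" "sets \<nu> = sigma_sets UNIV (Collect closed)"
      using \<mu>(2) \<nu>(2) by (simp_all add: borel_eq_closed)
    fix A :: "('u torus \<times> (real ^ 'd)) set" assume A: "A \<in> Collect closed"
    show "emeasure \<mu> A = emeasure \<nu> A"
    proof (cases "A = {}")
      case False
      have "measure \<mu> A = measure \<nu> A"
        using lim[OF \<mu> _ False] lim[OF \<nu> _ False] A eq[OF lip_test_tent] by (auto intro: LIMSEQ_unique)
      then show ?thesis by (simp add: \<mu>.emeasure_eq_measure \<nu>.emeasure_eq_measure)
    qed simp
  qed auto
qed

lemma lip_test_max: "lip_test \<phi> \<Longrightarrow> lip_test \<psi> \<Longrightarrow> lip_test (\<lambda>z. max (\<phi> z) (\<psi> z))"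
proof -
  assume "lip_test \<phi>" "lip_test \<psi>"
  from this(1) obtain b L where b: "L \<ge> 0" "\<And>z. \<bar>\<phi> z\<bar> \<le> b"
    "\<And>x x' y y'. \<bar>\<phi> (to_torus x, y) - \<phi> (to_torus x', y')\<bar> \<le> L * (norm (x - x') + norm (y - y'))"
    by (rule lip_testE) blast
  from \<open>lip_test \<psi>\<close> obtain c K where c: "K \<ge> 0" "\<And>z. \<bar>\<psi> z\<bar> \<le> c"
    "\<And>x x' y y'. \<bar>\<psi> (to_torus x, y) - \<psi> (to_torus x', y')\<bar> \<le> K * (norm (x - x') + norm (y - y'))"
    by (rule lip_testE) blast
  have "\<bar>max (\<phi> z) (\<psi> z)\<bar> \<le> max b c" for z using b(2)[of z] c(2)[of z] by linarith
  moreover have "\<bar>max (\<phi> (to_torus x, y)) (\<psi> (to_torus x, y)) - max (\<phi> (to_torus x', y')) (\<psi> (to_torus x', y'))\<bar> \<le>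
      (L + K) * (norm (x - x') + norm (y - y'))" for x x' y y'
  proof -
    have "0 \<le> L * (norm (x - x') + norm (y - y'))" "0 \<le> K * (norm (x - x') + norm (y - y'))" using b(1) c(1) by simp_all
    then show ?thesis using b(3)[of x y x' y'] c(3)[of x y x' y'] unfolding distrib_right[of L K] by linarith
  qed
  moreover have "L + K \<ge> 0" using b(1) c(1) by simp
  ultimately show ?thesis unfolding lip_test_def by blast
qed

lemma lip_test_scale: "lip_test \<phi> \<Longrightarrow> r \<ge> 0 \<Longrightarrow> lip_test (\<lambda>z. r * \<phi> z)"
proof -
  assume l: "lip_test \<phi>" and r: "r \<ge> 0"
  from l obtain b L where b: "L \<ge> 0" "\<And>z. \<bar>\<phi> z\<bar> \<le> b"
    "\<And>x x' y y'. \<bar>\<phi> (to_torus x, y) - \<phi> (to_torus x', y')\<bar> \<le> L * (norm (x - x') + norm (y - y'))"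
    by (rule lip_testE) blast
  have "\<bar>r * \<phi> z\<bar> \<le> r * b" for z using b(2)[of z] r by (simp add: abs_mult mult_left_mono)
  moreover have "\<bar>r * \<phi> (to_torus x, y) - r * \<phi> (to_torus x', y')\<bar> \<le> (r * L) * (norm (x - x') + norm (y - y'))" for x x' y y'
    using mult_left_mono[OF b(3)[of x y x' y'] r] r by (simp add: right_diff_distrib[symmetric] abs_mult mult.assoc)
  moreover have "r * L \<ge> 0" using b r by simp
  ultimately show ?thesis unfolding lip_test_def by blast
qed

lemma lip_test_Max:
  assumes "finite F" "F \<noteq> {}" "\<And>g. g \<in> F \<Longrightarrow> lip_test g"
  shows "lip_test (\<lambda>z. Max ((\<lambda>g. g z) ` F))"
  using assms
proof (induction rule: finite_ne_induct)
  case (singleton g)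
  then show ?case by (simp add: eta_contract_eq)
next
  case (insert g F)
  have "(\<lambda>z. Max ((\<lambda>g. g z) ` insert g F)) = (\<lambda>z. max (g z) (Max ((\<lambda>g. g z) ` F)))"
    using insert.hyps by auto
  then show ?case using insert by (simp add: lip_test_max)
qed

definition dense_pts :: "('u::finite torus \<times> (real ^ 'd)) set" where
  "dense_pts = (\<lambda>p. (to_torus (fst p), snd p)) `
     (SOME D. countable D \<and> (\<forall>U. open U \<longrightarrow> U \<noteq> {} \<longrightarrow> (\<exists>p\<in>D. p \<in> U)))"

text \<open>
  Countably many multiples of tents over points. Every nonnegative continuous function is the supremum
  of the cones below it (\<open>cones_below\<close>).
\<close>

definition cones :: "('u::finite torus \<times> (real ^ 'd) \<Rightarrow> real) set" where
  "cones = (\<lambda>(w, j, r) z. real_of_rat r * tent {w} j z) ` (dense_pts \<times> UNIV \<times> {r. r \<ge> 0})"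

lemma dense_pts: "countable (dense_pts :: ('u::finite torus \<times> (real ^ 'd)) set)"
  "open U \<Longrightarrow> U \<noteq> {} \<Longrightarrow> \<exists>p\<in>U. (to_torus (fst p), snd p) \<in> (dense_pts :: ('u::finite torus \<times> (real ^ 'd)) set)"
proof -
  define D where "D = (SOME D :: ((real^'u) \<times> (real ^ 'd)) set. countable D \<and> (\<forall>U. open U \<longrightarrow> U \<noteq> {} \<longrightarrow> (\<exists>p\<in>D. p \<in> U)))"
  have "\<exists>D :: ((real^'u) \<times> (real ^ 'd)) set. countable D \<and> (\<forall>U. open U \<longrightarrow> U \<noteq> {} \<longrightarrow> (\<exists>p\<in>D. p \<in> U))"
    using countable_dense_exists by blast
  then have D: "countable D \<and> (\<forall>U. open U \<longrightarrow> U \<noteq> {} \<longrightarrow> (\<exists>p\<in>D. p \<in> U))"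
    unfolding D_def by (rule someI_ex)
  then show "countable (dense_pts :: ('u::finite torus \<times> (real ^ 'd)) set)"
    unfolding dense_pts_def D_def[symmetric] by simp
  show "\<exists>p\<in>U. (to_torus (fst p), snd p) \<in> (dense_pts :: ('u::finite torus \<times> (real ^ 'd)) set)" if "open U" "U \<noteq> {}"
    using D that unfolding dense_pts_def D_def[symmetric] by blast
qed

lemma countable_cones: "countable cones"
  unfolding cones_def by (intro countable_image countable_SIGMA dense_pts) auto

lemma cones_lip_test: "g \<in> cones \<Longrightarrow> lip_test g"
  unfolding cones_def by (auto intro!: lip_test_scale lip_test_tent)

lemma cones_nonneg: "g \<in> cones \<Longrightarrow> g z \<ge> 0"
  unfolding cones_def by (auto simp: tent_bounds)

lemma zero_in_cones: "(\<lambda>_. 0) \<in> (cones :: ('u::finite torus \<times> (real ^ 'd) \<Rightarrow> real) set)"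
proof -
  obtain p :: "(real^'u) \<times> (real ^ 'd)" where "(to_torus (fst p), snd p) \<in> (dense_pts :: ('u torus \<times> (real ^ 'd)) set)"
    using dense_pts(2)[of UNIV] by auto
  then show ?thesis unfolding cones_def by (intro image_eqI[where x = "((to_torus (fst p), snd p), 0, 0)"]) auto
qed

text \<open>
  Near a lift of \<open>z\<close> the function exceeds a rational number \<open>r\<close> slightly below \<open>\<phi> z\<close>. A steep tent of
  height \<open>r\<close> over a dense point close to \<open>z\<close> is supported in that neighbourhood, and still has almost the
  height \<open>r\<close> at \<open>z\<close>.
\<close>

lemma cones_below:
  fixes \<phi> :: "'u::finite torus \<times> (real ^ 'd) \<Rightarrow> real"
  assumes cont: "continuous_on UNIV \<phi>" and pos: "\<And>z. \<phi> z \<ge> 0" and e: "e > 0"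
  shows "\<exists>g\<in>cones. (\<forall>x. g x \<le> \<phi> x) \<and> g z > \<phi> z - e"
proof (cases "\<phi> z - e < 0")
  case True
  then show ?thesis using zero_in_cones pos by (intro bexI[of _ "\<lambda>_. 0"]) auto
next
  case False
  then obtain q where q: "\<phi> z - e < real_of_rat q" "real_of_rat q < \<phi> z" using of_rat_dense[of "\<phi> z - e" "\<phi> z"] e by auto
  define r where "r = real_of_rat q"
  have r: "\<phi> z - e < r" "r < \<phi> z" "r > 0" using q False unfolding r_def by linarith+
  define \<Phi> where "\<Phi> p = \<phi> (to_torus (fst p), snd p)" for p :: "(real^'u) \<times> (real ^ 'd)"
  have "continuous_on UNIV (\<lambda>p :: (real^'u) \<times> (real^'d). (to_torus (fst p), snd p))"
    by (intro continuous_on_Pair continuous_on_compose2[OF continuous_on_to_torus continuous_on_fst] continuous_on_snd continuous_on_id) simp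
  then have \<Phi>: "continuous_on UNIV \<Phi>" unfolding \<Phi>_def by (rule continuous_on_compose2[OF cont]) simp
  define p0 where "p0 = (rep_torus (fst z), snd z)"
  have p0: "\<Phi> p0 = \<phi> z" by (simp add: \<Phi>_def p0_def)
  have "open (\<Phi> -` {r<..})" by (rule open_vimage[OF open_greaterThan \<Phi>])
  moreover have "p0 \<in> \<Phi> -` {r<..}" using r p0 by simp
  ultimately obtain \<delta> where \<delta>: "\<delta> > 0" "ball p0 \<delta> \<subseteq> \<Phi> -` {r<..}"
    by (rule openE)
  obtain j :: nat where j: "2 / \<delta> < real j" using reals_Archimedean2 by blast
  have j0: "real j > 0" using j \<delta>(1) by (smt (verit) divide_pos_pos)
  (* the first entry keeps the support inside the neighbourhood, the second keeps the loss of height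
     at z below half of r - (phi z - e) *)
  define \<eta> where "\<eta> = min (\<delta> / 2) ((r - (\<phi> z - e)) / (2 * r * real j))"
  have \<eta>: "\<eta> > 0" using \<delta>(1) r j0 by (simp add: \<eta>_def)
  obtain w where w: "w \<in> ball p0 \<eta>" "(to_torus (fst w), snd w) \<in> (dense_pts :: ('u torus \<times> (real ^ 'd)) set)"
    using dense_pts(2)[of "ball p0 \<eta>"] \<eta> by auto
  let ?W = "(to_torus (fst w), snd w)"
  define g where "g = (\<lambda>x. r * tent {?W} j x)"
  have "g \<in> cones" unfolding cones_def g_def r_def
  proof (rule image_eqI[where x = "(?W, j, q)"])
    have "q \<ge> 0" using r(3) by (simp add: r_def)
    then show "(?W, j, q) \<in> dense_pts \<times> UNIV \<times> {r. 0 \<le> r}" using w(2) by simp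
  qed simp
  moreover have "g x \<le> \<phi> x" for x
  proof (cases "tent {?W} j x = 0")
    case False
    let ?x = "(rep_torus (fst x), snd x)"
    have "w \<in> cover_set {?W}" by (simp add: cover_set_def)
    then have ne: "cover_set {?W} \<noteq> {}" by blast
    have "real j * infdist ?x (cover_set {?W}) < 1" using False by (auto simp: tent_def max_def split: if_splits)
    then have "infdist ?x (cover_set {?W}) < 1 / real j" using j0 by (simp add: field_simps)
    then have "(INF a\<in>cover_set {?W}. dist ?x a) < 1 / real j" using ne by (simp add: infdist_def)
    then obtain a where a: "a \<in> cover_set {?W}" "dist ?x a < 1 / real j"
      using ne by (subst (asm) cINF_less_iff) (auto intro!: bdd_belowI[of _ 0])
    define l where "l = fst a - fst w"
    have l: "l \<in> integer_lattice" and a_eq: "snd a = snd w"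
      using a(1) by (auto simp: cover_set_def l_def to_torus_eq_iff)
    define x' where "x' = (fst ?x - l, snd ?x)"
    have "dist x' w = dist ?x a" using a_eq by (simp add: x'_def l_def dist_prod_def dist_norm algebra_simps)
    moreover have "1 / real j < \<delta> / 2" using j \<delta>(1) j0 by (simp add: field_simps)
    ultimately have "dist x' w < \<delta> / 2" using a(2) by linarith
    moreover have "dist w p0 < \<delta> / 2" using w(1) by (simp add: \<eta>_def dist_commute)
    ultimately have "x' \<in> ball p0 \<delta>" using dist_triangle[of x' p0 w] by (simp add: dist_commute)
    then have "\<Phi> x' > r" using \<delta>(2) by auto
    moreover have "\<Phi> x' = \<phi> x"
      using to_torus_add_lattice[OF l, of "rep_torus (fst x) - l"] by (simp add: \<Phi>_def x'_def)
    moreover have "g x \<le> r * 1" unfolding g_def using r(3) by (intro mult_left_mono tent_bounds(2)) simp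
    ultimately show ?thesis by simp
  qed (simp add: g_def pos)
  moreover have "g z > \<phi> z - e"
  proof -
    have "w \<in> cover_set {?W}" by (simp add: cover_set_def)
    then have "infdist p0 (cover_set {?W}) \<le> dist p0 w" by (rule infdist_le)
    also have "\<dots> \<le> (r - (\<phi> z - e)) / (2 * r * real j)" using w(1) by (simp add: \<eta>_def)
    finally have "r * real j * infdist p0 (cover_set {?W}) \<le> (r - (\<phi> z - e)) / 2"
      using r(3) j0 by (simp add: field_simps)
    then have "r * (1 - real j * infdist p0 (cover_set {?W})) \<ge> r - (r - (\<phi> z - e)) / 2" by (simp add: algebra_simps)
    moreover have "g z \<ge> r * (1 - real j * infdist p0 (cover_set {?W}))"
      unfolding g_def tent_def p0_def using r(3) by (intro mult_left_mono) auto
    ultimately show ?thesis using r(1) by (simp add: field_simps)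
  qed
  ultimately show ?thesis by blast
qed

section \<open>From uniform bounds to the SRB measure\<close>

text \<open>
  The product of a null set with a whole fibre is null, although the fibre has infinite volume.
\<close>

lemma AE_product_volume_fiber:
  assumes "AE p in (torus_measure :: 'u::finite torus measure). \<forall>y :: real ^ 'd. P (p, y)"
  shows "AE z in product_volume. P z"
proof -
  from assms obtain N where N: "N \<in> null_sets torus_measure" "{p. \<not> (\<forall>y. P (p, y))} \<subseteq> N"
    unfolding eventually_ae_filter by auto
  have "emeasure (torus_measure \<Otimes>\<^sub>M (lborel :: (real ^ 'd) measure)) (N \<times> UNIV) = emeasure torus_measure N * emeasure (lborel :: (real ^ 'd) measure) UNIV"
    using N by (intro lborel.emeasure_pair_measure_Times) auto
  then have "N \<times> UNIV \<in> null_sets (product_volume :: ('u torus \<times> (real ^ 'd)) measure)"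
    using N unfolding product_volume_def by (intro null_setsI) auto
  moreover have "{z. \<not> P z} \<subseteq> N \<times> UNIV" using N(2) by auto
  ultimately show ?thesis by (intro AE_I') auto
qed

lemma emeasure_product_volume_Times:
  assumes "A \<in> sets borel" "B \<in> sets borel"
  shows "emeasure (product_volume :: ('u::finite torus \<times> (real ^ 'd)) measure) (A \<times> B) = emeasure torus_measure A * emeasure lborel B"
  unfolding product_volume_def using assms by (intro lborel.emeasure_pair_measure_Times) auto

text \<open>
  The volume is not zero, so some orbit is typical for both measures, and a sequence has only one weak
  limit.
\<close>

lemma SRB_measure_unique:
  fixes T :: "'u::finite torus \<times> (real ^ 'd) \<Rightarrow> _"
  assumes \<mu>: "SRB_measure T \<mu>" and \<nu>: "SRB_measure T \<nu>"
  shows "\<mu> = \<nu>"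
proof (rule measure_eqI_lip_test)
  show "prob_space \<mu>" "sets \<mu> = sets borel" "prob_space \<nu>" "sets \<nu> = sets borel"
    using \<mu> \<nu> by (auto simp: SRB_measure_def)
  have both: "AE z in product_volume. weakly_converges (empirical_measure T z) \<mu> \<and> weakly_converges (empirical_measure T z) \<nu>"
    using \<mu> \<nu> by (auto simp: SRB_measure_def)
  have nontrivial: "\<not> (AE z in (product_volume :: ('u torus \<times> (real ^ 'd)) measure). False)"
  proof
    assume "AE z in (product_volume :: ('u torus \<times> (real ^ 'd)) measure). False"
    then have "emeasure (product_volume :: ('u torus \<times> (real ^ 'd)) measure) (space product_volume) = 0"
      by (simp add: AE_iff_measurable[OF sets.top] )
    moreover have "space (product_volume :: ('u torus \<times> (real ^ 'd)) measure) = UNIV \<times> UNIV"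
      by (simp add: product_volume_def space_pair_measure)
    ultimately show False
      using emeasure_product_volume_Times[of "UNIV :: 'u torus set" "UNIV :: (real ^ 'd) set"]
        torus_prob.emeasure_space_1[where 'n = 'u] by simp
  qed
  have "\<exists>z. weakly_converges (empirical_measure T z) \<mu> \<and> weakly_converges (empirical_measure T z) \<nu>"
  proof (rule ccontr)
    assume "\<nexists>z. weakly_converges (empirical_measure T z) \<mu> \<and> weakly_converges (empirical_measure T z) \<nu>"
    then have "(weakly_converges (empirical_measure T z) \<mu> \<and> weakly_converges (empirical_measure T z) \<nu>) = False" for z
      by blast
    with both have "AE z in (product_volume :: ('u torus \<times> (real ^ 'd)) measure). False"
      by (simp only:)
    with nontrivial show False ..
  qed
  then obtain z where z: "weakly_converges (empirical_measure T z) \<mu>" "weakly_converges (empirical_measure T z) \<nu>"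
    by blast
  fix \<phi> :: "'u torus \<times> (real ^ 'd) \<Rightarrow> real" assume l: "lip_test \<phi>"
  then have "continuous_on UNIV \<phi>" by (rule lip_test_continuous)
  moreover have "bounded (range \<phi>)" using l by (auto simp: lip_test_def bounded_iff)
  ultimately show "(\<integral>z. \<phi> z \<partial>\<mu>) = (\<integral>z. \<phi> z \<partial>\<nu>)"
    using z unfolding weakly_converges_def by (blast intro: LIMSEQ_unique)
qed

text \<open>
  A continuous function is the increasing limit of finite maxima of cones, for which the averages
  converge. Hence the averages of the function are asymptotically at least its integral.
\<close>

lemma lower_limit_of_averages:
  fixes a :: "('u::finite torus \<times> (real ^ 'd) \<Rightarrow> real) \<Rightarrow> nat \<Rightarrow> real"
  assumes \<mu>: "prob_space \<mu>" "sets \<mu> = sets borel"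
    and mono: "\<And>g h n. (\<And>x. g x \<le> h x) \<Longrightarrow> a g n \<le> a h n"
    and lim: "\<And>F. finite F \<Longrightarrow> F \<noteq> {} \<Longrightarrow> F \<subseteq> cones \<Longrightarrow> a (\<lambda>z. Max ((\<lambda>g. g z) ` F)) \<longlonglongrightarrow> (\<integral>z. Max ((\<lambda>g. g z) ` F) \<partial>\<mu>)"
    and \<phi>: "continuous_on UNIV \<phi>" "\<And>z. 0 \<le> \<phi> z" "\<And>z. \<phi> z \<le> b" and e: "e > 0"
  shows "\<forall>\<^sub>F n in sequentially. a \<phi> n > (\<integral>z. \<phi> z \<partial>\<mu>) - e"
proof -
  interpret prob_space \<mu> by fact
  define \<G> where "\<G> = {g \<in> cones. \<forall>x. g x \<le> \<phi> x}"
  have cG: "countable \<G>" unfolding \<G>_def using countable_cones by (rule countable_subset[rotated]) auto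
  have ne: "\<G> \<noteq> {}" using zero_in_cones \<phi>(2) unfolding \<G>_def by blast
  define g where "g = from_nat_into \<G>"
  have g: "g i \<in> \<G>" for i unfolding g_def by (rule from_nat_into[OF ne])
  have gr: "\<exists>i. g i = h" if "h \<in> \<G>" for h
    using from_nat_into_surj[OF cG that] by (simp add: g_def)
  have gc: "g i \<in> cones" and gle: "g i x \<le> \<phi> x" for i x using g[of i] unfolding \<G>_def by blast+
  define H where "H m z = Max ((\<lambda>g. g z) ` (g ` {..m}))" for m z
  have F: "finite (g ` {..m})" "g ` {..m} \<noteq> {}" "g ` {..m} \<subseteq> cones" for m
    using gc by auto
  have H_le: "H m z \<le> \<phi> z" for m z
    unfolding H_def by (subst Max_le_iff) (auto intro: gle)
  have H_ge: "g i z \<le> H m z" if "i \<le> m" for i m z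
    unfolding H_def using that by (intro Max_ge) auto
  have H0: "0 \<le> H m z" for m z
    using H_ge[of 0 m z] cones_nonneg[OF gc[of 0], of z] by simp
  have Hlim: "(\<lambda>m. H m z) \<longlonglongrightarrow> \<phi> z" for z
  proof (rule LIMSEQ_I)
    fix r :: real assume r: "r > 0"
    obtain h where h: "h \<in> cones" "\<And>x. h x \<le> \<phi> x" "h z > \<phi> z - r"
      using cones_below[OF \<phi>(1,2) r] by blast
    then have "h \<in> \<G>" unfolding \<G>_def by blast
    then obtain i where i: "g i = h" using gr by blast
    show "\<exists>no. \<forall>m\<ge>no. norm (H m z - \<phi> z) < r"
    proof (intro exI[of _ i] allI impI)
      fix m assume "i \<le> m"
      from H_ge[OF this, of z] i h(3) H_le[of m z] show "norm (H m z - \<phi> z) < r" by simp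
    qed
  qed
  have Hm: "H m \<in> borel_measurable \<mu>" for m
  proof -
    have "lip_test (H m)" unfolding H_def[abs_def]
      by (rule lip_test_Max[OF F(1,2)]) (use F(3) cones_lip_test in blast)
    then show ?thesis using lip_test_measurable \<mu>(2) by (simp cong: measurable_cong_sets)
  qed
  have \<phi>m: "\<phi> \<in> borel_measurable \<mu>"
    using borel_measurable_continuous_onI[OF \<phi>(1)] \<mu>(2) by (simp cong: measurable_cong_sets)
  have "(\<lambda>m. \<integral>z. H m z \<partial>\<mu>) \<longlonglongrightarrow> (\<integral>z. \<phi> z \<partial>\<mu>)"
  proof (rule integral_dominated_convergence[where w = "\<lambda>_. b"])
    show "AE z in \<mu>. norm (H m z) \<le> b" for m
    proof (rule AE_I2)
      fix z show "norm (H m z) \<le> b" using H0[of m z] H_le[of m z] \<phi>(3)[of z] by simp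
    qed
  qed (use Hm \<phi>m Hlim in auto)
  then have "\<forall>\<^sub>F m in sequentially. (\<integral>z. H m z \<partial>\<mu>) > (\<integral>z. \<phi> z \<partial>\<mu>) - e"
    using e by (intro order_tendstoD) auto
  then obtain m where m: "(\<integral>z. H m z \<partial>\<mu>) > (\<integral>z. \<phi> z \<partial>\<mu>) - e" by (auto simp: eventually_sequentially)
  have "a (H m) \<longlonglongrightarrow> (\<integral>z. H m z \<partial>\<mu>)" using lim[OF F[of m]] unfolding H_def .
  then have "\<forall>\<^sub>F n in sequentially. a (H m) n > (\<integral>z. \<phi> z \<partial>\<mu>) - e" using m by (rule order_tendstoD)
  then show ?thesis
    by eventually_elim (use mono[of "H m" \<phi>] H_le in \<open>blast intro: less_le_trans\<close>)
qed

context skew_system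
begin

lemma limit_mean_T:
  assumes "lip_test \<phi>"
  shows "limit_mean (\<lambda>z. \<phi> (T z)) = limit_mean \<phi>"
proof -
  from assms obtain L where L: "L \<ge> 0" "\<And>p y y'. \<bar>\<phi> (p, y) - \<phi> (p, y')\<bar> \<le> L * norm (y - y')"
    by (rule lip_testE) blast
  from lip_test_T[OF assms] obtain K where K: "K \<ge> 0" "\<And>p y y'. \<bar>\<phi> (T (p, y)) - \<phi> (T (p, y'))\<bar> \<le> K * norm (y - y')"
    by (rule lip_testE) blast
  have "section_mean (\<lambda>z. \<phi> (T z)) = (\<lambda>n. section_mean \<phi> (Suc n))"
    by (simp add: section_mean_def fun_eq_iff)
  moreover have "(\<lambda>n. section_mean \<phi> (Suc n)) \<longlonglongrightarrow> limit_mean \<phi>"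
    using section_mean_limit(1)[OF assms L(2,1)] by (rule LIMSEQ_Suc)
  ultimately show ?thesis
    using section_mean_limit(1)[OF lip_test_T[OF assms] K(2,1)] by (metis LIMSEQ_unique)
qed

text \<open>
  Invariance follows since \<open>\<phi>\<close> and \<open>\<phi> \<circ> T\<close> have the same limit mean. For weak convergence,
  \<open>lower_limit_of_averages\<close> is applied to \<open>\<phi> + b\<close> and to \<open>b - \<phi>\<close>; only the countably many finite maxima
  of cones contribute exceptional null sets.
\<close>

lemma SRB_measure_if_limit_means:
  assumes \<mu>: "prob_space \<mu>" "sets \<mu> = sets borel"
    and mean: "\<And>\<phi>. lip_test \<phi> \<Longrightarrow> (\<integral>z. \<phi> z \<partial>\<mu>) = limit_mean \<phi>"
  shows "SRB_measure T \<mu>"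
proof -
  interpret prob_space \<mu> by fact
  have Tm: "T \<in> \<mu> \<rightarrow>\<^sub>M borel" using T_measurable \<mu>(2) by (simp cong: measurable_cong_sets)
  have inv: "distr \<mu> borel T = \<mu>"
  proof (rule measure_eqI_lip_test)
    show "prob_space (distr \<mu> borel T)" by (rule prob_space_distr[OF Tm])
    fix \<phi> :: "'u torus \<times> (real ^ 'd) \<Rightarrow> real" assume l: "lip_test \<phi>"
    have "(\<integral>z. \<phi> z \<partial>distr \<mu> borel T) = (\<integral>z. \<phi> (T z) \<partial>\<mu>)"
      by (rule integral_distr[OF Tm lip_test_measurable[OF l]])
    also have "\<dots> = (\<integral>z. \<phi> z \<partial>\<mu>)" using mean[OF l] mean[OF lip_test_T[OF l]] limit_mean_T[OF l] by simp
    finally show "(\<integral>z. \<phi> z \<partial>distr \<mu> borel T) = (\<integral>z. \<phi> z \<partial>\<mu>)" .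
  qed (use \<mu> in auto)
  define avg where "avg z \<phi> n = (\<Sum>k<n. \<phi> ((T ^^ k) z)) / n" for z and \<phi> :: "'u torus \<times> (real ^ 'd) \<Rightarrow> real" and n :: nat
  define \<F> where "\<F> = {F. finite F \<and> F \<subseteq> (cones :: ('u torus \<times> (real ^ 'd) \<Rightarrow> real) set)} - {{}}"
  have "countable \<F>" unfolding \<F>_def
    using countable_Collect_finite_subset[OF countable_cones] by (rule countable_Diff)
  moreover have "AE p in torus_measure. \<forall>y. avg (p, y) (\<lambda>z. Max ((\<lambda>g. g z) ` F)) \<longlonglongrightarrow> (\<integral>z. Max ((\<lambda>g. g z) ` F) \<partial>\<mu>)" if "F \<in> \<F>" for F
  proof -
    have l: "lip_test (\<lambda>z. Max ((\<lambda>g. g z) ` F))"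
      using that cones_lip_test by (intro lip_test_Max) (auto simp: \<F>_def)
    show ?thesis unfolding avg_def mean[OF l] by (rule orbit_averages[OF l])
  qed
  ultimately have "AE p in torus_measure. \<forall>F\<in>\<F>. \<forall>y. avg (p, y) (\<lambda>z. Max ((\<lambda>g. g z) ` F)) \<longlonglongrightarrow> (\<integral>z. Max ((\<lambda>g. g z) ` F) \<partial>\<mu>)"
    by (simp add: AE_ball_countable)
  then have "AE p in torus_measure. \<forall>y. \<forall>F\<in>\<F>. avg (p, y) (\<lambda>z. Max ((\<lambda>g. g z) ` F)) \<longlonglongrightarrow> (\<integral>z. Max ((\<lambda>g. g z) ` F) \<partial>\<mu>)"
    by (rule AE_mp) (auto intro!: AE_I2)
  then have "AE z in product_volume. \<forall>F\<in>\<F>. avg z (\<lambda>z. Max ((\<lambda>g. g z) ` F)) \<longlonglongrightarrow> (\<integral>z. Max ((\<lambda>g. g z) ` F) \<partial>\<mu>)"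
    by (rule AE_product_volume_fiber)
  then have "AE z in product_volume. weakly_converges (empirical_measure T z) \<mu>"
  proof (rule AE_mp, intro AE_I2 impI)
    fix z assume lim: "\<forall>F\<in>\<F>. avg z (\<lambda>z. Max ((\<lambda>g. g z) ` F)) \<longlonglongrightarrow> (\<integral>z. Max ((\<lambda>g. g z) ` F) \<partial>\<mu>)"
    have mono: "avg z g n \<le> avg z h n" if "\<And>x. g x \<le> h x" for g h n
      unfolding avg_def by (intro divide_right_mono sum_mono that) simp
    show "weakly_converges (empirical_measure T z) \<mu>"
      unfolding weakly_converges_def
    proof (intro allI impI, elim conjE)
      fix \<phi> :: "'u torus \<times> (real ^ 'd) \<Rightarrow> real" assume c: "continuous_on UNIV \<phi>" and "bounded (range \<phi>)"
      then obtain b where b: "\<And>x. \<bar>\<phi> x\<bar> \<le> b" by (auto simp: bounded_iff)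
      have \<phi>m: "\<phi> \<in> borel_measurable \<mu>"
        using borel_measurable_continuous_onI[OF c] \<mu>(2) by (simp cong: measurable_cong_sets)
      have int: "integrable \<mu> \<phi>" using b \<phi>m by (intro integrable_const_bound[where B = b]) auto
      have b1: "0 \<le> \<phi> x + b" "\<phi> x + b \<le> 2 * b" "0 \<le> b - \<phi> x" "b - \<phi> x \<le> 2 * b" for x
        using b[of x] by auto
      note low = lower_limit_of_averages[OF \<mu>, of "avg z", OF mono]
      have limF: "avg z (\<lambda>z. Max ((\<lambda>g. g z) ` F)) \<longlonglongrightarrow> (\<integral>z. Max ((\<lambda>g. g z) ` F) \<partial>\<mu>)"
        if "finite F" "F \<noteq> {}" "F \<subseteq> cones" for F using lim that by (simp add: \<F>_def)
      have "avg z \<phi> \<longlonglongrightarrow> (\<integral>z. \<phi> z \<partial>\<mu>)"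
      proof (rule LIMSEQ_I)
        fix e :: real assume e: "e > 0"
        have 1: "\<forall>\<^sub>F n in sequentially. avg z (\<lambda>x. \<phi> x + b) n > (\<integral>z. \<phi> z + b \<partial>\<mu>) - e"
          by (rule low[OF _ limF _ b1(1,2) e]) (auto intro!: continuous_intros c)
        have 2: "\<forall>\<^sub>F n in sequentially. avg z (\<lambda>x. b - \<phi> x) n > (\<integral>z. b - \<phi> z \<partial>\<mu>) - e"
          by (rule low[OF _ limF _ b1(3,4) e]) (auto intro!: continuous_intros c)
        have "\<forall>\<^sub>F n in sequentially. norm (avg z \<phi> n - (\<integral>z. \<phi> z \<partial>\<mu>)) < e"
          using 1 2 eventually_gt_at_top[of 0]
        proof eventually_elim
          case (elim n)
          have "avg z (\<lambda>x. \<phi> x + b) n = avg z \<phi> n + b" "avg z (\<lambda>x. b - \<phi> x) n = b - avg z \<phi> n"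
            using elim(3) by (simp_all add: avg_def sum.distrib sum_subtractf add_divide_distrib diff_divide_distrib)
          moreover have "(\<integral>z. \<phi> z + b \<partial>\<mu>) = (\<integral>z. \<phi> z \<partial>\<mu>) + b" "(\<integral>z. b - \<phi> z \<partial>\<mu>) = b - (\<integral>z. \<phi> z \<partial>\<mu>)"
            using int by (simp_all add: prob_space)
          ultimately show ?case using elim(1,2) by simp
        qed
        then show "\<exists>no. \<forall>n\<ge>no. norm (avg z \<phi> n - (\<integral>z. \<phi> z \<partial>\<mu>)) < e" by (simp add: eventually_sequentially)
      qed
      moreover have "integral\<^sup>L (empirical_measure T z n) \<phi> = avg z \<phi> n" for n
        unfolding avg_def by (rule integral_empirical_measure[OF borel_measurable_continuous_onI[OF c]])
      ultimately show "(\<lambda>n. integral\<^sup>L (empirical_measure T z n) \<phi>) \<longlonglongrightarrow> integral\<^sup>L \<mu> \<phi>" by simp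
    qed
  qed
  then show ?thesis using \<mu> inv by (simp add: SRB_measure_def)
qed

text \<open>
  The pushforwards live in a set of finite volume, so the assumed bound is uniform absolute
  continuity. A closed set is approximated by a tent from above with an error that is small for all
  pushforwards at once; as the integrals of the tent converge, so do the measures of the closed set,
  and \<open>setwise_limit_measure\<close> provides the limit.
\<close>

theorem absolutely_continuous_SRB:
  assumes q: "q > 0" and b: "b \<ge> 0"
    and unif: "\<And>n A t. A \<in> sets borel \<Longrightarrow> t > 0 \<Longrightarrow>
      emeasure initial_measure ((T ^^ (q * n)) -` A) \<le> ennreal t * emeasure product_volume A + ennreal (b / t)"
  shows "(\<exists>!\<mu>. SRB_measure T \<mu>) \<and> absolutely_continuous product_volume (THE \<mu>. SRB_measure T \<mu>)"
proof -
  let ?I = "initial_measure :: ('u torus \<times> (real ^ 'd)) measure" and ?P = "product_volume :: ('u torus \<times> (real ^ 'd)) measure"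
  interpret I: prob_space ?I by (rule prob_space_initial)
  define \<nu> where "\<nu> n = distr ?I borel (T ^^ (q * n))" for n
  have \<nu>: "prob_space (\<nu> n)" "sets (\<nu> n) = sets borel" for n
    unfolding \<nu>_def by (auto intro!: I.prob_space_distr)
  have sI: "space ?I = UNIV" using sets_eq_imp_space_eq[OF sets_initial] by simp
  have e\<nu>: "emeasure (\<nu> n) A = emeasure ?I ((T ^^ (q * n)) -` A)" if "A \<in> sets borel" for n A
    unfolding \<nu>_def using that by (subst emeasure_distr) (auto simp: sI)
  define K where "K = (UNIV :: 'u torus set) \<times> cball (0 :: real ^ 'd) (CARD('d) + R0)"
  have K: "K \<in> sets borel" unfolding K_def by (intro borel_closed closed_Times) auto
  define V where "V = density ?P (indicator K)"
  have sP: "sets ?P = sets borel" by (rule sets_product_volume)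
  have sV: "sets V = sets borel" by (simp add: V_def sP)
  have spV: "space V = UNIV" using sets_eq_imp_space_eq[OF sV] by simp
  have eV: "emeasure V A = emeasure ?P (A \<inter> K)" if "A \<in> sets borel" for A
  proof -
    have "indicator K \<in> borel_measurable ?P" using K sP by (intro borel_measurable_indicator) simp
    then have "emeasure V A = (\<integral>\<^sup>+z. indicator K z * indicator A z \<partial>?P)"
      unfolding V_def using that sP by (intro emeasure_density) simp_all
    also have "\<dots> = (\<integral>\<^sup>+z. indicator (A \<inter> K) z \<partial>?P)"
      by (intro nn_integral_cong) (auto simp: indicator_def)
    also have "\<dots> = emeasure ?P (A \<inter> K)" using that K sP by (intro nn_integral_indicator) auto
    finally show ?thesis .
  qed
  have V: "finite_measure V"
  proof (rule finite_measureI)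
    have "emeasure ?P K = emeasure torus_measure (UNIV :: 'u torus set) * emeasure lborel (cball (0 :: real ^ 'd) (CARD('d) + R0))"
      unfolding K_def by (rule emeasure_product_volume_Times) auto
    also have "\<dots> < \<top>"
      using torus_prob.emeasure_space_1[where 'n = 'u] emeasure_lborel_cball_finite[of "0 :: real ^ 'd" "CARD('d) + R0"] by simp
    finally show "emeasure V (space V) \<noteq> \<infinity>" using eV[of UNIV] by (simp add: spV)
  qed
  interpret V: finite_measure V by (rule V)
  have inK: "AE z in ?I. (T ^^ n) z \<in> K" for n
    using AE_initial_bound
  proof (rule AE_mp, intro AE_I2 impI)
    fix z :: "'u torus \<times> (real ^ 'd)" assume "norm (snd z) \<le> CARD('d)"
    with snd_T_bound[of n z] show "(T ^^ n) z \<in> K" by (simp add: K_def mem_Times_iff)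
  qed
  have \<nu>K: "emeasure (\<nu> n) A = emeasure (\<nu> n) (A \<inter> K)" if A: "A \<in> sets borel" for n A
    unfolding e\<nu>[OF A] e\<nu>[OF sets.Int[OF A K]]
  proof (rule emeasure_eq_AE)
    show "AE x in ?I. (x \<in> (T ^^ (q * n)) -` A) = (x \<in> (T ^^ (q * n)) -` (A \<inter> K))"
      using inK[of "q * n"] by (rule AE_mp) (auto intro!: AE_I2)
  qed (use A K in \<open>auto simp: sets_initial intro!: measurable_sets_borel[OF T_iterate_measurable]\<close>)
  have bound: "measure (\<nu> n) A \<le> t * measure V A + b / t" if A: "A \<in> sets borel" and t: "t > 0" for n A t
  proof -
    interpret prob_space "\<nu> n" by (rule \<nu>)
    have "ennreal (measure (\<nu> n) A) = emeasure (\<nu> n) (A \<inter> K)" using \<nu>K[OF A, of n] by (simp only: emeasure_eq_measure)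
    also have "\<dots> \<le> ennreal t * emeasure ?P (A \<inter> K) + ennreal (b / t)"
      unfolding e\<nu>[OF sets.Int[OF A K]] by (rule unif[OF sets.Int[OF A K] t])
    also have "\<dots> = ennreal t * ennreal (measure V A) + ennreal (b / t)"
      using eV[OF A] by (simp add: V.emeasure_eq_measure)
    also have "\<dots> = ennreal (t * measure V A + b / t)"
      using t b by (simp add: ennreal_mult ennreal_plus)
    finally show ?thesis using t b by (simp add: add_nonneg_nonneg del: ennreal_plus)
  qed
  have uni: "\<exists>\<delta>>0. \<forall>n. \<forall>A\<in>sets V. measure V A < \<delta> \<longrightarrow> measure (\<nu> n) A \<le> e" if e: "e > 0" for e
  proof -
    (* this makes b / t at most e / 2, whatever the set *)
    define t where "t = 2 * b / e + 1"
    have t: "t > 0" using b e by (simp add: t_def add_nonneg_pos)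
    have bt: "b / t \<le> e / 2" using t e b by (simp add: t_def field_simps)
    have tm: "t * m \<le> e / 2" if "m < e / (2 * t)" for m using that t by (simp add: field_simps)
    show ?thesis
    proof (intro exI[of _ "e / (2 * t)"] conjI allI ballI impI)
      show "0 < e / (2 * t)" using t e by simp
      fix n A assume A: "A \<in> sets V" "measure V A < e / (2 * t)"
      from A(1) have "A \<in> sets borel" by (simp only: sV)
      from bound[OF this t, of n] tm[OF A(2)] bt show "measure (\<nu> n) A \<le> e" by linarith
    qed
  qed
  have test_lim: "(\<lambda>n. \<integral>z. \<phi> z \<partial>\<nu> n) \<longlonglongrightarrow> limit_mean \<phi>" if l: "lip_test \<phi>" for \<phi>
  proof -
    have "(\<integral>z. \<phi> z \<partial>\<nu> n) = (\<integral>z. \<phi> ((T ^^ (q * n)) z) \<partial>?I)" for n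
      unfolding \<nu>_def by (rule integral_distr) (use lip_test_measurable[OF l] in auto)
    moreover have "filterlim (\<lambda>n. q * n) at_top sequentially"
      using q by (intro filterlim_subseq strict_monoI) simp
    ultimately show ?thesis using filterlim_compose[OF initial_means[OF l]] by simp
  qed
  have conv: "convergent (\<lambda>n. measure (\<nu> n) A)" if A: "closed A" for A
  proof (cases "A = {}")
    case False
    have Ab: "A \<in> sets borel" using A by (rule borel_closed)
    show ?thesis
    proof (rule convergent_of_approximants)
      fix e :: real assume "e > 0"
      then obtain \<delta> where \<delta>: "\<delta> > 0" "\<And>n S. S \<in> sets V \<Longrightarrow> measure V S < \<delta> \<Longrightarrow> measure (\<nu> n) S \<le> e" using uni by blast
      (* the error of approximating A by its j-th tent is supported here *)
      define S where "S j = {z. tent A j z > 0} - A" for j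
      have tm: "tent A j \<in> borel_measurable borel" for j by (rule lip_test_measurable[OF lip_test_tent])
      have Sm: "S j \<in> sets borel" for j
      proof -
        have "{z \<in> space borel. tent A j z > 0} \<in> sets borel" using tm by measurable
        then show ?thesis using Ab by (simp add: S_def)
      qed
      have "decseq S" unfolding decseq_def S_def using tent_limit(3)[OF A False] by (fastforce intro: less_le_trans)
      moreover have "(\<Inter>j. S j) = {}"
      proof (rule ccontr)
        assume "(\<Inter>j. S j) \<noteq> {}"
        then obtain z where z: "\<And>j. z \<in> S j" by blast
        then have "z \<notin> A" by (auto simp: S_def)
        have d: "tent A j z \<noteq> 0" for j using z[of j] by (simp add: S_def)
        from tent_limit(4)[OF A False \<open>z \<notin> A\<close>] d show False by blast
      qed
      ultimately have "(\<lambda>j. measure V (S j)) \<longlonglongrightarrow> 0"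
        using V.finite_Lim_measure_decseq[of S] Sm by (auto simp: sV)
      then obtain j where j: "measure V (S j) < \<delta>"
        using order_tendstoD(2)[OF _ \<delta>(1)] by (fastforce simp: eventually_sequentially)
      have "\<bar>measure (\<nu> n) A - (\<integral>z. tent A j z \<partial>\<nu> n)\<bar> \<le> e" for n
      proof -
        interpret prob_space "\<nu> n" by (rule \<nu>)
        have sp: "space (\<nu> n) = UNIV" using sets_eq_imp_space_eq[OF \<nu>(2)] by simp
        have [measurable]: "tent A j \<in> borel_measurable (\<nu> n)" using tm \<nu>(2) by (simp cong: measurable_cong_sets)
        have it: "integrable (\<nu> n) (tent A j)"
          using tent_bounds[of A j] by (intro integrable_const_bound[where B = 1]) auto
        have iA: "integrable (\<nu> n) (indicator A :: _ \<Rightarrow> real)" "integrable (\<nu> n) (indicator (S j) :: _ \<Rightarrow> real)"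
          using Ab Sm \<nu>(2) by (auto simp: emeasure_eq_measure)
        have "(\<integral>z. indicator A z \<partial>\<nu> n) \<le> (\<integral>z. tent A j z \<partial>\<nu> n)"
        proof (rule integral_mono[OF iA(1) it])
          fix z show "indicator A z \<le> tent A j z"
            using tent_bounds(1)[of A j z] tent_limit(2)[OF A False, of z j] by (cases "z \<in> A") simp_all
        qed
        moreover have "(\<integral>z. tent A j z \<partial>\<nu> n) \<le> (\<integral>z. indicator A z + indicator (S j) z \<partial>\<nu> n)"
        proof (intro integral_mono it Bochner_Integration.integrable_add iA)
          fix z show "tent A j z \<le> indicator A z + indicator (S j) z"
            using tent_bounds[of A j z] by (auto simp: indicator_def S_def)
        qed
        moreover have "measure (\<nu> n) (S j) \<le> e" using \<delta>(2)[OF _ j] Sm by (simp add: sV)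
        ultimately show ?thesis using iA by (simp add: sp)
      qed
      moreover have "convergent (\<lambda>n. \<integral>z. tent A j z \<partial>\<nu> n)" using test_lim[OF lip_test_tent] by (rule convergentI)
      ultimately show "\<exists>y. convergent y \<and> (\<forall>n. \<bar>measure (\<nu> n) A - y n\<bar> \<le> e)" by blast
    qed
  qed (simp add: convergent_const)
  have "\<exists>\<mu>. sets \<mu> = sets V \<and> prob_space \<mu> \<and> (\<forall>A\<in>sets V. (\<lambda>n. measure (\<nu> n) A) \<longlonglongrightarrow> measure \<mu> A)"
  proof (rule setwise_limit_measure[OF V \<nu>(1) _ _ _ _ uni])
    show "sets (\<nu> n) = sets V" for n using \<nu> sV by simp
    show "sets V = sigma_sets (space V) (Collect closed)" by (simp add: sV spV borel_eq_closed)
    show "Int_stable (Collect closed :: ('u torus \<times> (real ^ 'd)) set set)" by (auto simp: Int_stable_def)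
    show "Collect closed \<subseteq> Pow (space V)" by (simp add: spV)
  qed (use conv in auto)
  then obtain \<mu> where \<mu>: "prob_space \<mu>" "sets \<mu> = sets borel"
    and lim\<mu>: "\<And>A. A \<in> sets borel \<Longrightarrow> (\<lambda>n. measure (\<nu> n) A) \<longlonglongrightarrow> measure \<mu> A" by (auto simp: sV)
  interpret \<mu>: prob_space \<mu> by (rule \<mu>)
  have srb: "SRB_measure T \<mu>"
  proof (rule SRB_measure_if_limit_means[OF \<mu>])
    fix \<phi> :: "'u torus \<times> (real ^ 'd) \<Rightarrow> real" assume l: "lip_test \<phi>"
    then obtain c where c: "\<And>z. \<bar>\<phi> z\<bar> \<le> c" unfolding lip_test_def by blast
    have "(\<lambda>n. \<integral>z. \<phi> z \<partial>\<nu> n) \<longlonglongrightarrow> (\<integral>z. \<phi> z \<partial>\<mu>)"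
      using \<nu> \<mu> lim\<mu> lip_test_measurable[OF l]
      by (intro setwise_limit_integral[OF _ _ _ _ _ c]) (auto cong: measurable_cong_sets)
    with test_lim[OF l] show "(\<integral>z. \<phi> z \<partial>\<mu>) = limit_mean \<phi>" by (rule LIMSEQ_unique[rotated])
  qed
  have ac: "absolutely_continuous ?P \<mu>"
    unfolding absolutely_continuous_def
  proof
    fix A assume A: "A \<in> null_sets ?P"
    then have Ab: "A \<in> sets borel" by (auto simp: sP)
    have "measure \<mu> A \<le> 0 + e" if e: "e > 0" for e
    proof -
      define t where "t = b / e + 1"
      have t: "t > 0" using b e by (simp add: t_def add_nonneg_pos)
      have "emeasure V A = 0"
      proof -
        have "emeasure ?P (A \<inter> K) \<le> emeasure ?P A" using A by (intro emeasure_mono) auto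
        then show ?thesis using eV[OF Ab] null_setsD1[OF A] by simp
      qed
      then have "measure V A = 0" by (simp add: measure_def)
      then have "measure (\<nu> n) A \<le> b / t" for n using bound[OF Ab t, of n] by simp
      then have "measure \<mu> A \<le> b / t" by (intro LIMSEQ_le_const2[OF lim\<mu>[OF Ab]]) auto
      also have "b / t \<le> e" using t e b by (simp add: t_def field_simps)
      finally show ?thesis by simp
    qed
    then have "measure \<mu> A \<le> 0" by (rule field_le_epsilon)
    then show "A \<in> null_sets \<mu>"
      using Ab \<mu>(2) measure_nonneg[of \<mu> A] by (intro null_setsI) (auto simp: \<mu>.emeasure_eq_measure)
  qed
  have uniq: "\<rho> = \<mu>" if "SRB_measure T \<rho>" for \<rho> by (rule SRB_measure_unique[OF that srb])
  have the: "(THE \<mu>. SRB_measure T \<mu>) = \<mu>" by (rule the_equality[where P = "SRB_measure T", OF srb uniq])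
  show ?thesis
  proof (rule conjI)
    show "\<exists>!\<mu>. SRB_measure T \<mu>" by (rule ex1I[where P = "SRB_measure T", OF srb uniq])
    show "absolutely_continuous ?P (THE \<mu>. SRB_measure T \<mu>)" unfolding the by (rule ac)
  qed
qed

end

section \<open>Blocks of iterates and transversality\<close>

lemma emeasure_lborel_translate:
  fixes U :: "'a::euclidean_space set"
  assumes "U \<in> sets borel"
  shows "emeasure lborel ((\<lambda>w. v + w) -` U) = emeasure lborel U"
proof -
  have "emeasure lborel U = emeasure (distr lborel borel ((+) v)) U" by (simp add: lborel_distr_plus)
  also have "\<dots> = emeasure lborel ((\<lambda>w. v + w) -` U)" using assms by (subst emeasure_distr) auto
  finally show ?thesis ..
qed

lemma funpow_add_apply: "(h ^^ m) ((h ^^ n) x) = (h ^^ (m + n)) x"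
  by (simp add: funpow_add)

text \<open>
  If \<open>B\<close> is close to the identity, it maps the unit ball onto a set that contains a slightly smaller ball.
\<close>

lemma (in skew_block) jac_lower_bound:
  assumes \<eta>: "0 \<le> \<eta>" "\<eta> < 1" and near: "\<And>z. norm (B z - z) \<le> \<eta> * norm z"
  shows "(1 - \<eta>) ^ CARD('d) \<le> jac"
proof -
  have sub: "ball 0 (1 - \<eta>) \<subseteq> Bi -` ball (0 :: real ^ 'd) 1"
  proof
    fix z :: "real ^ 'd" assume "z \<in> ball 0 (1 - \<eta>)"
    then have z: "norm z < 1 - \<eta>" by simp
    have "norm (Bi z) - norm z \<le> norm (B (Bi z) - Bi z)" using norm_triangle_ineq2[of "Bi z" z] by (simp add: norm_minus_commute)
    also have "\<dots> \<le> \<eta> * norm (Bi z)" by (rule near)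
    finally have "(1 - \<eta>) * norm (Bi z) < (1 - \<eta>) * 1" using z by (simp add: algebra_simps)
    then show "z \<in> Bi -` ball 0 1" using \<eta> by (simp only: mult_less_cancel_left_pos) simp
  qed
  have v: "emeasure lborel (Bi -` ball (0 :: real ^ 'd) 1) = ennreal jac * emeasure lborel (ball (0 :: real ^ 'd) 1)"
    unfolding volume_factor_Bi[symmetric] by (rule emeasure_linear_vimage[OF linear_Bi linear_B]) simp_all
  define W where "W = measure lborel (ball (0 :: real ^ 'd) 1)"
  have W: "emeasure lborel (ball (0 :: real ^ 'd) 1) = ennreal W"
    unfolding W_def by (rule emeasure_eq_ennreal_measure) (use emeasure_lborel_ball_finite[of "0::real ^ 'd" 1] in \<open>simp add: less_top\<close>)
  have W0: "W > 0" unfolding W_def by (simp add: content_ball_pos)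
  have "ennreal ((1 - \<eta>) ^ CARD('d)) * ennreal W = emeasure lborel (ball (0 :: real ^ 'd) ((1 - \<eta>) * 1))"
    using \<eta> emeasure_ball_scale[of 1 "1 - \<eta>" "0 :: real ^ 'd" 0] by (simp add: W)
  also have "\<dots> \<le> emeasure lborel (Bi -` ball (0 :: real ^ 'd) 1)"
    using sub by (intro emeasure_mono) (auto intro: measurable_sets_borel[OF measurable_Bi])
  also have "\<dots> = ennreal jac * ennreal W" by (simp only: v W)
  finally have "ennreal ((1 - \<eta>) ^ CARD('d) * W) \<le> ennreal (jac * W)"
    using \<eta> jac_pos W0 by (simp add: ennreal_mult)
  then show ?thesis using W0 jac_pos by simp
qed

locale invertible_skew_system = skew_system E C f \<kappa> lam Lf bf
  for E :: "real ^ 'u ^ 'u" and C :: "real ^ 'd ^ 'd" and f :: "'u torus \<Rightarrow> real ^ 'd" and \<kappa> lam Lf bf +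
  assumes invertible_C: "invertible C"
begin

abbreviation "Ck k \<equiv> ((*v) C) ^^ k"
abbreviation "Cik k \<equiv> ((*v) (matrix_inv C)) ^^ k"

lemma Ck_Cik: "Ck k (Cik k x) = x" "Cik k (Ck k x) = x"
  by (simp_all add: funpow_inverse matrix_inverse_apply[OF invertible_C])

lemma Ck_norm: "norm (Ck k y) \<le> norm y"
proof (induction k)
  case (Suc k)
  have "norm (Ck (Suc k) y) \<le> lam * norm (Ck k y)" using lam(3) by simp
  also have "\<dots> \<le> 1 * norm (Ck k y)" using lam by (intro mult_right_mono) auto
  finally show ?case using Suc by simp
qed simp

lemmas Ck_add = linear_add[OF matrix_iterate_linear[where A = C]]
lemmas Ck_diff = linear_diff[OF matrix_iterate_linear[where A = C]]
lemmas Eik_add = linear_add[OF matrix_iterate_linear[where A = "matrix_inv E"]]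
lemmas Eik_diff = linear_diff[OF matrix_iterate_linear[where A = "matrix_inv E"]]

text \<open>
  The fibre translation of the power \<open>T ^^ q\<close>, which is again a skew product (\<open>snd_T_affine\<close>).
\<close>

definition block_fun :: "nat \<Rightarrow> real ^ 'u \<Rightarrow> real ^ 'd" where
  "block_fun q x = snd ((T ^^ q) (to_torus x, 0))"

lemma snd_T_affine: "snd ((T ^^ q) (p, y)) = snd ((T ^^ q) (p, 0)) + Ck q y"
proof (induction q)
  case (Suc q)
  have A: "snd ((T ^^ Suc q) (p, y')) = C *v snd ((T ^^ q) (p, y')) + f ((tm ^^ q) p)" for y'
    by (simp only: funpow.simps comp_apply T_eq[of "(T ^^ q) (p, y')"] snd_conv fst_T fst_conv)
  show ?case
    unfolding A[of y] A[of 0] Suc by (simp only: funpow.simps comp_apply matrix_vector_right_distrib add_ac)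
qed simp

lemma measurable_block_fun: "block_fun q \<in> borel_measurable borel"
proof -
  have "(\<lambda>p::'u torus. (p, 0 :: real ^ 'd)) \<in> borel \<rightarrow>\<^sub>M borel"
    by (intro borel_measurable_continuous_onI continuous_on_Pair continuous_on_id continuous_on_const)
  from measurable_compose[OF measurable_compose[OF measurable_to_torus this] T_iterate_measurable[of q]]
  have "(\<lambda>x. (T ^^ q) (to_torus x, 0)) \<in> borel \<rightarrow>\<^sub>M borel" .
  moreover have "snd \<in> borel \<rightarrow>\<^sub>M (borel :: (real ^ 'd) measure)"
    by (intro borel_measurable_continuous_onI continuous_on_snd continuous_on_id)
  ultimately show ?thesis unfolding block_fun_def by (rule measurable_compose)
qed

lemma block_fun_periodic: "lattice_periodic (block_fun q)"
  by (simp add: lattice_periodic_def block_fun_def to_torus_add_lattice)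

sublocale blk: skew_block "Ek q" "Eik q" "Ck q" "Cik q" "block_fun q" for q
  by (intro skew_block.intro skew_block_axioms.intro iter.lattice_map_axioms matrix_iterate_linear Ck_Cik
      block_fun_periodic measurable_block_fun)

lemma lifted_iterate:
  "(T ^^ (q * n)) (to_torus x, z) = (to_torus (fst ((blk.lifted q ^^ n) (x, z))), snd ((blk.lifted q ^^ n) (x, z)))"
proof (induction n)
  case (Suc n)
  define w where "w = (blk.lifted q ^^ n) (x, z)"
  have "(T ^^ (q * Suc n)) (to_torus x, z) = (T ^^ q) (to_torus (fst w), snd w)"
    using Suc by (simp add: funpow_add w_def)
  also have "\<dots> = (to_torus (Ek q (fst w)), block_fun q (fst w) + Ck q (snd w))"
    using fst_T[of q "(to_torus (fst w), snd w)"] snd_T_affine[of q "to_torus (fst w)" "snd w"]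
    by (simp add: prod_eq_iff tm_to_torus block_fun_def)
  also have "\<dots> = (to_torus (fst (blk.lifted q w)), snd (blk.lifted q w))" by (simp add: blk.lifted_def)
  finally show ?case by (simp add: w_def)
qed simp

lemma borel_torus_prod: "(borel :: ('u torus \<times> (real ^ 'd)) measure) = borel \<Otimes>\<^sub>M borel"
  by (rule borel_prod[symmetric])

text \<open>
  \<open>pushforward_uniform_bound\<close> for the power \<open>T ^^ q\<close>, carried over from the lift to the torus.
\<close>

lemma pushforward_bound:
  assumes e: "blk.energy q n \<le> ennreal b" and t: "t > 0" and A: "A \<in> sets borel"
  shows "emeasure initial_measure ((T ^^ (q * n)) -` A) \<le> ennreal t * emeasure product_volume A + ennreal (b / t)"
proof -
  let ?U = "uniform_measure lborel (box (0::real^'d) One)"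
  interpret U: prob_space ?U by (rule prob_space_uniform_box)
  define A' where "A' = (T ^^ (q * n)) -` A"
  define S where "S = cover_set A"
  have A'b: "A' \<in> sets borel" unfolding A'_def by (rule measurable_sets_borel[OF T_iterate_measurable A])
  have A'm [measurable]: "A' \<in> sets (borel \<Otimes>\<^sub>M borel)" using A'b by (simp only: borel_torus_prod)
  have Am [measurable]: "A \<in> sets (borel \<Otimes>\<^sub>M borel)" using A by (simp only: borel_torus_prod)
  have Sm [measurable]: "S \<in> sets (borel \<Otimes>\<^sub>M borel)"
  proof -
    have "(\<lambda>p :: (real^'u) \<times> (real^'d). (to_torus (fst p), snd p)) \<in> borel \<Otimes>\<^sub>M borel \<rightarrow>\<^sub>M borel \<Otimes>\<^sub>M borel"
      by measurable
    from measurable_sets[OF this Am] show ?thesis by (simp add: S_def cover_set_def vimage_def space_pair_measure)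
  qed
  have box1: "emeasure lborel (box (0::real^'d) One) = 1" by (simp add: emeasure_lborel_box)
  have "emeasure initial_measure A' = (\<integral>\<^sup>+p. emeasure ?U (Pair p -` A') \<partial>torus_measure)"
    unfolding initial_measure_def using A'm by (intro U.emeasure_pair_measure_alt) (simp cong: sets_pair_measure_cong)
  also have "\<dots> = (\<integral>\<^sup>+p. (\<integral>\<^sup>+z\<in>box 0 One. indicator A' (p, z) \<partial>lborel) \<partial>torus_measure)"
  proof (rule nn_integral_cong)
    fix p :: "'u torus"
    have m: "Pair p -` A' \<in> sets borel" by (rule sets_Pair1[OF A'm])
    have "emeasure ?U (Pair p -` A') = emeasure lborel (box 0 One \<inter> Pair p -` A')"
      using m by (subst emeasure_uniform_measure) (auto simp: box1 divide_ennreal_def)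
    also have "\<dots> = (\<integral>\<^sup>+z. indicator (box 0 One \<inter> Pair p -` A') z \<partial>lborel)" using m by simp
    also have "\<dots> = (\<integral>\<^sup>+z\<in>box 0 One. indicator A' (p, z) \<partial>lborel)"
      by (intro nn_integral_cong) (auto simp: indicator_def)
    finally show "emeasure ?U (Pair p -` A') = (\<integral>\<^sup>+z\<in>box 0 One. indicator A' (p, z) \<partial>lborel)" .
  qed
  also have "\<dots> = (\<integral>\<^sup>+x\<in>half_open_cube. (\<integral>\<^sup>+z\<in>box 0 One. indicator A' (to_torus x, z) \<partial>lborel) \<partial>lborel)"
    by (rule nn_integral_torus) measurable
  also have "\<dots> = (\<integral>\<^sup>+x\<in>half_open_cube. (\<integral>\<^sup>+z\<in>box 0 One. indicator S ((blk.lifted q ^^ n) (x, z)) \<partial>lborel) \<partial>lborel)"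
  proof -
    have "indicator A' (to_torus x, z) = (indicator S ((blk.lifted q ^^ n) (x, z)) :: ennreal)" for x z
      by (simp add: indicator_def A'_def S_def cover_set_def lifted_iterate)
    then show ?thesis by simp
  qed
  also have "\<dots> \<le> ennreal t * (\<integral>\<^sup>+x\<in>half_open_cube. (\<integral>\<^sup>+z. indicator S (x, z) \<partial>lborel) \<partial>lborel) + ennreal (b / t)"
    by (rule blk.pushforward_uniform_bound[OF e t Sm]) (simp add: S_def cover_set_def to_torus_add_lattice)
  also have "(\<integral>\<^sup>+x\<in>half_open_cube. (\<integral>\<^sup>+z. indicator S (x, z) \<partial>lborel) \<partial>lborel) = emeasure product_volume A"
  proof -
    have "emeasure product_volume A = (\<integral>\<^sup>+p. emeasure lborel (Pair p -` A) \<partial>torus_measure)"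
      unfolding product_volume_def using Am by (intro lborel.emeasure_pair_measure_alt) (simp cong: sets_pair_measure_cong)
    also have "\<dots> = (\<integral>\<^sup>+p. (\<integral>\<^sup>+z. indicator A (p, z) \<partial>lborel) \<partial>torus_measure)"
    proof (rule nn_integral_cong)
      fix p :: "'u torus"
      have m: "Pair p -` A \<in> sets borel" by (rule sets_Pair1[OF Am])
      have "emeasure lborel (Pair p -` A) = (\<integral>\<^sup>+z. indicator (Pair p -` A) z \<partial>lborel)" using m by simp
      also have "\<dots> = (\<integral>\<^sup>+z. indicator A (p, z) \<partial>lborel)" by (intro nn_integral_cong) (auto simp: indicator_def)
      finally show "emeasure lborel (Pair p -` A) = (\<integral>\<^sup>+z. indicator A (p, z) \<partial>lborel)" .
    qed
    also have "\<dots> = (\<integral>\<^sup>+x\<in>half_open_cube. (\<integral>\<^sup>+z. indicator A (to_torus x, z) \<partial>lborel) \<partial>lborel)"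
      by (rule nn_integral_torus) measurable
    finally show ?thesis by (simp add: S_def cover_set_def indicator_def)
  qed
  finally show ?thesis by (simp add: A'_def)
qed

text \<open>
  The fibre translation of a block, read from its end point: the sum of the values of \<open>f\<close> along the
  backward orbit of \<open>x\<close>, contracted by the powers of \<open>C\<close> (\<open>block_fun_Eik\<close>).
\<close>

definition hist :: "nat \<Rightarrow> real ^ 'u \<Rightarrow> real ^ 'd" where
  "hist q x = (\<Sum>k<q. Ck k (lift f (Eik (Suc k) x)))"

lemma block_fun_Eik: "block_fun q (Eik q x) = hist q x"
proof (induction q arbitrary: x)
  case 0
  then show ?case by (simp add: block_fun_def hist_def)
next
  case (Suc q)
  let ?y = "matrix_inv E *v x"
  have e: "Eik (Suc q) x = Eik q ?y" by (simp add: funpow_swap1)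
  have "(tm ^^ q) (to_torus (Eik q ?y)) = to_torus ?y" by (simp add: tm_to_torus Ek_Eik)
  then have "block_fun (Suc q) (Eik (Suc q) x) = C *v block_fun q (Eik q ?y) + lift f ?y"
    unfolding e by (simp add: block_fun_def T_eq fst_T lift_def)
  also have "\<dots> = C *v (\<Sum>k<q. Ck k (lift f (Eik (Suc k) ?y))) + lift f ?y" by (simp only: Suc hist_def)
  also have "C *v (\<Sum>k<q. Ck k (lift f (Eik (Suc k) ?y))) = (\<Sum>k<q. Ck (Suc k) (lift f (Eik (Suc (Suc k)) x)))"
    by (subst linear_sum[OF matrix_vector_mul_linear]) (simp add: funpow_swap1)
  also have "\<dots> + lift f ?y = hist (Suc q) x"
    unfolding hist_def by (subst sum.lessThan_Suc_shift) simp
  finally show ?case .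
qed

text \<open>
  The Lipschitz constant that the graph transform preserves: it solves \<open>\<sigma> = Lf * \<kappa> + \<kappa> * \<sigma>\<close>.
\<close>

definition \<sigma> :: real where "\<sigma> = Lf * \<kappa> / (1 - \<kappa>)"

lemma \<sigma>_nonneg: "\<sigma> \<ge> 0" using Lf(1) \<kappa> by (simp add: \<sigma>_def)

lemma geometric_bound:
  assumes "finite S" "S \<subseteq> {..<q}"
  shows "(\<Sum>k\<in>S. \<kappa> ^ Suc k) \<le> \<kappa> * (1 - \<kappa> ^ q) / (1 - \<kappa>)"
proof -
  have "(\<Sum>k\<in>S. \<kappa> ^ Suc k) \<le> (\<Sum>k<q. \<kappa> ^ Suc k)" using assms \<kappa>(1) by (intro sum_mono2) auto
  also have "\<dots> = \<kappa> * (\<Sum>k<q. \<kappa> ^ k)" by (simp add: sum_distrib_left)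
  also have "(\<Sum>k<q. \<kappa> ^ k) = (1 - \<kappa> ^ q) / (1 - \<kappa>)" using \<kappa>(2) by (simp add: sum_gp_strict)
  finally show ?thesis by simp
qed

lemma hist_term_lipschitz:
  assumes "\<And>x x'. norm (s x - s x') \<le> M * norm (x - x')" "M \<ge> 0"
  shows "norm (Ck k (s (Eik m (x + d))) - Ck k (s (Eik m (x' + d)))) \<le> M * \<kappa> ^ m * norm (x - x')"
proof -
  have "norm (Ck k (s (Eik m (x + d))) - Ck k (s (Eik m (x' + d)))) = norm (Ck k (s (Eik m (x + d)) - s (Eik m (x' + d))))"
    by (simp only: Ck_diff)
  also have "\<dots> \<le> norm (s (Eik m (x + d)) - s (Eik m (x' + d)))" by (rule Ck_norm)
  also have "\<dots> \<le> M * norm (Eik m (x + d) - Eik m (x' + d))" by (rule assms)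
  also have "Eik m (x + d) - Eik m (x' + d) = Eik m (x - x')" by (simp add: Eik_add Eik_diff)
  also have "M * norm (Eik m (x - x')) \<le> M * (\<kappa> ^ m * norm (x - x'))" by (intro mult_left_mono Eik_norm assms)
  finally show ?thesis by (simp add: mult.assoc)
qed

lemma branch_lipschitz: "norm (blk.branch q a x - blk.branch q a x') \<le> \<sigma> * norm (x - x')"
proof (induction a arbitrary: x x')
  case Nil
  then show ?case using \<sigma>_nonneg by simp
next
  case (Cons d a)
  have "norm (hist q (x + d) - hist q (x' + d)) \<le> (\<Sum>k<q. norm (Ck k (lift f (Eik (Suc k) (x + d))) - Ck k (lift f (Eik (Suc k) (x' + d)))))"
    unfolding hist_def by (simp only: sum_subtractf[symmetric] norm_sum)
  also have "\<dots> \<le> (\<Sum>k<q. Lf * \<kappa> ^ Suc k * norm (x - x'))"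
    by (intro sum_mono hist_term_lipschitz Lf)
  also have "\<dots> = Lf * (\<Sum>k<q. \<kappa> ^ Suc k) * norm (x - x')" by (simp add: sum_distrib_left sum_distrib_right)
  also have "\<dots> \<le> Lf * (\<kappa> * (1 - \<kappa> ^ q) / (1 - \<kappa>)) * norm (x - x')"
    by (intro mult_right_mono mult_left_mono geometric_bound Lf) auto
  also have "Lf * (\<kappa> * (1 - \<kappa> ^ q) / (1 - \<kappa>)) = \<sigma> - \<sigma> * \<kappa> ^ q" by (simp add: \<sigma>_def algebra_simps diff_divide_distrib)
  finally have 1: "norm (hist q (x + d) - hist q (x' + d)) \<le> (\<sigma> - \<sigma> * \<kappa> ^ q) * norm (x - x')" .
  have 2: "norm (Ck q (blk.branch q a (Eik q (x + d))) - Ck q (blk.branch q a (Eik q (x' + d)))) \<le> \<sigma> * \<kappa> ^ q * norm (x - x')"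
    by (rule hist_term_lipschitz[OF Cons \<sigma>_nonneg])
  have "blk.branch q (d # a) x - blk.branch q (d # a) x' =
      (hist q (x + d) - hist q (x' + d)) + (Ck q (blk.branch q a (Eik q (x + d))) - Ck q (blk.branch q a (Eik q (x' + d))))"
    by (simp add: block_fun_Eik)
  then have "norm (blk.branch q (d # a) x - blk.branch q (d # a) x') \<le>
     (\<sigma> - \<sigma> * \<kappa> ^ q) * norm (x - x') + \<sigma> * \<kappa> ^ q * norm (x - x')"
    using norm_triangle_mono[OF 1 2] by (simp only:)
  then show ?case by (simp add: algebra_simps)
qed

text \<open>
  Two inverse branches of \<open>E ^^ q\<close> are compared: the one given by the lattice vector 0 and the one given
  by \<open>Ek j l\<close>. Their backward orbits agree modulo the lattice for \<open>j\<close> steps, so these contributions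
  cancel. At step \<open>j + 1\<close> the second orbit passes through the bump of \<open>F0\<close> and produces a term close to
  \<open>s\<close> when the base point moves by \<open>R s\<close>; all other values of \<open>F0\<close> vanish. What remains is the perturbation
  \<open>e\<close>, with a geometric sum of small Lipschitz constants, and the earlier history, which is contracted by
  \<open>\<kappa> ^ q\<close>. In the application \<open>R\<close> depends on \<open>j\<close> but not on \<open>q\<close>, so a large \<open>q\<close> makes the
  last error small.
\<close>

theorem absolutely_continuous_SRB_of_transversality:
  fixes F0 e :: "real ^ 'u \<Rightarrow> real ^ 'd" and R :: "real ^ 'd \<Rightarrow> real ^ 'u"
    and r \<epsilon> \<eta> :: real
  assumes l: "l \<in> integer_lattice" "matrix_inv E *v l \<notin> integer_lattice" and jq: "j < q"
    and R: "linear R" "\<And>s. norm (R s) \<le> r * norm s" "r \<ge> 0"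
    and f: "\<And>x. lift f x = F0 x + e x"
    and e: "\<And>x x'. norm (e x - e x') \<le> \<epsilon> * norm (x - x')" "\<epsilon> \<ge> 0"
    and F1: "\<And>y k. y \<in> half_open_cube \<Longrightarrow> k \<ge> Suc j \<Longrightarrow> F0 (Eik k y) = 0"
    and F2: "\<And>y k. y \<in> half_open_cube \<Longrightarrow> k \<ge> Suc (Suc j) \<Longrightarrow> F0 (Eik k (y + Ek j l)) = 0"
    and F3: "\<And>y s. y \<in> half_open_cube \<Longrightarrow> y + R s \<in> half_open_cube \<Longrightarrow>
      norm (F0 (Eik (Suc j) (y + R s + Ek j l)) - F0 (Eik (Suc j) (y + Ek j l)) - s) \<le> norm s / 8"
    and Cj: "\<And>s. norm (Ck j s - s) \<le> norm s / 8"
    and small: "2 * \<epsilon> * (\<kappa> / (1 - \<kappa>)) * r + 2 * \<sigma> * \<kappa> ^ q * r \<le> 1 / 4"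
    and \<eta>: "0 \<le> \<eta>" "\<eta> < 1" "\<And>s. norm (Ck q s - s) \<le> \<eta> * norm s"
    and fat: "real (card (iter.D q)) - 1 < card (iter.D q) * (1 - \<eta>) ^ CARD('d)"
  shows "(\<exists>!\<mu>. SRB_measure T \<mu>) \<and> absolutely_continuous product_volume (THE \<mu>. SRB_measure T \<mu>)"
proof -
  let ?Q = "half_open_cube :: (real ^ 'u) set"
  let ?l = "Ek j l"
  (* the second branch must be named by the representative of the class of Ek j l *)
  define d1 where "d1 = iter.coset_rep q 0 ?l"
  have lj: "?l \<in> integer_lattice" using l(1) by (rule Ek_lattice)
  have d1: "d1 \<in> iter.D q" unfolding d1_def by (rule iter.coset_rep_in[OF lj])
  have d0: "0 \<in> iter.D q" by (rule iter.zero_in_D)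
  have Eik_split: "Eik m ?l = Ek (j - m) l" if "m \<le> j" for m
  proof -
    have "?l = Ek m (Ek (j - m) l)" using that by (simp add: funpow_add_apply)
    then show ?thesis by (simp add: Ek_Eik)
  qed
  have d01: "0 \<noteq> d1"
  proof
    assume "0 = d1"
    then have "Eik q ?l \<in> integer_lattice" using iter.Gi_diff_coset_rep[of q ?l 0] by (simp add: d1_def)
    then have "Ek (q - Suc j) (Eik q ?l) \<in> integer_lattice" by (rule Ek_lattice)
    moreover have "Eik q ?l = Eik (q - Suc j) (Eik (Suc j) ?l)"
      using jq by (simp only: funpow_add_apply) simp
    moreover have "Eik (Suc j) ?l = matrix_inv E *v l" by (simp only: funpow.simps comp_apply Ek_Eik)
    ultimately show False using l(2) by (simp only: Ek_Eik)
  qed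
  obtain K where K: "K \<ge> 0" and ball: "\<And>h v \<rho>. (h::real^'u \<Rightarrow> real^'d) \<in> borel_measurable borel \<Longrightarrow>
     (\<forall>y s. y \<in> ?Q \<longrightarrow> y + R s \<in> ?Q \<longrightarrow> norm (h (y + R s) - h y - s) \<le> norm s / 2) \<Longrightarrow> \<rho> > 0 \<Longrightarrow>
      emeasure lborel {x \<in> ?Q. dist (h x) v < \<rho>} \<le> ennreal K * emeasure lborel (ball v \<rho>)"
    using transversal_ball_bound[OF R(1) bounded_half_open_cube borel_half_open_cube] by blast
  have trans: "emeasure lborel {x \<in> ?Q. v + (blk.branch q (d1 # b) x - blk.branch q (0 # a) x) \<in> U} \<le> ennreal K * emeasure lborel U"
    if U: "open U" for a b v U
  proof -
    define h where "h x = blk.branch q (d1 # b) x - blk.branch q (0 # a) x" for x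
    have [measurable]: "h \<in> borel_measurable borel"
      unfolding h_def by (intro borel_measurable_diff blk.measurable_branch)
    define tl where "tl x = Ck q (blk.branch q b (Eik q (x + d1))) - Ck q (blk.branch q a (Eik q (x + 0)))" for x
    define ee where "ee x = (\<Sum>k=j..<q. Ck k (e (Eik (Suc k) (x + ?l))) - Ck k (e (Eik (Suc k) (x + 0))))" for x
    have h_eq: "h x = Ck j (F0 (Eik (Suc j) (x + ?l))) + ee x + tl x" if x: "x \<in> ?Q" for x
    proof -
      have "block_fun q (Eik q (x + d1)) = block_fun q (Eik q (x + ?l))"
      proof (rule lattice_periodicD[OF blk.g_periodic])
        have "Eik q (x + d1) - Eik q (x + ?l) = - Eik q (?l - d1)" by (simp add: Eik_add Eik_diff)
        then show "Eik q (x + d1) - Eik q (x + ?l) \<in> integer_lattice"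
          using integer_lattice_minus[OF iter.Gi_diff_coset_rep[of q ?l 0]] by (simp add: d1_def)
      qed
      then have "h x = hist q (x + ?l) - hist q x + tl x"
        unfolding h_def tl_def using block_fun_Eik by simp
      also have "hist q (x + ?l) - hist q x = (\<Sum>k<q. Ck k (lift f (Eik (Suc k) (x + ?l))) - Ck k (lift f (Eik (Suc k) x)))"
        by (simp only: hist_def sum_subtractf)
      also have "\<dots> = (\<Sum>k=j..<q. Ck k (lift f (Eik (Suc k) (x + ?l))) - Ck k (lift f (Eik (Suc k) x)))"
      proof (rule sum.mono_neutral_right)
        show "\<forall>k\<in>{..<q} - {j..<q}. Ck k (lift f (Eik (Suc k) (x + ?l))) - Ck k (lift f (Eik (Suc k) x)) = 0"
        proof
          fix k assume "k \<in> {..<q} - {j..<q}"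
          then have "Suc k \<le> j" by auto
          then have "Eik (Suc k) (x + ?l) = Eik (Suc k) x + Ek (j - Suc k) l"
            unfolding Eik_add using Eik_split by (simp only:)
          then show "Ck k (lift f (Eik (Suc k) (x + ?l))) - Ck k (lift f (Eik (Suc k) x)) = 0"
            using to_torus_add_lattice[OF Ek_lattice[OF l(1)]] by (simp only: lift_def) simp
        qed
      qed auto
      also have "\<dots> = (\<Sum>k=j..<q. (Ck k (F0 (Eik (Suc k) (x + ?l))) - Ck k (F0 (Eik (Suc k) x))) + (Ck k (e (Eik (Suc k) (x + ?l))) - Ck k (e (Eik (Suc k) (x + 0)))))"
        by (intro sum.cong refl) (simp only: f Ck_add add_0_right, simp)
      also have "\<dots> = (\<Sum>k=j..<q. Ck k (F0 (Eik (Suc k) (x + ?l))) - Ck k (F0 (Eik (Suc k) x))) + ee x"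
        by (simp only: sum.distrib ee_def)
      also have "(\<Sum>k=j..<q. Ck k (F0 (Eik (Suc k) (x + ?l))) - Ck k (F0 (Eik (Suc k) x))) = (\<Sum>k=j..<q. if k = j then Ck j (F0 (Eik (Suc j) (x + ?l))) else 0)"
      proof (intro sum.cong refl)
        fix k assume k: "k \<in> {j..<q}"
        have z: "Ck k 0 = 0" for k by (rule linear_0[OF matrix_iterate_linear])
        have 1: "F0 (Eik (Suc k) x) = 0" by (rule F1[OF x]) (use k in auto)
        have 2: "F0 (Eik (Suc k) (x + ?l)) = 0" if "k \<noteq> j" by (rule F2[OF x]) (use k that in auto)
        show "Ck k (F0 (Eik (Suc k) (x + ?l))) - Ck k (F0 (Eik (Suc k) x)) = (if k = j then Ck j (F0 (Eik (Suc j) (x + ?l))) else 0)"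
        proof (cases "k = j")
          case True
          show ?thesis using 1 unfolding True by (simp only: z diff_0_right if_True simp_thms)
        next
          case False
          then show ?thesis using 1 2 by (simp only: z diff_0_right if_False simp_thms)
        qed
      qed
      also have "\<dots> = Ck j (F0 (Eik (Suc j) (x + ?l)))" using jq by (simp del: funpow.simps)
      finally show ?thesis .
    qed
    have "\<forall>y s. y \<in> ?Q \<longrightarrow> y + R s \<in> ?Q \<longrightarrow> norm (h (y + R s) - h y - s) \<le> norm s / 2"
    proof (intro allI impI)
      fix y s assume y: "y \<in> ?Q" "y + R s \<in> ?Q"
      let ?n = "norm (R s)"
      define X where "X = F0 (Eik (Suc j) (y + R s + ?l)) - F0 (Eik (Suc j) (y + ?l))"
      have "Ck j X - s = Ck j (X - s) + (Ck j s - s)" by (simp add: Ck_diff)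
      then have "norm (Ck j X - s) \<le> norm (Ck j (X - s)) + norm (Ck j s - s)" by (simp only: norm_triangle_ineq)
      also have "\<dots> \<le> norm s / 8 + norm s / 8"
        using Ck_norm[of j "X - s"] F3[OF y] Cj[of s] unfolding X_def by linarith
      finally have 1: "norm (Ck j X - s) \<le> norm s / 4" by simp
      have "ee (y + R s) - ee y = (\<Sum>k=j..<q. (Ck k (e (Eik (Suc k) (y + R s + ?l))) - Ck k (e (Eik (Suc k) (y + ?l)))) -
          (Ck k (e (Eik (Suc k) (y + R s + 0))) - Ck k (e (Eik (Suc k) (y + 0)))))"
        unfolding ee_def sum_subtractf[symmetric] by (intro sum.cong refl) (simp only: algebra_simps)
      then have "norm (ee (y + R s) - ee y) \<le> (\<Sum>k=j..<q. norm ((Ck k (e (Eik (Suc k) (y + R s + ?l))) - Ck k (e (Eik (Suc k) (y + ?l)))) -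
          (Ck k (e (Eik (Suc k) (y + R s + 0))) - Ck k (e (Eik (Suc k) (y + 0))))))" by (simp only: norm_sum)
      also have "\<dots> \<le> (\<Sum>k=j..<q. \<epsilon> * \<kappa> ^ Suc k * ?n + \<epsilon> * \<kappa> ^ Suc k * ?n)"
      proof (rule sum_mono, rule order_trans[OF norm_triangle_ineq4], rule add_mono)
        fix k
        show "norm (Ck k (e (Eik (Suc k) (y + R s + ?l))) - Ck k (e (Eik (Suc k) (y + ?l)))) \<le> \<epsilon> * \<kappa> ^ Suc k * ?n"
          using hist_term_lipschitz[OF e, of k "Suc k" "y + R s" ?l y] by (simp del: funpow.simps)
        show "norm (Ck k (e (Eik (Suc k) (y + R s + 0))) - Ck k (e (Eik (Suc k) (y + 0)))) \<le> \<epsilon> * \<kappa> ^ Suc k * ?n"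
          using hist_term_lipschitz[OF e, of k "Suc k" "y + R s" 0 y] by (simp del: funpow.simps)
      qed
      also have "\<dots> = 2 * \<epsilon> * (\<Sum>k=j..<q. \<kappa> ^ Suc k) * ?n"
        by (simp add: sum_distrib_left sum_distrib_right mult_ac)
      also have "\<dots> \<le> 2 * \<epsilon> * (\<kappa> / (1 - \<kappa>)) * ?n"
      proof (intro mult_right_mono mult_left_mono)
        have "(\<Sum>k=j..<q. \<kappa> ^ Suc k) \<le> \<kappa> * (1 - \<kappa> ^ q) / (1 - \<kappa>)" by (rule geometric_bound) auto
        also have "\<dots> \<le> \<kappa> * 1 / (1 - \<kappa>)" using \<kappa> by (intro divide_right_mono mult_left_mono) auto
        finally show "(\<Sum>k=j..<q. \<kappa> ^ Suc k) \<le> \<kappa> / (1 - \<kappa>)" by simp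
      qed (use e in auto)
      finally have 2: "norm (ee (y + R s) - ee y) \<le> 2 * \<epsilon> * (\<kappa> / (1 - \<kappa>)) * ?n" .
      have "tl (y + R s) - tl y = (Ck q (blk.branch q b (Eik q (y + R s + d1))) - Ck q (blk.branch q b (Eik q (y + d1)))) -
         (Ck q (blk.branch q a (Eik q (y + R s + 0))) - Ck q (blk.branch q a (Eik q (y + 0))))"
        unfolding tl_def by simp
      also have "norm \<dots> \<le> \<sigma> * \<kappa> ^ q * ?n + \<sigma> * \<kappa> ^ q * ?n"
      proof (rule order_trans[OF norm_triangle_ineq4], rule add_mono)
        show "norm (Ck q (blk.branch q b (Eik q (y + R s + d1))) - Ck q (blk.branch q b (Eik q (y + d1)))) \<le> \<sigma> * \<kappa> ^ q * ?n"
          using hist_term_lipschitz[OF branch_lipschitz \<sigma>_nonneg, of q q b q "y + R s" d1 y] by simp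
        show "norm (Ck q (blk.branch q a (Eik q (y + R s + 0))) - Ck q (blk.branch q a (Eik q (y + 0)))) \<le> \<sigma> * \<kappa> ^ q * ?n"
          using hist_term_lipschitz[OF branch_lipschitz \<sigma>_nonneg, of q q a q "y + R s" 0 y] by simp
      qed
      finally have 3: "norm (tl (y + R s) - tl y) \<le> 2 * \<sigma> * \<kappa> ^ q * ?n" by (simp add: mult_ac)
      have "2 * \<epsilon> * (\<kappa> / (1 - \<kappa>)) * ?n + 2 * \<sigma> * \<kappa> ^ q * ?n = (2 * \<epsilon> * (\<kappa> / (1 - \<kappa>)) + 2 * \<sigma> * \<kappa> ^ q) * ?n"
        by (simp only: distrib_right)
      also have "\<dots> \<le> (2 * \<epsilon> * (\<kappa> / (1 - \<kappa>)) + 2 * \<sigma> * \<kappa> ^ q) * (r * norm s)"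
        using R(2) e(2) \<kappa> \<sigma>_nonneg by (intro mult_left_mono) auto
      also have "\<dots> = (2 * \<epsilon> * (\<kappa> / (1 - \<kappa>)) * r + 2 * \<sigma> * \<kappa> ^ q * r) * norm s" by (simp only: distrib_right mult.assoc)
      also have "\<dots> \<le> (1 / 4) * norm s" by (intro mult_right_mono small) simp
      finally have 4: "2 * \<epsilon> * (\<kappa> / (1 - \<kappa>)) * ?n + 2 * \<sigma> * \<kappa> ^ q * ?n \<le> norm s / 4" by simp
      have CX: "Ck j X = Ck j (F0 (Eik (Suc j) (y + R s + ?l))) - Ck j (F0 (Eik (Suc j) (y + ?l)))"
        unfolding X_def by (rule Ck_diff)
      have regroup: "(a' + b' + c') - (a + b + c) - d = ((a' - a) - d) + (b' - b) + (c' - c)" for a b c d a' b' c' :: "real ^ 'd"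
        by simp
      have "h (y + R s) - h y - s = (Ck j X - s) + (ee (y + R s) - ee y) + (tl (y + R s) - tl y)"
        unfolding h_eq[OF y(1)] h_eq[OF y(2)] CX by (rule regroup)
      then have "norm (h (y + R s) - h y - s) \<le> norm (Ck j X - s) + norm (ee (y + R s) - ee y) + norm (tl (y + R s) - tl y)"
        by (simp only: order_trans[OF norm_triangle_ineq add_right_mono[OF norm_triangle_ineq]])
      with 1 2 3 4 show "norm (h (y + R s) - h y - s) \<le> norm s / 2" by linarith
    qed
    note hb = ball[OF _ this]
    have Uv: "open ((\<lambda>w. v + w) -` U)" by (rule open_vimage[OF U]) (intro continuous_intros)
    have "emeasure lborel {x \<in> ?Q. h x \<in> (\<lambda>w. v + w) -` U} \<le> ennreal K * emeasure lborel ((\<lambda>w. v + w) -` U)"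
      by (rule open_bound_from_ball_bound[OF _ _ hb Uv]) measurable
    also have "emeasure lborel ((\<lambda>w. v + w) -` U) = emeasure lborel U" by (rule emeasure_lborel_translate) (use U in simp)
    finally show ?thesis by (simp only: h_def vimage_eq)
  qed
  have "real (card (iter.D q)) - 1 < card (iter.D q) * blk.jac q"
    using fat mult_left_mono[OF blk.jac_lower_bound[OF \<eta>], of "real (card (iter.D q))"] by simp
  then obtain b where "b \<ge> 0" "\<And>n. blk.energy q n \<le> ennreal b"
    using blk.energy_bounded[OF d0 d1 d01 K trans] by blast
  then show ?thesis using jq by (intro absolutely_continuous_SRB[of q b] pushforward_bound) auto
qed

end

section \<open>Twice differentiable maps given by coordinates\<close>

text \<open>
  The case 0 needs the exponent to be at least 2: then the difference quotients on both sides tend to 0.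
\<close>

lemma DERIV_pos_part_power:
  assumes "n \<ge> 1"
  shows "((\<lambda>t::real. (max 0 t) ^ Suc n) has_real_derivative (real (Suc n) * (max 0 t) ^ n)) (at t)"
proof (cases t "0::real" rule: linorder_cases)
  case less
  have "((\<lambda>t::real. 0) has_real_derivative 0) (at t)" by simp
  moreover have "\<forall>\<^sub>F x in nhds t. 0 = (max 0 x) ^ Suc n"
  proof -
    have "\<forall>\<^sub>F x in nhds t. x \<in> {..<0}" by (rule eventually_nhds_in_open) (use less in auto)
    then show ?thesis by eventually_elim auto
  qed
  ultimately have "((\<lambda>t::real. (max 0 t) ^ Suc n) has_real_derivative 0) (at t)"
    by (subst (asm) DERIV_cong_ev[OF refl _ refl]) auto
  then show ?thesis using less assms by (simp add: power_0_left)
next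
  case greater
  have "((\<lambda>t::real. t ^ Suc n) has_real_derivative (real (Suc n) * t ^ n)) (at t)"
    using DERIV_pow[of "Suc n" t] by simp
  moreover have "\<forall>\<^sub>F x in nhds t. x ^ Suc n = (max 0 x) ^ Suc n"
  proof -
    have "\<forall>\<^sub>F x in nhds t. x \<in> {0<..}" by (rule eventually_nhds_in_open) (use greater in auto)
    then show ?thesis by eventually_elim auto
  qed
  ultimately have "((\<lambda>t::real. (max 0 t) ^ Suc n) has_real_derivative (real (Suc n) * t ^ n)) (at t)"
    by (subst (asm) DERIV_cong_ev[OF refl _ refl]) auto
  then show ?thesis using greater by simp
next
  case equal
  have "((\<lambda>h::real. ((max 0 (0 + h)) ^ Suc n - (max 0 0) ^ Suc n) / h) \<longlongrightarrow> 0) (at 0)"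
  proof (rule Lim_null_comparison)
    show "\<forall>\<^sub>F h::real in at 0. norm (((max 0 (0 + h)) ^ Suc n - (max 0 0) ^ Suc n) / h) \<le> \<bar>h\<bar> ^ n"
      by (intro always_eventually allI) (simp add: max_def abs_mult power_abs)
    have "((\<lambda>h::real. \<bar>h\<bar> ^ n) \<longlongrightarrow> \<bar>0\<bar> ^ n) (at 0)" by (intro tendsto_intros)
    then show "((\<lambda>h::real. \<bar>h\<bar> ^ n) \<longlongrightarrow> 0) (at 0)" using assms by (simp add: power_0_left)
  qed
  then show ?thesis using equal assms by (simp add: DERIV_def power_0_left)
qed

definition elem1 :: "'d \<Rightarrow> 'u \<Rightarrow> (real ^ 'u) \<Rightarrow>\<^sub>L (real ^ 'd)" where
  "elem1 i v = Blinfun (\<lambda>h. (h $ v) *\<^sub>R axis i 1)"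

definition elem2 :: "'d \<Rightarrow> 'u \<Rightarrow> 'u \<Rightarrow> (real ^ 'u) \<Rightarrow>\<^sub>L (real ^ 'u) \<Rightarrow>\<^sub>L (real ^ 'd)" where
  "elem2 i v w = Blinfun (\<lambda>h. (h $ w) *\<^sub>R elem1 i v)"

lemma elem1_apply: "blinfun_apply (elem1 i v) h = (h $ v) *\<^sub>R axis i 1"
  unfolding elem1_def by (subst bounded_linear_Blinfun_apply) (intro bounded_linear_scaleR_const bounded_linear_vec_nth, simp)

lemma elem2_apply: "blinfun_apply (elem2 i v w) h = (h $ w) *\<^sub>R elem1 i v"
  unfolding elem2_def by (subst bounded_linear_Blinfun_apply) (intro bounded_linear_scaleR_const bounded_linear_vec_nth, simp)

text \<open>
  The coordinates of the first and second derivatives are collected on the operators \<open>elem1\<close> and \<open>elem2\<close>,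
  so differentiability and continuity of operator-valued maps reduce to those of finitely many real
  functions.
\<close>

lemma C2_vectorI:
  fixes c :: "'d::finite \<Rightarrow> real ^ 'u \<Rightarrow> real" and p :: "'d \<Rightarrow> 'u::finite \<Rightarrow> real ^ 'u \<Rightarrow> real"
  assumes c: "\<And>i x. (c i has_derivative (\<lambda>h. \<Sum>v\<in>UNIV. p i v x * h $ v)) (at x)"
    and p: "\<And>i v x. (p i v has_derivative (\<lambda>h. \<Sum>w\<in>UNIV. s i v w x * h $ w)) (at x)"
    and s: "\<And>i v w. continuous_on UNIV (s i v w)"
  shows "C2 (\<lambda>x. \<chi> i. c i x)" and "total_deriv (\<lambda>x. \<chi> i. c i x) = (\<lambda>x. \<Sum>i\<in>UNIV. \<Sum>v\<in>UNIV. p i v x *\<^sub>R elem1 i v)"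
proof -
  let ?F = "\<lambda>x. (\<chi> i. c i x) :: real ^ 'd"
  have F: "?F = (\<lambda>x. \<Sum>i\<in>UNIV. c i x *\<^sub>R axis i 1)"
    by (simp add: fun_eq_iff vec_eq_iff axis_def if_distrib[of "\<lambda>z. _ * z"] cong: if_cong)
  let ?D = "\<lambda>x. \<Sum>i\<in>UNIV. \<Sum>v\<in>UNIV. p i v x *\<^sub>R elem1 i v"
  let ?DD = "\<lambda>x. \<Sum>i\<in>UNIV. \<Sum>v\<in>UNIV. \<Sum>w\<in>UNIV. s i v w x *\<^sub>R elem2 i v w"
  have 1: "(?F has_derivative blinfun_apply (?D x)) (at x)" for x
  proof -
    have "((\<lambda>x. \<Sum>i\<in>UNIV. c i x *\<^sub>R axis i (1::real)) has_derivative (\<lambda>h. \<Sum>i\<in>UNIV. (\<Sum>v\<in>UNIV. p i v x * h $ v) *\<^sub>R axis i 1)) (at x)"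
      by (intro has_derivative_sum has_derivative_scaleR_left c)
    moreover have "blinfun_apply (?D x) = (\<lambda>h. \<Sum>i\<in>UNIV. (\<Sum>v\<in>UNIV. p i v x * h $ v) *\<^sub>R axis i 1)"
      by (simp add: fun_eq_iff blinfun.sum_left blinfun.scaleR_left elem1_apply scaleR_sum_left)
    ultimately show ?thesis by (simp only: F)
  qed
  have 2: "(?D has_derivative blinfun_apply (?DD x)) (at x)" for x
  proof -
    have "(?D has_derivative (\<lambda>h. \<Sum>i\<in>UNIV. \<Sum>v\<in>UNIV. (\<Sum>w\<in>UNIV. s i v w x * h $ w) *\<^sub>R elem1 i v)) (at x)"
      by (intro has_derivative_sum has_derivative_scaleR_left p)
    moreover have "blinfun_apply (?DD x) = (\<lambda>h. \<Sum>i\<in>UNIV. \<Sum>v\<in>UNIV. (\<Sum>w\<in>UNIV. s i v w x * h $ w) *\<^sub>R elem1 i v)"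
      by (simp add: fun_eq_iff blinfun.sum_left blinfun.scaleR_left elem2_apply scaleR_sum_left)
    ultimately show ?thesis by (simp only:)
  qed
  show D: "total_deriv ?F = ?D" using total_deriv_eqI[OF 1] by (simp add: fun_eq_iff)
  have DD: "total_deriv ?D = ?DD" using total_deriv_eqI[OF 2] by (simp add: fun_eq_iff)
  show "C2 ?F"
    unfolding C2_def D DD
  proof (intro conjI)
    show "?F differentiable_on UNIV" using 1 by (auto simp: differentiable_on_def differentiable_def)
    show "?D differentiable_on UNIV" using 2 by (auto simp: differentiable_on_def differentiable_def)
    show "continuous_on UNIV ?DD" by (intro continuous_intros s)
  qed
qed

text \<open>
  The cube of the positive part of a smooth function is twice continuously differentiable and vanishes
  where the function is not positive, which makes it a bump. The argument is a sum of functions of one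
  coordinate each, so its second derivative is diagonal.
\<close>

lemma C2_cubed_pos_part:
  fixes m m1 m2 :: "'d::finite \<Rightarrow> 'u::finite \<Rightarrow> real \<Rightarrow> real" and \<rho> c :: real
  assumes m: "\<And>i v t. (m i v has_real_derivative m1 i v t) (at t)"
    and m1: "\<And>i v t. (m1 i v has_real_derivative m2 i v t) (at t)"
    and m2: "\<And>i v. continuous_on UNIV (m2 i v)"
  defines "\<tau> \<equiv> \<lambda>i (x :: real ^ 'u). \<rho> + (\<Sum>v\<in>UNIV. m i v (x $ v))"
  shows "C2 (\<lambda>x. \<chi> i. c * (max 0 (\<tau> i x)) ^ 3)"
    and "total_deriv (\<lambda>x. \<chi> i. c * (max 0 (\<tau> i x)) ^ 3) =
      (\<lambda>x. \<Sum>i\<in>UNIV. \<Sum>v\<in>UNIV. (c * (3 * (max 0 (\<tau> i x))\<^sup>2 * m1 i v (x $ v))) *\<^sub>R elem1 i v)"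
proof -
  have nth: "((\<lambda>x. x $ v) has_derivative (\<lambda>h. h $ v)) (at x)" for v and x :: "real ^ 'u"
    by (rule bounded_linear_imp_has_derivative) (rule bounded_linear_vec_nth)
  have comp: "((\<lambda>x. h (x $ v)) has_derivative (\<lambda>k. h' * k $ v)) (at x)" if "(h has_real_derivative h') (at (x $ v))"
    for h h' v and x :: "real ^ 'u"
    using DERIV_compose_FDERIV[OF that nth] by (simp add: mult.commute)
  have \<tau>: "(\<tau> i has_derivative (\<lambda>k. \<Sum>v\<in>UNIV. m1 i v (x $ v) * k $ v)) (at x)" for i x
    unfolding \<tau>_def by (rule has_derivative_eq_rhs, (rule has_derivative_add has_derivative_const has_derivative_sum comp m)+) simp
  have pp: "((\<lambda>x. (max 0 (\<tau> i x)) ^ Suc n) has_derivative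
     (\<lambda>k. (real (Suc n) * (max 0 (\<tau> i x)) ^ n) * (\<Sum>v\<in>UNIV. m1 i v (x $ v) * k $ v))) (at x)" if "n \<ge> 1" for i x n
    using DERIV_compose_FDERIV[OF DERIV_pos_part_power[OF that] \<tau>] by (simp add: mult.commute)
  define p where "p i v x = c * (3 * (max 0 (\<tau> i x))\<^sup>2 * m1 i v (x $ v))" for i v x
  define s where "s i v w x = c * 3 * ((max 0 (\<tau> i x))\<^sup>2 * (if w = v then m2 i v (x $ v) else 0) +
      (2 * max 0 (\<tau> i x) * m1 i w (x $ w)) * m1 i v (x $ v))" for i v w x
  have \<tau>c: "continuous_on UNIV (\<tau> i)" for i
    using \<tau> by (intro differentiable_imp_continuous_on) (auto simp: differentiable_on_def differentiable_def)
  have mc: "continuous_on UNIV (\<lambda>x. h (x $ v))" if "continuous_on UNIV h" for h :: "real \<Rightarrow> real" and v :: 'u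
    by (rule continuous_on_compose2[OF that]) (auto intro: continuous_intros)
  have m1c: "continuous_on UNIV (m1 i v)" for i v
    using m1 by (intro DERIV_continuous_on) (auto intro: has_field_derivative_at_within)
  have A: "((\<lambda>x. c * (max 0 (\<tau> i x)) ^ 3) has_derivative (\<lambda>h. \<Sum>v\<in>UNIV. p i v x * h $ v)) (at x)" for i x
  proof (rule has_derivative_eq_rhs)
    show "((\<lambda>x. c * (max 0 (\<tau> i x)) ^ 3) has_derivative
        (\<lambda>k. c * ((3 * (max 0 (\<tau> i x))\<^sup>2) * (\<Sum>v\<in>UNIV. m1 i v (x $ v) * k $ v)))) (at x)"
      using pp[of 2 i x] by (intro has_derivative_mult_right) (simp add: numeral_3_eq_3 numeral_2_eq_2)
    show "(\<lambda>k. c * ((3 * (max 0 (\<tau> i x))\<^sup>2) * (\<Sum>v\<in>UNIV. m1 i v (x $ v) * k $ v))) = (\<lambda>h. \<Sum>v\<in>UNIV. p i v x * h $ v)"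
      by (simp add: fun_eq_iff p_def sum_distrib_left mult_ac)
  qed
  have B: "(p i v has_derivative (\<lambda>h. \<Sum>w\<in>UNIV. s i v w x * h $ w)) (at x)" for i v x
  proof (rule has_derivative_eq_rhs)
    have sq: "((\<lambda>x. (max 0 (\<tau> i x))\<^sup>2) has_derivative (\<lambda>k. 2 * max 0 (\<tau> i x) * (\<Sum>v\<in>UNIV. m1 i v (x $ v) * k $ v))) (at x)"
      using pp[of 1 i x] by (simp add: numeral_2_eq_2)
    have "((\<lambda>x. c * 3 * ((max 0 (\<tau> i x))\<^sup>2 * m1 i v (x $ v))) has_derivative
        (\<lambda>k. c * 3 * ((max 0 (\<tau> i x))\<^sup>2 * (m2 i v (x $ v) * k $ v) +
         2 * max 0 (\<tau> i x) * (\<Sum>v\<in>UNIV. m1 i v (x $ v) * k $ v) * m1 i v (x $ v)))) (at x)"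
      by (intro has_derivative_mult_right has_derivative_mult sq comp m1)
    then show "(p i v has_derivative (\<lambda>k. c * 3 * ((max 0 (\<tau> i x))\<^sup>2 * (m2 i v (x $ v) * k $ v) +
         2 * max 0 (\<tau> i x) * (\<Sum>v\<in>UNIV. m1 i v (x $ v) * k $ v) * m1 i v (x $ v)))) (at x)"
      by (simp add: p_def[abs_def] mult.assoc)
    show "(\<lambda>k. c * 3 * ((max 0 (\<tau> i x))\<^sup>2 * (m2 i v (x $ v) * k $ v) +
         2 * max 0 (\<tau> i x) * (\<Sum>v\<in>UNIV. m1 i v (x $ v) * k $ v) * m1 i v (x $ v))) = (\<lambda>h. \<Sum>w\<in>UNIV. s i v w x * h $ w)"
    proof
      fix k :: "real ^ 'u"
      have "(\<Sum>w\<in>UNIV. s i v w x * k $ w) = (\<Sum>w\<in>UNIV. (if w = v then c * 3 * ((max 0 (\<tau> i x))\<^sup>2 * (m2 i v (x $ v) * k $ v)) else 0) +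
          c * 3 * (2 * max 0 (\<tau> i x) * m1 i v (x $ v)) * (m1 i w (x $ w) * k $ w))"
        by (intro sum.cong refl) (simp add: s_def algebra_simps)
      also have "\<dots> = c * 3 * ((max 0 (\<tau> i x))\<^sup>2 * (m2 i v (x $ v) * k $ v)) +
          c * 3 * (2 * max 0 (\<tau> i x) * m1 i v (x $ v)) * (\<Sum>w\<in>UNIV. m1 i w (x $ w) * k $ w)"
        by (simp add: sum.distrib sum_distrib_left)
      finally show "c * 3 * ((max 0 (\<tau> i x))\<^sup>2 * (m2 i v (x $ v) * k $ v) +
         2 * max 0 (\<tau> i x) * (\<Sum>v\<in>UNIV. m1 i v (x $ v) * k $ v) * m1 i v (x $ v)) = (\<Sum>w\<in>UNIV. s i v w x * k $ w)"
        by (simp add: algebra_simps)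
    qed
  qed
  have S: "continuous_on UNIV (s i v w)" for i v w
    unfolding s_def by (cases "w = v") (auto intro!: continuous_intros \<tau>c mc m1c m2)
  from C2_vectorI[where c = "\<lambda>i x. c * (max 0 (\<tau> i x)) ^ 3", OF A B S]
  show "C2 (\<lambda>x. \<chi> i. c * (max 0 (\<tau> i x)) ^ 3)"
    "total_deriv (\<lambda>x. \<chi> i. c * (max 0 (\<tau> i x)) ^ 3) =
      (\<lambda>x. \<Sum>i\<in>UNIV. \<Sum>v\<in>UNIV. (c * (3 * (max 0 (\<tau> i x))\<^sup>2 * m1 i v (x $ v))) *\<^sub>R elem1 i v)"
    by (simp_all only: p_def)
qed

text \<open>
  The mean value inequality for \<open>F\<close> minus its derivative at \<open>w\<close>, on a ball where the derivative of \<open>F\<close>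
  varies by at most \<open>\<eta>\<close>.
\<close>

lemma C2_strict_derivative:
  fixes F :: "'a::euclidean_space \<Rightarrow> 'b::real_normed_vector"
  assumes F: "C2 F" and \<eta>: "\<eta> > 0"
  shows "\<exists>r>0. \<forall>x\<in>ball w r. \<forall>x'\<in>ball w r. norm (F x - F x' - blinfun_apply (total_deriv F w) (x - x')) \<le> \<eta> * norm (x - x')"
proof -
  let ?P = "total_deriv F w"
  have "continuous_on UNIV (total_deriv F)"
    using F by (auto simp: C2_def intro: differentiable_imp_continuous_on)
  then have "isCont (total_deriv F) w" by (simp add: continuous_on_eq_continuous_at)
  then obtain r where r: "r > 0" "\<And>x. dist x w < r \<Longrightarrow> dist (total_deriv F x) ?P < \<eta>"
    using \<eta> unfolding continuous_at_eps_delta by blast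
  have "norm ((F x - blinfun_apply ?P x) - (F x' - blinfun_apply ?P x')) \<le> \<eta> * norm (x - x')"
    if "x \<in> ball w r" "x' \<in> ball w r" for x x'
  proof (rule differentiable_bound[where S = "ball w r" and f' = "\<lambda>x h. blinfun_apply (total_deriv F x - ?P) h"])
    fix y assume y: "y \<in> ball w r"
    have "((\<lambda>x. F x - blinfun_apply ?P x) has_derivative (\<lambda>h. blinfun_apply (total_deriv F y) h - blinfun_apply ?P h)) (at y within ball w r)"
      using F by (intro has_derivative_diff has_derivative_at_withinI[OF has_derivative_total_deriv]
          bounded_linear_imp_has_derivative blinfun.bounded_linear_right) (auto simp: C2_def)
    then show "((\<lambda>x. F x - blinfun_apply ?P x) has_derivative (\<lambda>h. blinfun_apply (total_deriv F y - ?P) h)) (at y within ball w r)"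
      by (simp add: blinfun.diff_left)
    show "onorm (\<lambda>h. blinfun_apply (total_deriv F y - ?P) h) \<le> \<eta>"
      using r(2)[of y] y by (simp add: norm_blinfun.rep_eq[symmetric] dist_norm norm_minus_commute less_imp_le)
  qed (use that in auto)
  then show ?thesis using r(1) by (intro exI[of _ r]) (simp add: blinfun.diff_right algebra_simps)
qed

lemma C2_space_lipschitz:
  assumes g: "g \<in> C2_space" and M: "\<And>x. norm (total_deriv (lift g) x) \<le> M"
  shows "norm (lift g x - lift g x') \<le> M * norm (x - x')"
proof (rule differentiable_bound[where S = UNIV and f' = "\<lambda>x. blinfun_apply (total_deriv (lift g) x)"])
  show "(lift g has_derivative blinfun_apply (total_deriv (lift g) y)) (at y within UNIV)" for y
    using g by (intro has_derivative_total_deriv) (auto simp: C2_space_def C2_def)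
  show "onorm (blinfun_apply (total_deriv (lift g) y)) \<le> M" for y
    using M[of y] by (simp add: norm_blinfun.rep_eq)
qed auto

section \<open>Contractions and expanding matrices\<close>

lemma norm_matrix_vector_mult_le:
  fixes A :: "real ^ 'n ^ 'm"
  shows "norm (A *v x) \<le> norm A * norm x"
proof -
  have "\<bar>(A *v x) $ i\<bar> \<le> norm (A $ i) * norm x" for i
    using Cauchy_Schwarz_ineq2[of "A $ i" x] by (simp add: matrix_vector_mult_def inner_vec_def)
  then have "norm (A *v x) \<le> L2_set (\<lambda>i. norm (A $ i) * norm x) UNIV"
    unfolding norm_vec_def[of "A *v x"] by (intro L2_set_mono) auto
  also have "\<dots> = norm A * norm x"
    by (simp add: norm_vec_def[of A] L2_set_left_distrib)
  finally show ?thesis .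
qed

lemma continuous_on_det: "continuous_on UNIV (det :: real ^ 'n ^ 'n \<Rightarrow> real)"
  unfolding det_def by (intro continuous_intros)

text \<open>
  The norm of \<open>C y\<close> attains its maximum on the unit sphere, which is compact.
\<close>

lemma contraction_rate:
  fixes C :: "real ^ 'd ^ 'd"
  assumes "C \<in> contractions"
  shows "\<exists>lam. 0 \<le> lam \<and> lam < 1 \<and> (\<forall>y. norm (C *v y) \<le> lam * norm y)"
proof -
  let ?S = "sphere (0 :: real ^ 'd) 1"
  have "continuous_on ?S (\<lambda>y. norm (C *v y))"
    by (intro continuous_intros linear_continuous_on matrix_vector_mul_bounded_linear)
  moreover have "?S \<noteq> {}" by simp
  ultimately obtain y0 where y0: "y0 \<in> ?S" "\<And>y. y \<in> ?S \<Longrightarrow> norm (C *v y) \<le> norm (C *v y0)"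
    using continuous_attains_sup[of ?S "\<lambda>y. norm (C *v y)"] compact_sphere by blast
  have "y0 \<noteq> 0" using y0(1) by auto
  then have "norm (C *v y0) < 1" using assms y0(1) by (auto simp: contractions_def)
  moreover have "norm (C *v y) \<le> norm (C *v y0) * norm y" for y
  proof (cases "y = 0")
    case False
    have "norm (C *v ((1 / norm y) *\<^sub>R y)) \<le> norm (C *v y0)" using False by (intro y0(2)) simp
    then show ?thesis using False by (simp add: matrix_vector_mult_scaleR field_simps)
  qed simp
  ultimately show ?thesis by (intro exI[of _ "norm (C *v y0)"]) simp
qed

lemma iterate_near_identity:
  fixes C :: "real ^ 'd ^ 'd"
  assumes C: "\<And>y. norm (C *v y) \<le> norm y" and near: "norm (C - mat 1) \<le> \<gamma>"
  shows "norm ((((*v) C) ^^ k) y - y) \<le> real k * \<gamma> * norm y"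
proof (induction k)
  case (Suc k)
  let ?z = "(((*v) C) ^^ k) y"
  have "(((*v) C) ^^ Suc k) y - y = C *v (?z - y) + (C - mat 1) *v y"
    by (simp add: matrix_vector_mult_diff_distrib matrix_vector_mult_diff_rdistrib)
  also have "norm \<dots> \<le> norm (?z - y) + norm (C - mat 1) * norm y"
    by (intro norm_triangle_mono C norm_matrix_vector_mult_le)
  also have "\<dots> \<le> real k * \<gamma> * norm y + \<gamma> * norm y"
    by (intro add_mono Suc mult_right_mono near) simp
  finally show ?case by (simp add: algebra_simps)
qed simp

text \<open>
  The powers of the inverse of \<open>E\<close> tend to 0, so the powers of its determinant tend to \<open>det 0 = 0\<close> and
  that determinant is less than 1 in absolute value.
\<close>

lemma det_expanding:
  fixes E :: "real ^ 'u ^ 'u"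
  assumes inv: "invertible E" and \<kappa>: "0 \<le> \<kappa>" "\<kappa> < 1" "\<And>x. norm (matrix_inv E *v x) \<le> \<kappa> * norm x"
  shows "\<bar>det E\<bar> > 1"
proof -
  let ?A = "matrix_inv E"
  define M where "M k = matrix (((*v) ?A) ^^ k)" for k
  have lin: "linear (((*v) ?A) ^^ k)" for k by (rule matrix_iterate_linear)
  have bd: "norm ((((*v) ?A) ^^ k) x) \<le> \<kappa> ^ k * norm x" for k x
  proof (induction k)
    case (Suc k)
    have "norm ((((*v) ?A) ^^ Suc k) x) \<le> \<kappa> * norm ((((*v) ?A) ^^ k) x)" using \<kappa>(3) by simp
    also have "\<dots> \<le> \<kappa> * (\<kappa> ^ k * norm x)" using Suc \<kappa>(1) by (rule mult_left_mono)
    finally show ?case by simp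
  qed simp
  have dM: "det (M k) = det ?A ^ k" for k
  proof (induction k)
    case 0
    have "M 0 = mat 1" unfolding M_def by (simp add: matrix_id_mat_1[unfolded id_def] id_def)
    then show ?case by simp
  next
    case (Suc k)
    have "M (Suc k) = ?A ** M k"
      unfolding M_def using matrix_compose[OF lin[of k] matrix_vector_mul_linear[of ?A]]
      by (simp add: comp_def)
    then show ?case using Suc by (simp add: det_mul)
  qed
  have "(\<lambda>k. M k) \<longlonglongrightarrow> 0"
  proof (intro vec_tendstoI)
    fix i j
    have "norm (M k $ i $ j) \<le> \<kappa> ^ k * norm (axis j (1::real) :: real ^ 'u)" for k
    proof -
      have "M k $ i $ j = (((*v) ?A) ^^ k) (axis j 1) $ i" by (simp add: M_def matrix_def)
      then show ?thesis using component_le_norm_cart[of "(((*v) ?A) ^^ k) (axis j 1)" i] bd[of k "axis j 1"] by simp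
    qed
    moreover have "(\<lambda>k. \<kappa> ^ k * norm (axis j (1::real) :: real ^ 'u)) \<longlonglongrightarrow> 0"
      using \<kappa> by (intro tendsto_mult_left_zero LIMSEQ_power_zero) simp
    ultimately show "(\<lambda>k. M k $ i $ j) \<longlonglongrightarrow> 0 $ i $ j"
      by (simp add: Lim_null_comparison[where g = "\<lambda>k. \<kappa> ^ k * norm (axis j (1::real) :: real ^ 'u)"])
  qed
  then have "(\<lambda>k. det (M k)) \<longlonglongrightarrow> det (0 :: real ^ 'u ^ 'u)"
    by (rule continuous_on_tendsto_compose[OF continuous_on_det]) auto
  moreover have "det (0 :: real ^ 'u ^ 'u) = 0" by (rule det_zero_row(1)[of undefined]) (simp add: row_def vec_eq_iff)
  ultimately have "(\<lambda>k. det ?A ^ k) \<longlonglongrightarrow> 0" by (simp add: dM)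
  then have "\<bar>det ?A\<bar> < 1"
  proof -
    assume "(\<lambda>k. det ?A ^ k) \<longlonglongrightarrow> 0"
    then have lim: "(\<lambda>k. \<bar>det ?A\<bar> ^ k) \<longlonglongrightarrow> 0" using tendsto_rabs_zero by (fastforce simp: power_abs)
    show "\<bar>det ?A\<bar> < 1"
    proof (rule ccontr)
      assume "\<not> \<bar>det ?A\<bar> < 1"
      then have "1 \<le> \<bar>det ?A\<bar> ^ k" for k by (intro one_le_power) simp
      then have "1 \<le> (0::real)" by (intro LIMSEQ_le_const[OF lim]) auto
      then show False by simp
    qed
  qed
  moreover have "det E * det ?A = 1"
  proof -
    have "E ** ?A = mat 1 \<and> ?A ** E = mat 1"
      using inv unfolding invertible_def matrix_inv_def by (rule someI_ex)
    then show ?thesis by (metis det_I det_mul)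
  qed
  ultimately show ?thesis
  proof -
    assume A: "\<bar>det ?A\<bar> < 1" and 1: "det E * det ?A = 1"
    show ?thesis
    proof (rule ccontr)
      assume "\<not> \<bar>det E\<bar> > 1"
      then have "\<bar>det E\<bar> * \<bar>det ?A\<bar> \<le> 1 * \<bar>det ?A\<bar>" by (intro mult_right_mono) auto
      with A 1 show False by (simp add: abs_mult[symmetric])
    qed
  qed
qed

section \<open>A transverse fibre map\<close>

text \<open>
  A smooth periodic function that measures how far \<open>x\<close> is from \<open>w\<close> modulo the lattice.
\<close>

definition spread :: "real ^ 'u \<Rightarrow> real ^ 'u \<Rightarrow> real" where
  "spread w x = (\<Sum>v\<in>UNIV. 1 - cos (2 * pi * (x $ v - w $ v)))"

lemma spread_nonneg: "spread w x \<ge> 0"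
  unfolding spread_def by (intro sum_nonneg) simp

lemma spread_eq_0_iff: "spread w x = 0 \<longleftrightarrow> x - w \<in> integer_lattice"
proof -
  have "spread w x = 0 \<longleftrightarrow> (\<forall>v. 1 - cos (2 * pi * (x $ v - w $ v)) = 0)"
    unfolding spread_def by (subst sum_nonneg_eq_0_iff) auto
  also have "\<dots> \<longleftrightarrow> (\<forall>v. x $ v - w $ v \<in> \<int>)"
  proof (intro all_cong1)
    fix v
    have "1 - cos (2 * pi * (x $ v - w $ v)) = 0 \<longleftrightarrow> (\<exists>n::int. 2 * pi * (x $ v - w $ v) = of_int n * 2 * pi)"
      using cos_one_2pi_int[of "2 * pi * (x $ v - w $ v)"] by auto
    also have "\<dots> \<longleftrightarrow> (\<exists>n::int. x $ v - w $ v = of_int n)" by (intro ex_cong1) auto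
    finally show "1 - cos (2 * pi * (x $ v - w $ v)) = 0 \<longleftrightarrow> x $ v - w $ v \<in> \<int>" by (auto simp: Ints_def)
  qed
  finally show ?thesis by (simp add: integer_lattice_def)
qed

lemma abs_cos_diff_le: "\<bar>cos a - cos b\<bar> \<le> \<bar>a - b\<bar>" for a b :: real
proof -
  have "\<bar>cos a - cos b\<bar> = 2 * (\<bar>sin ((a + b) / 2)\<bar> * \<bar>sin ((b - a) / 2)\<bar>)"
    by (simp add: cos_diff_cos abs_mult)
  also have "\<dots> \<le> 2 * (1 * \<bar>(b - a) / 2\<bar>)"
    by (intro mult_left_mono mult_mono abs_sin_x_le_abs_x abs_sin_le_one) auto
  finally show ?thesis by (simp add: abs_minus_commute)
qed

lemma spread_lipschitz: "\<bar>spread w (x :: real ^ 'u) - spread w y\<bar> \<le> 2 * pi * CARD('u) * norm (x - y)"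
proof -
  have "\<bar>spread w x - spread w y\<bar> = \<bar>\<Sum>v\<in>UNIV. cos (2 * pi * (y $ v - w $ v)) - cos (2 * pi * (x $ v - w $ v))\<bar>"
    unfolding spread_def sum_subtractf[symmetric] by simp
  also have "\<dots> \<le> (\<Sum>v\<in>UNIV. \<bar>cos (2 * pi * (y $ v - w $ v)) - cos (2 * pi * (x $ v - w $ v))\<bar>)" by (rule sum_abs)
  also have "\<dots> \<le> (\<Sum>v\<in>(UNIV :: 'u set). 2 * pi * norm (x - y))"
  proof (rule sum_mono)
    fix v
    have "\<bar>cos (2 * pi * (y $ v - w $ v)) - cos (2 * pi * (x $ v - w $ v))\<bar> \<le> \<bar>2 * pi * (y $ v - w $ v) - 2 * pi * (x $ v - w $ v)\<bar>"
      by (rule abs_cos_diff_le)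
    also have "\<dots> = 2 * pi * \<bar>(x - y) $ v\<bar>" by (simp add: right_diff_distrib[symmetric] abs_mult abs_minus_commute)
    also have "\<dots> \<le> 2 * pi * norm (x - y)" by (intro mult_left_mono component_le_norm_cart) simp
    finally show "\<bar>cos (2 * pi * (y $ v - w $ v)) - cos (2 * pi * (x $ v - w $ v))\<bar> \<le> 2 * pi * norm (x - y)" .
  qed
  finally show ?thesis by (simp add: mult_ac)
qed

text \<open>
  Coordinate \<open>i\<close> of the bump is a multiple of the cube of the positive part of
  \<open>\<rho> - spread w x + \<rho> * sin (2 * pi * (x $ \<iota> i - w $ \<iota> i))\<close>. This is not positive once the spread is \<open>2 * \<rho>\<close>.
  At \<open>w\<close> it equals \<open>\<rho>\<close> and, as the spread is minimal there, only the sine contributes to the derivative.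
\<close>

lemma exists_bump:
  fixes \<iota> :: "'d::finite \<Rightarrow> 'u::finite" and w :: "real ^ 'u"
  assumes \<rho>: "\<rho> > 0"
  shows "\<exists>f0 :: 'u torus \<Rightarrow> real ^ 'd. f0 \<in> C2_space \<and> (\<forall>x. spread w x \<ge> 2 * \<rho> \<longrightarrow> lift f0 x = 0) \<and>
    (\<forall>h. blinfun_apply (total_deriv (lift f0) w) h = (\<chi> i. h $ \<iota> i))"
proof -
  define m where "m i v t = - (1 - cos (2 * pi * (t - w $ v))) + (if v = \<iota> i then \<rho> * sin (2 * pi * (t - w $ v)) else 0)" for i v t
  define m1 where "m1 i v t = - (2 * pi * sin (2 * pi * (t - w $ v))) + (if v = \<iota> i then 2 * pi * \<rho> * cos (2 * pi * (t - w $ v)) else 0)" for i v t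
  define m2 where "m2 i v t = - (2 * pi * (2 * pi * cos (2 * pi * (t - w $ v)))) + (if v = \<iota> i then - (2 * pi * \<rho> * (2 * pi * sin (2 * pi * (t - w $ v)))) else 0)" for i v t
  (* the inverse of the derivative at w before scaling, which is 3 * rho^2 * (2 * pi * rho) *)
  define c where "c = 1 / (6 * pi * \<rho> ^ 3)"
  define \<tau> where "\<tau> i x = \<rho> + (\<Sum>v\<in>UNIV. m i v (x $ v))" for i and x :: "real ^ 'u"
  define F where "F = (\<lambda>x. (\<chi> i. c * (max 0 (\<tau> i x)) ^ 3) :: real ^ 'd)"
  have d0: "(m i v has_real_derivative m1 i v t) (at t)" for i v t
    unfolding m_def m1_def by (cases "v = \<iota> i") (auto intro!: derivative_eq_intros)
  have d1: "(m1 i v has_real_derivative m2 i v t) (at t)" for i v t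
    unfolding m1_def m2_def by (cases "v = \<iota> i") (auto intro!: derivative_eq_intros)
  have d2: "continuous_on UNIV (m2 i v)" for i v
    unfolding m2_def by (cases "v = \<iota> i") (auto intro!: continuous_intros)
  have C2F: "C2 F" unfolding F_def \<tau>_def by (rule C2_cubed_pos_part(1)[OF d0 d1 d2])
  have DF: "total_deriv F = (\<lambda>x. \<Sum>i\<in>UNIV. \<Sum>v\<in>UNIV. (c * (3 * (max 0 (\<tau> i x))\<^sup>2 * m1 i v (x $ v))) *\<^sub>R elem1 i v)"
    unfolding F_def \<tau>_def by (rule C2_cubed_pos_part(2)[OF d0 d1 d2])
  have per: "m i v (t + k) = m i v t" if "k \<in> \<int>" for i v t k
  proof -
    have "2 * pi * (t + k - w $ v) = 2 * pi * (t - w $ v) + 2 * pi * k" by (simp add: algebra_simps)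
    then show ?thesis
      unfolding m_def by (simp only: cos_add sin_add cos_integer_2pi[OF that] sin_integer_2pi[OF that]) simp
  qed
  have Fper: "F (x + l) = F x" if "l \<in> integer_lattice" for x l
  proof -
    have "\<tau> i (x + l) = \<tau> i x" for i
      unfolding \<tau>_def using that by (simp add: integer_lattice_def per)
    then show ?thesis by (simp add: F_def)
  qed
  define f0 where "f0 p = F (rep_torus p)" for p
  have lift: "lift f0 = F"
  proof
    fix x :: "real ^ 'u"
    have "rep_torus (to_torus x) - x \<in> integer_lattice" by (simp flip: to_torus_eq_iff)
    from Fper[OF this, of x] show "lift f0 x = F x" by (simp add: lift_def f0_def)
  qed
  have \<tau>_eq: "\<tau> i x = \<rho> - spread w x + \<rho> * sin (2 * pi * (x $ \<iota> i - w $ \<iota> i))" for i x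
    unfolding \<tau>_def m_def spread_def by (simp add: sum.distrib sum_negf[symmetric] sum_subtractf)
  have zero: "F x = 0" if "spread w x \<ge> 2 * \<rho>" for x
  proof -
    have "\<rho> * sin (2 * pi * (x $ \<iota> i - w $ \<iota> i)) \<le> \<rho> * 1" for i using \<rho> by (intro mult_left_mono) auto
    then have "\<tau> i x \<le> 0" for i unfolding \<tau>_eq using that by (smt (verit))
    then show ?thesis by (simp add: F_def vec_eq_iff max_absorb1)
  qed
  have der: "blinfun_apply (total_deriv F w) h = (\<chi> i. h $ \<iota> i)" for h
  proof -
    have "\<tau> i w = \<rho>" for i unfolding \<tau>_eq by (simp add: spread_def)
    then have "c * (3 * (max 0 (\<tau> i w))\<^sup>2 * m1 i v (w $ v)) = (if v = \<iota> i then 1 else 0)" for i v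
      using \<rho> by (simp add: c_def m1_def power2_eq_square power3_eq_cube)
    then have "total_deriv F w = (\<Sum>i\<in>UNIV. elem1 i (\<iota> i))"
      unfolding DF by (simp add: if_distrib[of "\<lambda>z. z *\<^sub>R _"] cong: if_cong)
    then have "blinfun_apply (total_deriv F w) h = (\<Sum>i\<in>UNIV. (h $ \<iota> i) *\<^sub>R axis i 1)"
      by (simp add: blinfun.sum_left elem1_apply)
    then show ?thesis by (simp add: vec_eq_iff axis_def if_distrib[of "\<lambda>z. _ * z"] cong: if_cong)
  qed
  show ?thesis
    using C2F zero der by (intro exI[of _ f0]) (simp add: C2_space_def lift)
qed

context skew_system
begin

text \<open>
  Otherwise the inverse of \<open>E\<close> would map the lattice to itself, and its powers would shrink a nonzero
  lattice vector below length 1.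
\<close>

lemma exists_indivisible_lattice_vector: "\<exists>l\<in>integer_lattice. matrix_inv E *v l \<notin> integer_lattice"
proof (rule ccontr)
  assume "\<not> ?thesis"
  then have inv: "matrix_inv E *v l \<in> integer_lattice" if "l \<in> integer_lattice" for l using that by blast
  define e :: "real ^ 'u" where "e = axis undefined 1"
  have e: "e \<in> integer_lattice" "e \<noteq> 0" by (auto simp: e_def integer_lattice_def axis_def vec_eq_iff)
  have lat: "Eik k e \<in> integer_lattice" for k by (induction k) (auto simp: e inv)
  have "(\<lambda>k. \<kappa> ^ k * norm e) \<longlonglongrightarrow> 0"
    using \<kappa> by (intro tendsto_mult_left_zero LIMSEQ_power_zero) simp
  then obtain k where k: "\<kappa> ^ k * norm e < 1"
    using order_tendstoD(2)[of _ 0 sequentially 1] by (fastforce simp: eventually_sequentially)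
  have "Eik k e $ i = 0" for i
  proof -
    have "\<bar>Eik k e $ i\<bar> < 1" using component_le_norm_cart[of "Eik k e" i] Eik_norm[of k e] k by linarith
    moreover have "Eik k e $ i \<in> \<int>" using lat[of k] by (simp add: integer_lattice_def)
    ultimately show ?thesis by (auto elim!: Ints_cases)
  qed
  then have "Eik k e = 0" by (simp add: vec_eq_iff)
  then have "Ek k (Eik k e) = Ek k 0" by simp
  then have "e = 0" by (simp add: Ek_Eik linear_0[OF matrix_iterate_linear])
  with e(2) show False by simp
qed

text \<open>
  The bump is centred at \<open>w = matrix_inv E *v l\<close>. The other points of the homoclinic orbit stay away from
  \<open>w\<close> modulo the lattice: none of them is congruent to \<open>w\<close>, because a power of \<open>E\<close> maps such a
  congruence to one between \<open>w\<close> and a lattice vector, and they converge to 0, which is not congruent to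
  \<open>w\<close> either. The number \<open>j\<close> is chosen so large that the first \<open>j + 1\<close> steps backwards shrink the whole
  unit cube into the region where the bump is nearly linear and the vanishing conditions hold. The map
  \<open>R\<close> undoes these steps; it is a right inverse of the linear part of the difference of the branches.
\<close>

lemma exists_transverse_fibre_map:
  assumes "CARD('d) \<le> CARD('u)"
  shows "\<exists>(f0 :: 'u torus \<Rightarrow> real ^ 'd) l j R. f0 \<in> C2_space \<and> l \<in> integer_lattice \<and> matrix_inv E *v l \<notin> integer_lattice \<and>
    linear (R :: real ^ 'd \<Rightarrow> real ^ 'u) \<and>
    (\<forall>y k. y \<in> half_open_cube \<longrightarrow> k \<ge> Suc j \<longrightarrow> lift f0 (Eik k y) = 0) \<and>
    (\<forall>y k. y \<in> half_open_cube \<longrightarrow> k \<ge> Suc (Suc j) \<longrightarrow> lift f0 (Eik k (y + Ek j l)) = 0) \<and>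
    (\<forall>y s. y \<in> half_open_cube \<longrightarrow> y + R s \<in> half_open_cube \<longrightarrow>
      norm (lift f0 (Eik (Suc j) (y + R s + Ek j l)) - lift f0 (Eik (Suc j) (y + Ek j l)) - s) \<le> norm s / 8)"
proof -
  obtain \<iota> :: "'d \<Rightarrow> 'u" where \<iota>: "inj \<iota>"
    using card_le_inj[of "UNIV :: 'd set" "UNIV :: 'u set"] assms by auto
  obtain l where l: "l \<in> integer_lattice" "matrix_inv E *v l \<notin> integer_lattice"
    using exists_indivisible_lattice_vector by blast
  define w where "w = matrix_inv E *v l"
  have Eadd: "Eik k (a + b) = Eik k a + Eik k b" for k a b by (rule linear_add[OF matrix_iterate_linear])
  have pos0: "spread w 0 > 0"
  proof -
    have "0 - w \<notin> integer_lattice" using l(2) integer_lattice_minus[of "- w"] by (auto simp: w_def)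
    then show ?thesis using spread_nonneg[of w 0] spread_eq_0_iff[of w 0] by linarith
  qed
  have posk: "spread w (Eik (Suc (Suc k)) l) > 0" for k
  proof -
    have "Eik (Suc (Suc k)) l - w \<notin> integer_lattice"
    proof
      assume "Eik (Suc (Suc k)) l - w \<in> integer_lattice"
      then have "Ek (Suc k) (Eik (Suc (Suc k)) l - w) \<in> integer_lattice" by (rule Ek_lattice)
      moreover have "Ek (Suc k) (Eik (Suc (Suc k)) l - w) = Ek (Suc k) (Eik (Suc (Suc k)) l) - Ek (Suc k) w"
        by (rule linear_diff[OF matrix_iterate_linear])
      moreover have "Eik (Suc (Suc k)) l = Eik (Suc k) w" by (simp only: funpow_Suc_right[of "Suc k"] comp_apply w_def)
      moreover have "Ek (Suc k) w = Ek k l" by (simp only: funpow_Suc_right comp_apply w_def E_inv)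
      ultimately have "w - Ek k l \<in> integer_lattice" by (simp only: Ek_Eik)
      from integer_lattice_add[OF this Ek_lattice[OF l(1), of k]] l(2) show False by (simp add: w_def)
    qed
    then show ?thesis using spread_nonneg[of w "Eik (Suc (Suc k)) l"] spread_eq_0_iff[of w "Eik (Suc (Suc k)) l"] by linarith
  qed
  define P where "P = 2 * pi * CARD('u)"
  have P: "P > 0" by (simp add: P_def)
  have lip: "\<bar>spread w x - spread w y\<bar> \<le> P * norm (x - y)" for x y unfolding P_def by (rule spread_lipschitz)
  have "\<exists>\<rho>>0. 4 * \<rho> \<le> spread w 0 \<and> (\<forall>k. 4 * \<rho> \<le> spread w (Eik (Suc (Suc k)) l))"
  proof -
    have z: "(\<lambda>k. P * (\<kappa> ^ k * norm l)) \<longlonglongrightarrow> 0"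
      using \<kappa> by (intro tendsto_mult_right_zero tendsto_mult_left_zero LIMSEQ_power_zero) simp
    then obtain K where K: "\<And>k. k \<ge> K \<Longrightarrow> P * (\<kappa> ^ k * norm l) < spread w 0 / 2"
      using order_tendstoD(2)[OF z, of "spread w 0 / 2"] pos0 by (auto simp: eventually_sequentially)
    define S where "S = insert (spread w 0 / 2) ((\<lambda>k. spread w (Eik (Suc (Suc k)) l)) ` {..<K})"
    have S: "finite S" "S \<noteq> {}" by (simp_all add: S_def)
    have "Min S \<in> S" by (rule Min_in[OF S])
    then have M0: "Min S > 0" using pos0 posk by (auto simp: S_def simp del: funpow.simps)
    have "Min S \<le> spread w (Eik (Suc (Suc k)) l)" for k
    proof (cases "k < K")
      case True
      then show ?thesis by (intro Min_le) (auto simp: S_def simp del: funpow.simps)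
    next
      case False
      have "P * norm (Eik (Suc (Suc k)) l - 0) \<le> P * (\<kappa> ^ Suc (Suc k) * norm l)"
        using P Eik_norm[of "Suc (Suc k)" l] by (intro mult_left_mono) (auto simp del: funpow.simps power_Suc)
      moreover have "P * (\<kappa> ^ Suc (Suc k) * norm l) < spread w 0 / 2" by (rule K) (use False in simp)
      moreover have "Min S \<le> spread w 0 / 2" by (rule Min_le) (auto simp: S_def)
      ultimately show ?thesis using lip[of "Eik (Suc (Suc k)) l" 0] pos0 by linarith
    qed
    moreover have "Min S \<le> spread w 0 / 2" by (rule Min_le) (auto simp: S_def)
    ultimately show ?thesis using M0 pos0 by (intro exI[of _ "Min S / 4"]) auto
  qed
  then obtain \<rho> where \<rho>: "\<rho> > 0" "4 * \<rho> \<le> spread w 0" "\<And>k. 4 * \<rho> \<le> spread w (Eik (Suc (Suc k)) l)" by blast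
  obtain f0 :: "'u torus \<Rightarrow> real ^ 'd" where f0: "f0 \<in> C2_space" "\<And>x. spread w x \<ge> 2 * \<rho> \<Longrightarrow> lift f0 x = 0"
      "\<And>h. blinfun_apply (total_deriv (lift f0) w) h = (\<chi> i. h $ \<iota> i)"
    using exists_bump[OF \<rho>(1), of w \<iota>] by blast
  have "C2 (lift f0)" using f0(1) by (simp add: C2_space_def)
  from C2_strict_derivative[OF this, of "1/8" w] obtain r where r: "r > 0"
    "\<And>x x'. x \<in> ball w r \<Longrightarrow> x' \<in> ball w r \<Longrightarrow> norm (lift f0 x - lift f0 x' - (\<chi> i. (x - x') $ \<iota> i)) \<le> 1 / 8 * norm (x - x')"
    unfolding f0(3) by auto
  define r0 where "r0 = min r (2 * \<rho> / P)"
  have r0: "r0 > 0" using r \<rho> P by (simp add: r0_def)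
  have "(\<lambda>j. \<kappa> ^ j * CARD('u)) \<longlonglongrightarrow> 0"
    using \<kappa> by (intro tendsto_mult_left_zero LIMSEQ_power_zero) simp
  then obtain j where j: "\<And>k. k \<ge> j \<Longrightarrow> \<kappa> ^ k * CARD('u) < r0"
    using order_tendstoD(2)[of _ 0 sequentially r0] r0 by (fastforce simp: eventually_sequentially)
  have small: "norm (Eik k y) < r0" if "y \<in> half_open_cube" "k \<ge> j" for y k
  proof -
    have "norm (Eik k y) \<le> \<kappa> ^ k * norm y" by (rule Eik_norm)
    also have "\<dots> \<le> \<kappa> ^ k * CARD('u)" using norm_half_open_cube[OF that(1)] \<kappa> by (intro mult_left_mono) auto
    also have "\<dots> < r0" by (rule j[OF that(2)])
    finally show ?thesis .
  qed
  have vanish: "lift f0 (Eik k y + z) = 0" if "y \<in> half_open_cube" "k \<ge> j" "4 * \<rho> \<le> spread w z" for y k z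
  proof (rule f0(2))
    have "P * norm (Eik k y) \<le> P * (2 * \<rho> / P)" using small[OF that(1,2)] P by (intro mult_left_mono) (auto simp: r0_def)
    then have "P * norm (Eik k y) \<le> 2 * \<rho>" using P by simp
    moreover have "\<bar>spread w (Eik k y + z) - spread w z\<bar> \<le> P * norm (Eik k y)" using lip[of "Eik k y + z" z] by simp
    ultimately show "2 * \<rho> \<le> spread w (Eik k y + z)" using that(3) by linarith
  qed
  (* the isometric right inverse of the coordinate projection that is the derivative of the bump *)
  define PT where "PT s = (\<chi> v. if v \<in> range \<iota> then s $ (inv \<iota> v) else 0)" for s :: "real ^ 'd"
  have PT_lin: "linear PT" by (rule linearI) (auto simp: PT_def vec_eq_iff)
  have PT_P: "(\<chi> i. PT s $ \<iota> i) = s" for s by (simp add: PT_def vec_eq_iff inv_f_f[OF \<iota>])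
  have PT_norm: "norm (PT s) = norm s" for s
  proof -
    have "PT s \<bullet> PT s = (\<Sum>v\<in>UNIV. if v \<in> range \<iota> then (s $ (inv \<iota> v))\<^sup>2 else 0)"
      unfolding inner_vec_def PT_def by (intro sum.cong) (auto simp: power2_eq_square)
    also have "\<dots> = (\<Sum>v\<in>range \<iota>. (s $ (inv \<iota> v))\<^sup>2)" by (simp add: sum.If_cases)
    also have "\<dots> = (\<Sum>i\<in>UNIV. (s $ i)\<^sup>2)" by (subst sum.reindex[OF \<iota>]) (simp add: inv_f_f[OF \<iota>])
    also have "\<dots> = s \<bullet> s" by (simp add: inner_vec_def power2_eq_square)
    finally show ?thesis by (simp add: norm_eq_sqrt_inner)
  qed
  define R where "R s = Ek (Suc j) (PT s)" for s
  have R_lin: "linear R"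
    unfolding R_def using linear_compose[OF PT_lin matrix_iterate_linear[of "Suc j" E]] by (simp only: comp_def)
  have split: "Eik (Suc j) (y + Ek j l) = Eik (Suc j) y + w" for y
    unfolding Eadd by (simp only: funpow.simps comp_apply Ek_Eik w_def)
  show ?thesis
  proof (rule exI[of _ f0], rule exI[of _ l], rule exI[of _ j], rule exI[of _ R], intro conjI allI impI f0(1) l R_lin)
    fix y :: "real ^ 'u" and k assume y: "y \<in> half_open_cube"
    show "lift f0 (Eik k y) = 0" if "k \<ge> Suc j"
      using vanish[OF y _ \<rho>(2), of k] that by simp
    show "lift f0 (Eik k (y + Ek j l)) = 0" if k: "k \<ge> Suc (Suc j)"
    proof -
      have "Eik k (Ek j l) = Eik (k - j) (Eik j (Ek j l))" using k by (simp only: funpow_add_apply) simp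
      also have "\<dots> = Eik (Suc (Suc (k - Suc (Suc j)))) l" 
      proof -
        have e: "k - j = Suc (Suc (k - Suc (Suc j)))" using k by linarith
        show ?thesis unfolding Ek_Eik by (subst e) (rule refl)
      qed
      finally have "Eik k (y + Ek j l) = Eik k y + Eik (Suc (Suc (k - Suc (Suc j)))) l" unfolding Eadd by (simp only:)
      with vanish[OF y _ \<rho>(3), of k] k show ?thesis by (simp del: funpow.simps)
    qed
  next
    fix y s assume y: "y \<in> half_open_cube" "y + R s \<in> half_open_cube"
    have in_ball: "Eik (Suc j) t + w \<in> ball w r" if "t \<in> half_open_cube" for t
      using small[OF that, of "Suc j"] by (simp add: dist_norm r0_def del: funpow.simps)
    have d: "(Eik (Suc j) (y + R s) + w) - (Eik (Suc j) y + w) = PT s"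
      unfolding Eadd R_def by (simp only: Ek_Eik) simp
    have "norm (lift f0 (Eik (Suc j) (y + R s) + w) - lift f0 (Eik (Suc j) y + w) - s) \<le> 1 / 8 * norm s"
      using r(2)[OF in_ball[OF y(2)] in_ball[OF y(1)]] unfolding d PT_P PT_norm .
    then show "norm (lift f0 (Eik (Suc j) (y + R s + Ek j l)) - lift f0 (Eik (Suc j) (y + Ek j l)) - s) \<le> norm s / 8"
      unfolding split by simp
  qed
qed

end

text \<open>
  The constants are chosen in this order: the fibre map \<open>f0\<close> with \<open>j\<close> and \<open>R\<close>; then \<open>q\<close>, so that the history
  before a block is negligible against \<open>R\<close>; then \<open>\<eta>\<close>, so that the energy factor for \<open>E ^^ q\<close> is less than 1;
  and finally the radii \<open>\<gamma>\<close> around the identity and \<open>\<epsilon>\<close> around \<open>f0\<close>. Every contraction has operator norm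
  at most 1, so its first \<open>q\<close> powers are at most \<open>q * \<gamma>\<close> away from the identity.
\<close>

theorem theoremA:
  fixes E :: "real ^ 'u ^ 'u"
  assumes "CARD('d::finite) \<le> CARD('u)"
    and "expanding E"
  shows "\<exists>U :: ((real ^ 'd ^ 'd) \<times> ('u torus \<Rightarrow> real ^ 'd)) set.
    U \<noteq> {} \<and>
    openin (prod_topology (top_of_set contractions) C2_topology) U \<and>
    (\<forall>(C, f) \<in> U.
       \<bar>det E * det C\<bar> > 1 \<and>
       (\<exists>!\<mu>. SRB_measure (skew_map E C f) \<mu>) \<and>
       absolutely_continuous product_volume (THE \<mu>. SRB_measure (skew_map E C f) \<mu>))"
proof -
  let ?Ei = "matrix_inv E"
  define \<kappa> where "\<kappa> = onorm ((*v) ?Ei)"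
  have \<kappa>: "0 \<le> \<kappa>" "\<kappa> < 1" "norm (?Ei *v x) \<le> \<kappa> * norm x" for x
    using assms(2) onorm[OF matrix_vector_mul_bounded_linear, of ?Ei x]
    by (auto simp: \<kappa>_def expanding_def intro: onorm_pos_le matrix_vector_mul_bounded_linear)
  have detE: "\<bar>det E\<bar> > 1" by (rule det_expanding[OF _ \<kappa>]) (use assms(2) in \<open>simp add: expanding_def\<close>)
  (* the facts about the powers of E and of its inverse involve no fibre, so a trivial one is used *)
  interpret base: skew_system E "0 :: real ^ 'd ^ 'd" "\<lambda>_. 0" \<kappa> 0 0 0
    by unfold_locales (use assms(2) \<kappa> in \<open>auto simp: lift_def\<close>)
  obtain f0 :: "'u torus \<Rightarrow> real ^ 'd" and l j and R :: "real ^ 'd \<Rightarrow> real ^ 'u" where f0: "f0 \<in> C2_space"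
    and l: "l \<in> integer_lattice" "?Ei *v l \<notin> integer_lattice" and R: "linear R"
    and F1: "\<And>y k. y \<in> half_open_cube \<Longrightarrow> k \<ge> Suc j \<Longrightarrow> lift f0 (base.Eik k y) = 0"
    and F2: "\<And>y k. y \<in> half_open_cube \<Longrightarrow> k \<ge> Suc (Suc j) \<Longrightarrow> lift f0 (base.Eik k (y + base.Ek j l)) = 0"
    and F3: "\<And>y s. y \<in> half_open_cube \<Longrightarrow> y + R s \<in> half_open_cube \<Longrightarrow>
      norm (lift f0 (base.Eik (Suc j) (y + R s + base.Ek j l)) - lift f0 (base.Eik (Suc j) (y + base.Ek j l)) - s) \<le> norm s / 8"
    using base.exists_transverse_fibre_map[OF assms(1)] by metis
  obtain r where r0: "r > 0" and r: "\<And>s. norm (R s) \<le> norm s * r"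
    using R by (metis bounded_linear.pos_bounded linear_conv_bounded_linear)
  (* L0 + 1 is a Lipschitz constant for all fibre maps at distance at most 1 from f0 *)
  define L0 where "L0 = (SUP x. norm (total_deriv (lift f0) x))"
  have L0: "norm (total_deriv (lift f0) x) \<le> L0" for x
    unfolding L0_def by (rule cSUP_upper[OF UNIV_I C2_space_bdd(2)[OF f0]])
  have L00: "L0 \<ge> 0" using order_trans[OF norm_ge_zero L0] .
  define \<sigma> where "\<sigma> = (L0 + 1) * \<kappa> / (1 - \<kappa>)"
  have "(\<lambda>q. 2 * \<sigma> * \<kappa> ^ q * r) \<longlonglongrightarrow> 0"
    using \<kappa> by (intro tendsto_mult_left_zero tendsto_mult_right_zero LIMSEQ_power_zero) simp
  then have "\<forall>\<^sub>F q in sequentially. 2 * \<sigma> * \<kappa> ^ q * r < 1 / 8" by (rule order_tendstoD) simp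
  then have "\<forall>\<^sub>F q in sequentially. 2 * \<sigma> * \<kappa> ^ q * r < 1 / 8 \<and> j < q"
    using eventually_gt_at_top[of j] by (rule eventually_conj)
  then obtain q where q: "2 * \<sigma> * \<kappa> ^ q * r < 1 / 8" "j < q" by (auto simp: eventually_sequentially)
  define N where "N = real (card (base.iter.D q))"
  have "((\<lambda>\<eta>. N * (1 - \<eta>) ^ CARD('d)) \<longlongrightarrow> N * (1 - 0) ^ CARD('d)) (at_right 0)"
    by (intro tendsto_intros)
  then have "\<forall>\<^sub>F \<eta> in at_right 0. N - 1 < N * (1 - \<eta>) ^ CARD('d)" by (rule order_tendstoD) simp
  moreover have "\<forall>\<^sub>F \<eta> :: real in at_right 0. \<eta> \<in> {0<..<1}" by (rule eventually_at_right_real) simp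
  ultimately have "\<forall>\<^sub>F \<eta> in at_right 0. N - 1 < N * (1 - \<eta>) ^ CARD('d) \<and> \<eta> \<in> {0<..<1}"
    by (rule eventually_conj)
  then obtain \<eta> where \<eta>: "N - 1 < N * (1 - \<eta>) ^ CARD('d)" "0 < \<eta>" "\<eta> < 1"
    using eventually_happens'[OF trivial_limit_at_right_real] by fastforce
  define \<gamma> where "\<gamma> = min (1 / 8) \<eta> / (real q + 1)"
  have \<gamma>: "\<gamma> > 0" "real q * \<gamma> \<le> min (1 / 8) \<eta>"
  proof -
    show pos: "\<gamma> > 0" using \<eta> by (simp add: \<gamma>_def)
    have "(real q + 1) * \<gamma> = min (1 / 8) \<eta>" by (simp add: \<gamma>_def)
    moreover have "real q * \<gamma> \<le> (real q + 1) * \<gamma>" using pos by (intro mult_right_mono) auto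
    ultimately show "real q * \<gamma> \<le> min (1 / 8) \<eta>" by simp
  qed
  have \<gamma>j: "real j * \<gamma> \<le> 1 / 8"
  proof -
    have "real j * \<gamma> \<le> real q * \<gamma>" using q(2) \<gamma>(1) by (intro mult_right_mono) auto
    with \<gamma>(2) show ?thesis by simp
  qed
  define \<epsilon> where "\<epsilon> = min 1 (1 / (16 * (\<kappa> / (1 - \<kappa>) * r + 1)))"
  have kr: "\<kappa> / (1 - \<kappa>) * r \<ge> 0" using \<kappa> r0 by simp
  have \<epsilon>: "0 < \<epsilon>" "\<epsilon> \<le> 1" "2 * \<epsilon> * (\<kappa> / (1 - \<kappa>)) * r \<le> 1 / 8"
  proof -
    show "0 < \<epsilon>" "\<epsilon> \<le> 1" using kr by (auto simp: \<epsilon>_def intro!: divide_pos_pos add_nonneg_pos)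
    define X where "X = \<kappa> / (1 - \<kappa>) * r"
    have X: "X \<ge> 0" using kr by (simp add: X_def)
    have "\<epsilon> * X \<le> 1 / (16 * (X + 1)) * X" unfolding \<epsilon>_def X_def[symmetric] using X by (intro mult_right_mono) auto
    also have "\<dots> \<le> 1 / 16" using X by (simp add: field_simps)
    finally have "2 * (\<epsilon> * X) \<le> 1 / 8" by simp
    then show "2 * \<epsilon> * (\<kappa> / (1 - \<kappa>)) * r \<le> 1 / 8" by (simp only: X_def mult.assoc)
  qed
  define \<C> where "\<C> = contractions \<inter> {C :: real ^ 'd ^ 'd. norm (C - mat 1) < \<gamma> \<and> 1 < \<bar>det E * det C\<bar>}"
  interpret M: Metric_space "C2_space :: ('u torus \<Rightarrow> real ^ 'd) set" C2_dist by (rule Metric_space_C2)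
  define \<F> where "\<F> = M.mball f0 \<epsilon>"
  have op: "openin (prod_topology (top_of_set contractions) C2_topology) (\<C> \<times> \<F>)"
  proof -
    have "open {C :: real ^ 'd ^ 'd. norm (C - mat 1) < \<gamma> \<and> 1 < \<bar>det E * det C\<bar>}"
      by (intro open_Collect_conj open_Collect_less continuous_intros continuous_on_det)
    then have "openin (top_of_set contractions) \<C>" unfolding \<C>_def by (rule openin_open_Int)
    moreover have "openin C2_topology \<F>" unfolding \<F>_def C2_topology_def by (rule M.openin_mball)
    ultimately show ?thesis by (simp add: openin_prod_Times_iff)
  qed
  have ne: "\<C> \<times> \<F> \<noteq> {}"
  proof -
    have "((\<lambda>c. \<bar>det E\<bar> * c ^ CARD('d)) \<longlongrightarrow> \<bar>det E\<bar> * 1 ^ CARD('d)) (at_left (1::real))"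
      by (intro tendsto_intros)
    then have 1: "\<forall>\<^sub>F c in at_left 1. 1 < \<bar>det E\<bar> * c ^ CARD('d)" by (rule order_tendstoD) (use detE in simp)
    have "((\<lambda>c. (1 - c) * norm (mat 1 :: real ^ 'd ^ 'd)) \<longlongrightarrow> (1 - 1) * norm (mat 1 :: real ^ 'd ^ 'd)) (at_left (1::real))"
      by (intro tendsto_intros)
    then have 2: "\<forall>\<^sub>F c in at_left 1. (1 - c) * norm (mat 1 :: real ^ 'd ^ 'd) < \<gamma>" by (rule order_tendstoD) (use \<gamma> in simp)
    have 3: "\<forall>\<^sub>F c :: real in at_left 1. c \<in> {0<..<1}" by (rule eventually_at_left_real) simp
    have "\<forall>\<^sub>F c in at_left 1. 1 < \<bar>det E\<bar> * c ^ CARD('d) \<and> (1 - c) * norm (mat 1 :: real ^ 'd ^ 'd) < \<gamma> \<and> c \<in> {0<..<1}"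
      using 1 2 3 by eventually_elim simp
    then obtain c :: real where c: "1 < \<bar>det E\<bar> * c ^ CARD('d)" "(1 - c) * norm (mat 1 :: real ^ 'd ^ 'd) < \<gamma>" "0 < c" "c < 1"
      using eventually_happens'[OF trivial_limit_at_left_real] by fastforce
    let ?C = "mat c :: real ^ 'd ^ 'd"
    have "?C = c *\<^sub>R mat 1" by (simp add: vec_eq_iff mat_def)
    then have "?C *v v = c *\<^sub>R v" for v by (simp add: scaleR_matrix_vector_assoc[symmetric])
    then have "?C \<in> contractions" using c by (simp add: contractions_def)
    moreover have "det ?C = c ^ CARD('d)" by (simp add: mat_def det_diagonal)
    moreover have "?C - mat 1 = (c - 1) *\<^sub>R mat 1" by (simp add: vec_eq_iff mat_def)
    ultimately have "?C \<in> \<C>" using c by (simp add: \<C>_def abs_mult)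
    moreover have "f0 \<in> \<F>" unfolding \<F>_def using f0 \<epsilon>(1) by (simp add: M.in_mball)
    ultimately show ?thesis by blast
  qed
  have main: "\<bar>det E * det C\<bar> > 1 \<and> (\<exists>!\<mu>. SRB_measure (skew_map E C f) \<mu>) \<and>
       absolutely_continuous product_volume (THE \<mu>. SRB_measure (skew_map E C f) \<mu>)"
    if C: "C \<in> \<C>" and f: "f \<in> \<F>" for C f
  proof -
    have Cc: "C \<in> contractions" "norm (C - mat 1) \<le> \<gamma>" and detC: "1 < \<bar>det E * det C\<bar>" using C by (auto simp: \<C>_def)
    have invC: "invertible C" using detC by (auto simp: invertible_det_nz)
    obtain lam where lam: "0 \<le> lam" "lam < 1" "\<And>y. norm (C *v y) \<le> lam * norm y"
      using contraction_rate[OF Cc(1)] by blast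
    have C1: "norm (C *v y) \<le> norm y" for y
      using lam mult_right_mono[of lam 1 "norm y"] by (intro order_trans[OF lam(3)]) auto
    have f2: "f \<in> C2_space" "C2_dist f0 f < \<epsilon>" using f by (auto simp: \<F>_def M.in_mball)
    define g where "g = (\<lambda>p. f p - f0 p)"
    have g: "g \<in> C2_space" unfolding g_def using f2(1) f0 by (rule C2_space_diff)
    have "C2_norm g < \<epsilon>" using f2 f0 M.commute[of f0 f] by (simp add: C2_dist_def g_def)
    moreover have "(SUP x. norm (total_deriv (lift g) x)) \<le> C2_norm g"
      using C2_space_bdd[OF g, THEN SUP_norm_nonneg] by (simp add: C2_norm_def)
    ultimately have Dg: "norm (total_deriv (lift g) x) \<le> \<epsilon>" for x
      using cSUP_upper[OF UNIV_I C2_space_bdd(2)[OF g], of x] by linarith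
    have lip_g: "norm (lift g x - lift g x') \<le> \<epsilon> * norm (x - x')" for x x'
      by (rule C2_space_lipschitz[OF g Dg])
    have lift_f: "lift f x = lift f0 x + lift g x" for x by (simp add: lift_def g_def)
    have lip_f: "norm (lift f x - lift f x') \<le> (L0 + 1) * norm (x - x')" for x x'
    proof -
      have "norm (lift f x - lift f x') \<le> norm (lift f0 x - lift f0 x') + norm (lift g x - lift g x')"
        unfolding lift_f by (metis add_diff_add norm_triangle_ineq)
      also have "\<dots> \<le> L0 * norm (x - x') + \<epsilon> * norm (x - x')"
        by (intro add_mono C2_space_lipschitz[OF f0 L0] lip_g)
      also have "\<dots> \<le> L0 * norm (x - x') + 1 * norm (x - x')" using \<epsilon> by (intro add_left_mono mult_right_mono) auto
      finally show ?thesis by (simp add: distrib_right)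
    qed
    define bf where "bf = (SUP x. norm (lift f x))"
    have bf: "norm (f p) \<le> bf" for p
      using cSUP_upper[OF UNIV_I C2_space_bdd(1)[OF f2(1)], of "rep_torus p"] by (simp add: bf_def lift_def)
    interpret sys: invertible_skew_system E C f \<kappa> lam "L0 + 1" bf
      by unfold_locales (use assms(2) \<kappa> lam bf lip_f L00 invC in auto)
    have near: "norm (sys.Ck k s - s) \<le> real k * \<gamma> * norm s" for k s
      by (rule iterate_near_identity[OF C1 Cc(2)])
    have "(\<exists>!\<mu>. SRB_measure (skew_map E C f) \<mu>) \<and>
       absolutely_continuous product_volume (THE \<mu>. SRB_measure (skew_map E C f) \<mu>)"
    proof (rule sys.absolutely_continuous_SRB_of_transversality[OF l q(2) R _ _ lift_f lip_g _ F1 F2 F3])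
      show "norm (R s) \<le> r * norm s" for s using r[of s] by (simp add: mult.commute)
      show "norm (sys.Ck j s - s) \<le> norm s / 8" for s
        using order_trans[OF near mult_right_mono[OF \<gamma>j norm_ge_zero], of s] by simp
      show "norm (sys.Ck q s - s) \<le> \<eta> * norm s" for s
      proof -
        have "real q * \<gamma> \<le> \<eta>" using \<gamma>(2) by simp
        from order_trans[OF near mult_right_mono[OF this norm_ge_zero], of s] show ?thesis .
      qed
      show "2 * \<epsilon> * (\<kappa> / (1 - \<kappa>)) * r + 2 * sys.\<sigma> * \<kappa> ^ q * r \<le> 1 / 4"
        using \<epsilon>(3) q(1) unfolding sys.\<sigma>_def \<sigma>_def by linarith
      show "real (card (base.iter.D q)) - 1 < card (base.iter.D q) * (1 - \<eta>) ^ CARD('d)"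
        using \<eta>(1) by (simp only: N_def)
    qed (use r0 \<epsilon> \<eta> in auto)
    with detC show ?thesis by blast
  qed
  show ?thesis
    by (rule exI[of _ "\<C> \<times> \<F>"]) (use op ne main in blast)
qed

end
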